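(* Let $K$ be a field and let $E$ be a row-finite directed graph. Then $FP(L_K(E))$ satisfies the refinement property and $L_K(E)$ is a separative ring. Moreover, the monoid $V(L_K(E))$ is an unperforated monoid and $K_0(L_K(E))$ is an unperforated group.
   Context: A directed graph $E=(E^0,E^1)$ consists of a vertex set $E^0$, an edge set $E^1$, and maps $r,s\colon E^1\to E^0$ (range and source). A vertex $v$ emits edges if $s^{-1}(v)\neq\emptyset$. $E$ is row-finite if each vertex emits only finitely many edges. The graph algebra $L_K(E)$ is the (not necessarily unital) $K$-algebra generated by a set $\{p_v\mid v\in E^0\}$ together with a set $\{x_e,y_e\mid e\in E^1\}$, subject to the relations: (1) $p_vp_{v'}=\delta_{v,v'}p_v$ for all $v,v'\in E^0$; (2) $p_{s(e)}x_e=x_ep_{r(e)}=x_e$ for all $e\in E^1$; (3) $p_{r(e)}y_e=y_ep_{s(e)}=y_e$ for all $e\in E^1$; (4) $y_ex_{e'}=\delta_{e,e'}p_{r(e)}$ for all $e,e'\in E^1$; (5) $p_v=\sum_{\{e\in E^1\mid s(e)=v\}}x_ey_e$ for every $v\in E^0$ that emits edges. For a (possibly non-unital) $K$-algebra $I$, let $R$ be any unital $K$-algebra containing $I$ as a two-sided ideal; $FP(I)$ denotes the class of finitely generated projective left $R$-modules $P$ with $P=IP$, and $V(I)$ the abelian monoid of isomorphism classes of such modules under direct sum (it does not depend on $R$, and is also the monoid of equivalence classes of idempotents in $M_\infty(I)$, where $e\sim f$ iff $e=xy$, $f=yx$ for some $x,y\in M_\infty(I)$). $K_0(L_K(E))$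 is the universal (enveloping) group of $V(L_K(E))$, pre-ordered with positive cone the image of $V(L_K(E))$. $FP(I)$ satisfies the refinement property if whenever $A_1,A_2,B_1,B_2\in FP(I)$ satisfy $A_1\oplus A_2\cong B_1\oplus B_2$, there are decompositions $A_i=A_{i1}\oplus A_{i2}$ ($i=1,2$) such that $A_{1j}\oplus A_{2j}\cong B_j$ for $j=1,2$. $I$ is separative if whenever $A,B,C\in FP(I)$ satisfy $A\oplus C\cong B\oplus C$ and $C$ is isomorphic to direct summands of both $nA$ and $nB$ for some $n\in\mathbb N$, then $A\cong B$ (here $nA$ is the direct sum of $n$ copies of $A$). The algebraic pre-order on an abelian monoid $M$ is: $x\le y$ iff $y=x+z$ for some $z\in M$. $M$ is unperforated if for all $a,b\in M$ and positive integers $n$, $na\le nb$ implies $a\le b$. A pre-ordered abelian group $G$ is unperforated if for all $g\in G$ and positive integers $n$, $ng\ge0$ implies $g\ge 0$. *)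

theory Defs
  imports
    "HOL-Algebra.Generated_Groups"
    "HOL-Algebra.Module"
    "HOL-Algebra.QuotRing"
    "HOL-Library.Poly_Mapping"
    "Graph_Theory.Digraph"
begin

section \<open>Algebras over a field\<close>

text \<open>
  Algebras over a field \<open>'k\<close>, unital or not, are carried by the record type
  \<open>('k, 'a) module\<close>. For an algebra that is not assumed to be unital the field \<open>one\<close> has
  no meaning, and no definition below reads it.
\<close>

locale unital_algebra = ring A for A :: "('k::field, 'a) module" (structure) +
  assumes smult_closed: "x \<in> carrier A \<Longrightarrow> c \<odot> x \<in> carrier A"
    and smult_l_distr: "x \<in> carrier A \<Longrightarrow> (c + d) \<odot> x = c \<odot> x \<oplus> d \<odot> x"
    and smult_r_distr:
      "x \<in> carrier A \<Longrightarrow> y \<in> carrier A \<Longrightarrow> c \<odot> (x \<oplus> y) = c \<odot> x \<oplus> c \<odot> y"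
    and smult_assoc: "x \<in> carrier A \<Longrightarrow> (c * d) \<odot> x = c \<odot> (d \<odot> x)"
    and smult_one: "x \<in> carrier A \<Longrightarrow> 1 \<odot> x = x"
    and smult_mult_left:
      "x \<in> carrier A \<Longrightarrow> y \<in> carrier A \<Longrightarrow> (c \<odot> x) \<otimes> y = c \<odot> (x \<otimes> y)"
    and smult_mult_right:
      "x \<in> carrier A \<Longrightarrow> y \<in> carrier A \<Longrightarrow> x \<otimes> (c \<odot> y) = c \<odot> (x \<otimes> y)"

definition alg_hom :: "('k, 'a) module \<Rightarrow> ('k, 'b) module \<Rightarrow> ('a \<Rightarrow> 'b) set" where
  "alg_hom A B = {h \<in> carrier A \<rightarrow> carrier B.
     (\<forall>x\<in>carrier A. \<forall>y\<in>carrier A. h (x \<oplus>\<^bsub>A\<^esub> y) = h x \<oplus>\<^bsub>B\<^esub> h y) \<and>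
     (\<forall>x\<in>carrier A. \<forall>y\<in>carrier A. h (x \<otimes>\<^bsub>A\<^esub> y) = h x \<otimes>\<^bsub>B\<^esub> h y) \<and>
     (\<forall>c. \<forall>x\<in>carrier A. h (c \<odot>\<^bsub>A\<^esub> x) = c \<odot>\<^bsub>B\<^esub> h x)}"

text \<open>
  \<open>\<iota>\<close> identifies the possibly non-unital algebra \<open>A\<close> with a two-sided ideal of the unital
  algebra \<open>R\<close>.
\<close>

definition ideal_embedding ::
    "('k::field, 'a) module \<Rightarrow> ('k, 'r) module \<Rightarrow> ('a \<Rightarrow> 'r) \<Rightarrow> bool" where
  "ideal_embedding A R \<iota> \<longleftrightarrow>
     unital_algebra R \<and> \<iota> \<in> alg_hom A R \<and> inj_on \<iota> (carrier A) \<and> ideal (\<iota> ` carrier A) R"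

inductive_set alg_ideal :: "('k, 'a) module \<Rightarrow> 'a set \<Rightarrow> 'a set" for A S where
  incl: "s \<in> S \<Longrightarrow> s \<in> alg_ideal A S"
| zero: "\<zero>\<^bsub>A\<^esub> \<in> alg_ideal A S"
| add: "x \<in> alg_ideal A S \<Longrightarrow> y \<in> alg_ideal A S \<Longrightarrow> x \<oplus>\<^bsub>A\<^esub> y \<in> alg_ideal A S"
| smult: "x \<in> alg_ideal A S \<Longrightarrow> c \<odot>\<^bsub>A\<^esub> x \<in> alg_ideal A S"
| left: "a \<in> carrier A \<Longrightarrow> x \<in> alg_ideal A S \<Longrightarrow> a \<otimes>\<^bsub>A\<^esub> x \<in> alg_ideal A S"
| right: "a \<in> carrier A \<Longrightarrow> x \<in> alg_ideal A S \<Longrightarrow> x \<otimes>\<^bsub>A\<^esub> a \<in> alg_ideal A S"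

definition alg_quot :: "('k, 'a) module \<Rightarrow> 'a set \<Rightarrow> ('k, 'a set) module" where
  "alg_quot A J =
    \<lparr>carrier = a_rcosets\<^bsub>A\<^esub> J, mult = rcoset_mult A J, one = undefined,
     zero = J, add = set_add A, smult = (\<lambda>c U. \<Union>x\<in>U. J +>\<^bsub>A\<^esub> (c \<odot>\<^bsub>A\<^esub> x))\<rparr>"


section \<open>The graph algebra\<close>

text \<open>
  Words form a monoid under concatenation, so that the convolution product of
  \<open>'g list \<Rightarrow>\<^sub>0 'k\<close> is the product of noncommutative polynomials.
\<close>

instantiation list :: (type) monoid_add
begin
definition zero_list :: "'a list" where "zero_list = []"
definition plus_list :: "'a list \<Rightarrow> 'a list \<Rightarrow> 'a list" where "plus_list = (@)"
instance by standard (simp_all add: zero_list_def plus_list_def)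
end

text \<open>
  The free non-unital algebra consists of the noncommutative polynomials without constant
  term, that is, those in which the empty word does not occur.
\<close>

definition free_algebra :: "'g set \<Rightarrow> ('k::field, 'g list \<Rightarrow>\<^sub>0 'k) module" where
  "free_algebra G =
    \<lparr>carrier = {f. Poly_Mapping.keys f \<subseteq> lists G - {[]}}, mult = (*), one = undefined,
     zero = 0, add = (+), smult = (\<lambda>c. Poly_Mapping.map ((*) c))\<rparr>"

text \<open>
  In \<open>('v, 'e) pre_digraph\<close> the source of an edge is its \<open>tail\<close> and the range is its
  \<open>head\<close>. Loops, parallel edges and infinitely many vertices or edges are allowed.
\<close>

definition row_finite :: "('v, 'e) pre_digraph \<Rightarrow> bool" where
  "row_finite E \<longleftrightarrow> (\<forall>v\<in>verts E. finite (out_arcs E v))"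

datatype ('v, 'e) generator = Pgen 'v | Xgen 'e | Ygen 'e

definition generators :: "('v, 'e) pre_digraph \<Rightarrow> ('v, 'e) generator set" where
  "generators E = Pgen ` verts E \<union> Xgen ` arcs E \<union> Ygen ` arcs E"

abbreviation gen :: "'g \<Rightarrow> 'g list \<Rightarrow>\<^sub>0 'k::field" where
  "gen g \<equiv> Poly_Mapping.single [g] 1"

text \<open>A relation \<open>a = b\<close> is recorded as the element \<open>a - b\<close>.\<close>

definition relators ::
    "('v, 'e) pre_digraph \<Rightarrow> (('v, 'e) generator list \<Rightarrow>\<^sub>0 'k::field) set" where
  "relators E =
     {gen (Pgen v) * gen (Pgen w) - (if v = w then gen (Pgen v) else 0) | v w.
        v \<in> verts E \<and> w \<in> verts E} \<union>
     {gen (Pgen (tail E e)) * gen (Xgen e) - gen (Xgen e) | e. e \<in> arcs E} \<union>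
     {gen (Xgen e) * gen (Pgen (head E e)) - gen (Xgen e) | e. e \<in> arcs E} \<union>
     {gen (Pgen (head E e)) * gen (Ygen e) - gen (Ygen e) | e. e \<in> arcs E} \<union>
     {gen (Ygen e) * gen (Pgen (tail E e)) - gen (Ygen e) | e. e \<in> arcs E} \<union>
     {gen (Ygen e) * gen (Xgen e') - (if e = e' then gen (Pgen (head E e)) else 0) | e e'.
        e \<in> arcs E \<and> e' \<in> arcs E} \<union>
     {gen (Pgen v) - (\<Sum>e\<in>out_arcs E v. gen (Xgen e) * gen (Ygen e)) | v.
        v \<in> verts E \<and> out_arcs E v \<noteq> {}}"

definition graph_algebra ::
    "('v, 'e) pre_digraph \<Rightarrow> ('k::field, (('v, 'e) generator list \<Rightarrow>\<^sub>0 'k) set) module" where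
  "graph_algebra E =
     alg_quot (free_algebra (generators E)) (alg_ideal (free_algebra (generators E)) (relators E))"


section \<open>Left modules\<close>

text \<open>
  \<^locale>\<open>module\<close> of the library requires a commutative base ring. As there, a module is a
  record whose fields \<open>mult\<close> and \<open>one\<close> have no meaning.
\<close>

locale left_module = R?: ring R + M?: abelian_group M
  for R (structure) and M :: "('r, 'm) module" (structure) +
  assumes smult_closed:
      "a \<in> carrier R \<Longrightarrow> x \<in> carrier M \<Longrightarrow> a \<odot>\<^bsub>M\<^esub> x \<in> carrier M"
    and smult_l_distr: "a \<in> carrier R \<Longrightarrow> b \<in> carrier R \<Longrightarrow> x \<in> carrier M \<Longrightarrow>
      (a \<oplus>\<^bsub>R\<^esub> b) \<odot>\<^bsub>M\<^esub> x = a \<odot>\<^bsub>M\<^esub> x \<oplus>\<^bsub>M\<^esub> b \<odot>\<^bsub>M\<^esub> x"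
    and smult_r_distr: "a \<in> carrier R \<Longrightarrow> x \<in> carrier M \<Longrightarrow> y \<in> carrier M \<Longrightarrow>
      a \<odot>\<^bsub>M\<^esub> (x \<oplus>\<^bsub>M\<^esub> y) = a \<odot>\<^bsub>M\<^esub> x \<oplus>\<^bsub>M\<^esub> a \<odot>\<^bsub>M\<^esub> y"
    and smult_assoc: "a \<in> carrier R \<Longrightarrow> b \<in> carrier R \<Longrightarrow> x \<in> carrier M \<Longrightarrow>
      (a \<otimes>\<^bsub>R\<^esub> b) \<odot>\<^bsub>M\<^esub> x = a \<odot>\<^bsub>M\<^esub> (b \<odot>\<^bsub>M\<^esub> x)"
    and smult_one: "x \<in> carrier M \<Longrightarrow> \<one>\<^bsub>R\<^esub> \<odot>\<^bsub>M\<^esub> x = x"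

definition lmod_hom ::
    "('r, 'x) ring_scheme \<Rightarrow> ('r, 'm) module \<Rightarrow> ('r, 'n) module \<Rightarrow> ('m \<Rightarrow> 'n) set" where
  "lmod_hom R M N = {f \<in> carrier M \<rightarrow> carrier N.
     (\<forall>x\<in>carrier M. \<forall>y\<in>carrier M. f (x \<oplus>\<^bsub>M\<^esub> y) = f x \<oplus>\<^bsub>N\<^esub> f y) \<and>
     (\<forall>a\<in>carrier R. \<forall>x\<in>carrier M. f (a \<odot>\<^bsub>M\<^esub> x) = a \<odot>\<^bsub>N\<^esub> f x)}"

definition lmod_iso ::
    "('r, 'x) ring_scheme \<Rightarrow> ('r, 'm) module \<Rightarrow> ('r, 'n) module \<Rightarrow> bool" where
  "lmod_iso R M N \<longleftrightarrow> (\<exists>f \<in> lmod_hom R M N. bij_betw f (carrier M) (carrier N))"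

definition direct_sum :: "('r, 'm) module \<Rightarrow> ('r, 'n) module \<Rightarrow> ('r, 'm \<times> 'n) module" where
  "direct_sum M N =
    \<lparr>carrier = carrier M \<times> carrier N, mult = undefined, one = undefined,
     zero = (\<zero>\<^bsub>M\<^esub>, \<zero>\<^bsub>N\<^esub>),
     add = (\<lambda>(x, y) (x', y'). (x \<oplus>\<^bsub>M\<^esub> x', y \<oplus>\<^bsub>N\<^esub> y')),
     smult = (\<lambda>a (x, y). (a \<odot>\<^bsub>M\<^esub> x, a \<odot>\<^bsub>N\<^esub> y))\<rparr>"

text \<open>The direct sum of copies of \<open>M\<close> indexed by the possibly infinite set \<open>S\<close>.\<close>

definition direct_power :: "'s set \<Rightarrow> ('r, 'm) module \<Rightarrow> ('r, 's \<Rightarrow> 'm) module" where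
  "direct_power S M =
    \<lparr>carrier = {f \<in> S \<rightarrow>\<^sub>E carrier M. finite {s \<in> S. f s \<noteq> \<zero>\<^bsub>M\<^esub>}},
     mult = undefined, one = undefined,
     zero = (\<lambda>s\<in>S. \<zero>\<^bsub>M\<^esub>),
     add = (\<lambda>f g. \<lambda>s\<in>S. f s \<oplus>\<^bsub>M\<^esub> g s),
     smult = (\<lambda>a f. \<lambda>s\<in>S. a \<odot>\<^bsub>M\<^esub> f s)\<rparr>"

definition regular_module :: "('r, 'x) ring_scheme \<Rightarrow> ('r, 'r) module" where
  "regular_module R =
    \<lparr>carrier = carrier R, mult = undefined, one = undefined,
     zero = \<zero>\<^bsub>R\<^esub>, add = add R, smult = mult R\<rparr>"

abbreviation submod :: "('r, 'm) module \<Rightarrow> 'm set \<Rightarrow> ('r, 'm) module" where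
  "submod M H \<equiv> M\<lparr>carrier := H\<rparr>"

definition internal_direct_sum ::
    "('r, 'x) ring_scheme \<Rightarrow> ('r, 'm) module \<Rightarrow> 'm set \<Rightarrow> 'm set \<Rightarrow> bool" where
  "internal_direct_sum R M H L \<longleftrightarrow>
     submodule H R M \<and> submodule L R M \<and>
     H <+>\<^bsub>M\<^esub> L = carrier M \<and> H \<inter> L = {\<zero>\<^bsub>M\<^esub>}"

definition iso_direct_summand ::
    "('r, 'x) ring_scheme \<Rightarrow> ('r, 'm) module \<Rightarrow> ('r, 'n) module \<Rightarrow> bool" where
  "iso_direct_summand R C M \<longleftrightarrow>
     (\<exists>H L. internal_direct_sum R M H L \<and> lmod_iso R C (submod M H))"

text \<open>
  \<open>smult_span M I (carrier M)\<close> is the product \<open>IM\<close> of an ideal \<open>I\<close> and a module \<open>M\<close>, and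
  \<open>smult_span M (carrier R) S\<close> is the \<open>R\<close>-submodule generated by \<open>S\<close>.
\<close>

definition smult_span :: "('r, 'm) module \<Rightarrow> 'r set \<Rightarrow> 'm set \<Rightarrow> 'm set" where
  "smult_span M A S = generate (add_monoid M) {a \<odot>\<^bsub>M\<^esub> x | a x. a \<in> A \<and> x \<in> S}"

definition finitely_generated :: "('r, 'x) ring_scheme \<Rightarrow> ('r, 'm) module \<Rightarrow> bool" where
  "finitely_generated R M \<longleftrightarrow>
     (\<exists>S. finite S \<and> S \<subseteq> carrier M \<and> carrier M = smult_span M (carrier R) S)"

text \<open>
  A projective module is a direct summand of a free module. Indexing the basis by a subset of
  the type carrying \<open>M\<close> is no restriction: \<open>M\<close> is a quotient of the free module on its own
  elements, and this quotient map splits if \<open>M\<close> is projective.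
\<close>

definition projective :: "('r, 'x) ring_scheme \<Rightarrow> ('r, 'm) module \<Rightarrow> bool" where
  "projective R M \<longleftrightarrow>
     (\<exists>S :: 'm set. iso_direct_summand R M (direct_power S (regular_module R)))"


section \<open>Finitely generated projective modules and K-theory\<close>

definition FP :: "('r, 'x) ring_scheme \<Rightarrow> 'r set \<Rightarrow> ('r, 'm) module set" where
  "FP R I = {M. left_module R M \<and> finitely_generated R M \<and> projective R M \<and>
                carrier M = smult_span M I (carrier M)}"

text \<open>
  The modules of a class \<open>\<C>\<close> share a carrier type \<open>'m\<close>. As no single type carries all modules,
  a property of all finitely generated projective modules is stated for an arbitrary \<open>'m\<close>.
\<close>

definition refinement_property ::
    "('r, 'x) ring_scheme \<Rightarrow> ('r, 'm) module set \<Rightarrow> bool" where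
  "refinement_property R \<C> \<longleftrightarrow>
     (\<forall>A1\<in>\<C>. \<forall>A2\<in>\<C>. \<forall>B1\<in>\<C>. \<forall>B2\<in>\<C>.
        lmod_iso R (direct_sum A1 A2) (direct_sum B1 B2) \<longrightarrow>
        (\<exists>A11 A12 A21 A22.
           internal_direct_sum R A1 A11 A12 \<and>
           internal_direct_sum R A2 A21 A22 \<and>
           lmod_iso R (direct_sum (submod A1 A11) (submod A2 A21)) B1 \<and>
           lmod_iso R (direct_sum (submod A1 A12) (submod A2 A22)) B2))"

definition separative :: "('r, 'x) ring_scheme \<Rightarrow> ('r, 'm) module set \<Rightarrow> bool" where
  "separative R \<C> \<longleftrightarrow>
     (\<forall>A\<in>\<C>. \<forall>B\<in>\<C>. \<forall>C\<in>\<C>.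
        lmod_iso R (direct_sum A C) (direct_sum B C) \<longrightarrow>
        (\<exists>n::nat. iso_direct_summand R C (direct_power {..<n} A) \<and>
                  iso_direct_summand R C (direct_power {..<n} B)) \<longrightarrow>
        lmod_iso R A B)"

text \<open>
  For the monoid of isomorphism classes the modules are carried by \<open>nat \<Rightarrow> 'r\<close>: this type
  contains \<open>R\<^sup>n\<close> for all \<open>n\<close>, hence a copy of every finitely generated projective module.
  The abelian monoid is written multiplicatively, as in \<^locale>\<open>comm_monoid\<close>.
\<close>

definition iso_class ::
    "('r, 'x) ring_scheme \<Rightarrow> 'r set \<Rightarrow> ('r, 'm) module \<Rightarrow> ('r, nat \<Rightarrow> 'r) module set" where
  "iso_class R I M = {N \<in> FP R I. lmod_iso R M N}"

definition V_monoid ::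
    "('r, 'x) ring_scheme \<Rightarrow> 'r set \<Rightarrow> (('r, nat \<Rightarrow> 'r) module set) monoid" where
  "V_monoid R I =
    \<lparr>carrier = iso_class R I ` (FP R I :: ('r, nat \<Rightarrow> 'r) module set),
     mult = (\<lambda>U W. \<Union>M\<in>U. \<Union>N\<in>W. iso_class R I (direct_sum M N)),
     one = {N \<in> FP R I. carrier N = {\<zero>\<^bsub>N\<^esub>}}\<rparr>"

definition alg_le :: "('a, 'x) monoid_scheme \<Rightarrow> 'a \<Rightarrow> 'a \<Rightarrow> bool" where
  "alg_le M x y \<longleftrightarrow> (\<exists>z\<in>carrier M. y = x \<otimes>\<^bsub>M\<^esub> z)"

definition unperforated_monoid :: "('a, 'x) monoid_scheme \<Rightarrow> bool" where
  "unperforated_monoid M \<longleftrightarrow> comm_monoid M \<and>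
     (\<forall>a\<in>carrier M. \<forall>b\<in>carrier M. \<forall>n::nat. n > 0 \<longrightarrow>
        alg_le M (a [^]\<^bsub>M\<^esub> n) (b [^]\<^bsub>M\<^esub> n) \<longrightarrow> alg_le M a b)"

text \<open>
  The enveloping group of a commutative monoid consists of the formal differences \<open>a - b\<close>, with
  \<open>a - b = c - d\<close> iff \<open>a + d + e = c + b + e\<close> for some \<open>e\<close>.
\<close>

definition env_rel :: "('a, 'x) monoid_scheme \<Rightarrow> (('a \<times> 'a) \<times> ('a \<times> 'a)) set" where
  "env_rel M = {((a, b), (c, d)) | a b c d.
     a \<in> carrier M \<and> b \<in> carrier M \<and> c \<in> carrier M \<and> d \<in> carrier M \<and>
     (\<exists>e\<in>carrier M. a \<otimes>\<^bsub>M\<^esub> d \<otimes>\<^bsub>M\<^esub> e = c \<otimes>\<^bsub>M\<^esub> b \<otimes>\<^bsub>M\<^esub> e)}"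

definition env_group :: "('a, 'x) monoid_scheme \<Rightarrow> (('a \<times> 'a) set) monoid" where
  "env_group M =
    \<lparr>carrier = (carrier M \<times> carrier M) // env_rel M,
     mult = (\<lambda>U W. \<Union>(a, b)\<in>U. \<Union>(c, d)\<in>W. env_rel M `` {(a \<otimes>\<^bsub>M\<^esub> c, b \<otimes>\<^bsub>M\<^esub> d)}),
     one = env_rel M `` {(\<one>\<^bsub>M\<^esub>, \<one>\<^bsub>M\<^esub>)}\<rparr>"

definition env_cone :: "('a, 'x) monoid_scheme \<Rightarrow> ('a \<times> 'a) set set" where
  "env_cone M = {env_rel M `` {(a, \<one>\<^bsub>M\<^esub>)} | a. a \<in> carrier M}"

text \<open>
  A pre-ordered abelian group is given by its positive cone \<open>C = {g. g \<ge> 0}\<close>, which is an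
  arbitrary submonoid.
\<close>

definition unperforated_group :: "('a, 'x) monoid_scheme \<Rightarrow> 'a set \<Rightarrow> bool" where
  "unperforated_group G C \<longleftrightarrow> comm_group G \<and> Group.submonoid C G \<and>
     (\<forall>g\<in>carrier G. \<forall>n::nat. n > 0 \<longrightarrow> g [^]\<^bsub>G\<^esub> n \<in> C \<longrightarrow> g \<in> C)"

definition K0 ::
    "('r, 'x) ring_scheme \<Rightarrow> 'r set \<Rightarrow>
      (('r, nat \<Rightarrow> 'r) module set \<times> ('r, nat \<Rightarrow> 'r) module set) set monoid" where
  "K0 R I = env_group (V_monoid R I)"

definition K0_cone ::
    "('r, 'x) ring_scheme \<Rightarrow> 'r set \<Rightarrow>
      (('r, nat \<Rightarrow> 'r) module set \<times> ('r, nat \<Rightarrow> 'r) module set) set set" where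
  "K0_cone R I = env_cone (V_monoid R I)"

end

theory Submission
  imports Defs "HOL-Library.Multiset" "HOL-Library.Function_Algebras"
begin

text \<open>
  Let \<open>A\<close> be the algebra spanned by the words in the \<open>p\<^sub>v\<close> and \<open>y\<^sub>e\<close>. It is the
  path algebra of the opposite graph, so submodules of free \<open>A\<close>-modules are free and the rank at each
  vertex is well defined. By \<open>p\<^sub>v = \<Sum> x\<^sub>e y\<^sub>e\<close>, multiplication by sufficiently
  long words in the \<open>y\<^sub>e\<close> moves any element of \<open>L\<^sub>K(E)\<close> into \<open>A\<close>. Hence a module over \<open>L\<^sub>K(E)\<close>
  is controlled by its \<open>A\<close>-lattices: every submodule of a sum of modules \<open>R p\<^sub>v\<close> is again such a
  sum, and two such sums are isomorphic iff the multisets of their vertices are related by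
  replacing \<open>v\<close> with the heads of the edges emitted by \<open>v\<close>. This identifies the monoid of finitely
  generated projective modules with the graph monoid, where only finitely many vertices matter at
  a time. Vertices without loops can be eliminated by substitution; if every remaining vertex has
  a loop, firing only adds vertices and the three properties are checked by counting.
\<close>

section \<open>The graph monoid\<close>

text \<open>Modules over L_K(E) have no invariant rank, so an isomorphism cannot be analysed by
  counting basis elements over L_K(E) itself. Over the algebra of the \<open>p\<close> and
  \<open>y\<close> this is possible: the relations among these generators are homogeneous in the
  number of \<open>y\<close>, so words of positive length can be divided out and only the vertices
  remain.

  An isomorphism does not respect chosen lattices, but the elements of the first lattice that it
  sends into the second form a lattice for both sides. The leading monomials of a basis of it are
  the minimal elements of a set that contains all deep paths, hence a cut set in a forest of
  finitely branching trees, and a cut set is reached from the roots by firing vertices. Sinks shape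
  the notion of depth: \<open>p\<^sub>v\<close> cannot be expanded there and paths stop.

  Projective modules are given as summands of free modules of possibly infinite rank, over possibly
  infinitely many vertices. The structure of submodules is therefore established for arbitrary index
  sets, and finiteness is recovered from finite generation.\<close>

text \<open>
  For a graph, \<open>F\<close> is the set of vertices that emit edges and \<open>out v\<close> consists of the heads of
  the edges emitted by \<open>v\<close>. The graph monoid is the quotient by this congruence.
\<close>

inductive meq :: "'v set \<Rightarrow> ('v \<Rightarrow> 'v multiset) \<Rightarrow> 'v multiset \<Rightarrow> 'v multiset \<Rightarrow> bool"
  for F out where
  step: "v \<in> F \<Longrightarrow> meq F out (add_mset v \<delta>) (out v + \<delta>)"
| refl: "meq F out \<alpha> \<alpha>"
| sym: "meq F out \<alpha> \<beta> \<Longrightarrow> meq F out \<beta> \<alpha>"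
| trans: "meq F out \<alpha> \<beta> \<Longrightarrow> meq F out \<beta> \<gamma> \<Longrightarrow> meq F out \<alpha> \<gamma>"

lemma meq_add_right: "meq F out \<alpha> \<beta> \<Longrightarrow> meq F out (\<alpha> + \<zeta>) (\<beta> + \<zeta>)"
proof (induction rule: meq.induct)
  case (step v \<delta>)
  then show ?case using meq.step[of v F out "\<delta> + \<zeta>"] by (simp add: add.assoc)
qed (auto intro: meq.intros)

lemma meq_add:
  assumes "meq F out \<alpha> \<beta>" "meq F out \<gamma> \<delta>"
  shows "meq F out (\<alpha> + \<gamma>) (\<beta> + \<delta>)"
  using meq_add_right[OF assms(1), of \<gamma>] meq_add_right[OF assms(2), of \<beta>]
  by (metis add.commute meq.trans)

lemma meq_sum:
  assumes "\<And>i. i \<in># I \<Longrightarrow> meq F out (f i) (g i)"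
  shows "meq F out (\<Sum>i\<in>#I. f i) (\<Sum>i\<in>#I. g i)"
  using assms by (induction I) (auto intro: meq.refl meq_add)

lemma meq_single: "v \<in> F \<Longrightarrow> meq F out {#v#} (out v)"
  using meq.step[of v F out "{#}"] by simp

lemma meq_mono: "meq F out \<alpha> \<beta> \<Longrightarrow> F \<subseteq> F' \<Longrightarrow> meq F' out \<alpha> \<beta>"
  by (induction rule: meq.induct) (auto intro: meq.intros)

text \<open>A derivation fires finitely many vertices. This is the bridge from infinite graphs to
  the induction on the number of vertices that may be fired.\<close>

lemma meq_finite: "meq F out \<alpha> \<beta> \<Longrightarrow> \<exists>F0\<subseteq>F. finite F0 \<and> meq F0 out \<alpha> \<beta>"
proof (induction rule: meq.induct)
  case (step v \<delta>)
  then show ?case by (intro exI[of _ "{v}"]) (auto intro: meq.step)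
next
  case (refl \<alpha>)
  then show ?case by (intro exI[of _ "{}"]) (auto intro: meq.refl)
next
  case (sym \<alpha> \<beta>)
  then show ?case by (metis meq.sym)
next
  case (trans \<alpha> \<beta> \<gamma>)
  then obtain F1 F2 where "F1 \<subseteq> F" "finite F1" "meq F1 out \<alpha> \<beta>"
    "F2 \<subseteq> F" "finite F2" "meq F2 out \<beta> \<gamma>" by blast
  then show ?case
    by (intro exI[of _ "F1 \<union> F2"]) (simp, meson Un_upper1 Un_upper2 meq.trans meq_mono)
qed

text \<open>The conjuncts are refinement, separativity and unperforation of the quotient monoid,
  with \<open>\<le>\<close> unfolded into complements \<open>\<delta>\<close>,
  \<open>\<delta>'\<close>, \<open>\<zeta>\<close>, \<open>\<zeta>'\<close>. They are bundled
  because the elimination of a vertex transports all of them at once.\<close>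

definition tame :: "'v set \<Rightarrow> ('v \<Rightarrow> 'v multiset) \<Rightarrow> bool" where
  "tame F out \<longleftrightarrow>
     (\<forall>\<alpha>1 \<alpha>2 \<beta>1 \<beta>2. meq F out (\<alpha>1 + \<alpha>2) (\<beta>1 + \<beta>2) \<longrightarrow>
        (\<exists>\<gamma>11 \<gamma>12 \<gamma>21 \<gamma>22. meq F out \<alpha>1 (\<gamma>11 + \<gamma>12) \<and> meq F out \<alpha>2 (\<gamma>21 + \<gamma>22) \<and>
           meq F out \<beta>1 (\<gamma>11 + \<gamma>21) \<and> meq F out \<beta>2 (\<gamma>12 + \<gamma>22))) \<and>
     (\<forall>\<alpha> \<beta> \<gamma> \<delta> \<delta>' n. meq F out (\<alpha> + \<gamma>) (\<beta> + \<gamma>) \<longrightarrow>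
        meq F out (\<gamma> + \<delta>) (repeat_mset n \<alpha>) \<longrightarrow> meq F out (\<gamma> + \<delta>') (repeat_mset n \<beta>) \<longrightarrow>
        meq F out \<alpha> \<beta>) \<and>
     (\<forall>\<alpha> \<beta> \<zeta> n. n > 0 \<longrightarrow> meq F out (repeat_mset n \<alpha> + \<zeta>) (repeat_mset n \<beta>) \<longrightarrow>
        (\<exists>\<zeta>'. meq F out (\<alpha> + \<zeta>') \<beta>))"

lemma tame_refinement:
  assumes "tame F out" "meq F out (\<alpha>1 + \<alpha>2) (\<beta>1 + \<beta>2)"
  obtains \<gamma>11 \<gamma>12 \<gamma>21 \<gamma>22 where "meq F out \<alpha>1 (\<gamma>11 + \<gamma>12)" "meq F out \<alpha>2 (\<gamma>21 + \<gamma>22)"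
    "meq F out \<beta>1 (\<gamma>11 + \<gamma>21)" "meq F out \<beta>2 (\<gamma>12 + \<gamma>22)"
  using conjunct1[OF assms(1)[unfolded tame_def], rule_format, OF assms(2)] by blast

lemma tame_separative:
  assumes "tame F out" "meq F out (\<alpha> + \<gamma>) (\<beta> + \<gamma>)"
    "meq F out (\<gamma> + \<delta>) (repeat_mset n \<alpha>)" "meq F out (\<gamma> + \<delta>') (repeat_mset n \<beta>)"
  shows "meq F out \<alpha> \<beta>"
  using conjunct1[OF conjunct2[OF assms(1)[unfolded tame_def]], rule_format, OF assms(2-4)] .

lemma tame_unperforated:
  assumes "tame F out" "n > 0" "meq F out (repeat_mset n \<alpha> + \<zeta>) (repeat_mset n \<beta>)"
  obtains \<zeta>' where "meq F out (\<alpha> + \<zeta>') \<beta>"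
  using conjunct2[OF conjunct2[OF assms(1)[unfolded tame_def]], rule_format, OF assms(2-3)] by blast

text \<open>The overlap of \<open>a\<close> and \<open>c\<close> serves as \<open>p\<close>, their
  excesses over each other as \<open>q\<close> and \<open>r\<close>, and \<open>s\<close> is what
  \<open>d\<close> has left after \<open>q\<close>.\<close>

lemma mset_sum_refinement:
  fixes a b c d :: "'v multiset"
  assumes "a + b = c + d"
  shows "\<exists>p q r s. a = p + q \<and> b = r + s \<and> c = p + r \<and> d = q + s"
proof (intro exI conjI multiset_eqI)
  fix x
  have *: "count a x + count b x = count c x + count d x"
    using arg_cong[OF assms, of "\<lambda>m. count m x"] by simp
  show "count a x = count (a \<inter># c + (a - c)) x" by (simp add: min_def)
  show "count b x = count ((c - a) + (d - (a - c))) x" using * by simp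
  show "count c x = count (a \<inter># c + (c - a)) x" by (simp add: min_def)
  show "count d x = count ((a - c) + (d - (a - c))) x" using * by simp
qed

text \<open>When all of \<open>F\<close> carries loops, no firing removes a vertex, and the closure
  of the support of a multiset consists of the vertices that firings can make occur. It decides
  which firings are legal.\<close>

inductive_set supp_closure :: "'v set \<Rightarrow> ('v \<Rightarrow> 'v multiset) \<Rightarrow> 'v set \<Rightarrow> 'v set" for F e S where
  base: "v \<in> S \<Longrightarrow> v \<in> supp_closure F e S"
| step: "v \<in> supp_closure F e S \<Longrightarrow> v \<in> F \<Longrightarrow> w \<in># e v \<Longrightarrow> w \<in> supp_closure F e S"

lemma supp_closure_least:
  assumes "S \<subseteq> supp_closure F e T"
  shows "supp_closure F e S \<subseteq> supp_closure F e T"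
proof
  fix x assume "x \<in> supp_closure F e S"
  then show "x \<in> supp_closure F e T"
    by induction (use assms in \<open>auto intro: supp_closure.step\<close>)
qed

lemma supp_closure_empty [simp]: "supp_closure F e {} = {}"
  using supp_closure.induct[of _ F e "{}" "\<lambda>_. False"] by auto

lemma supp_closure_Un: "supp_closure F e (S \<union> T) = supp_closure F e S \<union> supp_closure F e T"
proof
  show "supp_closure F e (S \<union> T) \<subseteq> supp_closure F e S \<union> supp_closure F e T"
  proof
    fix x assume "x \<in> supp_closure F e (S \<union> T)"
    then show "x \<in> supp_closure F e S \<union> supp_closure F e T"
      by induction (auto intro: supp_closure.intros)
  qed
  show "supp_closure F e S \<union> supp_closure F e T \<subseteq> supp_closure F e (S \<union> T)"
    by (intro Un_least supp_closure_least) (auto intro: supp_closure.base)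
qed

text \<open>
  If every vertex that may be fired carries a loop, then firing only ever adds the multiset
  \<open>e v\<close>, and a multiset of firings is possible iff it takes place inside the closure of the
  support.
\<close>

lemma tame_loops:
  assumes out: "\<And>v. v \<in> F \<Longrightarrow> out v = add_mset v (e v)"
  shows "tame F out"
proof -
  define cl where "cl = (\<lambda>\<alpha>. supp_closure F e (set_mset \<alpha>))"
  define D where "D = (\<lambda>f. \<Sum>v\<in>#f. e v)"
  have cl_add: "cl (\<alpha> + \<beta>) = cl \<alpha> \<union> cl \<beta>" for \<alpha> \<beta>
    by (simp add: cl_def supp_closure_Un)
  have cl_sub: "set_mset \<alpha> \<subseteq> cl \<alpha>" for \<alpha>
    by (auto simp: cl_def intro: supp_closure.base)
  \<comment> \<open>Only an inclusion, since the separativity clause admits \<open>n = 0\<close>,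
    which empties the multiset.\<close>
  have cl_rep: "cl (repeat_mset n \<alpha>) \<subseteq> cl \<alpha>" for n \<alpha>
    by (induction n) (auto simp: cl_add, simp add: cl_def supp_closure_empty)
  have cl_rep': "n > 0 \<Longrightarrow> cl (repeat_mset n \<alpha>) = cl \<alpha>" for n \<alpha>
    by (cases n) (auto simp: cl_add dest: subsetD[OF cl_rep])
  have D_add: "D (f + g) = D f + D g" for f g by (simp add: D_def)
  \<comment> \<open>The vertex \<open>v\<close> need not occur in \<open>\<alpha>\<close> yet. Some
    congruent \<open>\<kappa>\<close> contains it; \<open>v\<close> is fired there, and the way back
    to \<open>\<alpha>\<close> is taken with \<open>e v\<close> as a bystander.\<close>
  have fire: "meq F out \<alpha> (\<alpha> + e v)" if v: "v \<in> F" "v \<in> cl \<alpha>" for v \<alpha>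
  proof -
    have "\<exists>\<kappa>. meq F out \<alpha> \<kappa> \<and> w \<in># \<kappa>" if "w \<in> cl \<alpha>" for w
      using that unfolding cl_def
    proof induction
      case (base v)
      then show ?case by (blast intro: meq.refl)
    next
      case (step v w)
      then obtain \<kappa> where \<kappa>: "meq F out \<alpha> \<kappa>" "v \<in># \<kappa>" by blast
      then have "meq F out \<kappa> (out v + (\<kappa> - {#v#}))"
        using meq.step[OF \<open>v \<in> F\<close>, of out "\<kappa> - {#v#}"] by simp
      moreover have "w \<in># out v + (\<kappa> - {#v#})" using step out by simp
      ultimately show ?case using \<kappa> meq.trans by blast
    qed
    then obtain \<kappa> where \<kappa>: "meq F out \<alpha> \<kappa>" "v \<in># \<kappa>" using v by blast
    have "meq F out \<kappa> (out v + (\<kappa> - {#v#}))"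
      using meq.step[OF \<open>v \<in> F\<close>, of out "\<kappa> - {#v#}"] \<kappa> by simp
    also have "out v + (\<kappa> - {#v#}) = \<kappa> + e v"
      using out[OF \<open>v \<in> F\<close>] \<kappa> by (metis add.commute add_mset_add_single insert_DiffM union_mset_add_mset_left)
    finally show ?thesis
      using \<kappa>(1) meq_add_right[OF \<kappa>(1), of "e v"] by (meson meq.sym meq.trans)
  qed
  have fires: "meq F out \<alpha> (\<alpha> + D f)" if "set_mset f \<subseteq> F \<inter> cl \<alpha>" for f \<alpha>
    using that
  proof (induction f)
    case empty
    then show ?case by (simp add: D_def meq.refl)
  next
    case (add v f)
    have "meq F out (\<alpha> + D f) (\<alpha> + e v + D f)"
      using add.prems by (intro meq_add_right fire) auto
    with add show ?case by (auto simp: D_def add_ac intro: meq.trans)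
  qed
  \<comment> \<open>Converse of \<open>fires\<close>: congruent multisets have the same closure and
    become equal after legal firings. Both firing multisets stay inside the common closure, so the
    equations of consecutive steps can be added.\<close>
  have rel: "cl \<alpha> = cl \<beta> \<and> (\<exists>f g. set_mset f \<subseteq> F \<inter> cl \<alpha> \<and> set_mset g \<subseteq> F \<inter> cl \<alpha> \<and> \<alpha> + D f = \<beta> +
      D g)"
    if "meq F out \<alpha> \<beta>" for \<alpha> \<beta>
    using that
  proof induction
    case (step v \<delta>)
    have "cl (add_mset v \<delta>) = cl (out v + \<delta>)"
    proof -
      have "cl (e v) \<subseteq> cl {#v#}"
        unfolding cl_def using supp_closure.step[OF supp_closure.base step]
        by (intro supp_closure_least) auto
      moreover have "cl (out v + \<delta>) = cl {#v#} \<union> cl (e v) \<union> cl \<delta>"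
        using out[OF step] by (metis add_mset_add_single cl_add sup_commute)
      moreover have "cl (add_mset v \<delta>) = cl {#v#} \<union> cl \<delta>"
        by (metis add_mset_add_single cl_add sup_commute)
      ultimately show ?thesis by blast
    qed
    moreover have "v \<in> cl (add_mset v \<delta>)" using cl_sub by fastforce
    ultimately show ?case
      using step out[OF step] by (intro conjI exI[of _ "{#v#}"] exI[of _ "{#}"]) (auto simp: D_def)
  next
    case (refl \<alpha>)
    show ?case by (rule conjI[OF HOL.refl], rule exI[of _ "{#}"], rule exI[of _ "{#}"]) simp
  next
    case (sym \<alpha> \<beta>)
    then show ?case by metis
  next
    case (trans \<alpha> \<beta> \<gamma>)
    obtain f g where 1: "set_mset f \<subseteq> F \<inter> cl \<alpha>" "set_mset g \<subseteq> F \<inter> cl \<alpha>" "\<alpha> + D f = \<beta> + D g"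
      using trans.IH(1) by blast
    obtain f' g' where 2: "set_mset f' \<subseteq> F \<inter> cl \<beta>" "set_mset g' \<subseteq> F \<inter> cl \<beta>" "\<beta> + D f' = \<gamma> + D g'"
      using trans.IH(2) by blast
    have "\<alpha> + D (f + f') = (\<alpha> + D f) + D f'" by (simp add: D_add add.assoc)
    also have "\<dots> = (\<beta> + D f') + D g" by (simp add: 1 add_ac)
    also have "\<dots> = \<gamma> + D (g + g')" by (simp add: 2 D_add add_ac)
    finally show ?case using 1 2 trans.IH
      by (intro conjI exI[of _ "f + f'"] exI[of _ "g + g'"]) auto
  qed
  have refine: "\<exists>\<gamma>11 \<gamma>12 \<gamma>21 \<gamma>22. meq F out \<alpha>1 (\<gamma>11 + \<gamma>12) \<and> meq F out \<alpha>2 (\<gamma>21 + \<gamma>22) \<and>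
           meq F out \<beta>1 (\<gamma>11 + \<gamma>21) \<and> meq F out \<beta>2 (\<gamma>12 + \<gamma>22)"
    if h: "meq F out (\<alpha>1 + \<alpha>2) (\<beta>1 + \<beta>2)" for \<alpha>1 \<alpha>2 \<beta>1 \<beta>2
  proof -
    \<comment> \<open>Every vertex of \<open>f\<close> is legal for one of the two summands; it is
      charged to \<open>\<alpha>1\<close> whenever possible.\<close>
    have split: "\<exists>f1 f2. meq F out \<alpha>1 f1 \<and> meq F out \<alpha>2 f2 \<and> \<alpha>1 + \<alpha>2 + D f = f1 + f2"
      if "set_mset f \<subseteq> F \<inter> cl (\<alpha>1 + \<alpha>2)" for \<alpha>1 \<alpha>2 f
    proof -
      let ?f1 = "filter_mset (\<lambda>v. v \<in> cl \<alpha>1) f" and ?f2 = "filter_mset (\<lambda>v. v \<notin> cl \<alpha>1) f"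
      have "f = ?f1 + ?f2" by (rule multiset_partition)
      then have "\<alpha>1 + \<alpha>2 + D f = (\<alpha>1 + D ?f1) + (\<alpha>2 + D ?f2)"
        by (metis D_add add.assoc add.left_commute)
      moreover have "meq F out \<alpha>1 (\<alpha>1 + D ?f1)" "meq F out \<alpha>2 (\<alpha>2 + D ?f2)"
        using that by (auto intro!: fires simp: cl_add)
      ultimately show ?thesis by blast
    qed
    obtain f g where fg: "set_mset f \<subseteq> F \<inter> cl (\<alpha>1 + \<alpha>2)" "set_mset g \<subseteq> F \<inter> cl (\<beta>1 + \<beta>2)"
      "\<alpha>1 + \<alpha>2 + D f = \<beta>1 + \<beta>2 + D g" using rel[OF h] by auto
    obtain a1 a2 where a: "meq F out \<alpha>1 a1" "meq F out \<alpha>2 a2" "\<alpha>1 + \<alpha>2 + D f = a1 + a2"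
      using split[OF fg(1)] by blast
    obtain b1 b2 where b: "meq F out \<beta>1 b1" "meq F out \<beta>2 b2" "\<beta>1 + \<beta>2 + D g = b1 + b2"
      using split[OF fg(2)] by blast
    have "a1 + a2 = b1 + b2" using a(3) b(3) fg(3) by simp
    from mset_sum_refinement[OF this] show ?thesis using a(1,2) b(1,2) by blast
  qed
  have sep: "meq F out \<alpha> \<beta>"
    if h: "meq F out (\<alpha> + \<gamma>) (\<beta> + \<gamma>)"
      "meq F out (\<gamma> + \<delta>) (repeat_mset n \<alpha>)" "meq F out (\<gamma> + \<delta>') (repeat_mset n \<beta>)"
    for \<alpha> \<beta> \<gamma> \<delta> \<delta>' n
  proof -
    have "cl \<gamma> \<subseteq> cl \<alpha>" "cl \<gamma> \<subseteq> cl \<beta>"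
      using rel[OF h(2)] rel[OF h(3)] cl_rep[of n \<alpha>] cl_rep[of n \<beta>] cl_add by auto
    \<comment> \<open>Being below multiples of \<open>\<alpha>\<close> and \<open>\<beta>\<close>,
      the multiset \<open>\<gamma>\<close> enlarges neither closure. The firings that relate the two
      sums are therefore legal without \<open>\<gamma>\<close>, which cancels in the free
      monoid.\<close>
    then have *: "cl (\<alpha> + \<gamma>) = cl \<alpha>" "cl (\<beta> + \<gamma>) = cl \<beta>" by (auto simp: cl_add)
    obtain f g where fg: "set_mset f \<subseteq> F \<inter> cl \<alpha>" "set_mset g \<subseteq> F \<inter> cl \<beta>"
      "\<alpha> + \<gamma> + D f = \<beta> + \<gamma> + D g" using rel[OF h(1)] * by auto
    then have "\<alpha> + D f = \<beta> + D g" by (simp add: add_ac)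
    then show ?thesis
      using fires[OF fg(1)] fires[OF fg(2)] by (metis meq.sym meq.trans)
  qed
  have unp: "\<exists>\<zeta>'. meq F out (\<alpha> + \<zeta>') \<beta>"
    if n: "n > 0" and h: "meq F out (repeat_mset n \<alpha> + \<zeta>) (repeat_mset n \<beta>)" for \<alpha> \<beta> \<zeta> n
  proof -
    obtain f g where fg: "set_mset g \<subseteq> F \<inter> cl \<beta>"
      "repeat_mset n \<alpha> + \<zeta> + D f = repeat_mset n \<beta> + D g" using rel[OF h] cl_rep'[OF n] by auto
    \<comment> \<open>The firings \<open>g\<close> of \<open>n\<close> copies of
      \<open>\<beta>\<close> are all performed on a single copy. This is legal because the closures
      agree, and sufficient because \<open>n * \<alpha> \<le> n * \<beta> + D g \<le> n * (\<beta> +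
      D g)\<close>.\<close>
    have "\<alpha> \<subseteq># \<beta> + D g"
    proof (rule mset_subset_eqI)
      fix a
      have "n * count \<alpha> a + count \<zeta> a + count (D f) a = n * count \<beta> a + count (D g) a"
        using arg_cong[OF fg(2), of "\<lambda>m. count m a"] by simp
      then have "n * count \<alpha> a \<le> n * count \<beta> a + count (D g) a" by linarith
      also have "\<dots> \<le> n * (count \<beta> a + count (D g) a)" using n by (simp add: algebra_simps)
      finally show "count \<alpha> a \<le> count (\<beta> + D g) a" using n by simp
    qed
    then have "\<alpha> + (\<beta> + D g - \<alpha>) = \<beta> + D g" by simp
    then show ?thesis using fires[OF fg(1)] by (metis meq.sym)
  qed
  show ?thesis unfolding tame_def using refine sep unp by blast
qed

text \<open>
  A vertex \<open>u\<close> without loop can be eliminated from the set of vertices that may be fired by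
  substituting \<open>out u\<close> for it everywhere.
\<close>

lemma tame_eliminate:
  fixes out :: "'v \<Rightarrow> 'v multiset"
  assumes u: "u \<in> F" "u \<notin># out u"
    and tame: "tame (F - {u}) (\<lambda>w. \<Sum>v\<in>#out w. if v = u then out u else {#v#})"
  shows "tame F out"
proof -
  define \<sigma> where "\<sigma> = (\<lambda>\<alpha>. \<Sum>v\<in>#\<alpha>. if v = u then out u else {#v#})"
  let ?eq = "meq F out" and ?eq' = "meq (F - {u}) (\<lambda>w. \<sigma> (out w))"
  have \<sigma>_add: "\<sigma> (\<alpha> + \<beta>) = \<sigma> \<alpha> + \<sigma> \<beta>" for \<alpha> \<beta> by (simp add: \<sigma>_def)
  have \<sigma>_rep: "\<sigma> (repeat_mset n \<alpha>) = repeat_mset n (\<sigma> \<alpha>)" for n \<alpha>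
    by (induction n) (auto simp: \<sigma>_add, simp add: \<sigma>_def)
  have \<sigma>_id: "\<sigma> \<alpha> = \<alpha>" if "u \<notin># \<alpha>" for \<alpha> using that by (induction \<alpha>) (auto simp: \<sigma>_def)
  have eq\<sigma>: "?eq \<alpha> (\<sigma> \<alpha>)" for \<alpha>
  proof -
    have "?eq (\<Sum>v\<in>#\<alpha>. {#v#}) (\<sigma> \<alpha>)"
      unfolding \<sigma>_def using u by (intro meq_sum) (auto intro: meq.refl meq_single)
    then show ?thesis by simp
  qed
  have to': "?eq' (\<sigma> \<alpha>) (\<sigma> \<beta>)" if "?eq \<alpha> \<beta>" for \<alpha> \<beta>
    using that
  proof induction
    case (step v \<delta>)
    show ?case
    proof (cases "v = u")
      case True
      \<comment> \<open>The absence of a loop enters here: \<open>\<sigma>\<close> fixes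
        \<open>out u\<close>, so firing \<open>u\<close> becomes an equality after
        substitution.\<close>
      then have "\<sigma> (add_mset v \<delta>) = \<sigma> (out v + \<delta>)"
        using \<sigma>_id[OF u(2)] by (simp add: \<sigma>_add) (simp add: \<sigma>_def)
      then show ?thesis by (simp add: meq.refl)
    next
      case False
      then have "\<sigma> (add_mset v \<delta>) = add_mset v (\<sigma> \<delta>)" by (simp add: \<sigma>_def)
      then show ?thesis using False step meq.step[of v "F - {u}" "\<lambda>w. \<sigma> (out w)" "\<sigma> \<delta>"]
        by (simp add: \<sigma>_add)
    qed
  qed (rule meq.refl, erule meq.sym, erule (1) meq.trans)
  have from': "?eq \<alpha> \<beta>" if "?eq' \<alpha> \<beta>" for \<alpha> \<beta>
    using that
  proof induction
    case (step v \<delta>)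
    have "?eq (out v + \<delta>) (\<sigma> (out v) + \<delta>)" by (intro meq_add_right eq\<sigma>)
    then show ?case using step by (auto intro: meq.intros)
  qed (rule meq.refl, erule meq.sym, erule (1) meq.trans)
  have bwd: "?eq \<alpha> \<beta>" if "?eq' (\<sigma> \<alpha>) \<beta>" for \<alpha> \<beta>
    using eq\<sigma>[of \<alpha>] from'[OF that] by (rule meq.trans)
  have tame': "tame (F - {u}) (\<lambda>w. \<sigma> (out w))" using tame by (simp add: \<sigma>_def)
  show ?thesis
    unfolding tame_def
  proof (intro conjI allI impI)
    fix \<alpha>1 \<alpha>2 \<beta>1 \<beta>2 assume "?eq (\<alpha>1 + \<alpha>2) (\<beta>1 + \<beta>2)"
    then have "?eq' (\<sigma> \<alpha>1 + \<sigma> \<alpha>2) (\<sigma> \<beta>1 + \<sigma> \<beta>2)" using to' \<sigma>_add by metis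
    with tame' obtain \<gamma>11 \<gamma>12 \<gamma>21 \<gamma>22 where "?eq' (\<sigma> \<alpha>1) (\<gamma>11 + \<gamma>12)" "?eq' (\<sigma> \<alpha>2) (\<gamma>21 + \<gamma>22)"
      "?eq' (\<sigma> \<beta>1) (\<gamma>11 + \<gamma>21)" "?eq' (\<sigma> \<beta>2) (\<gamma>12 + \<gamma>22)" unfolding tame_def by meson
    then show "\<exists>\<gamma>11 \<gamma>12 \<gamma>21 \<gamma>22. ?eq \<alpha>1 (\<gamma>11 + \<gamma>12) \<and> ?eq \<alpha>2 (\<gamma>21 + \<gamma>22) \<and>
           ?eq \<beta>1 (\<gamma>11 + \<gamma>21) \<and> ?eq \<beta>2 (\<gamma>12 + \<gamma>22)" using bwd by blast
  next
    fix \<alpha> \<beta> \<gamma> \<delta> \<delta>' n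
    assume "?eq (\<alpha> + \<gamma>) (\<beta> + \<gamma>)" "?eq (\<gamma> + \<delta>) (repeat_mset n \<alpha>)" "?eq (\<gamma> + \<delta>') (repeat_mset n \<beta>)"
    then have "?eq' (\<sigma> \<alpha> + \<sigma> \<gamma>) (\<sigma> \<beta> + \<sigma> \<gamma>)" "?eq' (\<sigma> \<gamma> + \<sigma> \<delta>) (repeat_mset n (\<sigma> \<alpha>))"
      "?eq' (\<sigma> \<gamma> + \<sigma> \<delta>') (repeat_mset n (\<sigma> \<beta>))" using to' \<sigma>_add \<sigma>_rep by metis+
    with tame' have "?eq' (\<sigma> \<alpha>) (\<sigma> \<beta>)" unfolding tame_def by blast
    then show "?eq \<alpha> \<beta>" using bwd eq\<sigma> by (meson meq.sym meq.trans)
  next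
    fix \<alpha> \<beta> \<zeta> and n :: nat assume n: "n > 0" and "?eq (repeat_mset n \<alpha> + \<zeta>) (repeat_mset n \<beta>)"
    then have "?eq' (repeat_mset n (\<sigma> \<alpha>) + \<sigma> \<zeta>) (repeat_mset n (\<sigma> \<beta>))" using to' \<sigma>_add \<sigma>_rep
        by metis
    with tame' n obtain \<zeta>' where "?eq' (\<sigma> \<alpha> + \<zeta>') (\<sigma> \<beta>)" unfolding tame_def by blast
    then have "?eq (\<sigma> \<alpha> + \<zeta>') \<beta>" using from' eq\<sigma> by (meson meq.sym meq.trans)
    then show "\<exists>\<zeta>'. ?eq (\<alpha> + \<zeta>') \<beta>"
      using meq_add_right[OF eq\<sigma>[of \<alpha>], of \<zeta>'] by (blast intro: meq.trans)
  qed
qed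

text \<open>Substitution may create new loops, but it shrinks \<open>F\<close>, so the elimination
  ends with loops at all remaining vertices, possibly with \<open>F\<close> empty.\<close>

lemma tame_finite:
  assumes "finite F"
  shows "tame F out"
  using assms
proof (induction "card F" arbitrary: F out)
  case (0 F out)
  then show ?case using tame_loops[of "{}" out "\<lambda>_. {#}"] by simp
next
  case (Suc n F out)
  show ?case
  proof (cases "\<exists>u\<in>F. u \<notin># out u")
    case True
    then obtain u where u: "u \<in> F" "u \<notin># out u" by blast
    then have "n = card (F - {u})" using Suc.hyps(2) Suc.prems by simp
    with Suc.hyps(1) Suc.prems u show ?thesis by (blast intro: tame_eliminate)
  next
    case False
    then show ?thesis by (intro tame_loops[of _ _ "\<lambda>v. out v - {#v#}"]) auto
  qed
qed

text \<open>Hypotheses and conclusions involve finitely many firings, so they live over a finite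
  part of \<open>F\<close>; the three derivations behind separativity are put into one common
  part.\<close>

theorem tame: "tame F out"
  unfolding tame_def
proof (intro conjI allI impI)
  fix \<alpha>1 \<alpha>2 \<beta>1 \<beta>2 assume "meq F out (\<alpha>1 + \<alpha>2) (\<beta>1 + \<beta>2)"
  from meq_finite[OF this] obtain F0 where F0: "F0 \<subseteq> F" "finite F0" "meq F0 out (\<alpha>1 + \<alpha>2) (\<beta>1 + \<beta>2)"
      by blast
  from tame_refinement[OF tame_finite[OF F0(2)] F0(3)]
  obtain \<gamma>11 \<gamma>12 \<gamma>21 \<gamma>22 where "meq F0 out \<alpha>1 (\<gamma>11 + \<gamma>12)" "meq F0 out \<alpha>2 (\<gamma>21 + \<gamma>22)"
      "meq F0 out \<beta>1 (\<gamma>11 + \<gamma>21)" "meq F0 out \<beta>2 (\<gamma>12 + \<gamma>22)" .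
  then show "\<exists>\<gamma>11 \<gamma>12 \<gamma>21 \<gamma>22. meq F out \<alpha>1 (\<gamma>11 + \<gamma>12) \<and> meq F out \<alpha>2 (\<gamma>21 + \<gamma>22) \<and>
           meq F out \<beta>1 (\<gamma>11 + \<gamma>21) \<and> meq F out \<beta>2 (\<gamma>12 + \<gamma>22)"
    using meq_mono[OF _ F0(1)] by blast
next
  fix \<alpha> \<beta> \<gamma> \<delta> \<delta>' n
  assume h: "meq F out (\<alpha> + \<gamma>) (\<beta> + \<gamma>)" "meq F out (\<gamma> + \<delta>) (repeat_mset n \<alpha>)"
    "meq F out (\<gamma> + \<delta>') (repeat_mset n \<beta>)"
  obtain F1 F2 F3 where "F1 \<subseteq> F" "finite F1" "meq F1 out (\<alpha> + \<gamma>) (\<beta> + \<gamma>)"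
    and "F2 \<subseteq> F" "finite F2" "meq F2 out (\<gamma> + \<delta>) (repeat_mset n \<alpha>)"
    and "F3 \<subseteq> F" "finite F3" "meq F3 out (\<gamma> + \<delta>') (repeat_mset n \<beta>)"
    using meq_finite[OF h(1)] meq_finite[OF h(2)] meq_finite[OF h(3)] by blast
  then have F0: "F1 \<union> F2 \<union> F3 \<subseteq> F" "finite (F1 \<union> F2 \<union> F3)"
    "meq (F1 \<union> F2 \<union> F3) out (\<alpha> + \<gamma>) (\<beta> + \<gamma>)"
    "meq (F1 \<union> F2 \<union> F3) out (\<gamma> + \<delta>) (repeat_mset n \<alpha>)"
    "meq (F1 \<union> F2 \<union> F3) out (\<gamma> + \<delta>') (repeat_mset n \<beta>)"
    by (auto elim: meq_mono)
  from tame_separative[OF tame_finite[OF F0(2)] F0(3-5)] have "meq (F1 \<union> F2 \<union> F3) out \<alpha> \<beta>" .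
  then show "meq F out \<alpha> \<beta>" using F0(1) by (rule meq_mono)
next
  fix \<alpha> \<beta> \<zeta> and n :: nat assume n: "n > 0"
  assume "meq F out (repeat_mset n \<alpha> + \<zeta>) (repeat_mset n \<beta>)"
  from meq_finite[OF this] obtain F0 where F0: "F0 \<subseteq> F" "finite F0" "meq F0 out (repeat_mset n \<alpha> +
      \<zeta>) (repeat_mset n \<beta>)" by blast
  from tame_unperforated[OF tame_finite[OF F0(2)] n F0(3)]
  obtain \<zeta>' where "meq F0 out (\<alpha> + \<zeta>') \<beta>" .
  then show "\<exists>\<zeta>'. meq F out (\<alpha> + \<zeta>') \<beta>" using meq_mono[OF _ F0(1)] by blast
qed

section \<open>Free modules over the path algebra\<close>

text \<open>The sum over an infinite \<open>S\<close> defaults to the empty multiset, so a type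
  carries information for finite \<open>S\<close> only. Row-finiteness secures this for
  \<open>out_mset\<close> at vertices.\<close>

definition type_of :: "'i set \<Rightarrow> ('i \<Rightarrow> 'v) \<Rightarrow> 'v multiset" where
  "type_of S t = (\<Sum>i\<in>S. {#t i#})"

definition out_mset :: "('v, 'e) pre_digraph \<Rightarrow> 'v \<Rightarrow> 'v multiset" where
  "out_mset E v = type_of (out_arcs E v) (head E)"

definition regular :: "('v, 'e) pre_digraph \<Rightarrow> 'v set" where
  "regular E = {v \<in> verts E. out_arcs E v \<noteq> {}}"

abbreviation gmeq :: "('v, 'e) pre_digraph \<Rightarrow> 'v multiset \<Rightarrow> 'v multiset \<Rightarrow> bool" where
  "gmeq E \<equiv> meq (regular E) (out_mset E)"

lemma count_type_of: "finite S \<Longrightarrow> count (type_of S t) v = card {i \<in> S. t i = v}"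
proof -
  assume S: "finite S"
  have "count (type_of S t) v = (\<Sum>i\<in>S. if t i = v then 1 else 0)"
    unfolding type_of_def count_sum by (intro sum.cong) auto
  also have "\<dots> = card {i \<in> S. t i = v}" using S by (simp add: sum.If_cases Int_def)
  finally show ?thesis .
qed

lemma set_type_of: "finite S \<Longrightarrow> set_mset (type_of S t) = t ` S"
  by (auto simp: type_of_def set_mset_sum)

lemma type_of_reindex: "inj_on h S \<Longrightarrow> type_of (h ` S) t = type_of S (t \<circ> h)"
  by (simp add: type_of_def sum.reindex)

lemma meq_sum_set:
  assumes "\<And>i. i \<in> I \<Longrightarrow> meq F out (f i) (g i)"
  shows "meq F out (\<Sum>i\<in>I. f i) (\<Sum>i\<in>I. g i)"
  using assms by (induction I rule: infinite_finite_induct) (auto intro: meq.refl meq_add)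

text \<open>
  A path is the list of its edges in reverse order, so that the list spells the product
  \<open>y\<^sub>n \<dots> y\<^sub>1\<close> of the corresponding generators \<open>y\<close>.
\<close>

fun end_of :: "('v, 'e) pre_digraph \<Rightarrow> 'v \<Rightarrow> 'e list \<Rightarrow> 'v" where
  "end_of E v [] = v"
| "end_of E v (e # w) = head E e"

fun walk :: "('v, 'e) pre_digraph \<Rightarrow> 'v \<Rightarrow> 'e list \<Rightarrow> bool" where
  "walk E v [] = (v \<in> verts E)"
| "walk E v (e # w) = (walk E v w \<and> e \<in> arcs E \<and> tail E e = end_of E v w)"

text \<open>A path that has reached a sink cannot be prolonged and counts as arbitrarily deep. With
  length alone, a sink would have no deep paths at all, and nothing could be recovered from its deep
  multiples in \<open>deep_induct\<close>.\<close>

definition deep :: "('v, 'e) pre_digraph \<Rightarrow> nat \<Rightarrow> 'v \<Rightarrow> 'e list \<Rightarrow> bool" where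
  "deep E n v w \<longleftrightarrow> walk E v w \<and> (length w \<ge> n \<or> out_arcs E (end_of E v w) = {})"

lemma end_of_append: "end_of E v (w1 @ w2) = end_of E (end_of E v w2) w1"
  by (cases w1) auto

lemma walk_append: "walk E v (w1 @ w2) \<Longrightarrow> walk E v w2"
  by (induction w1) auto

lemma walk_append_left:
  "walk E v (w1 @ w2) \<Longrightarrow> end_of E v w2 \<in> verts E \<Longrightarrow> walk E (end_of E v w2) w1"
  by (induction w1) (auto simp: end_of_append)

lemma deep_mono: "deep E m v w \<Longrightarrow> n \<le> m \<Longrightarrow> deep E n v w"
  by (auto simp: deep_def)

section \<open>Cut sets in the tree of paths\<close>

context wf_digraph
begin

lemma end_of_verts: "walk G v w \<Longrightarrow> end_of G v w \<in> verts G"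
  by (cases w) (auto intro: head_in_verts)

text \<open>Lists are reversed paths, so the appended edge is the first one of the path. Inductions
  on depth peel a path at its start, whereas the recursion of \<open>walk\<close> peels it at its
  end.\<close>

lemma walk_snoc: "walk G v (w @ [e]) \<longleftrightarrow> e \<in> arcs G \<and> tail G e = v \<and> walk G (head G e) w"
proof (induction w)
  case Nil
  then show ?case by (auto intro: tail_in_verts head_in_verts)
next
  case (Cons a w)
  then show ?case by (cases w) (auto simp: end_of_append)
qed

lemma deep_snoc:
  "e \<in> arcs G \<Longrightarrow> tail G e = v \<Longrightarrow> deep G n (head G e) w \<Longrightarrow> deep G (Suc n) v (w @ [e])"
  by (auto simp: deep_def walk_snoc end_of_append)

lemma cutset_Nil:
  assumes "U []" "v \<in> verts G"
  shows "{w. walk G v w \<and> U w \<and> (\<forall>w1 w2. w = w1 @ w2 \<longrightarrow> w1 \<noteq> [] \<longrightarrow> \<not> U w2)} = {[]}"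
proof -
  have "w = []" if "\<forall>w1 w2. w = w1 @ w2 \<longrightarrow> w1 \<noteq> [] \<longrightarrow> \<not> U w2" for w
    using that[rule_format, of w "[]"] assms(1) by auto
  with assms show ?thesis by auto
qed

text \<open>\<open>M\<close> consists of the paths that enter \<open>U\<close> for the first time.
  Paths with at least \<open>n\<close> edges lie in \<open>U\<close>, so \<open>M\<close> cuts the
  tree of paths from \<open>v\<close>. If \<open>[]\<close> is not in \<open>U\<close>, then
  \<open>v\<close> is fired, and the branches behind its edges are treated with one level
  less.\<close>

lemma cutset:
  assumes rf: "row_finite G" and v: "v \<in> verts G" and U: "\<And>w. deep G n v w \<Longrightarrow> U w"
    and M: "M = {w. walk G v w \<and> U w \<and> (\<forall>w1 w2. w = w1 @ w2 \<longrightarrow> w1 \<noteq> [] \<longrightarrow> \<not> U w2)}"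
  shows "finite M \<and> gmeq G {#v#} (type_of M (end_of G v))"
  using v U M
proof (induction n arbitrary: v U M)
  case 0
  have "U []" using 0 by (simp add: deep_def)
  then have "M = {[]}" using cutset_Nil "0.prems"(1) unfolding "0.prems"(3) by blast
  then show ?case by (simp add: type_of_def meq.refl)
next
  case (Suc n)
  show ?case
  proof (cases "U []")
    case True
    then have "M = {[]}" using cutset_Nil Suc.prems(1) unfolding Suc.prems(3) by blast
    then show ?thesis by (simp add: type_of_def meq.refl)
  next
    case False
    \<comment> \<open>At a sink \<open>[]\<close> would be deep and hence in
      \<open>U\<close>.\<close>
    then have reg: "v \<in> regular G"
      using Suc.prems(1) Suc.prems(2)[of "[]"] by (auto simp: deep_def regular_def)
    define B where "B e = {w. walk G (head G e) w \<and> U (w @ [e]) \<and>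
        (\<forall>w1 w2. w = w1 @ w2 \<longrightarrow> w1 \<noteq> [] \<longrightarrow> \<not> U (w2 @ [e]))}" for e
    have IH: "finite (B e) \<and> gmeq G {#head G e#} (type_of (B e) (end_of G (head G e)))"
      if "e \<in> out_arcs G v" for e
    proof (rule Suc.IH)
      show "head G e \<in> verts G" using that by (auto intro: head_in_verts)
      show "U (w @ [e])" if "deep G n (head G e) w" for w
        using that \<open>e \<in> out_arcs G v\<close> by (intro Suc.prems(2) deep_snoc) auto
    qed (simp add: B_def)
    have M: "M = (\<Union>e\<in>out_arcs G v. (\<lambda>w. w @ [e]) ` B e)" (is "_ = ?R")
    proof
      show "M \<subseteq> ?R"
      proof
        fix w assume w: "w \<in> M"
        then have "w \<noteq> []" using False unfolding Suc.prems(3) by auto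
        then obtain w' e where w': "w = w' @ [e]" by (meson rev_exhaust)
        have "w' \<in> B e" "e \<in> out_arcs G v"
          using w unfolding Suc.prems(3) B_def w' by (auto simp: walk_snoc)
        then show "w \<in> ?R" using w' by blast
      qed
      show "?R \<subseteq> M"
      proof
        fix x assume "x \<in> ?R"
        then obtain e w where e: "e \<in> out_arcs G v" "w \<in> B e" "x = w @ [e]" by blast
        have "\<not> U w2" if x: "x = w1 @ w2" "w1 \<noteq> []" for w1 w2
        proof (cases w2 rule: rev_cases)
          case Nil
          then show ?thesis using False by simp
        next
          case (snoc w2' e')
          then have "w = w1 @ w2'" "e' = e" using x e by auto
          then show ?thesis using e(2) x(2) snoc unfolding B_def by blast
        qed
        then show "x \<in> M" unfolding Suc.prems(3) using e by (auto simp: B_def walk_snoc)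
      qed
    qed
    have fin: "finite (out_arcs G v)" using rf Suc.prems(1) by (simp add: row_finite_def)
    have "type_of M (end_of G v) = (\<Sum>e\<in>out_arcs G v. type_of ((\<lambda>w. w @ [e]) ` B e) (end_of G v))"
      unfolding M type_of_def using fin IH by (intro sum.UNION_disjoint) auto
    also have "\<dots> = (\<Sum>e\<in>out_arcs G v. type_of (B e) (end_of G (head G e)))"
    proof (rule sum.cong[OF HOL.refl])
      fix e
      show "type_of ((\<lambda>w. w @ [e]) ` B e) (end_of G v) = type_of (B e) (end_of G (head G e))"
        by (subst type_of_reindex) (simp_all add: inj_on_def comp_def end_of_append)
    qed
    finally have *: "type_of M (end_of G v) = \<dots>" .
    have "gmeq G (type_of (out_arcs G v) (head G)) (type_of M (end_of G v))"
      unfolding * unfolding type_of_def[of "out_arcs G v"] using IH by (intro meq_sum_set) auto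
    then have "gmeq G {#v#} (type_of M (end_of G v))"
      using meq.trans[OF meq_single[OF reg, of "out_mset G"]] by (simp add: out_mset_def)
    then show ?thesis using M fin IH by auto
  qed
qed

end

text \<open>
  The free left module with generators \<open>i \<in> S\<close> placed at the vertices \<open>t i\<close>: the monomial
  \<open>Mo i w\<close> is the path \<open>w\<close>, starting at \<open>t i\<close>, applied to the generator \<open>i\<close>, and \<open>F E S t\<close>
  consists of the linear combinations of monomials. On it \<open>fsc\<close>, \<open>fy\<close> and \<open>fp\<close> are the actions of
  scalars, of \<open>y\<^sub>e\<close> and of \<open>p\<^sub>v\<close>.
\<close>

datatype ('i, 'e) mon = Mo (idx: 'i) (word: "'e list")

definition vx :: "('v, 'e) pre_digraph \<Rightarrow> ('i \<Rightarrow> 'v) \<Rightarrow> ('i, 'e) mon \<Rightarrow> 'v" where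
  "vx E t m = end_of E (t (idx m)) (word m)"

definition Mon :: "('v, 'e) pre_digraph \<Rightarrow> 'i set \<Rightarrow> ('i \<Rightarrow> 'v) \<Rightarrow> ('i, 'e) mon set" where
  "Mon E S t = {m. idx m \<in> S \<and> walk E (t (idx m)) (word m)}"

definition F :: "('v, 'e) pre_digraph \<Rightarrow> 'i set \<Rightarrow> ('i \<Rightarrow> 'v) \<Rightarrow> (('i, 'e) mon \<Rightarrow> 'k::field) set" where
  "F E S t = {f. finite {m. f m \<noteq> 0} \<and> {m. f m \<noteq> 0} \<subseteq> Mon E S t}"

definition fsc :: "'k::field \<Rightarrow> ('a \<Rightarrow> 'k) \<Rightarrow> ('a \<Rightarrow> 'k)" where
  "fsc c f = (\<lambda>m. c * f m)"

definition fy :: "('v, 'e) pre_digraph \<Rightarrow> ('i \<Rightarrow> 'v) \<Rightarrow> 'e \<Rightarrow> (('i, 'e) mon \<Rightarrow> 'k::field) \<Rightarrow> ('i,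
    'e) mon \<Rightarrow> 'k" where
  "fy E t e f = (\<lambda>m. case word m of [] \<Rightarrow> 0
     | e' # w \<Rightarrow> if e' = e \<and> tail E e = vx E t (Mo (idx m) w) then f (Mo (idx m) w) else 0)"

definition fp :: "('v, 'e) pre_digraph \<Rightarrow> ('i \<Rightarrow> 'v) \<Rightarrow> 'v \<Rightarrow> (('i, 'e) mon \<Rightarrow> 'k::field) \<Rightarrow> ('i,
    'e) mon \<Rightarrow> 'k" where
  "fp E t v f = (\<lambda>m. if vx E t m = v then f m else 0)"

definition delta :: "'a \<Rightarrow> 'a \<Rightarrow> 'k::field" where
  "delta m = (\<lambda>m'. if m' = m then 1 else 0)"

definition fsub :: "('v, 'e) pre_digraph \<Rightarrow> 'i set \<Rightarrow> ('i \<Rightarrow> 'v) \<Rightarrow> (('i, 'e) mon \<Rightarrow> 'k::field) set \<Rightarrow>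
    bool" where
  "fsub E S t N \<longleftrightarrow> N \<subseteq> F E S t \<and> 0 \<in> N \<and> (\<forall>f\<in>N. \<forall>g\<in>N. f + g \<in> N) \<and>
     (\<forall>c. \<forall>f\<in>N. fsc c f \<in> N) \<and> (\<forall>e\<in>arcs E. \<forall>f\<in>N. fy E t e f \<in> N) \<and>
     (\<forall>v. \<forall>f\<in>N. fp E t v f \<in> N)"

definition flin :: "('v, 'e) pre_digraph \<Rightarrow> 'i set \<Rightarrow> ('i \<Rightarrow> 'v) \<Rightarrow> 'j set \<Rightarrow> ('j \<Rightarrow> 'v) \<Rightarrow>
    ((('i, 'e) mon \<Rightarrow> 'k::field) \<Rightarrow> ('j, 'e) mon \<Rightarrow> 'k) \<Rightarrow> bool" where
  "flin E S t S' t' L \<longleftrightarrow> (\<forall>f\<in>F E S t. L f \<in> F E S' t') \<and>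
     (\<forall>f\<in>F E S t. \<forall>g\<in>F E S t. L (f + g) = L f + L g) \<and>
     (\<forall>c. \<forall>f\<in>F E S t. L (fsc c f) = fsc c (L f)) \<and>
     (\<forall>e\<in>arcs E. \<forall>f\<in>F E S t. L (fy E t e f) = fy E t' e (L f)) \<and>
     (\<forall>v. \<forall>f\<in>F E S t. L (fp E t v f) = fp E t' v (L f))"

lemma fsc_apply [simp]: "fsc c f m = c * f m" by (simp add: fsc_def)
lemma fy_add: "fy E t e (f + g) = fy E t e f + fy E t e g"
  by (auto simp: fun_eq_iff fy_def split: list.splits)
lemma fy_fsc: "fy E t e (fsc c f) = fsc c (fy E t e f)"
  by (auto simp: fun_eq_iff fy_def split: list.splits)
lemma fp_add: "fp E t v (f + g) = fp E t v f + fp E t v g"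
  by (auto simp: fun_eq_iff fp_def)
lemma fp_fsc: "fp E t v (fsc c f) = fsc c (fp E t v f)"
  by (auto simp: fun_eq_iff fp_def)
lemma fp_0 [simp]: "fp E t v 0 = 0" by (auto simp: fun_eq_iff fp_def)
lemma fsc_0 [simp]: "fsc c 0 = 0" by (auto simp: fun_eq_iff)

lemma vx_simps [simp]: "vx E t (Mo i []) = t i" "vx E t (Mo i (e # w)) = head E e"
  by (simp_all add: vx_def)

lemma fy_delta: "tail E e = vx E t (Mo i w) \<Longrightarrow> fy E t e (delta (Mo i w)) = delta (Mo i (e # w))"
proof
  fix m
  assume "tail E e = vx E t (Mo i w)"
  then show "fy E t e (delta (Mo i w)) m = delta (Mo i (e # w)) m"
    by (cases m) (auto simp: fy_def delta_def split: list.splits)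
qed

lemma fp_delta: "fp E t v (delta m) = (if vx E t m = v then delta m else 0)"
  by (auto simp: fun_eq_iff fp_def delta_def)

lemma F_0: "0 \<in> F E S t" by (simp add: F_def)

lemma F_add: "f \<in> F E S t \<Longrightarrow> g \<in> F E S t \<Longrightarrow> f + g \<in> F E S t"
proof -
  assume *: "f \<in> F E S t" "g \<in> F E S t"
  have "{m. (f + g) m \<noteq> 0} \<subseteq> {m. f m \<noteq> 0} \<union> {m. g m \<noteq> 0}" by auto
  with * show ?thesis unfolding F_def by (auto intro: finite_subset)
qed

lemma F_fsc: "f \<in> F E S t \<Longrightarrow> fsc c f \<in> F E S t"
  unfolding F_def by (auto elim: rev_finite_subset)

lemma fy_nonzero:
  "fy E t e f (Mo i w) \<noteq> 0 \<longleftrightarrow> (\<exists>w'. w = e # w' \<and> tail E e = vx E t (Mo i w') \<and> f (Mo i w') \<noteq> 0)"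
  by (cases w) (auto simp: fy_def)

lemma F_fy: "e \<in> arcs E \<Longrightarrow> f \<in> F E S t \<Longrightarrow> fy E t e f \<in> F E S t"
proof -
  assume e: "e \<in> arcs E" and f: "f \<in> F E S t"
  have "{m. fy E t e f m \<noteq> 0} \<subseteq> (\<lambda>m. Mo (idx m) (e # word m)) ` {m. f m \<noteq> 0}"
  proof
    fix m assume "m \<in> {m. fy E t e f m \<noteq> 0}"
    then obtain w where "word m = e # w" "f (Mo (idx m) w) \<noteq> 0"
      by (cases m) (auto simp: fy_nonzero)
    then show "m \<in> (\<lambda>m. Mo (idx m) (e # word m)) ` {m. f m \<noteq> 0}" 
      by (intro image_eqI[of _ _ "Mo (idx m) w"]) (auto simp: mon.expand)
  qed
  moreover have "{m. fy E t e f m \<noteq> 0} \<subseteq> Mon E S t"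
  proof
    fix m assume "m \<in> {m. fy E t e f m \<noteq> 0}"
    then obtain w where w: "word m = e # w" "tail E e = vx E t (Mo (idx m) w)"
        "f (Mo (idx m) w) \<noteq> 0"
      using fy_nonzero[of E t e f "idx m" "word m"] by auto
    then have "Mo (idx m) w \<in> Mon E S t" using f by (auto simp: F_def)
    with w e show "m \<in> Mon E S t" by (auto simp: Mon_def vx_def)
  qed
  ultimately show ?thesis using f unfolding F_def by (auto intro: finite_subset)
qed

lemma F_fp: "f \<in> F E S t \<Longrightarrow> fp E t v f \<in> F E S t"
  unfolding F_def fp_def by (auto elim: rev_finite_subset split: if_splits)

lemma F_delta: "m \<in> Mon E S t \<Longrightarrow> delta m \<in> F E S t"
  by (auto simp: F_def delta_def)

text \<open>The condition \<open>f m = 0\<close> keeps the support of \<open>f\<close> inside that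
  of the new element, so that assumptions about the support descend to \<open>f\<close>.\<close>

lemma F_induct [consumes 1, case_names zero step]:
  assumes "f \<in> F E S t" and "P 0"
    and step: "\<And>f c m. f \<in> F E S t \<Longrightarrow> m \<in> Mon E S t \<Longrightarrow> f m = 0 \<Longrightarrow> c \<noteq> 0 \<Longrightarrow> P f \<Longrightarrow> P (f +
        fsc c (delta m))"
  shows "P f"
  using assms(1)
proof (induction "card {m. f m \<noteq> 0}" arbitrary: f)
  case (0 f)
  then have "f = 0" by (auto simp: F_def fun_eq_iff)
  show ?case unfolding \<open>f = 0\<close> by (rule assms(2))
next
  case (Suc n f)
  then obtain m where m: "f m \<noteq> 0" by (metis (mono_tags, lifting) Collect_empty_eq card.empty
      nat.distinct(1))
  define g where "g = f + fsc (- f m) (delta m)"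
  have g: "g \<in> F E S t"
    unfolding g_def using Suc.prems m by (intro F_add F_fsc F_delta) (auto simp: F_def)
  have "{m'. g m' \<noteq> 0} = {m'. f m' \<noteq> 0} - {m}" by (auto simp: g_def delta_def)
  then have "n = card {m'. g m' \<noteq> 0}" using Suc.hyps(2) m Suc.prems by (simp add: F_def)
  then have "P g" using Suc.hyps(1) g by blast
  moreover have "g m = 0" by (simp add: g_def delta_def)
  moreover have "m \<in> Mon E S t" using Suc.prems m by (auto simp: F_def)
  moreover have "f = g + fsc (f m) (delta m)" by (auto simp: g_def fun_eq_iff)
  ultimately show ?case using step[OF g _ _ m] by metis
qed

lemma flinD:
  assumes "flin E S t S' t' L"
  shows "f \<in> F E S t \<Longrightarrow> L f \<in> F E S' t'"
    and "f \<in> F E S t \<Longrightarrow> g \<in> F E S t \<Longrightarrow> L (f + g) = L f + L g"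
    and "f \<in> F E S t \<Longrightarrow> L (fsc c f) = fsc c (L f)"
    and "e \<in> arcs E \<Longrightarrow> f \<in> F E S t \<Longrightarrow> L (fy E t e f) = fy E t' e (L f)"
    and "f \<in> F E S t \<Longrightarrow> L (fp E t v f) = fp E t' v (L f)"
  using assms unfolding flin_def by blast+

lemma flin_0: "flin E S t S' t' L \<Longrightarrow> L 0 = 0"
  using flinD(2)[of E S t S' t' L 0 0] F_0 by fastforce

text \<open>The length-lexicographic order over a well-order of the letters is well-founded even for
  infinite alphabets and compatible with prepending a letter. The generator is encoded as a final
  letter \<open>Inr\<close>, so that monomials over different generators become comparable.\<close>

lemma ex_monomial_order:
  "\<exists>r :: ('i, 'e) mon rel. wf r \<and> trans r \<and> total r \<and>
     (\<forall>i w j w' e. ((Mo i w), (Mo j w')) \<in> r \<longrightarrow> ((Mo i (e # w)), (Mo j (e # w'))) \<in> r)"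
proof -
  obtain s :: "('e + 'i) rel" where s: "Well_order s" "Field s = UNIV" using well_ordering by metis
  define enc :: "('i, 'e) mon \<Rightarrow> ('e + 'i) list" where "enc = (\<lambda>m. map Inl (word m) @ [Inr (idx m)])"
  have inj: "inj enc"
    by (auto simp: inj_def enc_def inj_map_eq_map mon.expand)
  have "wf (s - Id)" "trans (s - Id)" "total (s - Id)"
    using s unfolding order_on_defs well_order_on_def
    by (auto intro: trans_diff_Id)
  then have "wf (lenlex (s - Id))" "trans (lenlex (s - Id))" "total (lenlex (s - Id))"
    by (auto intro: total_lenlex)
  then have "wf (inv_image (lenlex (s - Id)) enc) \<and> trans (inv_image (lenlex (s - Id)) enc) \<and>
    total (inv_image (lenlex (s - Id)) enc)"
    using inj by (auto simp: trans_inv_image total_on_def inj_def)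
  then show ?thesis
    by (intro exI[of _ "inv_image (lenlex (s - Id)) enc"]) (auto simp: enc_def Cons_lenlex_iff)
qed

text \<open>Basis elements of a submodule are indexed by their leading monomials, so a monomial over
  the new basis carries a monomial as its index. Flattening it gives the leading monomial that it
  has in the old module.\<close>

definition cat :: "(('i, 'e) mon, 'e) mon \<Rightarrow> ('i, 'e) mon" where
  "cat q = Mo (idx (idx q)) (word q @ word (idx q))"

text \<open>
  A submodule \<open>N\<close> of a free module is free on elements whose leading monomials are the minimal
  leading monomials of \<open>N\<close> with respect to the suffix order. They form an antichain in the forest
  of monomials, so the leading monomials of their multiples are distinct.
\<close>

theorem submodule_basis:
  fixes N :: "(('i, 'e) mon \<Rightarrow> 'k::field) set"
  assumes wf: "wf_digraph E" and N: "fsub E T t N"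
  obtains U S c where "S = {m \<in> U. \<forall>w1 w2. word m = w1 @ w2 \<longrightarrow> w1 \<noteq> [] \<longrightarrow> Mo (idx m) w2 \<notin> U}"
    and "U \<subseteq> Mon E T t" and "\<And>m. delta m \<in> N \<Longrightarrow> m \<in> U"
    and "\<And>m. m \<in> S \<Longrightarrow> c m \<in> N" and "\<And>m. m \<in> S \<Longrightarrow> fp E t (vx E t m) (c m) = c m"
    and "\<And>L g. flin E S (vx E t) T t L \<Longrightarrow> (\<And>m. m \<in> S \<Longrightarrow> L (delta (Mo m [])) = c m) \<Longrightarrow>
           g \<in> F E S (vx E t) \<Longrightarrow> L g = 0 \<Longrightarrow> g = 0"
    and "\<And>L f. flin E S (vx E t) T t L \<Longrightarrow> (\<And>m. m \<in> S \<Longrightarrow> L (delta (Mo m [])) = c m) \<Longrightarrow>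
           f \<in> N \<Longrightarrow> \<exists>g\<in>F E S (vx E t). L g = f"
proof -
  obtain r :: "('i, 'e) mon rel" where r: "wf r \<and> trans r \<and> total r \<and>
     (\<forall>i w j w' e. (Mo i w, Mo j w') \<in> r \<longrightarrow> (Mo i (e # w), Mo j (e # w')) \<in> r)"
    using ex_monomial_order by (rule exE)
  then have "wf r" "trans r" "total r" by simp_all
  have comp: "(Mo i (e # w), Mo j (e # w')) \<in> r" if "(Mo i w, Mo j w') \<in> r" for i w j w' e
    using r that by simp
  have irr: "(m, m) \<notin> r" for m using \<open>wf r\<close> by simp
  have tot: "m = m' \<or> (m, m') \<in> r \<or> (m', m) \<in> r" for m m'
    using \<open>total r\<close> by (auto simp: total_on_def)
  have tr: "(a, b) \<in> r \<Longrightarrow> (b, c) \<in> r \<Longrightarrow> (a, c) \<in> r" for a b c using \<open>trans r\<close> by (rule transD)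
  define lead :: "(('i, 'e) mon \<Rightarrow> 'k) \<Rightarrow> ('i, 'e) mon \<Rightarrow> bool" where
    "lead f m \<longleftrightarrow> f m \<noteq> 0 \<and> (\<forall>m'. f m' \<noteq> 0 \<longrightarrow> m' = m \<or> (m', m) \<in> r)" for f m
  have ex_max: "\<exists>m\<in>X. \<forall>m'\<in>X. h m' = h m \<or> (h m', h m) \<in> r" if "finite X" "X \<noteq> {}"
    for X :: "'x set" and h
    using that
  proof (induction X rule: finite_ne_induct)
    case (insert x X)
    then obtain m where m: "m \<in> X" "\<forall>m'\<in>X. h m' = h m \<or> (h m', h m) \<in> r" by blast
    show ?case
    proof (cases "(h m, h x) \<in> r")
      case True
      then have "h m' = h x \<or> (h m', h x) \<in> r" if "m' \<in> insert x X" for m'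
        using that m(2) tr by (metis insert_iff)
      then show ?thesis by blast
    next
      case False
      with tot[of "h m" "h x"] m show ?thesis by auto
    qed
  qed simp
  have ex_lead: "\<exists>m. lead f m" if "f \<in> F E T t" "f \<noteq> 0" for f
  proof -
    have "finite {m. f m \<noteq> 0}" "{m. f m \<noteq> 0} \<noteq> {}" using that by (auto simp: F_def fun_eq_iff)
    from ex_max[OF this, of "\<lambda>m. m"] show ?thesis by (auto simp: lead_def)
  qed
  have lead_fy: "lead (fy E t e f) (Mo i (e # w))" if "lead f (Mo i w)" "tail E e = vx E t (Mo i w)"
      for e f i w
    unfolding lead_def
  proof (intro conjI allI impI)
    show "fy E t e f (Mo i (e # w)) \<noteq> 0" using that by (auto simp: fy_nonzero lead_def)
    fix m' assume "fy E t e f m' \<noteq> 0"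
    then obtain j w' where m': "m' = (Mo j (e # w'))" "f (Mo j w') \<noteq> 0"
        by (cases m') (auto simp: fy_nonzero)
    then have "(Mo j w') = (Mo i w) \<or> ((Mo j w'), (Mo i w)) \<in> r" using that(1) unfolding lead_def
        by blast
    then show "m' = (Mo i (e # w)) \<or> (m', (Mo i (e # w))) \<in> r" using comp m'(1) by auto
  qed
  define U where "U = {m. \<exists>f\<in>N. lead f m}"
  define S where "S = {m \<in> U. \<forall>w1 w2. word m = w1 @ w2 \<longrightarrow> w1 \<noteq> [] \<longrightarrow> Mo (idx m) w2 \<notin> U}"
  have N_F: "N \<subseteq> F E T t" using N by (simp add: fsub_def)
  have U_Mon: "U \<subseteq> Mon E T t" using N_F by (auto simp: U_def lead_def F_def)
  have S_U: "S \<subseteq> U" by (auto simp: S_def)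
  \<comment> \<open>Projecting to the vertex of the leading monomial keeps that monomial, so basis
    elements can be placed at a single vertex, as generators of these free modules must be.\<close>
  have "\<exists>f\<in>N. lead f m \<and> fp E t (vx E t m) f = f" if mU: "m \<in> U" for m
  proof -
    obtain f where f: "f \<in> N" "lead f m" using mU by (auto simp: U_def)
    have "lead (fp E t (vx E t m) f) m" using f(2) by (auto simp: lead_def fp_def)
    moreover have "fp E t v (fp E t v f) = fp E t v f" for v by (auto simp: fp_def)
    ultimately show ?thesis using f N by (auto simp: fsub_def)
  qed
  then obtain c where c: "\<And>m. m \<in> U \<Longrightarrow> c m \<in> N \<and> lead (c m) m \<and> fp E t (vx E t m) (c m) = c m"
    by metis
  have min_suffix: "\<exists>q. idx q \<in> S \<and> cat q = m" if "m \<in> U" for m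
  proof -
    have "\<exists>w1 w2. w = w1 @ w2 \<and> (Mo i w2) \<in> S" if "(Mo i w) \<in> U" for i w
      using that
    proof (induction "length w" arbitrary: w rule: less_induct)
      case less
      show ?case
      proof (cases "(Mo i w) \<in> S")
        case False
        then obtain w1 w2 where "w = w1 @ w2" "w1 \<noteq> []" "(Mo i w2) \<in> U"
          using less.prems by (auto simp: S_def)
        with less.hyps[of w2] show ?thesis
            by (metis append.assoc length_append length_greater_0_conv less_add_same_cancel2)
      qed auto
    qed
    then obtain w1 w2 where "word m = w1 @ w2" "Mo (idx m) w2 \<in> S"
      using \<open>m \<in> U\<close> by (metis mon.collapse)
    then show ?thesis
      by (intro exI[of _ "Mo (Mo (idx m) w2) w1"]) (auto simp: cat_def mon.expand)
  qed
  \<comment> \<open>Of two factorizations of one word, one suffix contains the other; by minimality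
    in \<open>U\<close> they coincide.\<close>
  have cat_inj: "q = q'" if "idx q \<in> S" "idx q' \<in> S" "cat q = cat q'" for q q'
  proof -
    obtain i w w1 where q: "q = (Mo (Mo i w) w1)" by (metis mon.exhaust)
    obtain i' w' w1' where q': "q' = (Mo (Mo i' w') w1')" by (metis mon.exhaust)
    have i: "i = i'" and eq: "w1 @ w = w1' @ w'" using that(3) by (auto simp: cat_def q q')
    have min: "u1 = []" if "(Mo i (u1 @ u2)) \<in> S" "(Mo i u2) \<in> U" for u1 u2
    proof -
      have "\<forall>w1 w2. u1 @ u2 = w1 @ w2 \<longrightarrow> w1 \<noteq> [] \<longrightarrow> Mo i w2 \<notin> U"
        using that(1) by (simp add: S_def)
      from this[rule_format, OF HOL.refl] that(2) show ?thesis by blast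
    qed
    from eq obtain u where "w1 = w1' @ u \<and> u @ w = w' \<or> w1 @ u = w1' \<and> w = u @ w'"
      by (auto simp: append_eq_append_conv2)
    then have "u = []" using min[of u w] min[of u w'] that(1,2) S_U i by (auto simp: q q')
    with \<open>w1 = w1' @ u \<and> u @ w = w' \<or> w1 @ u = w1' \<and> w = u @ w'\<close> show ?thesis
      using i by (auto simp: q q')
  qed
  \<comment> \<open>Left multiplication by \<open>y\<^sub>e\<close> preserves leading monomials at
    the tail of \<open>e\<close>, so the leading monomial of a multiple of a basis element is simply
    the prolonged one.\<close>
  have lead_L: "lead (L (delta q)) (cat q) \<and> L (delta q) \<in> N"
    if L: "flin E S (vx E t) T t L" "\<And>m. m \<in> S \<Longrightarrow> L (delta (Mo m [])) = c m"
      and q: "q \<in> Mon E S (vx E t)" for L q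
  proof -
    obtain m w where mw: "q = (Mo m w)" by (metis mon.exhaust)
    have "lead (L (delta (Mo m w))) (cat (Mo m w)) \<and> L (delta (Mo m w)) \<in> N"
      if "m \<in> S" "walk E (vx E t m) w" for m w
      using that
    proof (induction w)
      case Nil
      then show ?case using L(2) c S_U by (auto simp: cat_def)
    next
      case (Cons e w)
      then have e: "e \<in> arcs E" "tail E e = vx E (vx E t) (Mo m w)" by (auto simp: vx_def)
      have IH: "lead (L (delta (Mo m w))) (cat (Mo m w))" "L (delta (Mo m w)) \<in> N" using Cons
          by auto
      have "L (delta (Mo m (e # w))) = fy E t e (L (delta (Mo m w)))"
        using Cons.prems e flinD(4)[OF L(1) e(1) F_delta[of "(Mo m w)"]]
        by (simp add: fy_delta Mon_def)
      moreover have "tail E e = vx E t (cat (Mo m w))"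
        using e by (simp add: cat_def vx_def end_of_append)
      ultimately show ?case
        using IH e N lead_fy[of "L (delta (Mo m w))" "idx m" "w @ word m" e]
        by (auto simp: cat_def fsub_def)
    qed
    with q mw show ?thesis by (auto simp: Mon_def)
  qed
  have vanish: "L g x = 0"
    if L: "flin E S (vx E t) T t L" "\<And>m. m \<in> S \<Longrightarrow> L (delta (Mo m [])) = c m"
      and g: "g \<in> F E S (vx E t)" and lt: "\<And>q. g q \<noteq> 0 \<Longrightarrow> (cat q, x) \<in> r" for L g x
    using g lt
  proof (induction rule: F_induct)
    case zero
    show ?case by (subst flin_0[OF L(1)]) (rule zero_fun_apply)
  next
    case (step f a q)
    have "(cat q', x) \<in> r" if "f q' \<noteq> 0" for q'
      using step.prems[of q'] that step.hyps by (cases "q' = q") (auto simp: delta_def)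
    then have "L f x = 0" using step.IH by blast
    moreover have "(cat q, x) \<in> r" using step.prems[of q] step.hyps by (auto simp: delta_def)
    then have "L (delta q) x = 0"
      using lead_L[OF L step.hyps(2)] irr tr unfolding lead_def by metis
    moreover have "L (f + fsc a (delta q)) = L f + fsc a (L (delta q))"
      using step.hyps flinD(2)[OF L(1), of f "fsc a (delta q)"] flinD(3)[OF L(1), of "delta q" a]
      by (metis F_fsc F_delta)
    ultimately show ?case by (metis add_0 fsc_apply mult_zero_right plus_fun_apply)
  qed
  show thesis
  proof (rule that[OF S_def U_Mon])
    show "m \<in> U" if "delta m \<in> N" for m
    proof -
      have "lead (delta m) m" by (simp add: lead_def delta_def)
      with that show ?thesis by (auto simp: U_def)
    qed
    show "c m \<in> N" "fp E t (vx E t m) (c m) = c m" if "m \<in> S" for m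
      using c S_U that by auto
  next
    fix L g
    assume L: "flin E S (vx E t) T t L" "\<And>m. m \<in> S \<Longrightarrow> L (delta (Mo m [])) = c m"
      and g: "g \<in> F E S (vx E t)" "L g = 0"
    show "g = 0"
    proof (rule ccontr)
      assume "g \<noteq> 0"
      then have "finite {q. g q \<noteq> 0}" "{q. g q \<noteq> 0} \<noteq> {}" using g by (auto simp: F_def fun_eq_iff)
      \<comment> \<open>By \<open>cat_inj\<close> only one monomial has the largest flattening, so
        nothing can cancel its leading term in \<open>L g\<close>.\<close>
      from ex_max[OF this, of cat] obtain q where q: "g q \<noteq> 0"
        "\<And>q'. g q' \<noteq> 0 \<Longrightarrow> cat q' = cat q \<or> (cat q', cat q) \<in> r" by blast
      have supp: "q' \<in> Mon E S (vx E t)" if "g q' \<noteq> 0" for q' using g that by (auto simp: F_def)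
      define h where "h = g + fsc (- g q) (delta q)"
      have h: "h \<in> F E S (vx E t)"
        unfolding h_def using g supp[OF q(1)] by (intro F_add F_fsc F_delta) auto
      have lt: "(cat q', cat q) \<in> r" if "h q' \<noteq> 0" for q'
      proof -
        have "q' \<noteq> q" "g q' \<noteq> 0" using that by (auto simp: h_def delta_def split: if_splits)
        with q(2) cat_inj[of q' q] supp q(1) show ?thesis by (auto simp: Mon_def)
      qed
      have "L h (cat q) = 0" by (rule vanish[OF L h]) (assumption, rule lt)
      moreover have "g = h + fsc (g q) (delta q)" by (auto simp: h_def fun_eq_iff)
      then have "L g = L h + fsc (g q) (L (delta q))"
        using h supp[OF q(1)] by (metis flinD(2,3)[OF L(1)] F_fsc F_delta)
      then have "L g (cat q) = L h (cat q) + g q * L (delta q) (cat q)" by simp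
      ultimately show False
        using g(2) q(1) lead_L[OF L supp[OF q(1)]] by (simp add: lead_def)
    qed
  next
    fix L f
    assume L: "flin E S (vx E t) T t L" "\<And>m. m \<in> S \<Longrightarrow> L (delta (Mo m [])) = c m" and "f \<in> N"
    \<comment> \<open>Division with remainder: a multiple of a basis element removes the leading
      term, and this ends because the order is well-founded.\<close>
    have *: "\<exists>g\<in>F E S (vx E t). L g = f" if "lead f m" "f \<in> N" for m f
      using that
    proof (induction m arbitrary: f rule: wf_induct_rule[OF \<open>wf r\<close>])
      case (1 m)
      then have "m \<in> U" by (auto simp: U_def)
      then obtain q where q: "idx q \<in> S" "cat q = m" using min_suffix by blast
      have qM: "q \<in> Mon E S (vx E t)"
      proof -
        have "walk E (t (idx m)) (word m)" using \<open>m \<in> U\<close> U_Mon by (auto simp: Mon_def)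
        then have "walk E (t (idx (idx q))) (word q @ word (idx q))" using q(2)
            by (auto simp: cat_def)
        moreover from this have "end_of E (t (idx (idx q))) (word (idx q)) \<in> verts E"
          using wf walk_append by (metis wf_digraph.end_of_verts)
        ultimately have "walk E (vx E t (idx q)) (word q)"
          using walk_append_left by (metis vx_def)
        with q show ?thesis by (auto simp: Mon_def)
      qed
      define a where "a = f m / L (delta q) m"
      have Lq: "lead (L (delta q)) m" "L (delta q) \<in> N" using lead_L[OF L qM] q(2) by auto
      define f' where "f' = f + fsc (- a) (L (delta q))"
      have f': "f' \<in> N" unfolding f'_def using N 1 Lq by (auto simp: fsub_def)
      have "\<exists>g\<in>F E S (vx E t). L g = f'"
      proof (cases "f' = 0")
        case True
        then show ?thesis using flin_0[OF L(1)] F_0 by metis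
      next
        case False
        then obtain m' where m': "lead f' m'" using ex_lead N_F f' by blast
        have "f' m = 0" using Lq by (simp add: f'_def a_def lead_def)
        then have "m' \<noteq> m" using m' by (auto simp: lead_def)
        moreover have "f m' \<noteq> 0 \<or> L (delta q) m' \<noteq> 0"
          using m' by (auto simp: lead_def f'_def)
        ultimately have "(m', m) \<in> r" using 1(2) Lq(1) by (auto simp: lead_def)
        with 1(1) m' f' show ?thesis by blast
      qed
      then obtain g where g: "g \<in> F E S (vx E t)" "L g = f'" by blast
      have "L (g + fsc a (delta q)) = f' + fsc a (L (delta q))"
        using g qM by (simp add: flinD(2,3)[OF L(1)] F_fsc F_delta)
      also have "\<dots> = f" by (auto simp: f'_def fun_eq_iff)
      finally show ?case using g qM by (blast intro: F_add F_fsc F_delta)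
    qed
    show "\<exists>g\<in>F E S (vx E t). L g = f"
    proof (cases "f = 0")
      case True
      then show ?thesis using flin_0[OF L(1)] F_0 by metis
    next
      case False
      then show ?thesis using ex_lead * \<open>f \<in> N\<close> N_F by blast
    qed
  qed
qed

section \<open>Invariance of the rank at each vertex\<close>

lemma sum_fun_apply: "(\<Sum>b\<in>T. f b) s = (\<Sum>b\<in>T. f b s)"
  by (induction T rule: infinite_finite_induct) auto

lemma vector_space_fsc: "vector_space (fsc :: 'k::field \<Rightarrow> ('a \<Rightarrow> 'k) \<Rightarrow> _)"
  by unfold_locales (auto simp: fun_eq_iff algebra_simps)

text \<open>
  Modulo the ideal of paths of positive length, a surjection of free modules becomes a
  surjection of vector spaces for each vertex.
\<close>

lemma rank_le:
  fixes L :: "(('i, 'e) mon \<Rightarrow> 'k::field) \<Rightarrow> ('j, 'e) mon \<Rightarrow> 'k"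
  assumes fin: "finite S" and t': "t' ` S' \<subseteq> verts E"
    and L: "flin E S t S' t' L"
    and surj: "\<And>g. g \<in> F E S' t' \<Longrightarrow> \<exists>f\<in>F E S t. L f = g"
  shows "card {s \<in> S'. t' s = v} \<le> card {s \<in> S. t s = v}"
proof -
  interpret V: vector_space "fsc :: 'k \<Rightarrow> ('j \<Rightarrow> 'k) \<Rightarrow> _" by (rule vector_space_fsc)
  define D :: "(('j, 'e) mon \<Rightarrow> 'k) \<Rightarrow> 'j \<Rightarrow> 'k" where "D = (\<lambda>h s. h (Mo s []))"
  define A where "A = (\<lambda>s. D (L (delta (Mo s [])))) ` {s \<in> S. t s = v}"
  define B where "B = (delta :: 'j \<Rightarrow> 'j \<Rightarrow> 'k) ` {s \<in> S'. t' s = v}"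
  have D_add: "D (f + g) = D f + D g" and D_fsc: "D (fsc c f) = fsc c (D f)" for f g c
    by (auto simp: D_def)
  have span: "D (L (fp E t v f)) \<in> V.span A" if "f \<in> F E S t" for f
    using that
  proof (induction rule: F_induct)
    case zero
    have "D (L (fp E t v 0)) = 0" by (simp only: fp_0 flin_0[OF L]) (auto simp: D_def)
    then show ?case by (metis V.span_zero)
  next
    case (step f c m)
    have m: "delta m \<in> F E S t" using step.hyps(2) by (rule F_delta)
    have *: "D (L (fp E t v (delta m))) \<in> V.span A"
    proof (cases "word m")
      case Nil
      then have m: "m = Mo (idx m) []" by (simp add: mon.expand)
      have "idx m \<in> S" using step.hyps(2) by (simp add: Mon_def)
      show ?thesis
      proof (cases "t (idx m) = v")
        case True
        then have "fp E t v (delta m) = (delta (Mo (idx m) []) :: _ \<Rightarrow> 'k)"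
          by (subst (1 2) m) (simp add: fp_delta)
        then have "D (L (fp E t v (delta m))) \<in> A" using True \<open>idx m \<in> S\<close> by (auto simp: A_def)
        then show ?thesis by (rule V.span_base)
      next
        case False
        then have "fp E t v (delta m) = (0 :: _ \<Rightarrow> 'k)" by (subst m) (simp add: fp_delta)
        then have "D (L (fp E t v (delta m))) = 0"
          using flin_0[OF L] by (auto simp: D_def)
        then show ?thesis by (metis V.span_zero)
      qed
    next
      case (Cons e w)
      have e: "e \<in> arcs E" "tail E e = vx E t (Mo (idx m) w)" and w: "Mo (idx m) w \<in> Mon E S t"
        using step.hyps(2) Cons by (auto simp: Mon_def vx_def)
      have "delta m = fy E t e (delta (Mo (idx m) w) :: _ \<Rightarrow> 'k)"
        using Cons by (subst fy_delta[OF e(2)]) (metis mon.collapse)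
      then have "L (fp E t v (delta m)) = fp E t' v (fy E t' e (L (delta (Mo (idx m) w))))"
        using e(1) w m flinD(4,5)[OF L] by (metis F_delta)
      \<comment> \<open>A multiple of \<open>y\<^sub>e\<close> has no coefficient at an empty word,
        so only the generators at \<open>v\<close> contribute to the span.\<close>
      then have "D (L (fp E t v (delta m))) = 0"
        by (auto simp: D_def fp_def fy_def)
      then show ?thesis by (metis V.span_zero)
    qed
    have "L (fp E t v (f + fsc c (delta m))) = L (fp E t v f) + fsc c (L (fp E t v (delta m)))"
      using step.hyps(1) m flinD(2,3)[OF L] unfolding fp_add fp_fsc by (metis F_fp F_fsc)
    then show ?case using * step.IH unfolding D_add D_fsc
      by (simp only: D_add D_fsc) (intro V.span_add V.span_scale)
  qed
  have "B \<subseteq> V.span A"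
  proof
    fix b assume "b \<in> B"
    then obtain s where s: "s \<in> S'" "t' s = v" "b = delta s" by (auto simp: B_def)
    have "Mo s [] \<in> Mon E S' t'" using s t' by (auto simp: Mon_def)
    then obtain f where f: "f \<in> F E S t" "L f = delta (Mo s [])" using surj F_delta by blast
    have "L (fp E t v f) = fp E t' v (delta (Mo s []))" using flinD(5)[OF L f(1)] f(2) by simp
    also have "\<dots> = delta (Mo s [])" using s by (simp add: fp_delta)
    finally have "D (L (fp E t v f)) = b" using s by (auto simp: D_def delta_def)
    with span[OF f(1)] show "b \<in> V.span A" by simp
  qed
  moreover have "V.independent B"
  proof -
    have *: "u (delta s) = 0" if "finite T" "T \<subseteq> range delta" "(\<Sum>b\<in>T. fsc (u b) b) = 0" "delta s \<in>
        T"
      for T and u :: "('j \<Rightarrow> 'k) \<Rightarrow> 'k" and s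
    proof -
      have "b s = 0" if "b \<in> T - {delta s}" for b
        using that \<open>T \<subseteq> range delta\<close> by (auto simp: delta_def)
      then have 0: "(\<Sum>b\<in>T - {delta s}. fsc (u b) b s) = 0"
        by (intro sum.neutral) (simp only: fsc_apply, simp)
      have "(\<Sum>b\<in>T. fsc (u b) b) s = fsc (u (delta s)) (delta s) s +
          (\<Sum>b\<in>T - {delta s}. fsc (u b) b s)"
        unfolding sum_fun_apply using \<open>finite T\<close> \<open>delta s \<in> T\<close> by (rule sum.remove)
      then have "(\<Sum>b\<in>T. fsc (u b) b) s = u (delta s)" unfolding 0 by (simp add: delta_def)
      then show ?thesis using that(3) by simp
    qed
    have "\<not> V.dependent (range (delta :: 'j \<Rightarrow> 'j \<Rightarrow> 'k))"
    proof
      assume "V.dependent (range (delta :: 'j \<Rightarrow> 'j \<Rightarrow> 'k))"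
      then obtain T and u :: "('j \<Rightarrow> 'k) \<Rightarrow> 'k" and b where T: "finite T" "T \<subseteq> range delta" "b \<in> T"
        "u b \<noteq> 0" "(\<Sum>b\<in>T. fsc (u b) b) = 0" unfolding V.dependent_explicit by blast
      then obtain s where "b = delta s" by blast
      with T * show False by blast
    qed
    then show ?thesis using V.dependent_mono[of B "range delta"] by (auto simp: B_def)
  qed
  moreover have "finite A" using fin by (simp add: A_def)
  ultimately have "card B \<le> card A" using V.independent_span_bound by blast
  also have "\<dots> \<le> card {s \<in> S. t s = v}" unfolding A_def using fin by (intro card_image_le) simp
  also have "card B = card {s \<in> S'. t' s = v}"
    unfolding B_def by (intro card_image) (auto simp: inj_on_def delta_def fun_eq_iff split:
        if_splits)
  finally show ?thesis .
qed

text \<open>The inverse of a linear bijection is linear, and \<open>rank_le\<close> applies to both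
  of them at every vertex.\<close>

lemma type_of_unique:
  fixes L :: "(('i, 'e) mon \<Rightarrow> 'k::field) \<Rightarrow> ('j, 'e) mon \<Rightarrow> 'k"
  assumes "finite S" "finite S'" "t ` S \<subseteq> verts E" "t' ` S' \<subseteq> verts E"
    and L: "flin E S t S' t' L" and bij: "bij_betw L (F E S t) (F E S' t')"
  shows "type_of S t = type_of S' t'"
proof -
  let ?K = "inv_into (F E S t) L"
  have K: "?K g \<in> F E S t" "L (?K g) = g" if "g \<in> F E S' t'" for g
    using that bij unfolding bij_betw_def by (metis inv_into_into, metis f_inv_into_f)
  have KL: "?K (L f) = f" if "f \<in> F E S t" for f
    using that bij by (simp add: bij_betw_def)
  have "flin E S' t' S t ?K"
    unfolding flin_def
  proof (intro conjI ballI allI)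
    fix f g :: "('j, 'e) mon \<Rightarrow> 'k" assume f: "f \<in> F E S' t'"
    show "?K f \<in> F E S t" using K f by simp
    show "?K (f + g) = ?K f + ?K g" if g: "g \<in> F E S' t'"
      using KL[OF F_add[OF K(1)[OF f] K(1)[OF g]]]
          by (simp only: flinD(2)[OF L K(1)[OF f] K(1)[OF g]] K(2)[OF f] K(2)[OF g])
    show "?K (fsc c f) = fsc c (?K f)" for c
      using KL[OF F_fsc[OF K(1)[OF f]]] by (simp only: flinD(3)[OF L K(1)[OF f]] K(2)[OF f])
    show "?K (fy E t' e f) = fy E t e (?K f)" if "e \<in> arcs E" for e
      using KL[OF F_fy[OF that K(1)[OF f]]]
          by (simp only: flinD(4)[OF L that K(1)[OF f]] K(2)[OF f])
    show "?K (fp E t' v f) = fp E t v (?K f)" for v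
      using KL[OF F_fp[OF K(1)[OF f]]] by (simp only: flinD(5)[OF L K(1)[OF f]] K(2)[OF f])
  qed
  moreover have "\<exists>f\<in>F E S t. L f = g" if "g \<in> F E S' t'" for g using K[OF that] by blast
  moreover have "\<exists>g\<in>F E S' t'. ?K g = f" if "f \<in> F E S t" for f
    using KL[OF that] flinD(1)[OF L that] by blast
  ultimately have "card {s \<in> S'. t' s = v} = card {s \<in> S. t s = v}" for v
    using assms by (intro antisym rank_le[of _ _ _ _ t L] rank_le[of _ _ _ _ t' ?K]) blast+
  then show ?thesis using assms by (intro multiset_eqI) (simp add: count_type_of)
qed

section \<open>Left modules\<close>

text \<open>The law for the zero scalar takes the place of additive inverses, because the scalar
  \<open>-1\<close> then acts as negation.\<close>

lemma left_moduleI: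
  assumes "ring R"
    and "\<And>x y. x \<in> carrier M \<Longrightarrow> y \<in> carrier M \<Longrightarrow> x \<oplus>\<^bsub>M\<^esub> y \<in> carrier M"
    and "\<zero>\<^bsub>M\<^esub> \<in> carrier M"
    and "\<And>x y z. x \<in> carrier M \<Longrightarrow> y \<in> carrier M \<Longrightarrow> z \<in> carrier M \<Longrightarrow>
      (x \<oplus>\<^bsub>M\<^esub> y) \<oplus>\<^bsub>M\<^esub> z = x \<oplus>\<^bsub>M\<^esub> (y \<oplus>\<^bsub>M\<^esub> z)"
    and "\<And>x y. x \<in> carrier M \<Longrightarrow> y \<in> carrier M \<Longrightarrow> x \<oplus>\<^bsub>M\<^esub> y = y \<oplus>\<^bsub>M\<^esub> x"
    and "\<And>x. x \<in> carrier M \<Longrightarrow> \<zero>\<^bsub>M\<^esub> \<oplus>\<^bsub>M\<^esub> x = x"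
    and zero: "\<And>x. x \<in> carrier M \<Longrightarrow> \<zero>\<^bsub>R\<^esub> \<odot>\<^bsub>M\<^esub> x = \<zero>\<^bsub>M\<^esub>"
    and smult: "\<And>a x. a \<in> carrier R \<Longrightarrow> x \<in> carrier M \<Longrightarrow> a \<odot>\<^bsub>M\<^esub> x \<in> carrier M"
    and distr: "\<And>a b x. a \<in> carrier R \<Longrightarrow> b \<in> carrier R \<Longrightarrow> x \<in> carrier M \<Longrightarrow>
      (a \<oplus>\<^bsub>R\<^esub> b) \<odot>\<^bsub>M\<^esub> x = a \<odot>\<^bsub>M\<^esub> x \<oplus>\<^bsub>M\<^esub> b \<odot>\<^bsub>M\<^esub> x"
    and "\<And>a x y. a \<in> carrier R \<Longrightarrow> x \<in> carrier M \<Longrightarrow> y \<in> carrier M \<Longrightarrow>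
      a \<odot>\<^bsub>M\<^esub> (x \<oplus>\<^bsub>M\<^esub> y) = a \<odot>\<^bsub>M\<^esub> x \<oplus>\<^bsub>M\<^esub> a \<odot>\<^bsub>M\<^esub> y"
    and "\<And>a b x. a \<in> carrier R \<Longrightarrow> b \<in> carrier R \<Longrightarrow> x \<in> carrier M \<Longrightarrow>
      (a \<otimes>\<^bsub>R\<^esub> b) \<odot>\<^bsub>M\<^esub> x = a \<odot>\<^bsub>M\<^esub> (b \<odot>\<^bsub>M\<^esub> x)"
    and one: "\<And>x. x \<in> carrier M \<Longrightarrow> \<one>\<^bsub>R\<^esub> \<odot>\<^bsub>M\<^esub> x = x"
  shows "left_module R M"
proof -
  interpret R: ring R by fact
  have inv: "\<exists>y\<in>carrier M. y \<oplus>\<^bsub>M\<^esub> x = \<zero>\<^bsub>M\<^esub>" if "x \<in> carrier M" for x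
    using distr[of "\<ominus>\<^bsub>R\<^esub> \<one>\<^bsub>R\<^esub>" "\<one>\<^bsub>R\<^esub>" x] zero[OF that] one[OF that] smult[of "\<ominus>\<^bsub>R\<^esub> \<one>\<^bsub>R\<^esub>" x] that
    by (auto simp: R.l_neg)
  have "abelian_group M" by (rule abelian_groupI) (use assms inv in auto)
  with assms show ?thesis by (auto simp: left_module_def left_module_axioms_def)
qed

context left_module
begin

lemma smult_zero_left: "x \<in> carrier M \<Longrightarrow> \<zero> \<odot>\<^bsub>M\<^esub> x = \<zero>\<^bsub>M\<^esub>"
  using smult_l_distr[of \<zero> \<zero> x] smult_closed[of \<zero> x] by (simp add: M.add.r_cancel_one')

lemma smult_zero_right: "a \<in> carrier R \<Longrightarrow> a \<odot>\<^bsub>M\<^esub> \<zero>\<^bsub>M\<^esub> = \<zero>\<^bsub>M\<^esub>"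
  using smult_r_distr[of a "\<zero>\<^bsub>M\<^esub>" "\<zero>\<^bsub>M\<^esub>"] smult_closed[of a "\<zero>\<^bsub>M\<^esub>"]
  by (simp add: M.add.r_cancel_one')

lemma smult_minus_one: "x \<in> carrier M \<Longrightarrow> (\<ominus> \<one>) \<odot>\<^bsub>M\<^esub> x = \<ominus>\<^bsub>M\<^esub> x"
  using smult_l_distr[of "\<ominus> \<one>" \<one> x] smult_closed[of "\<ominus> \<one>" x] smult_one[of x]
  by (simp add: R.l_neg smult_zero_left M.minus_equality)

lemma submodule_iff:
  "submodule H R M \<longleftrightarrow> H \<subseteq> carrier M \<and> \<zero>\<^bsub>M\<^esub> \<in> H \<and> (\<forall>x\<in>H. \<forall>y\<in>H. x \<oplus>\<^bsub>M\<^esub> y \<in> H) \<and>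
     (\<forall>a\<in>carrier R. \<forall>x\<in>H. a \<odot>\<^bsub>M\<^esub> x \<in> H)" (is "_ \<longleftrightarrow> ?r")
proof
  assume "submodule H R M"
  then interpret submodule H R M .
  show ?r using subset one_closed m_closed by auto
next
  assume r: ?r
  have "\<ominus>\<^bsub>M\<^esub> x \<in> H" if "x \<in> H" for x
    using r that smult_minus_one[of x] R.a_inv_closed[OF R.one_closed] by (metis subsetD)
  with r show "submodule H R M"
    by (auto intro!: submodule.intro subgroup.intro submodule_axioms.intro simp: a_inv_def)
qed

lemma submod_left_module:
  assumes "submodule H R M"
  shows "left_module R (submod M H)"
  using assms unfolding submodule_iff
  by (intro left_moduleI)
     (auto simp: subset_iff M.a_ac smult_l_distr smult_r_distr smult_assoc smult_one
       smult_zero_left R.ring_axioms)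

end

lemma lmod_homD:
  assumes "f \<in> lmod_hom R M N"
  shows "x \<in> carrier M \<Longrightarrow> f x \<in> carrier N"
    and "x \<in> carrier M \<Longrightarrow> y \<in> carrier M \<Longrightarrow> f (x \<oplus>\<^bsub>M\<^esub> y) = f x \<oplus>\<^bsub>N\<^esub> f y"
    and "a \<in> carrier R \<Longrightarrow> x \<in> carrier M \<Longrightarrow> f (a \<odot>\<^bsub>M\<^esub> x) = a \<odot>\<^bsub>N\<^esub> f x"
  using assms by (auto simp: lmod_hom_def)

lemma lmod_hom_zero:
  assumes "left_module R M" "left_module R N" "f \<in> lmod_hom R M N"
  shows "f \<zero>\<^bsub>M\<^esub> = \<zero>\<^bsub>N\<^esub>"
proof -
  interpret M: left_module R M by fact
  interpret N: left_module R N by fact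
  show ?thesis
    using lmod_homD(3)[OF assms(3), of "\<zero>\<^bsub>R\<^esub>" "\<zero>\<^bsub>M\<^esub>"] lmod_homD(1)[OF assms(3), of "\<zero>\<^bsub>M\<^esub>"]
    by (simp add: M.smult_zero_left N.smult_zero_left)
qed

lemma lmod_hom_comp: "f \<in> lmod_hom R M N \<Longrightarrow> g \<in> lmod_hom R N K \<Longrightarrow> g \<circ> f \<in> lmod_hom R M K"
  by (auto simp: lmod_hom_def Pi_iff)

lemma lmod_hom_inv:
  assumes M: "left_module R M" and f: "f \<in> lmod_hom R M N"
      and bij: "bij_betw f (carrier M) (carrier N)"
  shows "inv_into (carrier M) f \<in> lmod_hom R N M"
proof -
  interpret M: left_module R M by fact
  let ?g = "inv_into (carrier M) f"
  have g: "?g y \<in> carrier M" "f (?g y) = y" if "y \<in> carrier N" for y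
    using that bij by (auto simp: bij_betw_def inv_into_into f_inv_into_f)
  have gf: "?g (f x) = x" if "x \<in> carrier M" for x using that bij by (simp add: bij_betw_def)
  show ?thesis
    unfolding lmod_hom_def
  proof (intro CollectI conjI ballI Pi_I)
    fix x y assume x: "x \<in> carrier N"
    show "?g x \<in> carrier M" using g x by simp
    show "?g (x \<oplus>\<^bsub>N\<^esub> y) = ?g x \<oplus>\<^bsub>M\<^esub> ?g y" if "y \<in> carrier N"
      using g[OF x] g[OF that] gf[of "?g x \<oplus>\<^bsub>M\<^esub> ?g y"] lmod_homD(2)[OF f, of "?g x" "?g y"] by simp
    show "?g (a \<odot>\<^bsub>N\<^esub> x) = a \<odot>\<^bsub>M\<^esub> ?g x" if "a \<in> carrier R" for a
      using g[OF x] that gf[of "a \<odot>\<^bsub>M\<^esub> ?g x"] lmod_homD(3)[OF f, of a "?g x"] M.smult_closed by simp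
  qed
qed

lemma lmod_isoI: "f \<in> lmod_hom R M N \<Longrightarrow> bij_betw f (carrier M) (carrier N) \<Longrightarrow> lmod_iso R M N"
  by (auto simp: lmod_iso_def)

lemma lmod_iso_refl: "lmod_iso R M M"
  by (rule lmod_isoI[of id]) (auto simp: lmod_hom_def)

lemma lmod_iso_sym: "left_module R M \<Longrightarrow> lmod_iso R M N \<Longrightarrow> lmod_iso R N M"
  unfolding lmod_iso_def using lmod_hom_inv bij_betw_inv_into by blast

lemma lmod_iso_trans: "lmod_iso R M N \<Longrightarrow> lmod_iso R N K \<Longrightarrow> lmod_iso R M K"
  unfolding lmod_iso_def using lmod_hom_comp bij_betw_trans by blast

lemma inj_onI_kernel:
  assumes "left_module R M" "left_module R N" "f \<in> lmod_hom R M N"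
    and ker: "\<And>x. x \<in> carrier M \<Longrightarrow> f x = \<zero>\<^bsub>N\<^esub> \<Longrightarrow> x = \<zero>\<^bsub>M\<^esub>"
  shows "inj_on f (carrier M)"
proof (rule inj_onI)
  interpret M: left_module R M by fact
  interpret N: left_module R N by fact
  fix x y assume xy: "x \<in> carrier M" "y \<in> carrier M" "f x = f y"
  let ?m = "\<ominus>\<^bsub>R\<^esub> \<one>\<^bsub>R\<^esub> \<odot>\<^bsub>M\<^esub> y"
  have m: "?m \<in> carrier M" using xy by (simp add: M.smult_closed)
  have "f (x \<oplus>\<^bsub>M\<^esub> ?m) = f x \<oplus>\<^bsub>N\<^esub> \<ominus>\<^bsub>N\<^esub> f y"
    using xy m lmod_homD(2)[OF assms(3) xy(1) m] lmod_homD(3)[OF assms(3) _ xy(2), of "\<ominus>\<^bsub>R\<^esub> \<one>\<^bsub>R\<^esub>"]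
    by (simp add: N.smult_minus_one lmod_homD(1)[OF assms(3)])
  also have "\<dots> = \<zero>\<^bsub>N\<^esub>" using xy lmod_homD(1)[OF assms(3)] by (simp add: N.r_neg)
  finally have "x \<oplus>\<^bsub>M\<^esub> ?m = \<zero>\<^bsub>M\<^esub>" using ker xy m by simp
  then have "x = \<ominus>\<^bsub>M\<^esub> (\<ominus>\<^bsub>M\<^esub> y)" using xy by (simp add: M.smult_minus_one M.minus_equality)
  then show "x = y" using xy by simp
qed

lemma submodule_image:
  assumes "left_module R M" "left_module R N" "f \<in> lmod_hom R M N" "submodule H R M"
  shows "submodule (f ` H) R N"
proof -
  interpret M: left_module R M by fact
  interpret N: left_module R N by fact
  have H: "H \<subseteq> carrier M" "\<zero>\<^bsub>M\<^esub> \<in> H" "\<And>x y. x \<in> H \<Longrightarrow> y \<in> H \<Longrightarrow> x \<oplus>\<^bsub>M\<^esub> y \<in> H"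
    "\<And>a x. a \<in> carrier R \<Longrightarrow> x \<in> H \<Longrightarrow> a \<odot>\<^bsub>M\<^esub> x \<in> H" using assms(4) by (auto simp: M.submodule_iff)
  show ?thesis
    unfolding N.submodule_iff
  proof (intro conjI ballI)
    show "f ` H \<subseteq> carrier N" using H lmod_homD(1)[OF assms(3)] by auto
    show "\<zero>\<^bsub>N\<^esub> \<in> f ` H" using lmod_hom_zero[OF assms(1-3)] H(2) by force
    fix x assume "x \<in> f ` H"
    then obtain x' where x': "x' \<in> H" "x = f x'" by blast
    show "x \<oplus>\<^bsub>N\<^esub> y \<in> f ` H" if y: "y \<in> f ` H" for y
    proof -
      obtain y' where y': "y' \<in> H" "y = f y'" using y by blast
      have "x \<oplus>\<^bsub>N\<^esub> y = f (x' \<oplus>\<^bsub>M\<^esub> y')" using lmod_homD(2)[OF assms(3), of x' y'] subsetD[OF H(1)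
          x'(1)] subsetD[OF H(1) y'(1)] x' y' by simp
      then show ?thesis using H(3) x' y' by blast
    qed
    show "a \<odot>\<^bsub>N\<^esub> x \<in> f ` H" if "a \<in> carrier R" for a
    proof -
      have "a \<odot>\<^bsub>N\<^esub> x = f (a \<odot>\<^bsub>M\<^esub> x')" using lmod_homD(3)[OF assms(3) that, of x'] subsetD[OF H(1)
          x'(1)] x' by simp
      then show ?thesis using H(4) x' that by blast
    qed
  qed
qed

lemma submodule_vimage:
  assumes "left_module R M" "left_module R N" "f \<in> lmod_hom R M N" "submodule W R N"
  shows "submodule {x \<in> carrier M. f x \<in> W} R M"
proof -
  interpret M: left_module R M by fact
  interpret N: left_module R N by fact
  show ?thesis
    using assms(4) lmod_homD[OF assms(3)] lmod_hom_zero[OF assms(1-3)]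
    by (auto simp: M.submodule_iff N.submodule_iff M.smult_closed)
qed

lemma submodule_carrier: "left_module R M \<Longrightarrow> submodule (carrier M) R M"
proof -
  assume "left_module R M"
  then interpret M: left_module R M .
  show ?thesis by (simp add: M.submodule_iff M.smult_closed)
qed

lemma lmod_hom_image_iso:
  assumes "f \<in> lmod_hom R M N" "inj_on f (carrier M)"
  shows "lmod_iso R M (submod N (f ` carrier M))"
  by (rule lmod_isoI[of f]) (use assms in \<open>auto simp: lmod_hom_def bij_betw_def\<close>)

section \<open>Direct sums, external and internal\<close>

lemma direct_sum_simps [simp]:
  "carrier (direct_sum M N) = carrier M \<times> carrier N"
  "\<zero>\<^bsub>direct_sum M N\<^esub> = (\<zero>\<^bsub>M\<^esub>, \<zero>\<^bsub>N\<^esub>)"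
  "(x, y) \<oplus>\<^bsub>direct_sum M N\<^esub> (x', y') = (x \<oplus>\<^bsub>M\<^esub> x', y \<oplus>\<^bsub>N\<^esub> y')"
  "a \<odot>\<^bsub>direct_sum M N\<^esub> (x, y) = (a \<odot>\<^bsub>M\<^esub> x, a \<odot>\<^bsub>N\<^esub> y)"
  by (simp_all add: direct_sum_def)

lemma left_module_direct_sum:
  assumes "left_module R M" "left_module R N"
  shows "left_module R (direct_sum M N)"
proof -
  interpret M: left_module R M by fact
  interpret N: left_module R N by fact
  show ?thesis
    by (rule left_moduleI)
       (auto simp: M.a_ac N.a_ac M.smult_l_distr N.smult_l_distr
         M.smult_r_distr N.smult_r_distr M.smult_assoc N.smult_assoc M.smult_one N.smult_one
         M.smult_zero_left N.smult_zero_left M.R.ring_axioms M.smult_closed N.smult_closed)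
qed

lemma direct_sum_cong:
  assumes "lmod_iso R M M'" "lmod_iso R N N'"
  shows "lmod_iso R (direct_sum M N) (direct_sum M' N')"
proof -
  obtain f g where f: "f \<in> lmod_hom R M M'" "bij_betw f (carrier M) (carrier M')"
    and g: "g \<in> lmod_hom R N N'" "bij_betw g (carrier N) (carrier N')"
    using assms by (auto simp: lmod_iso_def)
  have "map_prod f g \<in> lmod_hom R (direct_sum M N) (direct_sum M' N')"
    using f(1) g(1) by (auto simp: lmod_hom_def)
  moreover have "bij_betw (map_prod f g) (carrier M \<times> carrier N) (carrier M' \<times> carrier N')"
    using f(2) g(2) by (rule bij_betw_map_prod)
  ultimately show ?thesis by (auto intro: lmod_isoI)
qed

lemma set_add_iff: "z \<in> H <+>\<^bsub>M\<^esub> L \<longleftrightarrow> (\<exists>x\<in>H. \<exists>y\<in>L. z = x \<oplus>\<^bsub>M\<^esub> y)"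
  by (auto simp: set_add_def')

lemma internal_direct_sumE:
  assumes "left_module R M" "internal_direct_sum R M H L"
  shows "lmod_iso R (direct_sum (submod M H) (submod M L)) M"
proof -
  interpret M: left_module R M by fact
  have H: "submodule H R M" "submodule L R M" and sum: "H <+>\<^bsub>M\<^esub> L = carrier M"
      and int: "H \<inter> L = {\<zero>\<^bsub>M\<^esub>}"
    using assms(2) by (auto simp: internal_direct_sum_def)
  note Hs = H[unfolded M.submodule_iff]
  let ?D = "direct_sum (submod M H) (submod M L)"
  let ?f = "\<lambda>(x, y). x \<oplus>\<^bsub>M\<^esub> y"
  have D: "left_module R ?D" using H by (intro left_module_direct_sum M.submod_left_module)
  have f: "?f \<in> lmod_hom R ?D M"
    using Hs by (auto simp: lmod_hom_def subset_iff M.smult_r_distr M.a_ac)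
  moreover have "inj_on ?f (carrier ?D)"
  proof (rule inj_onI_kernel[OF D assms(1) f])
    fix z assume "z \<in> carrier ?D" "?f z = \<zero>\<^bsub>M\<^esub>"
    then obtain x y where z: "z = (x, y)" "x \<in> H" "y \<in> L" "x \<oplus>\<^bsub>M\<^esub> y = \<zero>\<^bsub>M\<^esub>" by auto
    have c: "x \<in> carrier M" "y \<in> carrier M" using z Hs by auto
    then have "x = \<ominus>\<^bsub>M\<^esub> y" using z by (simp add: M.minus_equality)
    then have "x \<in> L" using z c Hs M.smult_minus_one[of y]
        by (metis M.R.a_inv_closed M.R.one_closed)
    then have "x = \<zero>\<^bsub>M\<^esub>" using int z by blast
    then show "z = \<zero>\<^bsub>?D\<^esub>" using z c by simp
  qed
  moreover have "?f ` carrier ?D = carrier M"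
    unfolding sum[symmetric] by (auto simp: set_add_iff) blast
  ultimately show ?thesis by (auto simp: bij_betw_def intro: lmod_isoI)
qed

text \<open>Refinement asks for submodules of the given modules, whereas types only provide abstract
  isomorphisms. The images of the two injections are the required submodules.\<close>

lemma internal_direct_sumI:
  assumes M: "left_module R M" and A: "left_module R A" and B: "left_module R B"
    and iso: "lmod_iso R (direct_sum A B) M"
  obtains H L where "internal_direct_sum R M H L"
    "lmod_iso R A (submod M H)" "lmod_iso R B (submod M L)"
proof -
  interpret M: left_module R M by fact
  interpret A: left_module R A by fact
  interpret B: left_module R B by fact
  obtain f where f: "f \<in> lmod_hom R (direct_sum A B) M"
      and bij: "bij_betw f (carrier A \<times> carrier B) (carrier M)"
    using iso by (auto simp: lmod_iso_def)
  have D: "left_module R (direct_sum A B)" using A B by (rule left_module_direct_sum)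
  let ?a = "\<lambda>x. f (x, \<zero>\<^bsub>B\<^esub>)" and ?b = "\<lambda>y. f (\<zero>\<^bsub>A\<^esub>, y)"
  have i1: "(\<lambda>x. (x, \<zero>\<^bsub>B\<^esub>)) \<in> lmod_hom R A (direct_sum A B)"
    by (auto simp: lmod_hom_def B.smult_zero_right)
  have i2: "(\<lambda>y. (\<zero>\<^bsub>A\<^esub>, y)) \<in> lmod_hom R B (direct_sum A B)"
    by (auto simp: lmod_hom_def A.smult_zero_right)
  have a: "?a \<in> lmod_hom R A M" and b: "?b \<in> lmod_hom R B M"
    using lmod_hom_comp[OF i1 f] lmod_hom_comp[OF i2 f] by (simp_all add: comp_def)
  have inj: "inj_on f (carrier A \<times> carrier B)" using bij by (simp add: bij_betw_def)
  have ia: "inj_on ?a (carrier A)"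
    by (rule inj_onI) (use inj_onD[OF inj, of "(_, \<zero>\<^bsub>B\<^esub>)" "(_, \<zero>\<^bsub>B\<^esub>)"] in auto)
  have ib: "inj_on ?b (carrier B)"
    by (rule inj_onI) (use inj_onD[OF inj, of "(\<zero>\<^bsub>A\<^esub>, _)" "(\<zero>\<^bsub>A\<^esub>, _)"] in auto)
  have f0: "f (\<zero>\<^bsub>A\<^esub>, \<zero>\<^bsub>B\<^esub>) = \<zero>\<^bsub>M\<^esub>" using lmod_hom_zero[OF D M f] by simp
  have fs: "f (x, y) = ?a x \<oplus>\<^bsub>M\<^esub> ?b y" if "x \<in> carrier A" "y \<in> carrier B" for x y
    using lmod_homD(2)[OF f, of "(x, \<zero>\<^bsub>B\<^esub>)" "(\<zero>\<^bsub>A\<^esub>, y)"] that by simp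
  show thesis
  proof (rule that[of "?a ` carrier A" "?b ` carrier B"])
    show "lmod_iso R A (submod M (?a ` carrier A))" using a ia by (rule lmod_hom_image_iso)
    show "lmod_iso R B (submod M (?b ` carrier B))" using b ib by (rule lmod_hom_image_iso)
    show "internal_direct_sum R M (?a ` carrier A) (?b ` carrier B)"
      unfolding internal_direct_sum_def
    proof (intro conjI)
      show "submodule (?a ` carrier A) R M"
        by (rule submodule_image[OF A M a submodule_carrier[OF A]])
      show "submodule (?b ` carrier B) R M"
        by (rule submodule_image[OF B M b submodule_carrier[OF B]])
      have "?a ` carrier A <+>\<^bsub>M\<^esub> ?b ` carrier B = f ` (carrier A \<times> carrier B)"
      proof (intro Set.set_eqI iffI)
        fix z assume "z \<in> ?a ` carrier A <+>\<^bsub>M\<^esub> ?b ` carrier B"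
        then obtain x y where xy: "x \<in> carrier A" "y \<in> carrier B" "z = ?a x \<oplus>\<^bsub>M\<^esub> ?b y"
            by (auto simp: set_add_iff)
        then have "z = f (x, y)" by (simp only: fs[OF xy(1,2)])
        then show "z \<in> f ` (carrier A \<times> carrier B)" using xy by blast
      next
        fix z assume "z \<in> f ` (carrier A \<times> carrier B)"
        then obtain x y where xy: "x \<in> carrier A" "y \<in> carrier B" "z = f (x, y)" by blast
        then have "z = ?a x \<oplus>\<^bsub>M\<^esub> ?b y" by (simp only: fs[OF xy(1,2)])
        then show "z \<in> ?a ` carrier A <+>\<^bsub>M\<^esub> ?b ` carrier B"
          using xy(1,2) unfolding set_add_iff by blast
      qed
      then show "?a ` carrier A <+>\<^bsub>M\<^esub> ?b ` carrier B = carrier M"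
        using bij by (simp add: bij_betw_def)
      show "?a ` carrier A \<inter> ?b ` carrier B = {\<zero>\<^bsub>M\<^esub>}"
      proof
        show "?a ` carrier A \<inter> ?b ` carrier B \<subseteq> {\<zero>\<^bsub>M\<^esub>}"
          using f0 inj_onD[OF inj, of "(_, \<zero>\<^bsub>B\<^esub>)" "(\<zero>\<^bsub>A\<^esub>, _)"] by auto
        show "{\<zero>\<^bsub>M\<^esub>} \<subseteq> ?a ` carrier A \<inter> ?b ` carrier B"
          using imageI[of "\<zero>\<^bsub>A\<^esub>" "carrier A" ?a] imageI[of "\<zero>\<^bsub>B\<^esub>" "carrier B" ?b] f0 by simp
      qed
    qed
  qed
qed

text \<open>A form of finite generation that is easily transported along surjective homomorphisms.\<close>

definition fin_gen :: "('r, 'x) ring_scheme \<Rightarrow> ('r, 'm) module \<Rightarrow> bool" where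
  "fin_gen R M \<longleftrightarrow> (\<exists>G. finite G \<and> G \<subseteq> carrier M \<and>
     (\<forall>W. submodule W R M \<longrightarrow> G \<subseteq> W \<longrightarrow> W = carrier M))"

lemma fin_gen_surj:
  assumes "left_module R M" "left_module R N" "f \<in> lmod_hom R M N" "f ` carrier M = carrier N"
    and "fin_gen R M"
  shows "fin_gen R N"
proof -
  obtain G where G: "finite G" "G \<subseteq> carrier M" "\<And>W. submodule W R M \<Longrightarrow> G \<subseteq> W \<Longrightarrow> W = carrier M"
    using assms(5) by (auto simp: fin_gen_def)
  have "W = carrier N" if W: "submodule W R N" "f ` G \<subseteq> W" for W
  proof -
    interpret N: left_module R N by fact
    have "{x \<in> carrier M. f x \<in> W} = carrier M"
      using G(2) W by (intro G(3) submodule_vimage[OF assms(1-3)]) auto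
    then have "\<forall>x\<in>carrier M. f x \<in> W" by blast
    then have "carrier N \<subseteq> W" unfolding assms(4)[symmetric] by blast
    then show ?thesis using W by (auto simp: N.submodule_iff)
  qed
  with G assms(4) show ?thesis unfolding fin_gen_def by (intro exI[of _ "f ` G"]) auto
qed

lemma fin_gen_iso:
  assumes "left_module R M" "left_module R N" "lmod_iso R M N" "fin_gen R M"
  shows "fin_gen R N"
  using assms fin_gen_surj unfolding lmod_iso_def bij_betw_def by blast

text \<open>A summand is the image of a projection and inherits generators from the whole
  module.\<close>

lemma fin_gen_summand:
  assumes M: "left_module R M" and ids: "internal_direct_sum R M H L" and fg: "fin_gen R M"
  shows "fin_gen R (submod M L)"
proof -
  interpret M: left_module R M by fact
  have H: "submodule H R M" "submodule L R M" using ids by (auto simp: internal_direct_sum_def)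
  then have Hm: "left_module R (submod M H)" "left_module R (submod M L)"
    by (auto intro: M.submod_left_module)
  let ?D = "direct_sum (submod M H) (submod M L)"
  have D: "left_module R ?D" using Hm by (rule left_module_direct_sum)
  have fgD: "fin_gen R ?D"
    by (rule fin_gen_iso[OF M D lmod_iso_sym[OF D internal_direct_sumE[OF M ids]] fg])
  have "\<zero>\<^bsub>M\<^esub> \<in> H" using H by (simp add: M.submodule_iff)
  then show ?thesis
    by (intro fin_gen_surj[OF D Hm(2) _ _ fgD, of snd]) (auto simp: lmod_hom_def image_iff)
qed

lemma smult_span_submodule:
  assumes M: "left_module R M" and S: "S \<subseteq> carrier M" and A: "A \<subseteq> carrier R"
    and ideal: "\<And>a r. a \<in> A \<Longrightarrow> r \<in> carrier R \<Longrightarrow> r \<otimes>\<^bsub>R\<^esub> a \<in> A"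
  shows "submodule (smult_span M A S) R M"
proof -
  interpret M: left_module R M by fact
  let ?X = "{a \<odot>\<^bsub>M\<^esub> x | a x. a \<in> A \<and> x \<in> S}"
  have X: "?X \<subseteq> carrier M" using S A by (auto intro: M.smult_closed)
  have sub: "subgroup (generate (add_monoid M) ?X) (add_monoid M)"
    using X by (intro M.add.generate_is_subgroup) simp
  have "r \<odot>\<^bsub>M\<^esub> z \<in> generate (add_monoid M) ?X"
    if z: "z \<in> generate (add_monoid M) ?X" and r: "r \<in> carrier R" for r z
    using z
  proof induction
    case one
    show ?case using M.smult_zero_right[OF r] generate.one[of "add_monoid M" ?X] by simp
  next
    case (incl h)
    then obtain a x where h: "h = a \<odot>\<^bsub>M\<^esub> x" "a \<in> A" "x \<in> S" by blast
    then have "r \<odot>\<^bsub>M\<^esub> h = (r \<otimes>\<^bsub>R\<^esub> a) \<odot>\<^bsub>M\<^esub> x" using S A r by (auto simp: M.smult_assoc subset_iff)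
    then have "r \<odot>\<^bsub>M\<^esub> h \<in> ?X" using h ideal r by blast
    then show ?case by (rule generate.incl)
  next
    case (inv h)
    then obtain a x where h: "h = a \<odot>\<^bsub>M\<^esub> x" "a \<in> A" "x \<in> S" by blast
    have hc: "h \<in> carrier M" using inv X by blast
    \<comment> \<open>The negative of a product is again a product, since the sign can be absorbed
      into the factor from \<open>A\<close>.\<close>
    have "r \<odot>\<^bsub>M\<^esub> (\<ominus>\<^bsub>M\<^esub> h) = ((r \<otimes>\<^bsub>R\<^esub> \<ominus>\<^bsub>R\<^esub> \<one>\<^bsub>R\<^esub>) \<otimes>\<^bsub>R\<^esub> a) \<odot>\<^bsub>M\<^esub> x"
      using h S A r by (auto simp: M.smult_assoc subset_iff M.smult_closed simp flip:
          M.smult_minus_one)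
    then have "r \<odot>\<^bsub>M\<^esub> (\<ominus>\<^bsub>M\<^esub> h) \<in> ?X" using h r ideal[of a "r \<otimes>\<^bsub>R\<^esub> \<ominus>\<^bsub>R\<^esub> \<one>\<^bsub>R\<^esub>"] by blast
    then show ?case by (auto simp: a_inv_def[symmetric] intro: generate.incl)
  next
    case (eng h1 h2)
    have "h1 \<in> carrier M" "h2 \<in> carrier M" using eng.hyps subgroup.subset[OF sub] by auto
    then show ?case using eng.IH r generate.eng[of _ "add_monoid M" ?X]
        by (simp add: M.smult_r_distr)
  qed
  then show ?thesis
    unfolding M.submodule_iff smult_span_def
    using subgroup.subset[OF sub] subgroup.one_closed[OF sub] subgroup.m_closed[OF sub] by auto
qed

lemma smult_span_least:
  assumes M: "left_module R M" and W: "submodule W R M" and S: "\<And>a x. a \<in> A \<Longrightarrow> x \<in> S \<Longrightarrow> a \<odot>\<^bsub>M\<^esub> x \<in> W"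
  shows "smult_span M A S \<subseteq> W"
proof -
  interpret M: left_module R M by fact
  interpret W: submodule W R M by fact
  show ?thesis
    unfolding smult_span_def using S by (intro M.add.generate_subgroup_incl W.subgroup_axioms) auto
qed

lemma finitely_generated_iff:
  assumes M: "left_module R M"
  shows "finitely_generated R M \<longleftrightarrow> fin_gen R M"
proof
  interpret M: left_module R M by fact
  assume "finitely_generated R M"
  then obtain S where S: "finite S" "S \<subseteq> carrier M" "carrier M = smult_span M (carrier R) S"
    by (auto simp: finitely_generated_def)
  have "W = carrier M" if "submodule W R M" "S \<subseteq> W" for W
  proof -
    have "smult_span M (carrier R) S \<subseteq> W"
      by (rule smult_span_least[OF M that(1)]) (use that in \<open>auto simp: M.submodule_iff\<close>)
    then show ?thesis using that(1) S(3) by (simp add: M.submodule_iff)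
  qed
  with S show "fin_gen R M" by (auto simp: fin_gen_def)
next
  interpret M: left_module R M by fact
  assume "fin_gen R M"
  then obtain G where G: "finite G" "G \<subseteq> carrier M" "\<And>W. submodule W R M \<Longrightarrow> G \<subseteq> W \<Longrightarrow> W = carrier M"
    by (auto simp: fin_gen_def)
  have "G \<subseteq> smult_span M (carrier R) G"
  proof
    fix x assume "x \<in> G"
    moreover then have "x = \<one>\<^bsub>R\<^esub> \<odot>\<^bsub>M\<^esub> x" using G by (auto simp: M.smult_one)
    ultimately show "x \<in> smult_span M (carrier R) G"
      unfolding smult_span_def by (intro generate.incl) blast
  qed
  with G show "finitely_generated R M" unfolding finitely_generated_def
    by (metis smult_span_submodule[OF M] M.R.m_closed subset_refl)
qed

section \<open>Free modules and direct powers\<close>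

lemma left_module_regular: "ring R \<Longrightarrow> left_module R (regular_module R)"
proof -
  assume "ring R"
  then interpret ring R .
  show ?thesis
    by (rule left_moduleI)
       (auto simp: regular_module_def ring_axioms a_ac l_distr r_distr m_assoc)
qed

lemma direct_power_simps [simp]:
  "carrier (direct_power S M) = {f \<in> S \<rightarrow>\<^sub>E carrier M. finite {s \<in> S. f s \<noteq> \<zero>\<^bsub>M\<^esub>}}"
  "\<zero>\<^bsub>direct_power S M\<^esub> = (\<lambda>s\<in>S. \<zero>\<^bsub>M\<^esub>)"
  "f \<oplus>\<^bsub>direct_power S M\<^esub> g = (\<lambda>s\<in>S. f s \<oplus>\<^bsub>M\<^esub> g s)"
  "a \<odot>\<^bsub>direct_power S M\<^esub> f = (\<lambda>s\<in>S. a \<odot>\<^bsub>M\<^esub> f s)"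
  by (simp_all add: direct_power_def)

lemma left_module_direct_power:
  assumes "left_module R M"
  shows "left_module R (direct_power S M)"
proof -
  interpret M: left_module R M by fact
  have PiE: "f s \<in> carrier M" if "f \<in> S \<rightarrow>\<^sub>E carrier M" "s \<in> S" for f s using that by auto
  have fin: "finite {s \<in> S. f s \<oplus>\<^bsub>M\<^esub> g s \<noteq> \<zero>\<^bsub>M\<^esub>}"
    if "f \<in> S \<rightarrow>\<^sub>E carrier M" "g \<in> S \<rightarrow>\<^sub>E carrier M"
      "finite {s \<in> S. f s \<noteq> \<zero>\<^bsub>M\<^esub>}" "finite {s \<in> S. g s \<noteq> \<zero>\<^bsub>M\<^esub>}" for f g
    by (rule finite_subset[of _ "{s \<in> S. f s \<noteq> \<zero>\<^bsub>M\<^esub>} \<union> {s \<in> S. g s \<noteq> \<zero>\<^bsub>M\<^esub>}"]) (use that in auto)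
  have fin': "finite {s \<in> S. a \<odot>\<^bsub>M\<^esub> f s \<noteq> \<zero>\<^bsub>M\<^esub>}"
    if "a \<in> carrier R" "finite {s \<in> S. f s \<noteq> \<zero>\<^bsub>M\<^esub>}" for f a
    by (rule finite_subset[of _ "{s \<in> S. f s \<noteq> \<zero>\<^bsub>M\<^esub>}"]) (use that in \<open>auto simp: M.smult_zero_right\<close>)
  have fin0: "finite {s \<in> S. (if s \<in> S then \<zero>\<^bsub>M\<^esub> else undefined) \<noteq> \<zero>\<^bsub>M\<^esub>}"
      by (rule finite_subset[of _ "{}"]) auto
  have ext: "(\<lambda>s\<in>S. h s) = f" if "f \<in> S \<rightarrow>\<^sub>E carrier M" "\<And>s. s \<in> S \<Longrightarrow> h s = f s" for f h
    using that by (auto simp: PiE_def extensional_def fun_eq_iff)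
  show ?thesis
    by (rule left_moduleI)
       (auto simp: M.R.ring_axioms PiE fin fin' restrict_def[of _ S] M.smult_closed M.a_ac
           M.smult_l_distr
         M.smult_r_distr M.smult_assoc M.smult_one M.smult_zero_left fun_eq_iff PiE_def
             extensional_def
         cong: conj_cong)
qed

section \<open>Modules over a unital algebra containing a graph algebra\<close>

lemma (in abelian_monoid) finsum_mem:
  assumes "finite A" "\<And>x. x \<in> A \<Longrightarrow> f x \<in> J" "J \<subseteq> carrier G" "\<zero> \<in> J"
    "\<And>a b. a \<in> J \<Longrightarrow> b \<in> J \<Longrightarrow> a \<oplus> b \<in> J"
  shows "finsum G f A \<in> J"
  using assms(1,2)
proof (induction A rule: finite_induct)
  case (insert x A)
  then have "f \<in> A \<rightarrow> carrier G" "f x \<in> carrier G" using assms(3) by auto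
  with insert show ?case using assms(5) by simp
qed (use assms in simp)

text \<open>Everything that the module theory uses about the embedded algebra.
  \<open>I_induct\<close> says that scalars, sums and left multiplications by generators, starting
  from the \<open>P v\<close>, exhaust the ideal. \<open>indep\<close> prevents the relations from
  collapsing words in the \<open>y\<close>; the other axioms also hold with all generators zero and
  \<open>I\<close> the zero ideal.\<close>

locale graph_alg = unital_algebra R for R :: "('k::field, 'r) module" (structure) +
  fixes E :: "('v, 'e) pre_digraph" and P :: "'v \<Rightarrow> 'r" and X Y :: "'e \<Rightarrow> 'r" and I :: "'r set"
  assumes wf: "wf_digraph E" and rf: "row_finite E"
    and ideal: "ideal I R"
    and P_I: "v \<in> verts E \<Longrightarrow> P v \<in> I"
    and X_I: "e \<in> arcs E \<Longrightarrow> X e \<in> I"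
    and Y_I: "e \<in> arcs E \<Longrightarrow> Y e \<in> I"
    and PP: "v \<in> verts E \<Longrightarrow> u \<in> verts E \<Longrightarrow> P v \<otimes> P u = (if v = u then P v else \<zero>)"
    and PX: "e \<in> arcs E \<Longrightarrow> P (tail E e) \<otimes> X e = X e"
    and XP: "e \<in> arcs E \<Longrightarrow> X e \<otimes> P (head E e) = X e"
    and PY: "e \<in> arcs E \<Longrightarrow> P (head E e) \<otimes> Y e = Y e"
    and YP: "e \<in> arcs E \<Longrightarrow> Y e \<otimes> P (tail E e) = Y e"
    and YX: "e \<in> arcs E \<Longrightarrow> e' \<in> arcs E \<Longrightarrow> Y e \<otimes> X e' = (if e = e' then P (head E e) else \<zero>)"
    and sum_XY: "v \<in> verts E \<Longrightarrow> out_arcs E v \<noteq> {} \<Longrightarrow> P v = (\<Oplus>e\<in>out_arcs E v. X e \<otimes> Y e)"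
    and I_induct: "\<And>J a. a \<in> I \<Longrightarrow> (\<And>v. v \<in> verts E \<Longrightarrow> P v \<in> J) \<Longrightarrow> \<zero> \<in> J \<Longrightarrow>
      (\<And>a b. a \<in> J \<Longrightarrow> b \<in> J \<Longrightarrow> a \<oplus> b \<in> J) \<Longrightarrow> (\<And>c a. a \<in> J \<Longrightarrow> c \<odot> a \<in> J) \<Longrightarrow>
      (\<And>v a. v \<in> verts E \<Longrightarrow> a \<in> J \<Longrightarrow> P v \<otimes> a \<in> J) \<Longrightarrow>
      (\<And>e a. e \<in> arcs E \<Longrightarrow> a \<in> J \<Longrightarrow> X e \<otimes> a \<in> J) \<Longrightarrow>
      (\<And>e a. e \<in> arcs E \<Longrightarrow> a \<in> J \<Longrightarrow> Y e \<otimes> a \<in> J) \<Longrightarrow> a \<in> J"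
    and indep: "v \<in> verts E \<Longrightarrow> finite W \<Longrightarrow> (\<And>w. w \<in> W \<Longrightarrow> walk E v w) \<Longrightarrow>
      (\<Oplus>w\<in>W. c w \<odot> foldr (\<lambda>e a. Y e \<otimes> a) w (P v)) = \<zero> \<Longrightarrow> w \<in> W \<Longrightarrow> c w = 0"
begin

interpretation E: wf_digraph E by (rule wf)

lemma I_carrier: "I \<subseteq> carrier R"
  using additive_subgroup.a_subset[OF ideal.axioms(1)[OF ideal]] .

lemma P_carrier [simp]: "v \<in> verts E \<Longrightarrow> P v \<in> carrier R" using P_I I_carrier by blast
lemma X_carrier [simp]: "e \<in> arcs E \<Longrightarrow> X e \<in> carrier R" using X_I I_carrier by blast
lemma Y_carrier [simp]: "e \<in> arcs E \<Longrightarrow> Y e \<in> carrier R" using Y_I I_carrier by blast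

lemma verts_simps [simp]: "e \<in> arcs E \<Longrightarrow> head E e \<in> verts E" "e \<in> arcs E \<Longrightarrow> tail E e \<in> verts E"
  by simp_all

text \<open>As \<open>R\<close> is unital, scalars act through ring elements, so every
  \<open>R\<close>-linear map respects the action of the field.\<close>

definition scal :: "'k \<Rightarrow> 'r" where "scal c = c \<odot> \<one>"

lemma scal_carrier [simp]: "scal c \<in> carrier R" by (simp add: scal_def smult_closed)

lemma scal_mult: "a \<in> carrier R \<Longrightarrow> scal c \<otimes> a = c \<odot> a"
  by (simp add: scal_def smult_mult_left)

lemma mult_scal: "a \<in> carrier R \<Longrightarrow> a \<otimes> scal c = c \<odot> a"
  by (simp add: scal_def smult_mult_right)

lemma ksmult_zero_left: "a \<in> carrier R \<Longrightarrow> 0 \<odot> a = \<zero>"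
  using smult_l_distr[of a 0 0] smult_closed[of a 0] by (simp add: add.r_cancel_one')

definition yw :: "'v \<Rightarrow> 'e list \<Rightarrow> 'r" where
  "yw v w = foldr (\<lambda>e a. Y e \<otimes> a) w (P v)"

lemma yw_simps [simp]: "yw v [] = P v" "yw v (e # w) = Y e \<otimes> yw v w"
  by (simp_all add: yw_def)

lemma yw_carrier [simp]: "walk E v w \<Longrightarrow> yw v w \<in> carrier R"
  by (induction w) auto

lemma end_verts [simp]: "walk E v w \<Longrightarrow> end_of E v w \<in> verts E"
  by (rule E.end_of_verts)

lemma walk_verts [simp]: "walk E v w \<Longrightarrow> v \<in> verts E"
  by (induction w) auto

lemma yw_P: "walk E v w \<Longrightarrow> yw v w \<otimes> P v = yw v w"
  by (induction w) (auto simp: PP m_assoc)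

lemma PY': "v \<in> verts E \<Longrightarrow> e \<in> arcs E \<Longrightarrow> P v \<otimes> Y e = (if v = head E e then Y e else \<zero>)"
  using m_assoc[of "P v" "P (head E e)" "Y e"] by (auto simp: PY PP)

lemma PX': "v \<in> verts E \<Longrightarrow> e \<in> arcs E \<Longrightarrow> P v \<otimes> X e = (if v = tail E e then X e else \<zero>)"
  using m_assoc[of "P v" "P (tail E e)" "X e"] by (auto simp: PX PP)

lemma P_yw: "walk E v w \<Longrightarrow> u \<in> verts E \<Longrightarrow> P u \<otimes> yw v w = (if u = end_of E v w then yw v w else \<zero>)"
  by (cases w) (auto simp: PP PY' m_assoc[symmetric])

lemma Y_yw: "walk E v w \<Longrightarrow> e \<in> arcs E \<Longrightarrow> tail E e \<noteq> end_of E v w \<Longrightarrow> Y e \<otimes> yw v w = \<zero>"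
proof -
  assume a: "walk E v w" "e \<in> arcs E" "tail E e \<noteq> end_of E v w"
  have "Y e \<otimes> yw v w = (Y e \<otimes> P (tail E e)) \<otimes> yw v w" using a by (simp add: YP)
  also have "\<dots> = \<zero>" using a by (simp add: m_assoc P_yw)
  finally show ?thesis .
qed

lemma yw_snoc: "walk E v (w @ [e]) \<Longrightarrow> yw v (w @ [e]) = yw (head E e) w \<otimes> Y e"
proof (induction w)
  case Nil
  then show ?case using YP[of e] PY[of e] by auto
next
  case (Cons a w)
  then show ?case by (auto simp: E.walk_snoc m_assoc)
qed

lemma P_nonzero: "v \<in> verts E \<Longrightarrow> P v \<noteq> \<zero>"
  using indep[of v "{[]}" "\<lambda>_. 1" "[]"] by (auto simp: smult_one)

text \<open>The direct sum of the left ideals \<open>R p\<^bsub>t s\<^esub>\<close> for \<open>s \<in> S\<close>.\<close>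

definition Hm :: "'s set \<Rightarrow> ('s \<Rightarrow> 'v) \<Rightarrow> ('r, 's \<Rightarrow> 'r) module" where
  "Hm S t = submod (direct_power S (regular_module R))
     {u \<in> carrier (direct_power S (regular_module R)). \<forall>s\<in>S. u s \<otimes> P (t s) = u s}"

lemma Hm_carrier:
  "u \<in> carrier (Hm S t) \<longleftrightarrow> u \<in> extensional S \<and> (\<forall>s\<in>S. u s \<in> carrier R \<and> u s \<otimes> P (t s) = u s) \<and>
     finite {s \<in> S. u s \<noteq> \<zero>}"
  by (auto simp: Hm_def regular_module_def PiE_def)

lemma Hm_simps [simp]:
  "\<zero>\<^bsub>Hm S t\<^esub> = (\<lambda>s\<in>S. \<zero>)"
  "u \<oplus>\<^bsub>Hm S t\<^esub> u' = (\<lambda>s\<in>S. u s \<oplus> u' s)"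
  "a \<odot>\<^bsub>Hm S t\<^esub> u = (\<lambda>s\<in>S. a \<otimes> u s)"
  by (simp_all add: Hm_def regular_module_def)

lemma left_module_dp: "left_module R (direct_power S (regular_module R))"
  by (intro left_module_direct_power left_module_regular ring_axioms)

lemma submodule_Hm:
  assumes "t ` S \<subseteq> verts E"
  shows "submodule {u \<in> carrier (direct_power S (regular_module R)). \<forall>s\<in>S. u s \<otimes> P (t s) = u s}
    R (direct_power S (regular_module R))"
proof -
  interpret D: left_module R "direct_power S (regular_module R)" by (rule left_module_dp)
  have t: "s \<in> S \<Longrightarrow> P (t s) \<in> carrier R" for s using assms by auto
  show ?thesis
    unfolding D.submodule_iff
  proof (intro conjI ballI)
    show "\<zero>\<^bsub>direct_power S (regular_module R)\<^esub> \<in> {u \<in>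
        carrier (direct_power S (regular_module R)). \<forall>s\<in>S. u s \<otimes> P (t s) = u s}"
      using D.zero_closed t by (auto simp del: direct_power_simps(1)) (auto simp:
          regular_module_def)
    fix x assume x: "x \<in> {u \<in> carrier (direct_power S (regular_module R)). \<forall>s\<in>S. u s \<otimes> P (t s) =
        u s}"
    then have xc: "x \<in> carrier (direct_power S (regular_module R))"
        and xs: "\<And>s. s \<in> S \<Longrightarrow> x s \<in> carrier R"
      by (auto simp: regular_module_def)
    show "x \<oplus>\<^bsub>direct_power S (regular_module R)\<^esub> y \<in> {u \<in>
        carrier (direct_power S (regular_module R)). \<forall>s\<in>S. u s \<otimes> P (t s) = u s}"
      if y: "y \<in> {u \<in> carrier (direct_power S (regular_module R)). \<forall>s\<in>S. u s \<otimes> P (t s) = u s}" for y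
    proof -
      have yc: "y \<in> carrier (direct_power S (regular_module R))"
          and ys: "\<And>s. s \<in> S \<Longrightarrow> y s \<in> carrier R"
        using y by (auto simp: regular_module_def)
      show ?thesis using D.a_closed[OF xc yc] x y t xs ys
        by (auto simp: l_distr regular_module_def simp del: direct_power_simps(1))
    qed
    show "a \<odot>\<^bsub>direct_power S (regular_module R)\<^esub> x \<in> {u \<in>
        carrier (direct_power S (regular_module R)). \<forall>s\<in>S. u s \<otimes> P (t s) = u s}"
      if a: "a \<in> carrier R" for a
      using D.smult_closed[OF a xc] x t xs a
      by (auto simp: m_assoc regular_module_def simp del: direct_power_simps(1))
  qed auto
qed

lemma left_module_Hm:
  assumes "t ` S \<subseteq> verts E"
  shows "left_module R (Hm S t)"
  unfolding Hm_def by (intro left_module.submod_left_module left_module_dp submodule_Hm assms)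

definition single :: "'s set \<Rightarrow> 's \<Rightarrow> 'r \<Rightarrow> 's \<Rightarrow> 'r" where
  "single S s a = (\<lambda>s'\<in>S. if s' = s then a else \<zero>)"

lemma single_Hm:
  assumes "s \<in> S" "t ` S \<subseteq> verts E" "a \<in> carrier R" "a \<otimes> P (t s) = a"
  shows "single S s a \<in> carrier (Hm S t)"
proof -
  have "{s' \<in> S. single S s a s' \<noteq> \<zero>} \<subseteq> {s}" by (auto simp: single_def)
  then have "finite {s' \<in> S. single S s a s' \<noteq> \<zero>}" by (rule finite_subset) simp
  with assms show ?thesis by (auto simp: Hm_carrier) (auto simp: single_def)
qed

lemma single_smult:
  assumes "a \<in> carrier R" "r \<in> carrier R"
  shows "r \<odot>\<^bsub>Hm S t\<^esub> single S s a = single S s (r \<otimes> a)"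
  using assms by (auto simp: single_def fun_eq_iff)

lemma Hm_induct [consumes 2, case_names zero step]:
  assumes t: "t ` S \<subseteq> verts E" and "u \<in> carrier (Hm S t)" and "Q \<zero>\<^bsub>Hm S t\<^esub>"
    and step: "\<And>u s a. u \<in> carrier (Hm S t) \<Longrightarrow> s \<in> S \<Longrightarrow> a \<in> carrier R \<Longrightarrow> a \<otimes> P (t s) = a \<Longrightarrow>
      Q u \<Longrightarrow> Q (u \<oplus>\<^bsub>Hm S t\<^esub> single S s a)"
  shows "Q u"
  using assms(2)
proof (induction "card {s \<in> S. u s \<noteq> \<zero>}" arbitrary: u)
  case (0 u)
  then have "u = \<zero>\<^bsub>Hm S t\<^esub>" by (auto simp: Hm_carrier fun_eq_iff extensional_def)
  then show ?case using assms(3) by (simp only:)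
next
  case (Suc n u)
  from Suc.hyps(2) have "{s \<in> S. u s \<noteq> \<zero>} \<noteq> {}" by (metis card.empty nat.distinct(1))
  then obtain s where s: "s \<in> S" "u s \<noteq> \<zero>" by blast
  define u' where "u' = (\<lambda>s'\<in>S. if s' = s then \<zero> else u s')"
  have supp: "{s' \<in> S. u' s' \<noteq> \<zero>} = {s' \<in> S. u s' \<noteq> \<zero>} - {s}" by (auto simp: u'_def)
  have tc: "\<And>s. s \<in> S \<Longrightarrow> P (t s) \<in> carrier R" using t by auto
  have u': "u' \<in> carrier (Hm S t)"
    using Suc.prems supp tc unfolding Hm_carrier by (simp add: u'_def)
  have "n = card {s' \<in> S. u' s' \<noteq> \<zero>}"
    using Suc.hyps(2) s Suc.prems unfolding supp by (simp add: Hm_carrier)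
  then have "Q u'" using Suc.hyps(1) u' by blast
  moreover have "u = u' \<oplus>\<^bsub>Hm S t\<^esub> single S s (u s)"
    using Suc.prems s by (auto simp: u'_def single_def fun_eq_iff Hm_carrier extensional_def)
  ultimately show ?case using step[OF u' s(1)] Suc.prems s by (metis Hm_carrier)
qed

lemma hom_eqI:
  assumes t: "t ` S \<subseteq> verts E" and M: "left_module R M" and f: "f \<in> lmod_hom R (Hm S t) M"
      and g: "g \<in> lmod_hom R (Hm S t) M"
    and eq: "\<And>s. s \<in> S \<Longrightarrow> f (single S s (P (t s))) = g (single S s (P (t s)))"
    and u: "u \<in> carrier (Hm S t)"
  shows "f u = g u"
  using t u
proof (induction rule: Hm_induct)
  case zero
  then show ?case using lmod_hom_zero[OF left_module_Hm[OF t] M] f g by metis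
next
  case (step u s a)
  have P: "P (t s) \<in> carrier R" using step t by auto
  have s: "single S s a \<in> carrier (Hm S t)" using step t by (intro single_Hm) auto
  have sP: "single S s (P (t s)) \<in> carrier (Hm S t)" using step t
      by (intro single_Hm) (auto simp: PP)
  have "single S s a = a \<odot>\<^bsub>Hm S t\<^esub> single S s (P (t s))" using step P
      by (simp add: single_smult del: Hm_simps)
  then have "f (single S s a) = g (single S s a)"
    using lmod_homD(3)[OF f step(3) sP] lmod_homD(3)[OF g step(3) sP] eq[OF step(2)] by simp
  then show ?case
    by (simp only: lmod_homD(2)[OF f step(1) s] lmod_homD(2)[OF g step(1) s] step.IH)
qed

text \<open>The module \<open>Hm S t\<close> is projective with basis of type \<open>t\<close>: homomorphisms extend linearly.\<close>

lemma ext_hom: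
  assumes t: "t ` S \<subseteq> verts E" and M: "left_module R M" and b: "\<And>s. s \<in> S \<Longrightarrow> b s \<in> carrier M"
  obtains f where "f \<in> lmod_hom R (Hm S t) M"
    "\<And>s a. s \<in> S \<Longrightarrow> a \<in> carrier R \<Longrightarrow> a \<otimes> P (t s) = a \<Longrightarrow> f (single S s a) = a \<odot>\<^bsub>M\<^esub> b s"
proof -
  interpret M: left_module R M by fact
  define f where "f = (\<lambda>u. \<Oplus>\<^bsub>M\<^esub>s\<in>{s \<in> S. u s \<noteq> \<zero>}. u s \<odot>\<^bsub>M\<^esub> b s)"
  have sup: "f u = (\<Oplus>\<^bsub>M\<^esub>s\<in>T. u s \<odot>\<^bsub>M\<^esub> b s)"
    if "u \<in> carrier (Hm S t)" "finite T" "{s \<in> S. u s \<noteq> \<zero>} \<subseteq> T" "T \<subseteq> S" for u T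
    unfolding f_def
    by (rule M.add.finprod_mono_neutral_cong_left)
       (use that b in \<open>auto simp: Hm_carrier M.smult_zero_left intro!: M.smult_closed\<close>)
  show thesis
  proof
    show "f \<in> lmod_hom R (Hm S t) M"
      unfolding lmod_hom_def
    proof (intro CollectI conjI ballI Pi_I)
      fix u assume u: "u \<in> carrier (Hm S t)"
      then have uc: "\<And>s. s \<in> S \<Longrightarrow> u s \<in> carrier R" and uf: "finite {s \<in> S. u s \<noteq> \<zero>}"
          by (auto simp: Hm_carrier)
      show "f u \<in> carrier M"
        unfolding f_def using uc b by (intro M.finsum_closed) (auto intro!: M.smult_closed)
      show "f (u \<oplus>\<^bsub>Hm S t\<^esub> u') = f u \<oplus>\<^bsub>M\<^esub> f u'" if u': "u' \<in> carrier (Hm S t)" for u'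
      proof -
        have uc': "\<And>s. s \<in> S \<Longrightarrow> u' s \<in> carrier R" and uf': "finite {s \<in> S. u' s \<noteq> \<zero>}" using u'
            by (auto simp: Hm_carrier)
        let ?T = "{s \<in> S. u s \<noteq> \<zero>} \<union> {s \<in> S. u' s \<noteq> \<zero>}"
        have s: "u \<oplus>\<^bsub>Hm S t\<^esub> u' \<in> carrier (Hm S t)"
          using left_module_Hm[OF t] u u' by (simp add: left_module_def abelian_groupE(1) del:
              Hm_simps)
        have "f (u \<oplus>\<^bsub>Hm S t\<^esub> u') = (\<Oplus>\<^bsub>M\<^esub>s\<in>?T. (u \<oplus>\<^bsub>Hm S t\<^esub> u') s \<odot>\<^bsub>M\<^esub> b s)"
          using uf uf' by (intro sup[OF s]) auto
        also have "\<dots> = (\<Oplus>\<^bsub>M\<^esub>s\<in>?T. u s \<odot>\<^bsub>M\<^esub> b s \<oplus>\<^bsub>M\<^esub> u' s \<odot>\<^bsub>M\<^esub> b s)"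
          using uc uc' b by (intro M.finsum_cong') (auto simp: M.smult_l_distr intro!:
              M.smult_closed M.a_closed)
        also have "\<dots> = f u \<oplus>\<^bsub>M\<^esub> f u'"
          using uc uc' b uf uf' by (subst M.finsum_addf) (auto simp: sup[OF u, of ?T] sup[OF u',
              of ?T] intro!: M.smult_closed)
        finally show ?thesis .
      qed
      show "f (a \<odot>\<^bsub>Hm S t\<^esub> u) = a \<odot>\<^bsub>M\<^esub> f u" if a: "a \<in> carrier R" for a
      proof -
        let ?T = "{s \<in> S. u s \<noteq> \<zero>}"
        have s: "a \<odot>\<^bsub>Hm S t\<^esub> u \<in> carrier (Hm S t)"
          by (rule left_module.smult_closed[OF left_module_Hm[OF t] a u])
        have "f (a \<odot>\<^bsub>Hm S t\<^esub> u) = (\<Oplus>\<^bsub>M\<^esub>s\<in>?T. (a \<odot>\<^bsub>Hm S t\<^esub> u) s \<odot>\<^bsub>M\<^esub> b s)"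
          using uf a by (intro sup[OF s]) auto
        also have "\<dots> = (\<Oplus>\<^bsub>M\<^esub>s\<in>?T. a \<odot>\<^bsub>M\<^esub> (u s \<odot>\<^bsub>M\<^esub> b s))"
          using uc b a by (intro M.finsum_cong') (auto simp: M.smult_assoc intro!: M.smult_closed)
        also have "\<dots> = a \<odot>\<^bsub>M\<^esub> f u"
        proof -
          have "(\<Oplus>\<^bsub>M\<^esub>s\<in>T. a \<odot>\<^bsub>M\<^esub> (u s \<odot>\<^bsub>M\<^esub> b s)) = a \<odot>\<^bsub>M\<^esub> (\<Oplus>\<^bsub>M\<^esub>s\<in>T. u s \<odot>\<^bsub>M\<^esub> b s)"
            if "finite T" "T \<subseteq> S" for T
            using that
          proof (induction T rule: finite_induct)
            case (insert x T)
            then have "(\<lambda>s. u s \<odot>\<^bsub>M\<^esub> b s) \<in> T \<rightarrow> carrier M" "u x \<odot>\<^bsub>M\<^esub> b x \<in> carrier M"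
              "(\<lambda>s. a \<odot>\<^bsub>M\<^esub> (u s \<odot>\<^bsub>M\<^esub> b s)) \<in> T \<rightarrow> carrier M"
              using uc b a by (auto intro!: M.smult_closed)
            with insert a show ?case by (simp add: M.smult_r_distr M.smult_closed)
          qed (simp add: M.smult_zero_right a)
          then show ?thesis using uf unfolding f_def by auto
        qed
        finally show ?thesis .
      qed
    qed
    fix s a assume s: "s \<in> S" "a \<in> carrier R" "a \<otimes> P (t s) = a"
    have "f (single S s a) = (\<Oplus>\<^bsub>M\<^esub>s'\<in>{s}. single S s a s' \<odot>\<^bsub>M\<^esub> b s')"
      using s t by (intro sup single_Hm) (auto simp: single_def split: if_splits)
    also have "\<dots> = a \<odot>\<^bsub>M\<^esub> b s" using s b by (simp add: single_def M.smult_closed)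
    finally show "f (single S s a) = a \<odot>\<^bsub>M\<^esub> b s" .
  qed
qed

end

section \<open>The path-algebra lattice and deep multiples\<close>

context graph_alg
begin

interpretation E: wf_digraph E by (rule wf)

text \<open>\<open>Th\<close> embeds the free module over the path algebra into \<open>Hm S t\<close>.\<close>

definition Th :: "'s set \<Rightarrow> ('s \<Rightarrow> 'v) \<Rightarrow> (('s, 'e) mon \<Rightarrow> 'k) \<Rightarrow> 's \<Rightarrow> 'r" where
  "Th S t f = (\<lambda>s\<in>S. \<Oplus>w\<in>{w. f (Mo s w) \<noteq> 0}. f (Mo s w) \<odot> yw (t s) w)"

lemma F_supp:
  assumes "f \<in> F E S t"
  shows "finite {w. f (Mo s w) \<noteq> 0}" "f (Mo s w) \<noteq> 0 \<Longrightarrow> s \<in> S \<and> walk E (t s) w"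
proof -
  have "{w. f (Mo s w) \<noteq> 0} \<subseteq> word ` {m. f m \<noteq> 0}" by (force simp: image_iff)
  then show "finite {w. f (Mo s w) \<noteq> 0}" using assms finite_subset by (fastforce simp: F_def)
  show "f (Mo s w) \<noteq> 0 \<Longrightarrow> s \<in> S \<and> walk E (t s) w" using assms by (auto simp: F_def Mon_def)
qed

lemma Th_superset:
  assumes "f \<in> F E S t" "finite W" "{w. f (Mo s w) \<noteq> 0} \<subseteq> W" "\<And>w. w \<in> W \<Longrightarrow> walk E (t s) w" "s \<in> S"
  shows "Th S t f s = (\<Oplus>w\<in>W. f (Mo s w) \<odot> yw (t s) w)"
proof -
  have "(\<Oplus>w\<in>{w. f (Mo s w) \<noteq> 0}. f (Mo s w) \<odot> yw (t s) w) = (\<Oplus>w\<in>W. f (Mo s w) \<odot> yw (t s) w)"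
    by (rule add.finprod_mono_neutral_cong_left) (use assms in \<open>auto simp: ksmult_zero_left intro!: smult_closed\<close>)
  then show ?thesis using assms(5) by (simp add: Th_def)
qed

lemma Th_closed:
  assumes t: "t ` S \<subseteq> verts E" and f: "f \<in> F E S t"
  shows "Th S t f \<in> carrier (Hm S t)"
  unfolding Hm_carrier
proof (intro conjI ballI)
  show "Th S t f \<in> extensional S" by (simp add: Th_def)
  fix s assume s: "s \<in> S"
  have ts: "t s \<in> verts E" using s t by auto
  have c: "f (Mo s w) \<odot> yw (t s) w \<in> carrier R" if "f (Mo s w) \<noteq> 0" for w
    using F_supp(2)[OF f that] by (auto intro!: smult_closed)
  show "Th S t f s \<in> carrier R" using s c by (auto simp: Th_def intro!: finsum_closed)
  have "(\<Oplus>w\<in>{w. f (Mo s w) \<noteq> 0}. f (Mo s w) \<odot> yw (t s) w) \<otimes> P (t s) =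
    (\<Oplus>w\<in>{w. f (Mo s w) \<noteq> 0}. (f (Mo s w) \<odot> yw (t s) w) \<otimes> P (t s))"
    using s t c by (intro finsum_ldistr F_supp(1)[OF f]) auto
  also have "\<dots> = (\<Oplus>w\<in>{w. f (Mo s w) \<noteq> 0}. f (Mo s w) \<odot> yw (t s) w)"
    using F_supp(2)[OF f] s ts c by (intro finsum_cong') (auto simp: smult_mult_left yw_P)
  finally show "Th S t f s \<otimes> P (t s) = Th S t f s" using s by (simp add: Th_def)
next
  have *: "{s \<in> S. Th S t f s \<noteq> \<zero>} \<subseteq> idx ` {m. f m \<noteq> 0}"
  proof
    fix s assume s: "s \<in> {s \<in> S. Th S t f s \<noteq> \<zero>}"
    have "{w. f (Mo s w) \<noteq> 0} \<noteq> {}"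
    proof
      assume "{w. f (Mo s w) \<noteq> 0} = {}"
      then have "Th S t f s = \<zero>" using s by (simp only: Th_def restrict_apply' mem_Collect_eq
          finsum_empty)
      then show False using s by simp
    qed
    then obtain w where "f (Mo s w) \<noteq> 0" by blast
    then show "s \<in> idx ` {m. f m \<noteq> 0}" by (intro image_eqI[of _ _ "Mo s w"]) auto
  qed
  show "finite {s \<in> S. Th S t f s \<noteq> \<zero>}"
    by (rule finite_subset[OF *]) (use f in \<open>simp add: F_def\<close>)
qed

lemma Th_add:
  assumes "f \<in> F E S t" "g \<in> F E S t"
  shows "Th S t (f + g) = Th S t f \<oplus>\<^bsub>Hm S t\<^esub> Th S t g"
proof
  fix s
  show "Th S t (f + g) s = (Th S t f \<oplus>\<^bsub>Hm S t\<^esub> Th S t g) s"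
  proof (cases "s \<in> S")
    case True
    let ?W = "{w. f (Mo s w) \<noteq> 0} \<union> {w. g (Mo s w) \<noteq> 0}"
    have W: "finite ?W" "\<And>w. w \<in> ?W \<Longrightarrow> walk E (t s) w"
      using F_supp[OF assms(1)] F_supp[OF assms(2)] by auto
    have "Th S t (f + g) s = (\<Oplus>w\<in>?W. (f + g) (Mo s w) \<odot> yw (t s) w)"
      using W True by (intro Th_superset F_add assms) auto
    also have "\<dots> = (\<Oplus>w\<in>?W. f (Mo s w) \<odot> yw (t s) w \<oplus> g (Mo s w) \<odot> yw (t s) w)"
      using W by (intro finsum_cong') (auto simp: smult_l_distr intro!: smult_closed a_closed)
    also have "\<dots> = (\<Oplus>w\<in>?W. f (Mo s w) \<odot> yw (t s) w) \<oplus> (\<Oplus>w\<in>?W. g (Mo s w) \<odot> yw (t s) w)"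
      using W by (intro finsum_addf) (auto intro!: smult_closed)
    also have "\<dots> = Th S t f s \<oplus> Th S t g s"
      using W True assms by (subst (1 2) Th_superset[of _ S t ?W]) auto
    finally show ?thesis using True by simp
  qed (simp add: Th_def)
qed

lemma Th_fsc:
  assumes "f \<in> F E S t"
  shows "Th S t (fsc c f) = scal c \<odot>\<^bsub>Hm S t\<^esub> Th S t f"
proof
  fix s
  show "Th S t (fsc c f) s = (scal c \<odot>\<^bsub>Hm S t\<^esub> Th S t f) s"
  proof (cases "s \<in> S")
    case True
    let ?W = "{w. f (Mo s w) \<noteq> 0}"
    have W: "finite ?W" "\<And>w. w \<in> ?W \<Longrightarrow> walk E (t s) w"
      using F_supp[OF assms] by auto
    have "Th S t (fsc c f) s = (\<Oplus>w\<in>?W. fsc c f (Mo s w) \<odot> yw (t s) w)"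
      using W True by (intro Th_superset F_fsc assms) auto
    also have "\<dots> = (\<Oplus>w\<in>?W. scal c \<otimes> (f (Mo s w) \<odot> yw (t s) w))"
      using W by (intro finsum_cong') (auto simp: smult_assoc scal_mult smult_closed)
    also have "\<dots> = scal c \<otimes> (\<Oplus>w\<in>?W. f (Mo s w) \<odot> yw (t s) w)"
      using W by (intro finsum_rdistr[symmetric]) (auto intro!: smult_closed)
    finally show ?thesis using True by (simp add: Th_def)
  qed (simp add: Th_def)
qed

lemma Th_delta:
  assumes "m \<in> Mon E S t"
  shows "Th S t (delta m) = single S (idx m) (yw (t (idx m)) (word m))"
proof
  fix s
  have w: "walk E (t (idx m)) (word m)" using assms by (simp add: Mon_def)
  show "Th S t (delta m) s = single S (idx m) (yw (t (idx m)) (word m)) s"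
  proof (cases "s \<in> S")
    case True
    show ?thesis
    proof (cases "s = idx m")
      case True
      have "{w. (delta m :: _ \<Rightarrow> 'k) (Mo s w) \<noteq> 0} = {word m}" using True
          by (auto simp: delta_def mon.expand dest: arg_cong[of _ _ word])
      then show ?thesis using True \<open>s \<in> S\<close> w by (simp add: Th_def single_def delta_def smult_one mon.expand)
    next
      case False
      then have "{w. (delta m :: _ \<Rightarrow> 'k) (Mo s w) \<noteq> 0} = {}" by (auto simp: delta_def)
      then show ?thesis using False \<open>s \<in> S\<close> by (simp add: Th_def single_def)
    qed
  qed (simp add: Th_def single_def)
qed

lemma Th_0: "Th S t 0 = \<zero>\<^bsub>Hm S t\<^esub>"
  by (simp add: Th_def fun_eq_iff)

text \<open>One induction for the actions of \<open>y\<^sub>e\<close> and \<open>p\<^sub>v\<close>: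
  both are linear operations that agree with left multiplication by \<open>a\<close> on monomials.
  It extends to linear combinations because scalars are central, even though \<open>R\<close> need
  not be commutative.\<close>

lemma Th_op:
  assumes t: "t ` S \<subseteq> verts E" and f: "f \<in> F E S t" and a: "a \<in> carrier R"
    and add: "\<And>f g. \<phi> (f + g) = \<phi> f + \<phi> g" and fsc: "\<And>c f. \<phi> (fsc c f) = fsc c (\<phi> f)"
    and mem: "\<And>f. f \<in> F E S t \<Longrightarrow> \<phi> f \<in> F E S t"
    and delta: "\<And>m. m \<in> Mon E S t \<Longrightarrow> Th S t (\<phi> (delta m)) = a \<odot>\<^bsub>Hm S t\<^esub> Th S t (delta m)"
  shows "Th S t (\<phi> f) = a \<odot>\<^bsub>Hm S t\<^esub> Th S t f"
proof -
  interpret H: left_module R "Hm S t" by (rule left_module_Hm[OF t])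
  note [simp del] = Hm_simps
  show ?thesis
    using f
  proof (induction rule: F_induct)
    case zero
    have "\<phi> 0 + \<phi> 0 = \<phi> 0" using add[of 0 0] by simp
    then have "\<phi> 0 = 0" by simp
    then show ?case by (simp only: Th_0 H.smult_zero_right[OF a])
  next
    case (step f c m)
    have d: "delta m \<in> F E S t" using step by (intro F_delta)
    have "Th S t (\<phi> (f + fsc c (delta m))) =
        a \<odot>\<^bsub>Hm S t\<^esub> Th S t f \<oplus>\<^bsub>Hm S t\<^esub> scal c \<odot>\<^bsub>Hm S t\<^esub> (a \<odot>\<^bsub>Hm S t\<^esub> Th S t (delta m))"
      by (simp only: add fsc Th_add[OF mem[OF step(1)] F_fsc[OF mem[OF d]]] Th_fsc[OF mem[OF d]]
          step.IH delta[OF step(2)])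
    also have "scal c \<odot>\<^bsub>Hm S t\<^esub> (a \<odot>\<^bsub>Hm S t\<^esub> Th S t (delta m)) =
        a \<odot>\<^bsub>Hm S t\<^esub> (scal c \<odot>\<^bsub>Hm S t\<^esub> Th S t (delta m))"
      using H.smult_assoc[OF scal_carrier a Th_closed[OF t d]] H.smult_assoc[OF a scal_carrier
          Th_closed[OF t d]]
      by (simp add: a scal_mult mult_scal)
    also have "a \<odot>\<^bsub>Hm S t\<^esub> Th S t f \<oplus>\<^bsub>Hm S t\<^esub> \<dots> =
        a \<odot>\<^bsub>Hm S t\<^esub> (Th S t f \<oplus>\<^bsub>Hm S t\<^esub> scal c \<odot>\<^bsub>Hm S t\<^esub> Th S t (delta m))"
      using H.smult_r_distr[OF a Th_closed[OF t step(1)] H.smult_closed[OF scal_carrier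
          Th_closed[OF t d]]] by simp
    also have "Th S t f \<oplus>\<^bsub>Hm S t\<^esub> scal c \<odot>\<^bsub>Hm S t\<^esub> Th S t (delta m) = Th S t (f + fsc c (delta m))"
      by (simp only: Th_add[OF step(1) F_fsc[OF d]] Th_fsc[OF d])
    finally show ?case .
  qed
qed

lemma Th_fy:
  assumes t: "t ` S \<subseteq> verts E" and f: "f \<in> F E S t" and e: "e \<in> arcs E"
  shows "Th S t (fy E t e f) = Y e \<odot>\<^bsub>Hm S t\<^esub> Th S t f"
proof (rule Th_op[OF t f])
  fix m assume m: "m \<in> Mon E S t"
  then have w: "walk E (t (idx m)) (word m)" "idx m \<in> S" by (auto simp: Mon_def)
  show "Th S t (fy E t e (delta m)) = Y e \<odot>\<^bsub>Hm S t\<^esub> Th S t (delta m)"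
  proof (cases "tail E e = vx E t m")
    case True
    then have "fy E t e (delta m) = (delta (Mo (idx m) (e # word m)) :: _ \<Rightarrow> 'k)"
      using fy_delta[of E e t "idx m" "word m"] by simp
    moreover have "Mo (idx m) (e # word m) \<in> Mon E S t" using True m e
        by (auto simp: Mon_def vx_def)
    ultimately show ?thesis using m w e by (simp add: Th_delta single_smult del: Hm_simps)
  next
    case False
    have "fy E t e (delta m) = (0 :: _ \<Rightarrow> 'k)"
    proof
      fix m'
      show "fy E t e (delta m) m' = (0 :: _ \<Rightarrow> 'k) m'"
        using fy_nonzero[of E t e "delta m :: _ \<Rightarrow> 'k" "idx m'" "word m'"] False
            by (auto simp: delta_def split: if_splits)
    qed
    then show ?thesis using m w e False Y_yw[OF w(1) e]
      by (simp add: Th_0 Th_delta single_smult vx_def del: Hm_simps) (auto simp: single_def)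
  qed
qed (use e in \<open>auto simp: fy_add fy_fsc F_fy simp del: plus_fun_apply fsc_apply\<close>)

lemma Th_fp:
  assumes t: "t ` S \<subseteq> verts E" and f: "f \<in> F E S t" and v: "v \<in> verts E"
  shows "Th S t (fp E t v f) = P v \<odot>\<^bsub>Hm S t\<^esub> Th S t f"
proof (rule Th_op[OF t f])
  fix m assume m: "m \<in> Mon E S t"
  then have w: "walk E (t (idx m)) (word m)" "idx m \<in> S" by (auto simp: Mon_def)
  show "Th S t (fp E t v (delta m)) = P v \<odot>\<^bsub>Hm S t\<^esub> Th S t (delta m)"
    using m w v by (simp add: fp_delta Th_delta Th_0 single_smult P_yw vx_def del: Hm_simps) (auto
        simp: single_def)
qed (use v in \<open>auto simp: fp_add fp_fsc F_fp simp del: plus_fun_apply fsc_apply\<close>)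

text \<open>\<open>fsub\<close> and \<open>flin\<close> quantify over all \<open>v\<close>, while
  \<open>P v\<close> is controlled at vertices only; this settles the remaining values.\<close>

lemma fp_outside:
  assumes f: "f \<in> F E S t" and v: "v \<notin> verts E"
  shows "fp E t v f = 0"
proof
  fix m
  show "fp E t v f m = 0 m"
  proof (cases "f m = 0")
    case False
    then have "m \<in> Mon E S t" using f by (auto simp: F_def)
    then have "vx E t m \<in> verts E" by (auto simp: Mon_def vx_def)
    then show ?thesis using v by (auto simp: fp_def)
  qed (simp add: fp_def)
qed

text \<open>In each coordinate the path words starting at \<open>t s\<close> are linearly
  independent by \<open>indep\<close>; the difference of two elements is written with the scalar
  \<open>-1\<close>.\<close>

lemma Th_inj:
  assumes t: "t ` S \<subseteq> verts E" and f: "f \<in> F E S t" "g \<in> F E S t" and eq: "Th S t f = Th S t g"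
  shows "f = g"
proof -
  interpret H: left_module R "Hm S t" by (rule left_module_Hm[OF t])
  have ker: "h = 0" if h: "h \<in> F E S t" "Th S t h = \<zero>\<^bsub>Hm S t\<^esub>" for h
  proof
    fix m
    show "h m = 0 m"
    proof (rule ccontr)
      assume "h m \<noteq> 0 m"
      then have m: "h (Mo (idx m) (word m)) \<noteq> 0" by simp
      have s: "idx m \<in> S" using F_supp(2)[OF h(1) m] by simp
      have "(\<Oplus>w\<in>{w. h (Mo (idx m) w) \<noteq> 0}. h (Mo (idx m) w) \<odot> foldr (\<lambda>e a. Y e \<otimes>
          a) w (P (t (idx m)))) = \<zero>"
        using fun_cong[OF h(2), of "idx m"] s by (simp add: Th_def yw_def)
      from indep[OF _ _ _ this, of "word m"] show False
        using m s t F_supp[OF h(1)] by blast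
    qed
  qed
  have g': "fsc (-1) g \<in> F E S t" using f by (intro F_fsc)
  have "Th S t (f + fsc (-1) g) = Th S t g \<oplus>\<^bsub>Hm S t\<^esub> scal (-1) \<odot>\<^bsub>Hm S t\<^esub> Th S t g"
    by (simp only: Th_add[OF f(1) g'] Th_fsc[OF f(2)] eq)
  also have "\<dots> = Th S t (g + fsc (-1) g)"
    by (simp only: Th_add[OF f(2) g'] Th_fsc[OF f(2)])
  also have "g + fsc (-1) g = 0" by (auto simp: fun_eq_iff)
  finally have "f + fsc (-1) g = 0" by (intro ker F_add f g') (simp only: Th_0)
  then have "f m + (- 1) * g m = 0" for m by (metis fsc_apply plus_fun_apply zero_fun_apply)
  then show ?thesis by (auto simp: fun_eq_iff)
qed

text \<open>Left multiplication by a deep path moves every element of \<open>I\<close> into the path algebra.\<close>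

lemma deep_snoc_iff: "deep E (Suc n) v (w @ [e]) \<Longrightarrow> deep E n (head E e) w"
  by (auto simp: deep_def E.walk_snoc end_of_append)

text \<open>One level \<open>n\<close> serves all starting vertices. In the construction of good
  elements it grows only when a letter \<open>x\<close> has to be absorbed.\<close>

definition good :: "'s set \<Rightarrow> ('s \<Rightarrow> 'v) \<Rightarrow> nat \<Rightarrow> ('s \<Rightarrow> 'r) \<Rightarrow> bool" where
  "good S t n u \<longleftrightarrow> (\<forall>v w. deep E n v w \<longrightarrow> (\<exists>f\<in>F E S t. Th S t f = yw v w \<odot>\<^bsub>Hm S t\<^esub> u))"

lemma good_mono: "good S t n u \<Longrightarrow> n \<le> m \<Longrightarrow> good S t m u"
  by (auto simp: good_def dest: deep_mono)

lemma deep_walk: "deep E n v w \<Longrightarrow> walk E v w" by (simp add: deep_def)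

lemma good_add:
  assumes t: "t ` S \<subseteq> verts E" and u: "u \<in> carrier (Hm S t)" "u' \<in> carrier (Hm S t)"
    and good: "good S t n u" "good S t m u'"
  shows "good S t (max n m) (u \<oplus>\<^bsub>Hm S t\<^esub> u')"
  unfolding good_def
proof (intro allI impI)
  interpret H: left_module R "Hm S t" by (rule left_module_Hm[OF t])
  fix v w assume d: "deep E (max n m) v w"
  obtain f where f: "f \<in> F E S t" "Th S t f = yw v w \<odot>\<^bsub>Hm S t\<^esub> u"
    using good(1) deep_mono[OF d, of n] unfolding good_def by auto
  obtain g where g: "g \<in> F E S t" "Th S t g = yw v w \<odot>\<^bsub>Hm S t\<^esub> u'"
    using good(2) deep_mono[OF d, of m] unfolding good_def by auto
  have "Th S t (f + g) = yw v w \<odot>\<^bsub>Hm S t\<^esub> (u \<oplus>\<^bsub>Hm S t\<^esub> u')"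
    by (simp only: Th_add[OF f(1) g(1)] f(2) g(2) H.smult_r_distr[OF yw_carrier[OF deep_walk[OF d]]
        u])
  then show "\<exists>f\<in>F E S t. Th S t f = yw v w \<odot>\<^bsub>Hm S t\<^esub> (u \<oplus>\<^bsub>Hm S t\<^esub> u')"
    using F_add[OF f(1) g(1)] by blast
qed

lemma good_zero:
  assumes t: "t ` S \<subseteq> verts E"
  shows "good S t n \<zero>\<^bsub>Hm S t\<^esub>"
  unfolding good_def
proof (intro allI impI)
  interpret H: left_module R "Hm S t" by (rule left_module_Hm[OF t])
  fix v w assume d: "deep E n v w"
  show "\<exists>f\<in>F E S t. Th S t f = yw v w \<odot>\<^bsub>Hm S t\<^esub> \<zero>\<^bsub>Hm S t\<^esub>"
    using F_0 Th_0 H.smult_zero_right[OF yw_carrier[OF deep_walk[OF d]]] by metis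
qed

text \<open>By induction over the ideal: a letter \<open>x\<close> costs one level, since it cancels
  against the adjacent \<open>y\<close> of a deep path or kills the product, while letters
  \<open>p\<close> and \<open>y\<close> cost nothing. The factor \<open>P (t s)\<close> makes an
  arbitrary element of \<open>I\<close> a legal coordinate.\<close>

lemma good_single:
  assumes t: "t ` S \<subseteq> verts E" and s: "s \<in> S" and a: "a \<in> I"
  shows "\<exists>n. good S t n (single S s (a \<otimes> P (t s)))"
proof -
  note [simp del] = Hm_simps
  have ts: "t s \<in> verts E" using s t by auto
  interpret H: left_module R "Hm S t" by (rule left_module_Hm[OF t])
  let ?s = "\<lambda>a. single S s (a \<otimes> P (t s))"
  have sc: "?s a \<in> carrier (Hm S t)" if "a \<in> carrier R" for a
    using that s t ts by (intro single_Hm) (auto simp: m_assoc PP)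
  have gs: "(\<exists>f\<in>F E S t. Th S t f = r \<odot>\<^bsub>Hm S t\<^esub> ?s a) \<longleftrightarrow> (\<exists>f\<in>F E S t. Th S t f = ?s (r \<otimes> a))"
    if "r \<in> carrier R" "a \<in> carrier R" for r a
    using that ts by (simp add: single_smult m_assoc)
  have good_s: "good S t n (?s a) \<longleftrightarrow> (\<forall>v w. deep E n v w \<longrightarrow> (\<exists>f\<in>F E S t. Th S t f = ?s (yw v w \<otimes> a)))"
    if "a \<in> carrier R" for n a
    unfolding good_def using gs[OF yw_carrier[OF deep_walk] that] by blast
  have z: "\<exists>f\<in>F E S t. Th S t f = ?s \<zero>"
  proof -
    have "?s \<zero> = \<zero>\<^bsub>Hm S t\<^esub>" using ts by (auto simp: single_def Hm_simps)
    then show ?thesis using F_0 Th_0 by metis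
  qed
  let ?J = "{a \<in> carrier R. \<exists>n. good S t n (?s a)}"
  have "a \<in> ?J"
    using a
  proof (rule I_induct)
    fix v assume v: "v \<in> verts E"
    have "good S t 0 (?s (P v))"
      unfolding good_s[OF P_carrier[OF v]]
    proof (intro allI impI)
      fix u w assume d: "deep E 0 u w"
      show "\<exists>f\<in>F E S t. Th S t f = ?s (yw u w \<otimes> P v)"
      proof (cases "u = v \<and> v = t s")
        case True
        then have "yw u w \<otimes> P v \<otimes> P (t s) = yw (t s) w" using deep_walk[OF d] ts
            by (simp add: yw_P m_assoc PP)
        moreover have "Mo s w \<in> Mon E S t" using True s deep_walk[OF d] by (simp add: Mon_def)
        ultimately show ?thesis using Th_delta[of "Mo s w" S t] F_delta by force
      next
        case False
        have "yw u w \<otimes> P v \<otimes> P (t s) = yw u w \<otimes> (P u \<otimes> (P v \<otimes> P (t s)))"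
          using deep_walk[OF d] v ts by (simp add: m_assoc[symmetric] yw_P)
        also have "\<dots> = \<zero>" using False deep_walk[OF d] v ts by (auto simp: PP)
        finally show ?thesis using z ts by simp
      qed
    qed
    then show "P v \<in> ?J" using v by auto
  next
    have "?s \<zero> = \<zero>\<^bsub>Hm S t\<^esub>" using ts by (auto simp: single_def Hm_simps)
    then show "\<zero> \<in> ?J" using good_zero[OF t, of 0] by auto
  next
    fix a b assume "a \<in> ?J" "b \<in> ?J"
    then obtain n m where ab: "a \<in> carrier R" "b \<in> carrier R" "good S t n (?s a)"
        "good S t m (?s b)" by blast
    have "?s (a \<oplus> b) = ?s a \<oplus>\<^bsub>Hm S t\<^esub> ?s b"
      using ab ts by (auto simp: single_def Hm_simps fun_eq_iff l_distr)
    then show "a \<oplus> b \<in> ?J" using good_add[OF t sc sc, of a b n m] ab by auto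
  next
    fix c a assume "a \<in> ?J"
    then obtain n where a: "a \<in> carrier R" "good S t n (?s a)" by blast
    have "good S t n (?s (c \<odot> a))"
      unfolding good_s[OF smult_closed[OF a(1)]]
    proof (intro allI impI)
      fix u w assume d: "deep E n u w"
      then obtain f where f: "f \<in> F E S t" "Th S t f = ?s (yw u w \<otimes> a)"
        using a(2) unfolding good_s[OF a(1)] by blast
      have "Th S t (fsc c f) = ?s (yw u w \<otimes> (c \<odot> a))"
        using a deep_walk[OF d] ts
        by (simp add: Th_fsc[OF f(1)] f(2) single_smult scal_mult smult_mult_left smult_mult_right
            smult_closed)
      then show "\<exists>f\<in>F E S t. Th S t f = ?s (yw u w \<otimes> (c \<odot> a))" using F_fsc[OF f(1)] by blast
    qed
    then show "c \<odot> a \<in> ?J" using a smult_closed by blast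
  next
    fix v a assume v: "v \<in> verts E" and "a \<in> ?J"
    then obtain n where a: "a \<in> carrier R" "good S t n (?s a)" by blast
    have "good S t n (?s (P v \<otimes> a))"
      unfolding good_s[OF m_closed[OF P_carrier[OF v] a(1)]]
    proof (intro allI impI)
      fix u w assume d: "deep E n u w"
      have "yw u w \<otimes> (P v \<otimes> a) = (yw u w \<otimes> (P u \<otimes> P v)) \<otimes> a"
        using deep_walk[OF d] v a by (simp add: m_assoc[symmetric] yw_P)
      then have "yw u w \<otimes> (P v \<otimes> a) = (if u = v then yw u w \<otimes> a else \<zero>)"
        using deep_walk[OF d] v a by (auto simp: PP yw_P)
      then show "\<exists>f\<in>F E S t. Th S t f = ?s (yw u w \<otimes> (P v \<otimes> a))"
        using a(2)[unfolded good_s[OF a(1)], rule_format, OF d] z by auto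
    qed
    then show "P v \<otimes> a \<in> ?J" using m_closed[OF P_carrier[OF v] a(1)] by blast
  next
    fix e a assume e: "e \<in> arcs E" and "a \<in> ?J"
    then obtain n where a: "a \<in> carrier R" "good S t n (?s a)" by blast
    \<comment> \<open>The additional level pays for the first edge of the path, which is the one
      that meets \<open>X e\<close>.\<close>
    have "good S t (Suc n) (?s (X e \<otimes> a))"
      unfolding good_s[OF m_closed[OF X_carrier[OF e] a(1)]]
    proof (intro allI impI)
      fix u w assume d: "deep E (Suc n) u w"
      show "\<exists>f\<in>F E S t. Th S t f = ?s (yw u w \<otimes> (X e \<otimes> a))"
      proof (cases w rule: rev_cases)
        case Nil
        \<comment> \<open>The empty path has depth at least one only at a sink, and a sink is not
          the tail of \<open>e\<close>.\<close>
        then have "out_arcs E u = {}" "u \<in> verts E" using d by (auto simp: deep_def)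
        then have "u \<noteq> tail E e" using e by auto
        then have "yw u w \<otimes> (X e \<otimes> a) = \<zero>"
          using Nil e a \<open>u \<in> verts E\<close> by (simp add: m_assoc[symmetric] PX')
        then show ?thesis using z by simp
      next
        case (snoc w' e')
        have wk: "walk E u (w' @ [e'])" using deep_walk[OF d] snoc by simp
        then have e': "e' \<in> arcs E" "walk E (head E e') w'" by (auto simp: E.walk_snoc)
        have "yw u w \<otimes> (X e \<otimes> a) = yw (head E e') w' \<otimes> ((Y e' \<otimes> X e) \<otimes> a)"
          unfolding snoc yw_snoc[OF wk] using e e' a by (simp add: m_assoc)
        also have "\<dots> = (if e' = e then yw (head E e') w' \<otimes> a else \<zero>)"
          using e e' a by (auto simp: YX m_assoc[symmetric] yw_P)
        finally show ?thesis
          using a(2) z deep_snoc_iff[of n u w' e'] d unfolding good_s[OF a(1)] snoc by auto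
      qed
    qed
    then show "X e \<otimes> a \<in> ?J" using m_closed[OF X_carrier[OF e] a(1)] by blast
  next
    fix e a assume e: "e \<in> arcs E" and "a \<in> ?J"
    then obtain n where a: "a \<in> carrier R" "good S t n (?s a)" by blast
    \<comment> \<open>\<open>Y e\<close> prolongs the path at its start, which makes it deeper, so
      the level stays.\<close>
    have "good S t n (?s (Y e \<otimes> a))"
      unfolding good_s[OF m_closed[OF Y_carrier[OF e] a(1)]]
    proof (intro allI impI)
      fix u w assume d: "deep E n u w"
      show "\<exists>f\<in>F E S t. Th S t f = ?s (yw u w \<otimes> (Y e \<otimes> a))"
      proof (cases "u = head E e")
        case True
        then have d': "deep E (Suc n) (tail E e) (w @ [e])"
            using E.deep_snoc[OF e HOL.refl, of n w] d by simp
        then have "yw u w \<otimes> (Y e \<otimes> a) = yw (tail E e) (w @ [e]) \<otimes> a"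
          using deep_walk[OF d'] deep_walk[OF d] a e True by (simp add: yw_snoc m_assoc)
        then show ?thesis using a(2) deep_mono[OF d', of n] unfolding good_s[OF a(1)] by auto
      next
        case False
        have "yw u w \<otimes> (Y e \<otimes> a) = yw u w \<otimes> ((P u \<otimes> Y e) \<otimes> a)"
          using deep_walk[OF d] a e by (simp add: m_assoc[symmetric] yw_P)
        also have "\<dots> = \<zero>" using False deep_walk[OF d] a e by (simp add: PY')
        finally show ?thesis using z by simp
      qed
    qed
    then show "Y e \<otimes> a \<in> ?J" using m_closed[OF Y_carrier[OF e] a(1)] by blast
  qed
  then show ?thesis by blast
qed

lemma ex_good:
  assumes t: "t ` S \<subseteq> verts E" and u: "u \<in> carrier (Hm S t)"
  shows "\<exists>n. good S t n u"
  using t u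
proof (induction rule: Hm_induct)
  case zero
  then show ?case using good_zero[OF t] by blast
next
  case (step u s a)
  have "a \<in> I" using step t P_I ideal.I_l_closed[OF ideal, of "P (t s)" a] by auto
  with good_single[OF t step(2)] step obtain n m where "good S t n u" "good S t m (single S s a)"
      by metis
  moreover have "single S s a \<in> carrier (Hm S t)" using step t by (intro single_Hm) auto
  ultimately show ?case using good_add[OF t step(1)] by blast
qed

text \<open>The way back from deep multiples: \<open>p\<^sub>v = \<Sum> x\<^sub>e y\<^sub>e\<close>
  undoes one level of left multiplication, and at a sink the empty path is already deep.\<close>

lemma deep_induct:
  assumes M: "left_module R M" and W: "submodule W R M"
    and m: "m \<in> carrier M" and v: "v \<in> verts E" and d: "\<And>w. deep E n v w \<Longrightarrow> yw v w \<odot>\<^bsub>M\<^esub> m \<in> W"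
  shows "P v \<odot>\<^bsub>M\<^esub> m \<in> W"
  using m v d
proof (induction n arbitrary: v m)
  case 0
  then show ?case using "0.prems"(3)[of "[]"] by (simp add: deep_def)
next
  case (Suc n)
  interpret M: left_module R M by (rule M)
  show ?case
  proof (cases "out_arcs E v = {}")
    case True
    then show ?thesis using Suc.prems(2) Suc.prems(3)[of "[]"] by (simp add: deep_def)
  next
    case False
    let ?J = "{a \<in> carrier R. a \<odot>\<^bsub>M\<^esub> m \<in> W}"
    have "(\<Oplus>e\<in>out_arcs E v. X e \<otimes> Y e) \<in> ?J"
    proof (rule finsum_mem)
      show "finite (out_arcs E v)" using rf Suc.prems(2) by (simp add: row_finite_def)
      fix e assume "e \<in> out_arcs E v"
      then have e: "e \<in> arcs E" "tail E e = v" by auto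
      have "P (head E e) \<odot>\<^bsub>M\<^esub> (Y e \<odot>\<^bsub>M\<^esub> m) \<in> W"
      proof (rule Suc.IH)
        show "Y e \<odot>\<^bsub>M\<^esub> m \<in> carrier M" using e Suc.prems by (simp add: M.smult_closed)
        show "yw (head E e) w \<odot>\<^bsub>M\<^esub> (Y e \<odot>\<^bsub>M\<^esub> m) \<in> W" if "deep E n (head E e) w" for w
        proof -
          have d: "deep E (Suc n) v (w @ [e])" using E.deep_snoc[OF e that] .
          show ?thesis using Suc.prems(3)[OF d] yw_snoc[OF deep_walk[OF d]] e that Suc.prems(1)
            by (simp add: M.smult_assoc[symmetric] deep_walk)
        qed
      qed (use e in simp)
      then have "Y e \<odot>\<^bsub>M\<^esub> m \<in> W" using e Suc.prems(1) by (simp add: M.smult_assoc[symmetric] PY)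
      then have "X e \<odot>\<^bsub>M\<^esub> (Y e \<odot>\<^bsub>M\<^esub> m) \<in> W" using W e by (simp add: M.submodule_iff)
      then show "X e \<otimes> Y e \<in> ?J" using e Suc.prems(1) by (simp add: M.smult_assoc)
    qed (use W Suc.prems(1) in \<open>auto simp: M.submodule_iff M.smult_zero_left M.smult_l_distr\<close>)
    then show ?thesis using sum_XY[OF Suc.prems(2) False] by simp
  qed
qed

end

text \<open>Each generator is the root of one tree. \<open>cutset\<close> is applied to all trees
  with the same depth, and the cut sets are disjoint because a monomial remembers its
  generator.\<close>

lemma (in wf_digraph) cutset_forest:
  assumes rf: "row_finite G" and T: "finite T" "t ` T \<subseteq> verts G" and U: "U \<subseteq> Mon G T t"
    and deep: "\<And>i w. i \<in> T \<Longrightarrow> deep G n (t i) w \<Longrightarrow> Mo i w \<in> U"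
    and S: "S = {m \<in> U. \<forall>w1 w2. word m = w1 @ w2 \<longrightarrow> w1 \<noteq> [] \<longrightarrow> Mo (idx m) w2 \<notin> U}"
  shows "finite S \<and> gmeq G (type_of T t) (type_of S (vx G t))"
proof -
  define M where "M i = {w. walk G (t i) w \<and> Mo i w \<in> U \<and>
    (\<forall>w1 w2. w = w1 @ w2 \<longrightarrow> w1 \<noteq> [] \<longrightarrow> Mo i w2 \<notin> U)}" for i
  have M: "finite (M i) \<and> gmeq G {#t i#} (type_of (M i) (end_of G (t i)))" if "i \<in> T" for i
    by (rule cutset[OF rf, of "t i" n "\<lambda>w. Mo i w \<in> U"]) (use that T deep in \<open>auto simp: M_def\<close>)
  have S_eq: "S = (\<Union>i\<in>T. Mo i ` M i)"
  proof (intro Set.set_eqI iffI)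
    fix m assume "m \<in> S"
    moreover from this have "idx m \<in> T" "walk G (t (idx m)) (word m)" using U S
        by (auto simp: Mon_def)
    ultimately have "word m \<in> M (idx m)" unfolding S M_def by auto
    then show "m \<in> (\<Union>i\<in>T. Mo i ` M i)" using \<open>idx m \<in> T\<close> by (intro UN_I[of "idx m"] image_eqI[of _ _ "word m"]) auto
  next
    fix m assume "m \<in> (\<Union>i\<in>T. Mo i ` M i)"
    then show "m \<in> S" unfolding S M_def by auto
  qed
  have "type_of S (vx G t) = (\<Sum>i\<in>T. type_of (Mo i ` M i) (vx G t))"
    unfolding S_eq type_of_def using T M by (intro sum.UNION_disjoint) auto
  also have "\<dots> = (\<Sum>i\<in>T. type_of (M i) (end_of G (t i)))"
  proof (rule sum.cong[OF HOL.refl])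
    fix i
    show "type_of (Mo i ` M i) (vx G t) = type_of (M i) (end_of G (t i))"
      by (subst type_of_reindex) (simp_all add: inj_on_def comp_def vx_def)
  qed
  finally have "type_of S (vx G t) = \<dots>" .
  moreover have "gmeq G (\<Sum>i\<in>T. {#t i#}) (\<Sum>i\<in>T. type_of (M i) (end_of G (t i)))"
    using M by (intro meq_sum_set) auto
  ultimately show ?thesis using M T unfolding S_eq by (simp add: type_of_def)
qed

section \<open>Local units, bases of lattices and heredity\<close>

context graph_alg
begin

interpretation E: wf_digraph E by (rule wf)

lemma Hm_gen:
  assumes t: "t ` S \<subseteq> verts E" and W: "submodule W R (Hm S t)"
    and P: "\<And>s. s \<in> S \<Longrightarrow> single S s (P (t s)) \<in> W"
  shows "W = carrier (Hm S t)"
proof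
  interpret H: left_module R "Hm S t" by (rule left_module_Hm[OF t])
  show "W \<subseteq> carrier (Hm S t)" using W by (simp add: H.submodule_iff)
  show "carrier (Hm S t) \<subseteq> W"
  proof
    fix u assume "u \<in> carrier (Hm S t)"
    with t show "u \<in> W"
    proof (induction rule: Hm_induct)
      case zero
      show ?case using W unfolding H.submodule_iff by blast
    next
      case (step u s a)
      have "P (t s) \<in> carrier R" using step t by auto
      then have "single S s a = a \<odot>\<^bsub>Hm S t\<^esub> single S s (P (t s))"
        using step by (simp add: single_smult del: Hm_simps)
      then show ?case using W step P unfolding H.submodule_iff by metis
    qed
  qed
qed

lemma single_P_Hm: "t ` S \<subseteq> verts E \<Longrightarrow> s \<in> S \<Longrightarrow> single S s (P (t s)) \<in> carrier (Hm S t)"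
  by (intro single_Hm) (auto simp: PP)

lemma Th_delta_Nil: "t ` S \<subseteq> verts E \<Longrightarrow> s \<in> S \<Longrightarrow> Th S t (delta (Mo s [])) = single S s (P (t s))"
  by (subst Th_delta) (auto simp: Mon_def)

lemma delta_Nil_F: "t ` S \<subseteq> verts E \<Longrightarrow> s \<in> S \<Longrightarrow> delta (Mo s []) \<in> F E S t"
  by (intro F_delta) (auto simp: Mon_def)

text \<open>The ideal has local units: each generator \<open>p\<close>, \<open>x\<close> or
  \<open>y\<close> is fixed from the left by the \<open>P\<close> of one vertex, and such units pass
  to finite sums.\<close>

lemma ex_left_unit:
  assumes "finite A" "A \<subseteq> I"
  shows "\<exists>V\<subseteq>verts E. finite V \<and> (\<forall>a\<in>A. (\<Oplus>v\<in>V. P v) \<otimes> a = a)"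
proof -
  have Pc: "V \<subseteq> verts E \<Longrightarrow> P \<in> V \<rightarrow> carrier R" for V by auto
  have unit: "(\<Oplus>v\<in>V. P v) \<otimes> P u = P u" if "u \<in> V" "V \<subseteq> verts E" "finite V" for u V
  proof -
    have "(\<Oplus>v\<in>V. P v) \<otimes> P u = (\<Oplus>v\<in>V. P v \<otimes> P u)" using that by (intro finsum_ldistr Pc) auto
    also have "\<dots> = (\<Oplus>v\<in>V. if u = v then P v else \<zero>)" using that
        by (intro finsum_cong') (auto simp: PP subset_iff)
    also have "\<dots> = P u" using that Pc by (intro add.finprod_singleton) auto
    finally show ?thesis .
  qed
  have Vc: "(\<Oplus>v\<in>V. P v) \<in> carrier R" if "V \<subseteq> verts E" for V using Pc[OF that]
      by (rule finsum_closed)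
  have unit': "(\<Oplus>v\<in>V. P v) \<otimes> (b \<otimes> a) = b \<otimes> a"
    if "u \<in> V" "V \<subseteq> verts E" "finite V" "P u \<otimes> b = b" "a \<in> carrier R" "b \<in> carrier R" for u V a b
  proof -
    have u: "P u \<in> carrier R" using that by auto
    have "(\<Oplus>v\<in>V. P v) \<otimes> b = b" using unit[OF that(1-3)] Vc[OF that(2)] m_assoc[of "\<Oplus>v\<in>V. P v" "P u"
        b] u that by simp
    then show ?thesis using Vc[OF that(2)] that m_assoc[of "\<Oplus>v\<in>V. P v" b a] by simp
  qed
  \<comment> \<open>Asking for the identity at all larger finite sets makes it stable when
    \<open>V\<close> grows, as sums and finite sets \<open>A\<close> require.\<close>
  define ok where "ok V a \<longleftrightarrow> (\<forall>V'. V \<subseteq> V' \<longrightarrow> V' \<subseteq> verts E \<longrightarrow> finite V' \<longrightarrow> (\<Oplus>v\<in>V'. P v) \<otimes> a = a)" for V a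
  have all: "a \<in> {a \<in> carrier R. \<exists>V\<subseteq>verts E. finite V \<and> ok V a}" if "a \<in> I" for a
    using that
  proof (rule I_induct)
    fix v assume "v \<in> verts E"
    then show "P v \<in> {a \<in> carrier R. \<exists>V\<subseteq>verts E. finite V \<and> ok V a}"
      using unit by (auto simp: ok_def intro!: exI[of _ "{v}"])
  next
    show "\<zero> \<in> {a \<in> carrier R. \<exists>V\<subseteq>verts E. finite V \<and> ok V a}"
      using Vc by (auto simp: ok_def intro!: exI[of _ "{}"])
  next
    fix a b assume "a \<in> {a \<in> carrier R. \<exists>V\<subseteq>verts E. finite V \<and> ok V a}"
      "b \<in> {a \<in> carrier R. \<exists>V\<subseteq>verts E. finite V \<and> ok V a}"
    then obtain V V' where V: "a \<in> carrier R" "b \<in> carrier R" "V \<subseteq> verts E" "finite V" "ok V a"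
        "V' \<subseteq> verts E" "finite V'" "ok V' b" by blast
    have "ok (V \<union> V') (a \<oplus> b)"
    unfolding ok_def
    proof (intro allI impI)
      fix W assume W: "V \<union> V' \<subseteq> W" "W \<subseteq> verts E" "finite W"
      have "(\<Oplus>v\<in>W. P v) \<otimes> a = a" by (rule V(5)[unfolded ok_def, rule_format, OF _ W(2,3)]) (use W(1)
          in blast)
      moreover have "(\<Oplus>v\<in>W. P v) \<otimes> b = b" by (rule V(8)[unfolded ok_def, rule_format, OF _ W(2,3)])
          (use W(1) in blast)
      ultimately show "(\<Oplus>v\<in>W. P v) \<otimes> (a \<oplus> b) = a \<oplus> b"
        by (simp add: r_distr Vc[OF W(2)] V(1,2))
    qed
    with V show "a \<oplus> b \<in> {a \<in> carrier R. \<exists>V\<subseteq>verts E. finite V \<and> ok V a}"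
      by (intro CollectI conjI exI[of _ "V \<union> V'"]) auto
  next
    fix c a assume "a \<in> {a \<in> carrier R. \<exists>V\<subseteq>verts E. finite V \<and> ok V a}"
    then obtain V where V: "a \<in> carrier R" "V \<subseteq> verts E" "finite V" "ok V a" by blast
    have "ok V (c \<odot> a)" using V Vc by (auto simp: ok_def smult_mult_right)
    with V smult_closed show "c \<odot> a \<in> {a \<in> carrier R. \<exists>V\<subseteq>verts E. finite V \<and> ok V a}" by blast
  next
    fix v a assume v: "v \<in> verts E" and "a \<in> {a \<in> carrier R. \<exists>V\<subseteq>verts E. finite V \<and> ok V a}"
    then have "a \<in> carrier R" by blast
    then have "ok {v} (P v \<otimes> a)" using unit'[of v _ "P v" a] v by (auto simp: ok_def PP)
    with \<open>a \<in> carrier R\<close> v show "P v \<otimes> a \<in> {a \<in> carrier R. \<exists>V\<subseteq>verts E. finite V \<and> ok V a}"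
      by (intro CollectI conjI exI[of _ "{v}"]) auto
  next
    fix e a assume e: "e \<in> arcs E" and "a \<in> {a \<in> carrier R. \<exists>V\<subseteq>verts E. finite V \<and> ok V a}"
    then have "a \<in> carrier R" by blast
    then have "ok {tail E e} (X e \<otimes> a)" using unit'[of "tail E e" _ "X e" a] e
        by (auto simp: ok_def PX)
    with \<open>a \<in> carrier R\<close> e show "X e \<otimes> a \<in> {a \<in> carrier R. \<exists>V\<subseteq>verts E. finite V \<and> ok V a}"
      by (intro CollectI conjI exI[of _ "{tail E e}"]) auto
  next
    fix e a assume e: "e \<in> arcs E" and "a \<in> {a \<in> carrier R. \<exists>V\<subseteq>verts E. finite V \<and> ok V a}"
    then have "a \<in> carrier R" by blast
    then have "ok {head E e} (Y e \<otimes> a)" using unit'[of "head E e" _ "Y e" a] e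
        by (auto simp: ok_def PY)
    with \<open>a \<in> carrier R\<close> e show "Y e \<otimes> a \<in> {a \<in> carrier R. \<exists>V\<subseteq>verts E. finite V \<and> ok V a}"
      by (intro CollectI conjI exI[of _ "{head E e}"]) auto
  qed
  have "\<exists>V\<subseteq>verts E. finite V \<and> ok V a" if "a \<in> A" for a
    using all[OF subsetD[OF assms(2) that]] unfolding mem_Collect_eq by (rule conjunct2)
  then obtain V where V: "\<And>a. a \<in> A \<Longrightarrow> V a \<subseteq> verts E" "\<And>a. a \<in> A \<Longrightarrow> finite (V a)"
    "\<And>a. a \<in> A \<Longrightarrow> ok (V a) a" by metis
  show ?thesis
  proof (intro exI[of _ "\<Union>a\<in>A. V a"] conjI ballI)
    show sub: "(\<Union>a\<in>A. V a) \<subseteq> verts E" using V(1) by blast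
    show fin: "finite (\<Union>a\<in>A. V a)" using assms(1) V(2) by blast
    fix a assume a: "a \<in> A"
    show "(\<Oplus>v\<in>(\<Union>a\<in>A. V a). P v) \<otimes> a = a"
      by (rule V(3)[OF a, unfolded ok_def, rule_format, OF _ sub fin]) (use a in blast)
  qed
qed

text \<open>Right units are inherited under left multiplication by any ring element. Since
  \<open>I_induct\<close> builds elements by left multiplication, only the \<open>P v\<close> and
  sums need attention.\<close>

lemma ex_right_unit:
  assumes "a \<in> I"
  shows "\<exists>V\<subseteq>verts E. finite V \<and> a \<otimes> (\<Oplus>v\<in>V. P v) = a"
proof -
  have Pc: "V \<subseteq> verts E \<Longrightarrow> P \<in> V \<rightarrow> carrier R" for V by auto
  have Vc: "(\<Oplus>v\<in>V. P v) \<in> carrier R" if "V \<subseteq> verts E" for V using Pc[OF that]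
      by (rule finsum_closed)
  have unit: "P u \<otimes> (\<Oplus>v\<in>V. P v) = P u" if "u \<in> V" "V \<subseteq> verts E" "finite V" for u V
  proof -
    have "P u \<otimes> (\<Oplus>v\<in>V. P v) = (\<Oplus>v\<in>V. P u \<otimes> P v)" using that by (intro finsum_rdistr Pc) auto
    also have "\<dots> = (\<Oplus>v\<in>V. if u = v then P v else \<zero>)" using that
        by (intro finsum_cong') (auto simp: PP subset_iff)
    also have "\<dots> = P u" using that Pc by (intro add.finprod_singleton) auto
    finally show ?thesis .
  qed
  define ok where "ok V a \<longleftrightarrow> (\<forall>V'. V \<subseteq> V' \<longrightarrow> V' \<subseteq> verts E \<longrightarrow> finite V' \<longrightarrow> a \<otimes> (\<Oplus>v\<in>V'. P v) = a)" for V a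
  let ?J = "{a \<in> carrier R. \<exists>V\<subseteq>verts E. finite V \<and> ok V a}"
  have left: "b \<otimes> a \<in> ?J" if "b \<in> carrier R" "a \<in> ?J" for a b
  proof -
    obtain V where V: "a \<in> carrier R" "V \<subseteq> verts E" "finite V" "ok V a" using \<open>a \<in> ?J\<close> by blast
    have "ok V (b \<otimes> a)" using V Vc \<open>b \<in> carrier R\<close> by (auto simp: ok_def m_assoc)
    with V \<open>b \<in> carrier R\<close> show ?thesis by blast
  qed
  have "a \<in> ?J"
    using assms
  proof (rule I_induct)
    fix v assume "v \<in> verts E"
    then show "P v \<in> ?J" using unit by (auto simp: ok_def intro!: exI[of _ "{v}"])
  next
    show "\<zero> \<in> ?J" using Vc by (auto simp: ok_def intro!: exI[of _ "{}"])
  next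
    fix a b assume "a \<in> ?J" "b \<in> ?J"
    then obtain V V' where V: "a \<in> carrier R" "b \<in> carrier R" "V \<subseteq> verts E" "finite V" "ok V a"
        "V' \<subseteq> verts E" "finite V'" "ok V' b" by blast
    have "ok (V \<union> V') (a \<oplus> b)"
    unfolding ok_def
    proof (intro allI impI)
      fix W assume W: "V \<union> V' \<subseteq> W" "W \<subseteq> verts E" "finite W"
      have "a \<otimes> (\<Oplus>v\<in>W. P v) = a" by (rule V(5)[unfolded ok_def, rule_format, OF _ W(2,3)]) (use W(1)
          in blast)
      moreover have "b \<otimes> (\<Oplus>v\<in>W. P v) = b" by (rule V(8)[unfolded ok_def, rule_format, OF _ W(2,3)])
          (use W(1) in blast)
      ultimately show "(a \<oplus> b) \<otimes> (\<Oplus>v\<in>W. P v) = a \<oplus> b"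
        by (simp add: l_distr Vc[OF W(2)] V(1,2))
    qed
    with V show "a \<oplus> b \<in> ?J" by (intro CollectI conjI exI[of _ "V \<union> V'"]) auto
  next
    fix c a assume a: "a \<in> ?J"
    then have "c \<odot> a = scal c \<otimes> a" by (simp add: scal_mult)
    with left[OF scal_carrier a] show "c \<odot> a \<in> ?J" by simp
  qed (rule left, simp, assumption)+
  then show ?thesis unfolding ok_def by blast
qed

lemma Hm_I: "t ` S \<subseteq> verts E \<Longrightarrow> u \<in> carrier (Hm S t) \<Longrightarrow> s \<in> S \<Longrightarrow> u s \<in> I"
  using ideal.I_l_closed[OF ideal, of "P (t s)" "u s"] P_I[of "t s"] by (auto simp: Hm_carrier)

text \<open>\<open>deep_induct\<close> recovers the elements \<open>P v\<close> times
  \<open>u\<close>. Only finitely many coordinates of \<open>u\<close> are nonzero, so a local unit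
  reassembles \<open>u\<close> from finitely many of them.\<close>

lemma deep_Hm:
  assumes t: "t ` S \<subseteq> verts E" and W: "submodule W R (Hm S t)"
    and u: "u \<in> carrier (Hm S t)" and d: "\<And>v w. deep E n v w \<Longrightarrow> yw v w \<odot>\<^bsub>Hm S t\<^esub> u \<in> W"
  shows "u \<in> W"
proof -
  interpret H: left_module R "Hm S t" by (rule left_module_Hm[OF t])
  have Pu: "P v \<odot>\<^bsub>Hm S t\<^esub> u \<in> W" if "v \<in> verts E" for v
    by (rule deep_induct[OF left_module_Hm[OF t] W u that d])
  let ?A = "u ` {s \<in> S. u s \<noteq> \<zero>}"
  have "finite ?A" "?A \<subseteq> I" using u Hm_I[OF t u] by (auto simp: Hm_carrier)
  then obtain V where V: "V \<subseteq> verts E" "finite V" "\<forall>a\<in>?A. (\<Oplus>v\<in>V. P v) \<otimes> a = a"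
    using ex_left_unit[of ?A] by blast
  have c: "(\<Oplus>v\<in>V. P v) \<in> carrier R" using V by (intro finsum_closed) auto
  have "(\<Oplus>v\<in>V. P v) \<odot>\<^bsub>Hm S t\<^esub> u = u"
  proof
    fix s
    show "((\<Oplus>v\<in>V. P v) \<odot>\<^bsub>Hm S t\<^esub> u) s = u s"
      using V c u by (cases "s \<in> S \<and> u s \<noteq> \<zero>") (auto simp: Hm_carrier extensional_def)
  qed
  moreover have "(\<Oplus>v\<in>V. P v) \<in> {a \<in> carrier R. a \<odot>\<^bsub>Hm S t\<^esub> u \<in> W}"
  proof (rule finsum_mem[OF V(2)])
    show "P v \<in> {a \<in> carrier R. a \<odot>\<^bsub>Hm S t\<^esub> u \<in> W}" if "v \<in> V" for v
      by (intro CollectI conjI P_carrier Pu) (use that V(1) in blast)+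
    show "\<zero> \<in> {a \<in> carrier R. a \<odot>\<^bsub>Hm S t\<^esub> u \<in> W}"
      using W H.smult_zero_left[OF u] unfolding H.submodule_iff by (auto simp del: Hm_simps)
    show "a \<oplus> b \<in> {a \<in> carrier R. a \<odot>\<^bsub>Hm S t\<^esub> u \<in> W}"
      if "a \<in> {a \<in> carrier R. a \<odot>\<^bsub>Hm S t\<^esub> u \<in> W}" "b \<in> {a \<in> carrier R. a \<odot>\<^bsub>Hm S t\<^esub> u \<in> W}" for a b
      using that W H.smult_l_distr[of a b u] u unfolding H.submodule_iff
          by (auto simp del: Hm_simps)
  qed blast
  ultimately show ?thesis by simp
qed

lemma ex_hom:
  assumes "t ` S \<subseteq> verts E" "left_module R M" "\<And>s. s \<in> S \<Longrightarrow> b s \<in> carrier M"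
  shows "\<exists>f\<in>lmod_hom R (Hm S t) M. \<forall>s\<in>S. \<forall>a\<in>carrier R. a \<otimes> P (t s) = a \<longrightarrow>
    f (single S s a) = a \<odot>\<^bsub>M\<^esub> b s"
  by (rule ext_hom[OF assms]) blast+

text \<open>After the embedding \<open>\<beta> \<circ> Th S' t'\<close>, which is injective, the map
  \<open>\<Phi>\<close> becomes the restriction of an \<open>R\<close>-linear map; hence its
  compatibility with all operations can be checked there.\<close>

lemma hom_to_flin:
  fixes S :: "'a set" and S' :: "'b set"
  assumes t: "t ` S \<subseteq> verts E" "t' ` S' \<subseteq> verts E" and M: "left_module R M"
    and \<alpha>: "\<alpha> \<in> lmod_hom R (Hm S t) M" and \<beta>: "\<beta> \<in> lmod_hom R (Hm S' t') M"
    and inj: "inj_on \<beta> (carrier (Hm S' t'))"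
    and \<Phi>: "\<And>g. g \<in> F E S t \<Longrightarrow> \<Phi> g \<in> F E S' t'" "\<And>g. g \<in> F E S t \<Longrightarrow> \<beta> (Th S' t' (\<Phi> g)) = \<alpha> (Th S t g)"
  shows "flin E S t S' t' \<Phi>"
proof -
  note [simp del] = Hm_simps
  have eqI: "x = y" if "x \<in> F E S' t'" "y \<in> F E S' t'" "\<beta> (Th S' t' x) = \<beta> (Th S' t' y)" for x y
    using that Th_inj[OF t(2)] inj_onD[OF inj] Th_closed[OF t(2)] by blast
  note T = Th_closed[OF t(1)] and T' = Th_closed[OF t(2) \<Phi>(1)]
  show ?thesis
    unfolding flin_def
  proof (intro conjI ballI allI)
    fix f :: "('a, 'e) mon \<Rightarrow> 'k" assume f: "f \<in> F E S t"
    show "\<Phi> f \<in> F E S' t'" by (rule \<Phi>(1)[OF f])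
    show "\<Phi> (f + g) = \<Phi> f + \<Phi> g" if g: "g \<in> F E S t" for g
      by (rule eqI[OF \<Phi>(1)[OF F_add[OF f g]] F_add[OF \<Phi>(1)[OF f] \<Phi>(1)[OF g]]])
         (simp only: \<Phi>(2)[OF F_add[OF f g]] Th_add[OF f g] Th_add[OF \<Phi>(1)[OF f] \<Phi>(1)[OF g]]
           lmod_homD(2)[OF \<alpha> T[OF f] T[OF g]] lmod_homD(2)[OF \<beta> T'[OF f] T'[OF g]] \<Phi>(2)[OF f]
               \<Phi>(2)[OF g])
    show "\<Phi> (fsc c f) = fsc c (\<Phi> f)" for c
      by (rule eqI[OF \<Phi>(1)[OF F_fsc[OF f]] F_fsc[OF \<Phi>(1)[OF f]]])
         (simp only: \<Phi>(2)[OF F_fsc[OF f]] Th_fsc[OF f] Th_fsc[OF \<Phi>(1)[OF f]]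
           lmod_homD(3)[OF \<alpha> scal_carrier T[OF f]] lmod_homD(3)[OF \<beta> scal_carrier T'[OF f]]
               \<Phi>(2)[OF f])
    show "\<Phi> (fy E t e f) = fy E t' e (\<Phi> f)" if e: "e \<in> arcs E" for e
      by (rule eqI[OF \<Phi>(1)[OF F_fy[OF e f]] F_fy[OF e \<Phi>(1)[OF f]]])
         (simp only: \<Phi>(2)[OF F_fy[OF e f]] Th_fy[OF t(1) f e] Th_fy[OF t(2) \<Phi>(1)[OF f] e]
           lmod_homD(3)[OF \<alpha> Y_carrier[OF e] T[OF f]] lmod_homD(3)[OF \<beta> Y_carrier[OF e] T'[OF f]]
               \<Phi>(2)[OF f])
    show "\<Phi> (fp E t v f) = fp E t' v (\<Phi> f)" for v
    proof (cases "v \<in> verts E")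
      case v: True
      show ?thesis
        by (rule eqI[OF \<Phi>(1)[OF F_fp[OF f]] F_fp[OF \<Phi>(1)[OF f]]])
           (simp only: \<Phi>(2)[OF F_fp[OF f]] Th_fp[OF t(1) f v] Th_fp[OF t(2) \<Phi>(1)[OF f] v]
             lmod_homD(3)[OF \<alpha> P_carrier[OF v] T[OF f]] lmod_homD(3)[OF \<beta> P_carrier[OF v] T'[OF f]]
                 \<Phi>(2)[OF f])
    next
      case False
      have "\<Phi> 0 = 0"
        by (rule eqI[OF \<Phi>(1)[OF F_0] F_0])
           (simp only: \<Phi>(2)[OF F_0] Th_0 lmod_hom_zero[OF left_module_Hm[OF t(1)] M \<alpha>]
               lmod_hom_zero[OF left_module_Hm[OF t(2)] M \<beta>])
      then show ?thesis by (simp only: fp_outside[OF f False] fp_outside[OF \<Phi>(1)[OF f] False])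
    qed
  qed
qed

text \<open>The basis of \<open>N\<close> over the path algebra stays independent over
  \<open>R\<close>: a deep path moves a relation into the lattice, where it is trivial, and
  \<open>deep_Hm\<close> brings the conclusion back. \<open>U\<close> and \<open>S\<close> are
  handed on so that the type of the basis can be computed as that of a cut set.\<close>

lemma lattice_basis:
  fixes T :: "'i set"
  assumes t: "t ` T \<subseteq> verts E" and N: "fsub E T t N"
  obtains U S \<Psi> where "S = {m \<in> U. \<forall>w1 w2. word m = w1 @ w2 \<longrightarrow> w1 \<noteq> [] \<longrightarrow> Mo (idx m) w2 \<notin> U}"
    and "U \<subseteq> Mon E T t" and "\<And>m. delta m \<in> N \<Longrightarrow> m \<in> U" and "vx E t ` S \<subseteq> verts E"
    and "\<Psi> \<in> lmod_hom R (Hm S (vx E t)) (Hm T t)" and "inj_on \<Psi> (carrier (Hm S (vx E t)))"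
    and "(\<lambda>g. \<Psi> (Th S (vx E t) g)) ` F E S (vx E t) = Th T t ` N"
proof (rule submodule_basis[OF wf N])
  note [simp del] = Hm_simps
  fix U S c
  assume S: "S = {m \<in> U. \<forall>w1 w2. word m = w1 @ w2 \<longrightarrow> w1 \<noteq> [] \<longrightarrow> Mo (idx m) w2 \<notin> U}"
    and U: "U \<subseteq> Mon E T t" "\<And>m. delta m \<in> N \<Longrightarrow> m \<in> U"
    and c: "\<And>m. m \<in> S \<Longrightarrow> c m \<in> N" "\<And>m. m \<in> S \<Longrightarrow> fp E t (vx E t m) (c m) = c m"
    and Linj: "\<And>L g. flin E S (vx E t) T t L \<Longrightarrow> (\<And>m. m \<in> S \<Longrightarrow> L (delta (Mo m [])) = c m) \<Longrightarrow>
           g \<in> F E S (vx E t) \<Longrightarrow> L g = 0 \<Longrightarrow> g = 0"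
    and Lsurj: "\<And>L f. flin E S (vx E t) T t L \<Longrightarrow> (\<And>m. m \<in> S \<Longrightarrow> L (delta (Mo m [])) = c m) \<Longrightarrow>
           f \<in> N \<Longrightarrow> \<exists>g\<in>F E S (vx E t). L g = f"
  have NF: "f \<in> N \<Longrightarrow> f \<in> F E T t" for f using N by (auto simp: fsub_def)
  have vx: "vx E t ` S \<subseteq> verts E" using S U(1) by (auto simp: Mon_def vx_def)
  interpret T: left_module R "Hm T t" by (rule left_module_Hm[OF t])
  interpret S: left_module R "Hm S (vx E t)" by (rule left_module_Hm[OF vx])
  have bc: "Th T t (c m) \<in> carrier (Hm T t)" if "m \<in> S" for m using c(1)[OF that] NF t
      by (intro Th_closed)
  obtain \<Psi> where \<Psi>: "\<Psi> \<in> lmod_hom R (Hm S (vx E t)) (Hm T t)"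
    and \<Psi>s: "\<And>m a. m \<in> S \<Longrightarrow> a \<in> carrier R \<Longrightarrow> a \<otimes> P (vx E t m) = a \<Longrightarrow> \<Psi> (single S m a) =
        a \<odot>\<^bsub>Hm T t\<^esub> Th T t (c m)"
    using ex_hom[OF vx left_module_Hm[OF t], of "\<lambda>m. Th T t (c m)", OF bc] by blast
  \<comment> \<open>The map \<open>L\<close> between the free modules is not constructed directly
    but read off from the \<open>R\<close>-linear extension \<open>\<Psi>\<close>, which sends the
    lattice into the image of \<open>N\<close>.\<close>
  have "\<exists>f\<in>N. Th T t f = \<Psi> (Th S (vx E t) g)" if "g \<in> F E S (vx E t)" for g
    using that
  proof (induction rule: F_induct)
    case zero
    show ?case
      using N lmod_hom_zero[OF left_module_Hm[OF vx] left_module_Hm[OF t] \<Psi>] Th_0 unfolding fsub_def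
          by metis
  next
    case (step g k q)
    have q: "delta q \<in> F E S (vx E t)" using step by (intro F_delta)
    have qS: "idx q \<in> S" "walk E (vx E t (idx q)) (word q)" using step by (auto simp: Mon_def)
    have "\<exists>f\<in>N. Th T t f = \<Psi> (Th S (vx E t) (delta (Mo (idx q) w)))" if "walk E (vx E t (idx q)) w"
        for w
      using that
    proof (induction w)
      case Nil
      have v: "vx E t (idx q) \<in> verts E" using vx qS by auto
      have "\<Psi> (Th S (vx E t) (delta (Mo (idx q) []))) =
          P (vx E t (idx q)) \<odot>\<^bsub>Hm T t\<^esub> Th T t (c (idx q))"
        using \<Psi>s[OF qS(1) P_carrier[OF v]] v unfolding Th_delta_Nil[OF vx qS(1)] by (simp add: PP)
      also have "\<dots> = Th T t (c (idx q))"
        using Th_fp[OF t NF[OF c(1)[OF qS(1)]] v] c(2)[OF qS(1)] by simp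
      finally show ?case using c(1)[OF qS(1)] by metis
    next
      case (Cons e w)
      then have e: "e \<in> arcs E" "walk E (vx E t (idx q)) w" "tail E e =
          vx E (vx E t) (Mo (idx q) w)"
        by (auto simp: vx_def)
      then obtain f where f: "f \<in> N" "Th T t f = \<Psi> (Th S (vx E t) (delta (Mo (idx q) w)))"
        using Cons.IH by blast
      have d: "delta (Mo (idx q) w) \<in> F E S (vx E t)" using e qS
          by (intro F_delta) (simp add: Mon_def)
      have "\<Psi> (Th S (vx E t) (delta (Mo (idx q) (e # w)))) =
          \<Psi> (Y e \<odot>\<^bsub>Hm S (vx E t)\<^esub> Th S (vx E t) (delta (Mo (idx q) w)))"
        by (simp only: fy_delta[OF e(3), symmetric] Th_fy[OF vx d e(1)])
      also have "\<dots> = Th T t (fy E t e f)"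
        by (simp only: lmod_homD(3)[OF \<Psi> Y_carrier[OF e(1)] Th_closed[OF vx d]] f(2)[symmetric]
            Th_fy[OF t NF[OF f(1)] e(1)])
      finally show ?case using f(1) e(1) N unfolding fsub_def by metis
    qed
    from this[OF qS(2)] obtain f where f: "f \<in> N" "Th T t f = \<Psi> (Th S (vx E t) (delta q))" by auto
    obtain h where h: "h \<in> N" "Th T t h = \<Psi> (Th S (vx E t) g)" using step by blast
    have "\<Psi> (Th S (vx E t) (g + fsc k (delta q))) = Th T t (h + fsc k f)"
      by (simp only: Th_add[OF step(1) F_fsc[OF q]] Th_fsc[OF q] Th_add[OF NF[OF h(1)]
          F_fsc[OF NF[OF f(1)]]] Th_fsc[OF NF[OF f(1)]]
          lmod_homD(2)[OF \<Psi> Th_closed[OF vx step(1)] S.smult_closed[OF scal_carrier Th_closed[OF vx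
              q]]]
          lmod_homD(3)[OF \<Psi> scal_carrier Th_closed[OF vx q]] f(2) h(2))
    moreover have "h + fsc k f \<in> N" using N f h unfolding fsub_def by blast
    ultimately show ?case by metis
  qed
  then obtain L where L: "\<And>g. g \<in> F E S (vx E t) \<Longrightarrow> L g \<in> N" "\<And>g. g \<in> F E S (vx E t) \<Longrightarrow> Th T t (L g) =
      \<Psi> (Th S (vx E t) g)"
    by metis
  have id: "id \<in> lmod_hom R (Hm T t) (Hm T t)" by (simp add: lmod_hom_def)
  have Llin: "flin E S (vx E t) T t L"
    by (rule hom_to_flin[OF vx t left_module_Hm[OF t] \<Psi> id]) (use L NF in auto)
  have Ldelta: "L (delta (Mo m [])) = c m" if m: "m \<in> S" for m
  proof (rule Th_inj[OF t])
    have v: "vx E t m \<in> verts E" using vx m by auto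
    show "Th T t (L (delta (Mo m []))) = Th T t (c m)"
      using L(2)[OF delta_Nil_F[OF vx m]] \<Psi>s[OF m P_carrier[OF v]] v Th_fp[OF t NF[OF c(1)[OF m]] v]
          c(2)[OF m]
      unfolding Th_delta_Nil[OF vx m] by (simp add: PP)
    show "L (delta (Mo m [])) \<in> F E T t" by (rule NF[OF L(1)[OF delta_Nil_F[OF vx m]]])
    show "c m \<in> F E T t" by (rule NF[OF c(1)[OF m]])
  qed
  have img: "(\<lambda>g. \<Psi> (Th S (vx E t) g)) ` F E S (vx E t) = Th T t ` N"
    using L Lsurj[OF Llin Ldelta] by (force simp: image_iff)
  have "inj_on \<Psi> (carrier (Hm S (vx E t)))"
  proof (rule inj_onI_kernel[OF left_module_Hm[OF vx] left_module_Hm[OF t] \<Psi>])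
    fix u assume u: "u \<in> carrier (Hm S (vx E t))" "\<Psi> u = \<zero>\<^bsub>Hm T t\<^esub>"
    obtain n where n: "good S (vx E t) n u" using ex_good[OF vx u(1)] by blast
    have "u \<in> {\<zero>\<^bsub>Hm S (vx E t)\<^esub>}"
    proof (rule deep_Hm[OF vx _ u(1)])
      show "submodule {\<zero>\<^bsub>Hm S (vx E t)\<^esub>} R (Hm S (vx E t))"
        unfolding S.submodule_iff using S.zero_closed S.r_zero[OF S.zero_closed] S.smult_zero_right
            by auto
      fix v w assume d: "deep E n v w"
      then obtain g where g: "g \<in> F E S (vx E t)" "Th S (vx E t) g = yw v w \<odot>\<^bsub>Hm S (vx E t)\<^esub> u"
        using n unfolding good_def by blast
      have "Th T t (L g) = \<zero>\<^bsub>Hm T t\<^esub>"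
        by (simp only: L(2)[OF g(1)] g(2) lmod_homD(3)[OF \<Psi> yw_carrier[OF deep_walk[OF d]] u(1)]
            u(2)
            T.smult_zero_right[OF yw_carrier[OF deep_walk[OF d]]])
      then have "L g = 0" using Th_inj[OF t NF[OF L(1)[OF g(1)]] F_0] by (simp add: Th_0)
      then have "g = 0" using Linj[OF Llin Ldelta g(1)] by blast
      then have "Th S (vx E t) 0 = yw v w \<odot>\<^bsub>Hm S (vx E t)\<^esub> u" using g(2) by (simp only:)
      then show "yw v w \<odot>\<^bsub>Hm S (vx E t)\<^esub> u \<in> {\<zero>\<^bsub>Hm S (vx E t)\<^esub>}" unfolding Th_0 by simp
    qed
    then show "u = \<zero>\<^bsub>Hm S (vx E t)\<^esub>" by simp
  qed
  with that[OF S U vx \<Psi> _ img] show thesis by blast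
qed

text \<open>Submodules of these modules are again of this form: graph algebras are left hereditary.\<close>

theorem submodule_Hm_iso:
  fixes T :: "'i set"
  assumes t: "t ` T \<subseteq> verts E" and Q: "submodule Q R (Hm T t)"
  obtains S :: "('i, 'e) mon set" and t'
      where "t' ` S \<subseteq> verts E" "lmod_iso R (Hm S t') (submod (Hm T t) Q)"
proof -
  note [simp del] = Hm_simps
  interpret T: left_module R "Hm T t" by (rule left_module_Hm[OF t])
  note Qs = Q[unfolded T.submodule_iff]
  \<comment> \<open>The part of the lattice that lies in \<open>Q\<close>. Sufficiently deep
    multiples of an element of \<open>Q\<close> belong to it, so \<open>deep_Hm\<close> recovers
    \<open>Q\<close> from \<open>N\<close>.\<close>
  define N where "N = {f \<in> F E T t. Th T t f \<in> Q}"
  have "fsub E T t N"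
    unfolding fsub_def
  proof (intro conjI ballI allI)
    show "N \<subseteq> F E T t" by (auto simp: N_def)
    show "0 \<in> N" using Qs F_0 unfolding N_def by (simp add: Th_0)
    fix f assume "f \<in> N"
    then have f: "f \<in> F E T t" "Th T t f \<in> Q" by (auto simp: N_def)
    show "f + g \<in> N" if "g \<in> N" for g
      using that f Qs F_add[OF f(1), of g] Th_add[OF f(1), of g] unfolding N_def by simp
    show "fsc k f \<in> N" for k
      using f Qs F_fsc[OF f(1), of k] Th_fsc[OF f(1), of k] unfolding N_def by simp
    show "fy E t e f \<in> N" if "e \<in> arcs E" for e
      using that f Qs F_fy[OF that f(1)] Th_fy[OF t f(1) that] unfolding N_def by simp
    show "fp E t v f \<in> N" for v
    proof (cases "v \<in> verts E")
      case True
      then show ?thesis using f Qs F_fp[OF f(1)] Th_fp[OF t f(1) True] unfolding N_def by simp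
    next
      case False
      then show ?thesis using \<open>0 \<in> N\<close> fp_outside[OF f(1) False] by (simp only:)
    qed
  qed
  then obtain U S \<Psi> where S: "S = {m \<in> U. \<forall>w1 w2. word m = w1 @ w2 \<longrightarrow> w1 \<noteq> [] \<longrightarrow> Mo (idx m) w2 \<notin> U}"
    and U: "U \<subseteq> Mon E T t" "\<And>m. delta m \<in> N \<Longrightarrow> m \<in> U"
    and vx: "vx E t ` S \<subseteq> verts E"
    and \<Psi>: "\<Psi> \<in> lmod_hom R (Hm S (vx E t)) (Hm T t)" "inj_on \<Psi> (carrier (Hm S (vx E t)))"
    and img: "(\<lambda>g. \<Psi> (Th S (vx E t) g)) ` F E S (vx E t) = Th T t ` N"
    by (rule lattice_basis[OF t]) (rule that)
  note lS = left_module_Hm[OF vx]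
  have W: "submodule (\<Psi> ` carrier (Hm S (vx E t))) R (Hm T t)"
    by (rule submodule_image[OF lS left_module_Hm[OF t] \<Psi>(1) submodule_carrier[OF lS]])
  have "\<Psi> ` carrier (Hm S (vx E t)) = Q"
  proof
    have "{u \<in> carrier (Hm S (vx E t)). \<Psi> u \<in> Q} = carrier (Hm S (vx E t))"
    proof (rule Hm_gen[OF vx submodule_vimage[OF lS left_module_Hm[OF t] \<Psi>(1) Q]])
      fix s assume s: "s \<in> S"
      have "\<Psi> (Th S (vx E t) (delta (Mo s []))) \<in> Th T t ` N"
        unfolding img[symmetric] using delta_Nil_F[OF vx s] by blast
      then have "\<Psi> (Th S (vx E t) (delta (Mo s []))) \<in> Q" by (auto simp: N_def)
      then show "single S s (P (vx E t s)) \<in> {u \<in> carrier (Hm S (vx E t)). \<Psi> u \<in> Q}"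
        using single_P_Hm[OF vx s] Th_delta_Nil[OF vx s] by simp
    qed
    then show "\<Psi> ` carrier (Hm S (vx E t)) \<subseteq> Q" by blast
    show "Q \<subseteq> \<Psi> ` carrier (Hm S (vx E t))"
    proof
      fix q assume q: "q \<in> Q"
      then have qc: "q \<in> carrier (Hm T t)" using Qs by blast
      obtain n where n: "good T t n q" using ex_good[OF t qc] by blast
      show "q \<in> \<Psi> ` carrier (Hm S (vx E t))"
      proof (rule deep_Hm[OF t W qc])
        fix v w assume d: "deep E n v w"
        then obtain f where f: "f \<in> F E T t" "Th T t f = yw v w \<odot>\<^bsub>Hm T t\<^esub> q" using n
            unfolding good_def by blast
        have "yw v w \<odot>\<^bsub>Hm T t\<^esub> q \<in> Q" using Qs q yw_carrier[OF deep_walk[OF d]] by blast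
        then have "yw v w \<odot>\<^bsub>Hm T t\<^esub> q \<in> Th T t ` N" using f unfolding N_def
            by (metis (mono_tags, lifting) imageI mem_Collect_eq)
        then show "yw v w \<odot>\<^bsub>Hm T t\<^esub> q \<in> \<Psi> ` carrier (Hm S (vx E t))"
          unfolding img[symmetric] using Th_closed[OF vx] by blast
      qed
    qed
  qed
  with lmod_hom_image_iso[OF \<Psi>] that[OF vx] show thesis by simp
qed

text \<open>
  The lattice of all \<open>f\<close> in the path-algebra lattice of \<open>Hm T t\<close> that \<open>\<Phi>\<close> maps into the one of
  \<open>Hm T' t'\<close> contains all deep monomials. Hence the type of its basis is obtained from \<open>t\<close> by
  firing vertices, and likewise from \<open>t'\<close>.
\<close>

theorem Hm_iso_type:
  fixes T :: "'i set" and T' :: "'j set"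
  assumes T: "finite T" "t ` T \<subseteq> verts E" and T': "finite T'" "t' ` T' \<subseteq> verts E"
    and iso: "lmod_iso R (Hm T t) (Hm T' t')"
  shows "gmeq E (type_of T t) (type_of T' t')"
proof -
  note [simp del] = Hm_simps
  \<comment> \<open>Stated for arbitrary index types and an arbitrary homomorphism, since it is
    applied to \<open>\<Phi>\<close> and to its inverse.\<close>
  have half: "\<exists>(S :: ('a, 'e) mon set) \<tau> \<Psi>. finite S \<and> \<tau> ` S \<subseteq> verts E \<and>
      gmeq E (type_of T t) (type_of S \<tau>) \<and>
      \<Psi> \<in> lmod_hom R (Hm S \<tau>) (Hm T t) \<and> inj_on \<Psi> (carrier (Hm S \<tau>)) \<and>
      (\<lambda>g. \<Psi> (Th S \<tau> g)) ` F E S \<tau> = {u \<in> Th T t ` F E T t. \<Phi> u \<in> Th T' t' ` F E T' t'}"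
    if T: "finite T" "t ` T \<subseteq> verts E" and t': "t' ` T' \<subseteq> verts E"
        and \<Phi>: "\<Phi> \<in> lmod_hom R (Hm T t) (Hm T' t')"
    for T :: "'a set" and t and T' :: "'b set" and t' \<Phi>
  proof -
    note t = T(2)
    note Tc = Th_closed[OF t]
    define N where "N = {f \<in> F E T t. \<Phi> (Th T t f) \<in> Th T' t' ` F E T' t'}"
    interpret T: left_module R "Hm T t" by (rule left_module_Hm[OF t])
    have "fsub E T t N"
      unfolding fsub_def
    proof (intro conjI ballI allI)
      show "N \<subseteq> F E T t" by (auto simp: N_def)
      show N0: "0 \<in> N"
        using F_0 lmod_hom_zero[OF left_module_Hm[OF t] left_module_Hm[OF t'] \<Phi>] unfolding N_def
        by (metis (mono_tags, lifting) Th_0 image_eqI mem_Collect_eq)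
      fix f assume "f \<in> N"
      then obtain f' where f: "f \<in> F E T t" "f' \<in> F E T' t'" "\<Phi> (Th T t f) = Th T' t' f'"
          by (auto simp: N_def)
      have NI: "g \<in> N" if "g \<in> F E T t" "g' \<in> F E T' t'" "\<Phi> (Th T t g) = Th T' t' g'" for g g'
        using that unfolding N_def by blast
      show "f + g \<in> N" if "g \<in> N" for g
      proof -
        obtain g' where g: "g \<in> F E T t" "g' \<in> F E T' t'" "\<Phi> (Th T t g) = Th T' t' g'" using \<open>g \<in> N\<close> by (auto simp: N_def)
        show ?thesis
          by (rule NI[OF F_add[OF f(1) g(1)] F_add[OF f(2) g(2)]])
             (simp only: Th_add[OF f(1) g(1)] Th_add[OF f(2) g(2)] lmod_homD(2)[OF \<Phi> Tc[OF f(1)]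
                 Tc[OF g(1)]] f(3) g(3))
      qed
      show "fsc k f \<in> N" for k
        by (rule NI[OF F_fsc[OF f(1)] F_fsc[OF f(2)]])
           (simp only: Th_fsc[OF f(1)] Th_fsc[OF f(2)] lmod_homD(3)[OF \<Phi> scal_carrier Tc[OF f(1)]]
               f(3))
      show "fy E t e f \<in> N" if e: "e \<in> arcs E" for e
        by (rule NI[OF F_fy[OF e f(1)] F_fy[OF e f(2)]])
           (simp only: Th_fy[OF t f(1) e] Th_fy[OF t' f(2) e] lmod_homD(3)[OF \<Phi> Y_carrier[OF e]
               Tc[OF f(1)]] f(3))
      show "fp E t v f \<in> N" for v
      proof (cases "v \<in> verts E")
        case v: True
        show ?thesis
          by (rule NI[OF F_fp[OF f(1)] F_fp[OF f(2), of v]])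
             (simp only: Th_fp[OF t f(1) v] Th_fp[OF t' f(2) v] lmod_homD(3)[OF \<Phi> P_carrier[OF v]
                 Tc[OF f(1)]] f(3))
      next
        case False
        then show ?thesis using N0 fp_outside[OF f(1) False] by (simp only:)
      qed
    qed
    then obtain U S \<Psi> where S: "S = {m \<in> U. \<forall>w1 w2. word m = w1 @ w2 \<longrightarrow> w1 \<noteq> [] \<longrightarrow> Mo (idx m) w2 \<notin> U}"
      and U: "U \<subseteq> Mon E T t" "\<And>m. delta m \<in> N \<Longrightarrow> m \<in> U"
      and vx: "vx E t ` S \<subseteq> verts E"
      and \<Psi>: "\<Psi> \<in> lmod_hom R (Hm S (vx E t)) (Hm T t)" "inj_on \<Psi> (carrier (Hm S (vx E t)))"
      and img: "(\<lambda>g. \<Psi> (Th S (vx E t) g)) ` F E S (vx E t) = Th T t ` N"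
      by (rule lattice_basis[OF t]) (rule that)
    \<comment> \<open>Each generator has its own level; \<open>T\<close> is finite, so the maximum
      serves all of them.\<close>
    have "\<exists>n. \<forall>i\<in>T. good T' t' n (\<Phi> (single T i (P (t i))))"
    proof -
      have "\<exists>n. good T' t' n (\<Phi> (single T i (P (t i))))" if "i \<in> T" for i
        using ex_good[OF t' lmod_homD(1)[OF \<Phi> single_P_Hm[OF t that]]] .
      then obtain n where n: "\<And>i. i \<in> T \<Longrightarrow> good T' t' (n i) (\<Phi> (single T i (P (t i))))" by metis
      have "good T' t' (Max (n ` T)) (\<Phi> (single T i (P (t i))))" if "i \<in> T" for i
        using good_mono[OF n[OF that], of "Max (n ` T)"] T(1) that by simp
      then show ?thesis by blast
    qed
    then obtain n where n: "\<And>i. i \<in> T \<Longrightarrow> good T' t' n (\<Phi> (single T i (P (t i))))" by blast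
    \<comment> \<open>A deep multiple of a generator is sent into the second lattice, so the deep
      monomials lie in \<open>N\<close>. This is the depth condition of
      \<open>cutset_forest\<close>.\<close>
    have deepU: "Mo i w \<in> U" if i: "i \<in> T" and d: "deep E n (t i) w" for i w
    proof (rule U(2))
      have m: "Mo i w \<in> Mon E T t" using i deep_walk[OF d] by (simp add: Mon_def)
      obtain g where g: "g \<in> F E T' t'" "Th T' t' g = yw (t i) w \<odot>\<^bsub>Hm T' t'\<^esub> \<Phi> (single T i (P (t i)))"
        using n[OF i] d unfolding good_def by blast
      have "\<Phi> (Th T t (delta (Mo i w))) = \<Phi> (yw (t i) w \<odot>\<^bsub>Hm T t\<^esub> single T i (P (t i)))"
        using deep_walk[OF d] i t by (subst Th_delta[OF m]) (auto simp: single_smult yw_P)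
      also have "\<dots> = Th T' t' g"
        by (simp only: lmod_homD(3)[OF \<Phi> yw_carrier[OF deep_walk[OF d]] single_P_Hm[OF t i]] g(2))
      finally show "delta (Mo i w) \<in> N" using F_delta[OF m] g(1) unfolding N_def by blast
    qed
    have fin: "finite S" and eq: "gmeq E (type_of T t) (type_of S (vx E t))"
      using E.cutset_forest[OF rf T U(1) deepU S] by auto
    have "Th T t ` N = {u \<in> Th T t ` F E T t. \<Phi> u \<in> Th T' t' ` F E T' t'}" by (auto simp: N_def)
    with img have img': "(\<lambda>g. \<Psi> (Th S (vx E t) g)) ` F E S (vx E t) = {u \<in> Th T t ` F E T t. \<Phi> u \<in>
        Th T' t' ` F E T' t'}"
      by (rule HOL.trans)
    show ?thesis
      by (intro exI[of _ S] exI[of _ "vx E t"] exI[of _ \<Psi>] conjI fin vx eq \<Psi> img')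
  qed
  obtain \<Phi> where \<Phi>: "\<Phi> \<in> lmod_hom R (Hm T t) (Hm T' t')" "bij_betw \<Phi> (carrier (Hm T t)) (carrier (Hm T' t'))"
    using iso by (auto simp: lmod_iso_def)
  let ?\<Phi> = "inv_into (carrier (Hm T t)) \<Phi>"
  have \<Phi>': "?\<Phi> \<in> lmod_hom R (Hm T' t') (Hm T t)"
      by (rule lmod_hom_inv[OF left_module_Hm[OF T(2)] \<Phi>])
  obtain S :: "('i, 'e) mon set" and \<tau> \<Psi>
      where S: "finite S" "\<tau> ` S \<subseteq> verts E" "gmeq E (type_of T t) (type_of S \<tau>)"
    "\<Psi> \<in> lmod_hom R (Hm S \<tau>) (Hm T t)" "inj_on \<Psi> (carrier (Hm S \<tau>))"
    "(\<lambda>g. \<Psi> (Th S \<tau> g)) ` F E S \<tau> = {u \<in> Th T t ` F E T t. \<Phi> u \<in> Th T' t' ` F E T' t'}"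
    using half[OF T T'(2) \<Phi>(1)] by (elim exE conjE) (rule that)
  obtain S' :: "('j, 'e) mon set" and \<tau>' \<Psi>'
      where S': "finite S'" "\<tau>' ` S' \<subseteq> verts E" "gmeq E (type_of T' t') (type_of S' \<tau>')"
    "\<Psi>' \<in> lmod_hom R (Hm S' \<tau>') (Hm T' t')" "inj_on \<Psi>' (carrier (Hm S' \<tau>'))"
    "(\<lambda>g. \<Psi>' (Th S' \<tau>' g)) ` F E S' \<tau>' = {u \<in> Th T' t' ` F E T' t'. ?\<Phi> u \<in> Th T t ` F E T t}"
    using half[OF T' T(2) \<Phi>'] by (elim exE conjE) (rule that)
  let ?\<alpha> = "\<lambda>g. \<Phi> (\<Psi> (Th S \<tau> g))" and ?\<beta> = "\<lambda>g. \<Psi>' (Th S' \<tau>' g)"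
  have \<Phi>inj: "inj_on \<Phi> (carrier (Hm T t))" using \<Phi>(2) by (simp add: bij_betw_def)
  have \<Phi>\<Psi>: "\<Phi> \<circ> \<Psi> \<in> lmod_hom R (Hm S \<tau>) (Hm T' t')" using lmod_hom_comp[OF S(4) \<Phi>(1)] .
  \<comment> \<open>\<open>\<Phi>\<close> carries the part of the first lattice that lands in the
    second onto the part of the second that comes from the first, so both bases describe one
    lattice.\<close>
  have images: "?\<alpha> ` F E S \<tau> = ?\<beta> ` F E S' \<tau>'"
  proof -
    have "?\<alpha> ` F E S \<tau> = \<Phi> ` {u \<in> Th T t ` F E T t. \<Phi> u \<in> Th T' t' ` F E T' t'}"
      unfolding S(6)[symmetric] by (simp add: image_image)
    also have "\<dots> = {u \<in> Th T' t' ` F E T' t'. ?\<Phi> u \<in> Th T t ` F E T t}"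
    proof (intro Set.set_eqI iffI)
      fix u assume "u \<in> \<Phi> ` {u \<in> Th T t ` F E T t. \<Phi> u \<in> Th T' t' ` F E T' t'}"
      then obtain x where x: "x \<in> Th T t ` F E T t" "\<Phi> x \<in> Th T' t' ` F E T' t'" "u = \<Phi> x" by blast
      then have "x \<in> carrier (Hm T t)" using Th_closed[OF T(2)] by blast
      then have "?\<Phi> u = x" using x(3) \<Phi>inj by simp
      with x show "u \<in> {u \<in> Th T' t' ` F E T' t'. ?\<Phi> u \<in> Th T t ` F E T t}" by simp
    next
      fix u assume u: "u \<in> {u \<in> Th T' t' ` F E T' t'. ?\<Phi> u \<in> Th T t ` F E T t}"
      then have "u \<in> carrier (Hm T' t')" using Th_closed[OF T'(2)] by blast
      then have "\<Phi> (?\<Phi> u) = u" using \<Phi>(2) by (metis bij_betw_def f_inv_into_f)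
      then show "u \<in> \<Phi> ` {u \<in> Th T t ` F E T t. \<Phi> u \<in> Th T' t' ` F E T' t'}"
        using u by (intro image_eqI[of _ _ "?\<Phi> u"]) auto
    qed
    finally show ?thesis unfolding S'(6) .
  qed
  have ainj: "inj_on ?\<alpha> (F E S \<tau>)"
  proof (rule inj_onI)
    fix f g assume fg: "f \<in> F E S \<tau>" "g \<in> F E S \<tau>" "?\<alpha> f = ?\<alpha> g"
    note c = Th_closed[OF S(2) fg(1)] Th_closed[OF S(2) fg(2)]
    have "\<Psi> (Th S \<tau> f) = \<Psi> (Th S \<tau> g)"
      using inj_onD[OF \<Phi>inj, OF fg(3)] lmod_homD(1)[OF S(4) c(1)] lmod_homD(1)[OF S(4) c(2)]
          by blast
    then have "Th S \<tau> f = Th S \<tau> g" using inj_onD[OF S(5)] c by blast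
    then show "f = g" using Th_inj[OF S(2) fg(1,2)] by blast
  qed
  have binj: "inj_on ?\<beta> (F E S' \<tau>')"
  proof (rule inj_onI)
    fix f g assume fg: "f \<in> F E S' \<tau>'" "g \<in> F E S' \<tau>'" "?\<beta> f = ?\<beta> g"
    note c = Th_closed[OF S'(2) fg(1)] Th_closed[OF S'(2) fg(2)]
    have "Th S' \<tau>' f = Th S' \<tau>' g" using inj_onD[OF S'(5), OF fg(3)] c by blast
    then show "f = g" using Th_inj[OF S'(2) fg(1,2)] by blast
  qed
  \<comment> \<open>The change between the two bases is an isomorphism of free modules over the path
    algebra, where types are invariant. This joins the firings from the two sides.\<close>
  define \<Omega> where "\<Omega> = inv_into (F E S' \<tau>') ?\<beta> \<circ> ?\<alpha>"
  have bij: "bij_betw \<Omega> (F E S \<tau>) (F E S' \<tau>')"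
    unfolding \<Omega>_def
    by (rule bij_betw_trans[of _ _ "?\<alpha> ` F E S \<tau>"])
       (use ainj binj in \<open>auto simp: bij_betw_def images intro: inj_on_inv_into\<close>)
  have \<Omega>: "?\<beta> (\<Omega> g) = ?\<alpha> g" if "g \<in> F E S \<tau>" for g
    using f_inv_into_f[of "?\<alpha> g" ?\<beta> "F E S' \<tau>'"] images that by (auto simp: \<Omega>_def)
  have "flin E S \<tau> S' \<tau>' \<Omega>"
    by (rule hom_to_flin[OF S(2) S'(2) left_module_Hm[OF T'(2)] \<Phi>\<Psi> S'(4,5)])
       (use \<Omega> bij in \<open>auto simp: bij_betw_def\<close>)
  then have "type_of S \<tau> = type_of S' \<tau>'"
    using type_of_unique[OF S(1) S'(1) S(2) S'(2) _ bij] by blast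
  with S(3) S'(3) show ?thesis by (metis meq.sym meq.trans)
qed

text \<open>Right multiplication by the \<open>x\<^sub>e\<close> leads from
  \<open>R p\<^sub>v\<close> to the sum over the heads; multiplying coordinates by
  \<open>y\<^sub>e\<close> and adding leads back. \<open>YX\<close> shows that the map back is
  injective, and it is surjective because \<open>p\<^sub>v = \<Sum> x\<^sub>e y\<^sub>e\<close> lies
  in its image.\<close>

lemma Hm_fire:
  assumes v: "v \<in> regular E"
  shows "lmod_iso R (Hm (out_arcs E v) (head E)) (Hm {s :: 's} (\<lambda>_. v))"
proof -
  note [simp del] = Hm_simps
  let ?O = "out_arcs E v" and ?t = "\<lambda>_. v"
  have vv: "v \<in> verts E" and ne: "?O \<noteq> {}" using v by (auto simp: regular_def)
  have tO: "head E ` ?O \<subseteq> verts E" by auto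
  have ts: "?t ` {s} \<subseteq> verts E" using vv by simp
  interpret O: left_module R "Hm ?O (head E)" by (rule left_module_Hm[OF tO])
  interpret V: left_module R "Hm {s} ?t" by (rule left_module_Hm[OF ts])
  have bc: "single {s} s (Y e) \<in> carrier (Hm {s} ?t)" if "e \<in> ?O" for e
    using that ts YP[of e] by (intro single_Hm) auto
  obtain \<Psi> where \<Psi>: "\<Psi> \<in> lmod_hom R (Hm ?O (head E)) (Hm {s} ?t)"
    and \<Psi>s: "\<And>e a. e \<in> ?O \<Longrightarrow> a \<in> carrier R \<Longrightarrow> a \<otimes> P (head E e) = a \<Longrightarrow>
      \<Psi> (single ?O e a) = a \<odot>\<^bsub>Hm {s} ?t\<^esub> single {s} s (Y e)"
    using ex_hom[OF tO left_module_Hm[OF ts], of "\<lambda>e. single {s} s (Y e)", OF bc] by blast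
  define \<Xi> where "\<Xi> u = (\<lambda>e\<in>?O. u s \<otimes> X e)" for u :: "'s \<Rightarrow> 'r"
  have fin: "finite ?O" using rf vv by (simp add: row_finite_def)
  have \<Xi>: "\<Xi> \<in> lmod_hom R (Hm {s} ?t) (Hm ?O (head E))"
    unfolding lmod_hom_def
  proof (intro CollectI conjI ballI Pi_I)
    fix u assume u: "u \<in> carrier (Hm {s} ?t)"
    then have us: "u s \<in> carrier R" by (simp add: Hm_carrier)
    have "finite {e \<in> ?O. \<Xi> u e \<noteq> \<zero>}" by (rule finite_subset[OF _ fin]) blast
    then show "\<Xi> u \<in> carrier (Hm ?O (head E))"
      unfolding Hm_carrier by (intro conjI ballI) (use us in \<open>auto simp: \<Xi>_def m_assoc XP\<close>)
    show "\<Xi> (u \<oplus>\<^bsub>Hm {s} ?t\<^esub> u') = \<Xi> u \<oplus>\<^bsub>Hm ?O (head E)\<^esub> \<Xi> u'" if "u' \<in> carrier (Hm {s} ?t)" for u'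
      using us that by (auto simp: \<Xi>_def Hm_simps Hm_carrier l_distr fun_eq_iff)
    show "\<Xi> (a \<odot>\<^bsub>Hm {s} ?t\<^esub> u) = a \<odot>\<^bsub>Hm ?O (head E)\<^esub> \<Xi> u" if "a \<in> carrier R" for a
      using us that by (auto simp: \<Xi>_def Hm_simps Hm_carrier m_assoc fun_eq_iff)
  qed
  have \<Psi>P: "\<Psi> (single ?O e (P (head E e))) = single {s} s (Y e)" if "e \<in> ?O" for e
    using \<Psi>s[OF that, of "P (head E e)"] that by (auto simp: PP single_smult PY)
  have id: "\<Xi> (\<Psi> u) = u" if u: "u \<in> carrier (Hm ?O (head E))" for u
  proof -
    have "(\<Xi> \<circ> \<Psi>) u = id u"
    proof (rule hom_eqI[OF tO left_module_Hm[OF tO] lmod_hom_comp[OF \<Psi> \<Xi>] _ _ u])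
      show "id \<in> lmod_hom R (Hm ?O (head E)) (Hm ?O (head E))" by (simp add: lmod_hom_def)
      fix e assume e: "e \<in> ?O"
      have "\<Xi> (single {s} s (Y e)) = single ?O e (P (head E e))"
        using e by (auto simp: \<Xi>_def single_def YX fun_eq_iff)
      then show "(\<Xi> \<circ> \<Psi>) (single ?O e (P (head E e))) = id (single ?O e (P (head E e)))"
        by (simp only: comp_apply \<Psi>P[OF e] id_apply)
    qed
    then show ?thesis by simp
  qed
  have inj: "inj_on \<Psi> (carrier (Hm ?O (head E)))" by (rule inj_on_inverseI[of _ \<Xi>]) (rule id)
  have W: "submodule (\<Psi> ` carrier (Hm ?O (head E))) R (Hm {s} ?t)" (is "submodule ?W _ _")
    by (rule submodule_image[OF left_module_Hm[OF tO] left_module_Hm[OF ts] \<Psi>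
        submodule_carrier[OF left_module_Hm[OF tO]]])
  note Ws = W[unfolded V.submodule_iff]
  have W0: "\<zero>\<^bsub>Hm {s} ?t\<^esub> \<in> ?W" by (rule conjunct1[OF conjunct2[OF Ws]])
  note W1 = conjunct1[OF conjunct2[OF conjunct2[OF Ws]], rule_format]
  note W2 = conjunct2[OF conjunct2[OF conjunct2[OF Ws]], rule_format]
  have "?W = carrier (Hm {s} ?t)"
  proof (rule Hm_gen[OF ts W])
    fix s' assume "s' \<in> {s}"
    have sP: "single {s} s (P v) \<in> carrier (Hm {s} ?t)" using single_P_Hm[OF ts, of s] by simp
    let ?J = "{a \<in> carrier R. a \<odot>\<^bsub>Hm {s} ?t\<^esub> single {s} s (P v) \<in> ?W}"
    have "(\<Oplus>e\<in>?O. X e \<otimes> Y e) \<in> ?J"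
    proof (rule finsum_mem[OF fin])
      fix e assume e: "e \<in> ?O"
      then have e': "e \<in> arcs E" "tail E e = v" by auto
      have "(X e \<otimes> Y e) \<odot>\<^bsub>Hm {s} ?t\<^esub> single {s} s (P v) = X e \<odot>\<^bsub>Hm {s} ?t\<^esub> single {s} s (Y e)"
        using e' vv YP[of e] by (simp add: single_smult m_assoc)
      also have "\<dots> = X e \<odot>\<^bsub>Hm {s} ?t\<^esub> \<Psi> (single ?O e (P (head E e)))" by (simp only: \<Psi>P[OF e])
      finally have "(X e \<otimes> Y e) \<odot>\<^bsub>Hm {s} ?t\<^esub> single {s} s (P v) \<in> ?W"
        by (simp only: W2[OF X_carrier[OF e'(1)] imageI[OF single_P_Hm[OF tO e]]])
      then show "X e \<otimes> Y e \<in> ?J" using e' by simp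
    next
      show "\<zero> \<in> ?J" using W0 V.smult_zero_left[OF sP]
          by (simp only: mem_Collect_eq zero_closed simp_thms)
      show "a \<oplus> b \<in> ?J" if "a \<in> ?J" "b \<in> ?J" for a b
      proof -
        have ab: "a \<in> carrier R" "b \<in> carrier R" using that by blast+
        have "a \<odot>\<^bsub>Hm {s} ?t\<^esub> single {s} s (P v) \<oplus>\<^bsub>Hm {s} ?t\<^esub> b \<odot>\<^bsub>Hm {s} ?t\<^esub> single {s} s (P v) \<in> ?W"
          using that by (intro W1) blast+
        then show ?thesis unfolding V.smult_l_distr[OF ab sP, symmetric] using ab by blast
      qed
    qed blast
    then have "P v \<in> ?J" using sum_XY[OF vv ne] by simp
    then have "single {s} s (P v) \<in> ?W" using vv by (simp add: single_smult PP)
    then show "single {s} s' (P v) \<in> ?W" using \<open>s' \<in> {s}\<close> by simp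
  qed
  with inj show ?thesis by (intro lmod_isoI[OF \<Psi>]) (simp add: bij_betw_def)
qed

end

section \<open>Types of finitely generated projective modules\<close>

lemma ex_type_of: "\<exists>(n::nat) t. type_of {..<n} t = \<alpha>"
proof -
  obtain vs where vs: "mset vs = \<alpha>" using ex_mset by blast
  have "type_of {..<length vs} (\<lambda>i. vs ! i) = mset vs"
  proof (induction vs rule: rev_induct)
    case (snoc x xs)
    have "(\<Sum>i<length xs. {#(xs @ [x]) ! i#}) = (\<Sum>i<length xs. {#xs ! i#})"
      by (intro sum.cong) (auto simp: nth_append)
    with snoc show ?case by (simp add: type_of_def)
  qed (simp add: type_of_def)
  with vs show ?thesis by blast
qed

lemma type_of_bij:
  assumes "finite S" "finite S'" "type_of S t = type_of S' t'"
  obtains h where "bij_betw h S' S" "\<And>s. s \<in> S' \<Longrightarrow> t (h s) = t' s"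
proof -
  have "\<exists>h. bij_betw h {s \<in> S'. t' s = v} {s \<in> S. t s = v}" for v
    using assms count_type_of[of S t v] count_type_of[of S' t' v]
    by (intro finite_same_card_bij) auto
  then obtain h where h: "\<And>v. bij_betw (h v) {s \<in> S'. t' s = v} {s \<in> S. t s = v}" by metis
  have mem: "h (t' s) s \<in> S \<and> t (h (t' s) s) = t' s" if "s \<in> S'" for s
    using bij_betwE[OF h[of "t' s"]] that by auto
  have "bij_betw (\<lambda>s. h (t' s) s) S' S"
    unfolding bij_betw_def
  proof
    show "inj_on (\<lambda>s. h (t' s) s) S'"
    proof (rule inj_onI)
      fix x y assume xy: "x \<in> S'" "y \<in> S'" "h (t' x) x = h (t' y) y"
      then have "t' x = t' y" using mem by metis
      then show "x = y" using xy inj_onD[OF bij_betw_imp_inj_on[OF h[of "t' x"]], of x y] by simp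
    qed
    show "(\<lambda>s. h (t' s) s) ` S' = S"
    proof
      show "S \<subseteq> (\<lambda>s. h (t' s) s) ` S'"
      proof
        fix x assume "x \<in> S"
        then have "x \<in> h (t x) ` {s \<in> S'. t' s = t x}" using bij_betw_imp_surj_on[OF h[of "t x"]]
            by auto
        then obtain y where "y \<in> S'" "t' y = t x" "x = h (t x) y" by blast
        then show "x \<in> (\<lambda>s. h (t' s) s) ` S'" by (intro image_eqI[of _ _ y]) auto
      qed
    qed (use mem in auto)
  qed
  with mem that show thesis by blast
qed

section \<open>Modules of a given type\<close>

context graph_alg
begin

interpretation E: wf_digraph E by (rule wf)

lemma Hm_reindex:
  fixes S :: "'a set" and S' :: "'b set"
  assumes h: "bij_betw h S' S" and th: "\<And>s. s \<in> S' \<Longrightarrow> t (h s) = t' s"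
  shows "lmod_iso R (Hm S t) (Hm S' t')"
proof -
  define g where "g = inv_into S' h"
  have hS: "h s \<in> S" if "s \<in> S'" for s using h that by (auto simp: bij_betw_def)
  have gS: "g s \<in> S'" "h (g s) = s" if "s \<in> S" for s
    using h that unfolding g_def bij_betw_def by (auto simp: inv_into_into f_inv_into_f)
  have gh: "g (h s) = s" if "s \<in> S'" for s using h that unfolding g_def bij_betw_def by simp
  define f where "f u = (\<lambda>s\<in>S'. u (h s))" for u :: "'a \<Rightarrow> 'r"
  define f' where "f' u = (\<lambda>s\<in>S. u (g s))" for u :: "'b \<Rightarrow> 'r"
  have f: "f u \<in> carrier (Hm S' t')" if u: "u \<in> carrier (Hm S t)" for u
  proof -
    have "{s \<in> S'. f u s \<noteq> \<zero>} \<subseteq> g ` {s \<in> S. u s \<noteq> \<zero>}"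
    proof
      fix s assume s: "s \<in> {s \<in> S'. f u s \<noteq> \<zero>}"
      then have "h s \<in> {s \<in> S. u s \<noteq> \<zero>}" using hS by (auto simp: f_def)
      then show "s \<in> g ` {s \<in> S. u s \<noteq> \<zero>}" using gh s by (intro image_eqI[of _ _ "h s"]) auto
    qed
    then have "finite {s \<in> S'. f u s \<noteq> \<zero>}" by (rule finite_subset) (use u in \<open>simp add: Hm_carrier\<close>)
    then show ?thesis using u hS th[symmetric] unfolding Hm_carrier by (auto simp: f_def)
  qed
  have f': "f' u \<in> carrier (Hm S t)" if u: "u \<in> carrier (Hm S' t')" for u
  proof -
    have "{s \<in> S. f' u s \<noteq> \<zero>} \<subseteq> h ` {s \<in> S'. u s \<noteq> \<zero>}"
    proof
      fix s assume s: "s \<in> {s \<in> S. f' u s \<noteq> \<zero>}"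
      then have "g s \<in> {s \<in> S'. u s \<noteq> \<zero>}" using gS by (auto simp: f'_def)
      then show "s \<in> h ` {s \<in> S'. u s \<noteq> \<zero>}" using gS s by (intro image_eqI[of _ _ "g s"]) auto
    qed
    then have fin: "finite {s \<in> S. f' u s \<noteq> \<zero>}" by (rule finite_subset) (use u in \<open>simp add: Hm_carrier\<close>)
    have tg: "t s = t' (g s)" if "s \<in> S" for s using th[of "g s"] gS[OF that] by simp
    show ?thesis using fin u gS tg unfolding Hm_carrier by (auto simp: f'_def)
  qed
  have "f \<in> lmod_hom R (Hm S t) (Hm S' t')"
    unfolding lmod_hom_def
  proof (intro CollectI conjI ballI Pi_I)
    fix u u' assume "u \<in> carrier (Hm S t)" "u' \<in> carrier (Hm S t)"
    then show "f (u \<oplus>\<^bsub>Hm S t\<^esub> u') = f u \<oplus>\<^bsub>Hm S' t'\<^esub> f u'"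
      using hS by (auto simp: f_def fun_eq_iff)
  next
    fix a u assume "a \<in> carrier R" "u \<in> carrier (Hm S t)"
    then show "f (a \<odot>\<^bsub>Hm S t\<^esub> u) = a \<odot>\<^bsub>Hm S' t'\<^esub> f u"
      using hS by (auto simp: f_def fun_eq_iff)
  qed (rule f)
  moreover have "bij_betw f (carrier (Hm S t)) (carrier (Hm S' t'))"
  proof (rule bij_betw_byWitness[of _ f'])
    show "\<forall>u\<in>carrier (Hm S t). f' (f u) = u"
      using gS by (auto simp: f_def f'_def Hm_carrier fun_eq_iff extensional_def)
    show "\<forall>u\<in>carrier (Hm S' t'). f (f' u) = u"
      using hS gh by (auto simp: f_def f'_def Hm_carrier fun_eq_iff extensional_def)
  qed (use f f' in blast)+
  ultimately show ?thesis by (rule lmod_isoI)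
qed

lemma Hm_type_iso:
  assumes "finite S" "finite S'" "type_of S t = type_of S' t'"
  shows "lmod_iso R (Hm S t) (Hm S' t')"
  using type_of_bij[OF assms] Hm_reindex by metis

lemma Hm_union:
  fixes S1 S2 :: "'a set"
  assumes disj: "S1 \<inter> S2 = {}"
  shows "lmod_iso R (Hm (S1 \<union> S2) t) (direct_sum (Hm S1 t) (Hm S2 t))"
proof -
  define f where "f u = (restrict u S1, restrict u S2)" for u :: "'a \<Rightarrow> 'r"
  define f' where "f' p = (\<lambda>s\<in>S1 \<union> S2. if s \<in> S1 then fst p s else snd p s)"
      for p :: "('a \<Rightarrow> 'r) \<times> ('a \<Rightarrow> 'r)"
  have f: "f u \<in> carrier (direct_sum (Hm S1 t) (Hm S2 t))" if u: "u \<in> carrier (Hm (S1 \<union> S2) t)"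
      for u
  proof -
    have fin: "finite {s \<in> S1 \<union> S2. u s \<noteq> \<zero>}" using u by (simp add: Hm_carrier)
    have "finite {s \<in> S1. restrict u S1 s \<noteq> \<zero>}" "finite {s \<in> S2. restrict u S2 s \<noteq> \<zero>}"
      by (rule finite_subset[OF _ fin], force)+
    with u show ?thesis by (auto simp: f_def Hm_carrier)
  qed
  have f': "f' p \<in> carrier (Hm (S1 \<union> S2) t)" if p: "p \<in> carrier (direct_sum (Hm S1 t) (Hm S2 t))"
      for p
  proof -
    obtain p1 p2 where p12: "p = (p1, p2)" by (cases p)
    have "{s \<in> S1 \<union> S2. f' p s \<noteq> \<zero>} \<subseteq> {s \<in> S1. p1 s \<noteq> \<zero>} \<union> {s \<in> S2. p2 s \<noteq> \<zero>}"
      using disj by (auto simp: f'_def p12)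
    then have "finite {s \<in> S1 \<union> S2. f' p s \<noteq> \<zero>}"
      by (rule finite_subset) (use p in \<open>auto simp: p12 Hm_carrier\<close>)
    then show ?thesis using p unfolding Hm_carrier by (auto simp: f'_def p12 Hm_carrier)
  qed
  have "f \<in> lmod_hom R (Hm (S1 \<union> S2) t) (direct_sum (Hm S1 t) (Hm S2 t))"
    unfolding lmod_hom_def
  proof (intro CollectI conjI ballI Pi_I)
    fix u u' assume "u \<in> carrier (Hm (S1 \<union> S2) t)" "u' \<in> carrier (Hm (S1 \<union> S2) t)"
    then show "f (u \<oplus>\<^bsub>Hm (S1 \<union> S2) t\<^esub> u') = f u \<oplus>\<^bsub>direct_sum (Hm S1 t) (Hm S2 t)\<^esub> f u'"
      by (auto simp: f_def fun_eq_iff)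
  next
    fix a u assume "a \<in> carrier R" "u \<in> carrier (Hm (S1 \<union> S2) t)"
    then show "f (a \<odot>\<^bsub>Hm (S1 \<union> S2) t\<^esub> u) = a \<odot>\<^bsub>direct_sum (Hm S1 t) (Hm S2 t)\<^esub> f u"
      by (auto simp: f_def fun_eq_iff)
  qed (rule f)
  moreover have "bij_betw f (carrier (Hm (S1 \<union> S2) t)) (carrier (direct_sum (Hm S1 t) (Hm S2 t)))"
  proof (rule bij_betw_byWitness[of _ f'])
    show "\<forall>u\<in>carrier (Hm (S1 \<union> S2) t). f' (f u) = u"
      by (auto simp: f_def f'_def Hm_carrier fun_eq_iff extensional_def)
    show "\<forall>p\<in>carrier (direct_sum (Hm S1 t) (Hm S2 t)). f (f' p) = p"
      using disj by (auto simp: f_def f'_def Hm_carrier fun_eq_iff extensional_def)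
  qed (use f f' in blast)+
  ultimately show ?thesis by (rule lmod_isoI)
qed

text \<open>Index sets \<open>{..<n}\<close> avoid a quantification over index types and lose
  nothing, since only the multiset of vertices matters. The types of one module form a class of
  \<open>gmeq E\<close>.\<close>

definition has_type :: "('r, 'm) module \<Rightarrow> 'v multiset \<Rightarrow> bool" where
  "has_type M \<alpha> \<longleftrightarrow> left_module R M \<and> (\<exists>(n::nat) t. t ` {..<n} \<subseteq> verts E \<and> type_of {..<n} t = \<alpha> \<and>
     lmod_iso R (Hm {..<n} t) M)"

lemma has_type_left_module: "has_type M \<alpha> \<Longrightarrow> left_module R M" by (simp add: has_type_def)

lemma has_type_verts: "has_type M \<alpha> \<Longrightarrow> set_mset \<alpha> \<subseteq> verts E"
  by (auto simp: has_type_def set_type_of)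

lemma has_type_iso: "has_type M \<alpha> \<Longrightarrow> left_module R N \<Longrightarrow> lmod_iso R M N \<Longrightarrow> has_type N \<alpha>"
  unfolding has_type_def using lmod_iso_trans by blast

lemma has_type_Hm:
  assumes "finite S" "t ` S \<subseteq> verts E"
  shows "has_type (Hm S t) (type_of S t)"
proof -
  obtain n :: nat and t' where t': "type_of {..<n} t' = type_of S t" using ex_type_of by blast
  then have "t' ` {..<n} \<subseteq> verts E" using assms by (metis finite_lessThan set_type_of)
  then show ?thesis
    unfolding has_type_def using Hm_type_iso[OF finite_lessThan assms(1) t'] t'
        left_module_Hm[OF assms(2)] by blast
qed

lemma ex_has_type:
  assumes "set_mset \<alpha> \<subseteq> verts E"
  shows "\<exists>M :: ('r, nat \<Rightarrow> 'r) module. has_type M \<alpha>"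
proof -
  obtain n :: nat and t where t: "type_of {..<n} t = \<alpha>" using ex_type_of by blast
  then have "t ` {..<n} \<subseteq> verts E" using assms by (metis finite_lessThan set_type_of)
  then show ?thesis using has_type_Hm[of "{..<n}" t] t by blast
qed

lemma has_type_unique: "has_type M \<alpha> \<Longrightarrow> has_type M \<beta> \<Longrightarrow> gmeq E \<alpha> \<beta>"
proof -
  assume "has_type M \<alpha>" "has_type M \<beta>"
  then obtain n m :: nat and t t' where t: "t ` {..<n} \<subseteq> verts E" "type_of {..<n} t =
      \<alpha>" "lmod_iso R (Hm {..<n} t) M"
    and t': "t' ` {..<m} \<subseteq> verts E" "type_of {..<m} t' = \<beta>" "lmod_iso R (Hm {..<m} t') M"
        by (auto simp: has_type_def)
  have "lmod_iso R (Hm {..<n} t) (Hm {..<m} t')"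
    using lmod_iso_trans[OF t(3) lmod_iso_sym[OF left_module_Hm[OF t'(1)] t'(3)]] .
  from Hm_iso_type[OF _ t(1) _ t'(1) this] show ?thesis using t t' by simp
qed

lemma has_type_same: "has_type M \<alpha> \<Longrightarrow> has_type N \<alpha> \<Longrightarrow> lmod_iso R M N"
proof -
  assume "has_type M \<alpha>" "has_type N \<alpha>"
  then obtain n m :: nat and t t' where t: "t ` {..<n} \<subseteq> verts E" "type_of {..<n} t =
      \<alpha>" "lmod_iso R (Hm {..<n} t) M"
    and t': "t' ` {..<m} \<subseteq> verts E" "type_of {..<m} t' = \<alpha>" "lmod_iso R (Hm {..<m} t') N"
        by (auto simp: has_type_def)
  have "lmod_iso R (Hm {..<n} t) (Hm {..<m} t')" using t t' by (intro Hm_type_iso) auto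
  from lmod_iso_trans[OF lmod_iso_sym[OF left_module_Hm[OF t(1)] t(3)] lmod_iso_trans[OF this
      t'(3)]] show ?thesis .
qed

lemma has_type_sum:
  assumes "has_type M \<alpha>" "has_type N \<beta>"
  shows "has_type (direct_sum M N) (\<alpha> + \<beta>)"
proof -
  obtain n m :: nat and t t' where t: "t ` {..<n} \<subseteq> verts E" "type_of {..<n} t =
      \<alpha>" "lmod_iso R (Hm {..<n} t) M"
    and t': "t' ` {..<m} \<subseteq> verts E" "type_of {..<m} t' = \<beta>" "lmod_iso R (Hm {..<m} t') N"
    using assms by (auto simp: has_type_def)
  define T where "T i = (if i < n then t i else t' (i - n))" for i
  have img: "{n..<n + m} = (\<lambda>i. i + n) ` {..<m}" by (simp add: lessThan_atLeast0 add.commute)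
  have T1: "type_of {..<n} T = \<alpha>" unfolding t(2)[symmetric] type_of_def
      by (intro sum.cong) (auto simp: T_def)
  have T2: "type_of {n..<n + m} T = \<beta>"
    unfolding img by (subst type_of_reindex) (auto simp: inj_on_def t'(2)[symmetric] type_of_def
        T_def)
  have Tv: "T ` ({..<n} \<union> {n..<n + m}) \<subseteq> verts E" using t(1) t'(1) by (auto simp: T_def)
  then have Tv1: "T ` {..<n} \<subseteq> verts E" and Tv2: "T ` {n..<n + m} \<subseteq> verts E" by auto
  have "type_of ({..<n} \<union> {n..<n + m}) T = \<alpha> + \<beta>"
    unfolding T1[symmetric] T2[symmetric] type_of_def by (intro sum.union_disjoint) auto
  then have "has_type (Hm ({..<n} \<union> {n..<n + m}) T) (\<alpha> + \<beta>)" using has_type_Hm[OF _ Tv] by simp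
  moreover have "lmod_iso R (Hm ({..<n} \<union> {n..<n + m}) T) (direct_sum (Hm {..<n} T) (Hm {n..<n +
      m} T))"
    by (rule Hm_union) auto
  moreover have "lmod_iso R (Hm {..<n} T) M"
    using has_type_same[of "Hm {..<n} T" \<alpha> M] has_type_Hm[OF _ Tv1] T1 assms(1) by simp
  moreover have "lmod_iso R (Hm {n..<n + m} T) N"
    using has_type_same[of "Hm {n..<n + m} T" \<beta> N] has_type_Hm[OF _ Tv2] T2 assms(2) by simp
  ultimately show ?thesis
    using assms has_type_left_module left_module_direct_sum
        by (meson direct_sum_cong lmod_iso_trans has_type_iso)
qed

text \<open>\<open>Hm_fire\<close> replaces one summand; adding a module of type
  \<open>\<delta>\<close> to both sides gives the general firing.\<close>

lemma has_type_meq: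
  assumes "gmeq E \<alpha> \<beta>"
  shows "has_type M \<alpha> \<longleftrightarrow> has_type M \<beta>"
  using assms
proof (induction rule: meq.induct)
  case (step v \<delta>)
  have v: "v \<in> verts E" and fin: "finite (out_arcs E v)"
    using step rf by (auto simp: regular_def row_finite_def)
  have hv: "head E ` out_arcs E v \<subseteq> verts E" by auto
  have ds: "gmeq E (add_mset v \<delta>) (out_mset E v + \<delta>)" using step by (rule meq.step)
  show ?case
  proof (cases "set_mset \<delta> \<subseteq> verts E")
    case True
    then obtain D :: "('r, nat \<Rightarrow> 'r) module" where D: "has_type D \<delta>" using ex_has_type by blast
    have 1: "has_type (direct_sum (Hm {0::nat} (\<lambda>_. v)) D) (add_mset v \<delta>)"
      using has_type_sum[OF has_type_Hm[of "{0::nat}" "\<lambda>_. v"] D] v by (simp add: type_of_def)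
    have 2: "has_type (direct_sum (Hm (out_arcs E v) (head E)) D) (out_mset E v + \<delta>)"
      using has_type_sum[OF has_type_Hm[OF fin hv] D] by (simp add: out_mset_def)
    have 3: "lmod_iso R (direct_sum (Hm (out_arcs E v) (head E)) D) (direct_sum (Hm {0::nat} (\<lambda>_.
        v)) D)"
      by (intro direct_sum_cong Hm_fire step lmod_iso_refl)
    have 4: "has_type (direct_sum (Hm (out_arcs E v) (head E)) D) (add_mset v \<delta>)"
      using has_type_iso[OF 1 has_type_left_module[OF 2] lmod_iso_sym[OF has_type_left_module[OF 2]
          3]] .
    show ?thesis
    proof
      assume M: "has_type M (add_mset v \<delta>)"
      show "has_type M (out_mset E v + \<delta>)" using has_type_iso[OF 2 has_type_left_module[OF M]
          has_type_same[OF 4 M]] .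
    next
      assume M: "has_type M (out_mset E v + \<delta>)"
      show "has_type M (add_mset v \<delta>)" using has_type_iso[OF 4 has_type_left_module[OF M]
          has_type_same[OF 2 M]] .
    qed
  next
    case False
    \<comment> \<open>The congruence is defined for arbitrary multisets. A non-vertex in
      \<open>\<delta>\<close> occurs on both sides, and then no module has either type.\<close>
    then show ?thesis using has_type_verts by fastforce
  qed
qed auto

text \<open>Model modules of the two types are chosen; their sum is isomorphic to \<open>M\<close>,
  and its summands are transported into \<open>M\<close>.\<close>

lemma has_type_split:
  assumes "has_type M (\<alpha> + \<beta>)"
  obtains H L where "internal_direct_sum R M H L" "has_type (submod M H) \<alpha>"
      "has_type (submod M L) \<beta>"
proof -
  have "set_mset \<alpha> \<subseteq> verts E" "set_mset \<beta> \<subseteq> verts E" using has_type_verts[OF assms] by auto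
  then obtain A B :: "('r, nat \<Rightarrow> 'r) module" where AB: "has_type A \<alpha>" "has_type B \<beta>"
      using ex_has_type by metis
  have M: "left_module R M" using assms by (rule has_type_left_module)
  interpret M: left_module R M by (rule M)
  obtain H L where HL: "internal_direct_sum R M H L" "lmod_iso R A (submod M H)"
      "lmod_iso R B (submod M L)"
    by (rule internal_direct_sumI[OF M has_type_left_module[OF AB(1)] has_type_left_module[OF AB(2)]
        has_type_same[OF has_type_sum[OF AB] assms]])
  have "submodule H R M" "submodule L R M" using HL(1) by (auto simp: internal_direct_sum_def)
  then show thesis
    using that[OF HL(1)] has_type_iso[OF AB(1) _ HL(2)] has_type_iso[OF AB(2) _ HL(3)]
        M.submod_left_module by blast
qed

lemma fin_gen_Hm:
  assumes "finite S" "t ` S \<subseteq> verts E"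
  shows "fin_gen R (Hm S t)"
  unfolding fin_gen_def
  using assms Hm_gen[OF assms(2)] single_P_Hm[OF assms(2)]
  by (intro exI[of _ "(\<lambda>s. single S s (P (t s))) ` S"]) (auto simp: image_subset_iff)

lemma fin_gen_has_type:
  assumes "has_type M \<alpha>"
  shows "fin_gen R M"
proof -
  obtain n :: nat and t where t: "t ` {..<n} \<subseteq> verts E" "lmod_iso R (Hm {..<n} t) M"
    using assms by (auto simp: has_type_def)
  show ?thesis
    by (rule fin_gen_iso[OF left_module_Hm[OF t(1)] has_type_left_module[OF assms] t(2)
        fin_gen_Hm[OF _ t(1)]]) simp
qed

text \<open>Finitely many generators have only finitely many nonzero coordinates among them, while
  every coordinate is nonzero somewhere because \<open>P v\<close> is nonzero.\<close>

lemma fin_gen_Hm_finite: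
  assumes t: "t ` S \<subseteq> verts E" and fg: "fin_gen R (Hm S t)"
  shows "finite S"
proof -
  interpret H: left_module R "Hm S t" by (rule left_module_Hm[OF t])
  obtain G where G: "finite G" "G \<subseteq> carrier (Hm S t)"
    "\<And>W. submodule W R (Hm S t) \<Longrightarrow> G \<subseteq> W \<Longrightarrow> W = carrier (Hm S t)"
    using fg unfolding fin_gen_def by blast
  define S0 where "S0 = (\<Union>g\<in>G. {s \<in> S. g s \<noteq> \<zero>})"
  have "finite S0" unfolding S0_def using G by (auto simp: Hm_carrier)
  define W where "W = {u \<in> carrier (Hm S t). \<forall>s\<in>S. s \<notin> S0 \<longrightarrow> u s = \<zero>}"
  have "submodule W R (Hm S t)"
    unfolding H.submodule_iff
  proof (intro conjI ballI)
    show "W \<subseteq> carrier (Hm S t)" by (auto simp: W_def)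
    show "\<zero>\<^bsub>Hm S t\<^esub> \<in> W" unfolding W_def using H.zero_closed by auto
    fix x assume x: "x \<in> W"
    show "x \<oplus>\<^bsub>Hm S t\<^esub> y \<in> W" if "y \<in> W" for y
      using x that H.a_closed[of x y] unfolding W_def by (auto simp: Hm_carrier)
    show "a \<odot>\<^bsub>Hm S t\<^esub> x \<in> W" if "a \<in> carrier R" for a
      using x that H.smult_closed[of a x] unfolding W_def by (auto simp: Hm_carrier)
  qed
  moreover have "G \<subseteq> W" using G(2) by (auto simp: W_def S0_def)
  ultimately have W: "W = carrier (Hm S t)" by (rule G(3))
  have "S \<subseteq> S0"
  proof
    fix s assume s: "s \<in> S"
    then have "single S s (P (t s)) \<in> W" unfolding W by (rule single_P_Hm[OF t])
    moreover have "P (t s) \<noteq> \<zero>" using s t P_nonzero by auto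
    ultimately show "s \<in> S0" using s by (auto simp: W_def single_def)
  qed
  then show ?thesis using \<open>finite S0\<close> by (rule finite_subset)
qed

text \<open>Heredity gives a sum of modules \<open>R p\<^sub>v\<close> over some index set, and
  finite generation makes that index set finite, even if \<open>T\<close> is infinite.\<close>

lemma has_type_embed:
  fixes T :: "'i set"
  assumes N: "left_module R N" and fg: "fin_gen R N" and t: "t ` T \<subseteq> verts E"
    and f: "f \<in> lmod_hom R N (Hm T t)" "inj_on f (carrier N)"
  shows "\<exists>\<alpha>. has_type N \<alpha>"
proof -
  interpret H: left_module R "Hm T t" by (rule left_module_Hm[OF t])
  let ?Q = "f ` carrier N"
  have Q: "submodule ?Q R (Hm T t)"
    by (rule submodule_image[OF N left_module_Hm[OF t] f(1) submodule_carrier[OF N]])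
  obtain S :: "('i, 'e) mon set" and t' where t': "t' ` S \<subseteq> verts E"
    and iso: "lmod_iso R (Hm S t') (submod (Hm T t) ?Q)"
    by (rule submodule_Hm_iso[OF t Q])
  note lQ = H.submod_left_module[OF Q] and lS = left_module_Hm[OF t']
  have NQ: "lmod_iso R N (submod (Hm T t) ?Q)" by (rule lmod_hom_image_iso[OF f])
  have NS: "lmod_iso R N (Hm S t')" by (rule lmod_iso_trans[OF NQ lmod_iso_sym[OF lS iso]])
  have "finite S" by (rule fin_gen_Hm_finite[OF t' fin_gen_iso[OF N lS NS fg]])
  from has_type_iso[OF has_type_Hm[OF this t'] N lmod_iso_sym[OF N NS]] show ?thesis by blast
qed

text \<open>The complement \<open>L\<close> embeds through \<open>M\<close> into a sum of modules
  \<open>R p\<^sub>v\<close>, so it has a type as well, which serves as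
  \<open>\<delta>\<close>.\<close>

lemma has_type_summand:
  assumes M: "has_type M \<alpha>" and ids: "internal_direct_sum R M H L" and H: "has_type (submod M H) \<gamma>"
  shows "\<exists>\<delta>. gmeq E (\<gamma> + \<delta>) \<alpha>"
proof -
  have lM: "left_module R M" using M by (rule has_type_left_module)
  interpret M: left_module R M by (rule lM)
  obtain n :: nat and t where t: "t ` {..<n} \<subseteq> verts E" "type_of {..<n} t =
      \<alpha>" "lmod_iso R (Hm {..<n} t) M"
    using M by (auto simp: has_type_def)
  obtain f where f: "f \<in> lmod_hom R M (Hm {..<n} t)" "bij_betw f (carrier M) (carrier (Hm {..<n} t))"
    using lmod_iso_sym[OF left_module_Hm[OF t(1)] t(3)] by (auto simp: lmod_iso_def)
  have L: "submodule L R M" using ids by (simp add: internal_direct_sum_def)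
  then have LM: "L \<subseteq> carrier M" by (simp add: M.submodule_iff)
  have "f \<in> lmod_hom R (submod M L) (Hm {..<n} t)" using f(1) LM
    by (auto simp: lmod_hom_def subset_iff simp del: Hm_simps)
  moreover have "inj_on f (carrier (submod M L))"
    using f(2) LM by (auto simp: bij_betw_def intro: inj_on_subset)
  ultimately obtain \<delta> where \<delta>: "has_type (submod M L) \<delta>"
    using has_type_embed[OF M.submod_left_module[OF L] fin_gen_summand[OF lM ids
        fin_gen_has_type[OF M]] t(1)] by blast
  have "has_type M (\<gamma> + \<delta>)"
    by (rule has_type_iso[OF has_type_sum[OF H \<delta>] lM internal_direct_sumE[OF lM ids]])
  then show ?thesis using M has_type_unique by blast
qed

lemma direct_power_insert:
  fixes S :: "'a set" and A :: "('r, 'b) module"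
  assumes A: "left_module R A" and S: "finite S" "a \<notin> S"
  shows "lmod_iso R (direct_power (insert a S) A) (direct_sum A (direct_power S A))"
proof -
  interpret A: left_module R A by (rule A)
  note [simp del] = direct_power_simps(1)
  have Dc: "u \<in> carrier (direct_power T A) \<longleftrightarrow> u \<in> extensional T \<and> (\<forall>s\<in>T. u s \<in> carrier A)"
    if "finite T" for u and T :: "'a set"
    using that by (auto simp: direct_power_simps(1) PiE_def)
  note D1 = Dc[OF S(1)] and D2 = Dc[of "insert a S"]
  define f where "f u = (u a, restrict u S)" for u :: "'a \<Rightarrow> 'b"
  define f' where "f' p = (\<lambda>i\<in>insert a S. if i = a then fst p else snd p i)"
      for p :: "'b \<times> ('a \<Rightarrow> 'b)"
  have f: "f u \<in> carrier (direct_sum A (direct_power S A))"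
      if "u \<in> carrier (direct_power (insert a S) A)" for u
    using that S D1 D2 by (simp add: f_def)
  have f': "f' p \<in> carrier (direct_power (insert a S) A)"
      if "p \<in> carrier (direct_sum A (direct_power S A))" for p
    using that S D1 D2 by (auto simp: f'_def)
  have "f \<in> lmod_hom R (direct_power (insert a S) A) (direct_sum A (direct_power S A))"
    unfolding lmod_hom_def
  proof (intro CollectI conjI ballI Pi_I)
    fix u u' assume "u \<in> carrier (direct_power (insert a S) A)" "u' \<in>
        carrier (direct_power (insert a S) A)"
    then show "f (u \<oplus>\<^bsub>direct_power (insert a S) A\<^esub> u') =
        f u \<oplus>\<^bsub>direct_sum A (direct_power S A)\<^esub> f u'"
      by (auto simp: f_def fun_eq_iff)
  next
    fix c u assume "c \<in> carrier R" "u \<in> carrier (direct_power (insert a S) A)"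
    then show "f (c \<odot>\<^bsub>direct_power (insert a S) A\<^esub> u) = c \<odot>\<^bsub>direct_sum A (direct_power S A)\<^esub> f u"
      by (auto simp: f_def fun_eq_iff)
  qed (rule f)
  moreover have "bij_betw f (carrier (direct_power (insert a S) A)) (carrier (direct_sum A
      (direct_power S A)))"
  proof (rule bij_betw_byWitness[of _ f'])
    show "\<forall>u\<in>carrier (direct_power (insert a S) A). f' (f u) = u"
      using S D2 by (auto simp: f_def f'_def fun_eq_iff extensional_def)
    show "\<forall>p\<in>carrier (direct_sum A (direct_power S A)). f (f' p) = p"
      using S D1 by (auto simp: f_def f'_def fun_eq_iff extensional_def)
  qed (use f f' in blast)+
  ultimately show ?thesis by (rule lmod_isoI)
qed

lemma has_type_power:
  assumes A: "has_type A \<alpha>"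
  shows "has_type (direct_power {..<n::nat} A) (repeat_mset n \<alpha>)"
proof (induction n)
  case 0
  let ?E = "{} :: nat set"
  have c: "carrier (Hm ?E undefined) = {\<lambda>_. undefined}" by (auto simp: Hm_carrier)
  have "has_type (Hm ?E undefined) {#}" using has_type_Hm[of ?E undefined]
      by (simp add: type_of_def)
  moreover have "lmod_iso R (Hm ?E undefined) (direct_power ?E A)"
    by (rule lmod_isoI[of "\<lambda>_ _. undefined"]) (auto simp: lmod_hom_def c bij_betw_def fun_eq_iff)
  ultimately have "has_type (direct_power ?E A) {#}"
    using has_type_iso[OF _ left_module_direct_power[OF has_type_left_module[OF A]]] by blast
  then show ?case by simp
next
  case (Suc n)
  have lA: "left_module R A" using A by (rule has_type_left_module)
  note l = left_module_direct_power[OF lA]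
  have "lmod_iso R (direct_power (insert n {..<n}) A) (direct_sum A (direct_power {..<n} A))"
    by (rule direct_power_insert[OF lA]) auto
  from has_type_iso[OF has_type_sum[OF A Suc.IH] l lmod_iso_sym[OF l this]] show ?case
    by (simp add: lessThan_Suc)
qed

text \<open>A projective \<open>M\<close> embeds into a free module, but \<open>R\<close> itself is
  not a sum of modules \<open>R p\<^sub>v\<close>. The condition \<open>M = IM\<close> moves the
  image into the coordinates in \<open>I\<close>, and these split along the vertices.\<close>

lemma FP_has_type:
  assumes "M \<in> FP R I"
  shows "\<exists>\<alpha>. has_type M \<alpha>"
proof -
  have M: "left_module R M" and fg: "finitely_generated R M" and proj: "projective R M"
    and IM: "carrier M = smult_span M I (carrier M)" using assms by (auto simp: FP_def)
  interpret M: left_module R M by (rule M)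
  obtain S :: "'a set" and H L where ids: "internal_direct_sum R (direct_power S (regular_module R)) H L"
    and iso: "lmod_iso R M (submod (direct_power S (regular_module R)) H)"
    using proj by (auto simp: projective_def iso_direct_summand_def)
  let ?D = "direct_power S (regular_module R)"
  interpret D: left_module R ?D by (rule left_module_dp)
  have H: "submodule H R ?D" using ids by (simp add: internal_direct_sum_def)
  then have HD: "H \<subseteq> carrier ?D" by (simp add: D.submodule_iff)
  obtain f where f: "f \<in> lmod_hom R M (submod ?D H)" "bij_betw f (carrier M) H"
    using iso by (auto simp: lmod_iso_def)
  have fD: "f \<in> lmod_hom R M ?D" using f(1) HD by (auto simp: lmod_hom_def)
  have finj: "inj_on f (carrier M)" using f(2) by (simp add: bij_betw_def)
  define W where "W = {u \<in> carrier ?D. \<forall>s\<in>S. u s \<in> I}"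
  have Iz: "\<zero> \<in> I" and Ia: "\<And>a b. a \<in> I \<Longrightarrow> b \<in> I \<Longrightarrow> a \<oplus> b \<in> I"
    and Il: "\<And>a b. a \<in> I \<Longrightarrow> b \<in> carrier R \<Longrightarrow> b \<otimes> a \<in> I"
    and Ir: "\<And>a b. a \<in> I \<Longrightarrow> b \<in> carrier R \<Longrightarrow> a \<otimes> b \<in> I"
    using ideal.axioms(1)[OF ideal] ideal.I_l_closed[OF ideal] ideal.I_r_closed[OF ideal]
    by (auto simp: additive_subgroup.zero_closed additive_subgroup.a_closed)
  have W: "submodule W R ?D"
    unfolding D.submodule_iff
  proof (intro conjI ballI)
    show "W \<subseteq> carrier ?D" by (auto simp: W_def)
    show "\<zero>\<^bsub>?D\<^esub> \<in> W"
      unfolding W_def using D.zero_closed Iz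
          by (simp del: direct_power_simps(1)) (simp add: regular_module_def)
    fix x assume x: "x \<in> W"
    show "x \<oplus>\<^bsub>?D\<^esub> y \<in> W" if "y \<in> W" for y
      using x that D.a_closed[of x y] Ia unfolding W_def
          by (simp del: direct_power_simps(1)) (simp add: regular_module_def)
    show "a \<odot>\<^bsub>?D\<^esub> x \<in> W" if "a \<in> carrier R" for a
      using x that D.smult_closed[of a x] Il unfolding W_def
          by (simp del: direct_power_simps(1)) (simp add: regular_module_def)
  qed
  \<comment> \<open>The ideal is two-sided: a factor from \<open>I\<close> on the left puts every
    coordinate into \<open>I\<close>.\<close>
  have fW: "f m \<in> W" if m: "m \<in> carrier M" for m
  proof -
    have "smult_span M I (carrier M) \<subseteq> {x \<in> carrier M. f x \<in> W}"
    proof (rule smult_span_least[OF M submodule_vimage[OF M left_module_dp fD W]])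
      fix a x assume a: "a \<in> I" and x: "x \<in> carrier M"
      have ac: "a \<in> carrier R" using a I_carrier by blast
      have fx: "f x \<in> carrier ?D" using lmod_homD(1)[OF fD x] .
      have "f (a \<odot>\<^bsub>M\<^esub> x) = a \<odot>\<^bsub>?D\<^esub> f x" using lmod_homD(3)[OF fD ac x] .
      moreover have "a \<odot>\<^bsub>?D\<^esub> f x \<in> W"
        using D.smult_closed[OF ac fx] a fx Ir unfolding W_def
        by (simp del: direct_power_simps(1)) (auto simp: regular_module_def)
      ultimately show "a \<odot>\<^bsub>M\<^esub> x \<in> {x \<in> carrier M. f x \<in> W}" using M.smult_closed[OF ac x] by simp
    qed
    then show ?thesis using m IM by blast
  qed
  let ?T = "S \<times> verts E"
  \<comment> \<open>Each coordinate is cut into its pieces \<open>u s \<otimes> P v\<close>. A right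
    local unit makes almost all pieces vanish and lets the others add up to the coordinate, which
    gives finite support and injectivity.\<close>
  define \<kappa> where "\<kappa> u = (\<lambda>p\<in>?T. u (fst p) \<otimes> P (snd p))" for u :: "'a \<Rightarrow> 'r"
  have tT: "snd ` ?T \<subseteq> verts E" by auto
  have \<kappa>c: "\<kappa> u \<in> carrier (Hm ?T snd)" if u: "u \<in> W" for u
  proof -
    have uc: "u s \<in> I" "u s \<in> carrier R" if "s \<in> S" for s using u that I_carrier
        by (auto simp: W_def)
    have "\<exists>V\<subseteq>verts E. finite V \<and> (\<forall>v\<in>verts E. v \<notin> V \<longrightarrow> u s \<otimes> P v = \<zero>)" if s: "s \<in> S" for s
    proof -
      obtain V where V: "V \<subseteq> verts E" "finite V" "u s \<otimes> (\<Oplus>v\<in>V. P v) = u s"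
        using ex_right_unit[OF uc(1)[OF s]] by blast
      have Pc: "P \<in> V \<rightarrow> carrier R" using V by auto
      have "u s \<otimes> P v = \<zero>" if v: "v \<in> verts E" "v \<notin> V" for v
      proof -
        have "(\<Oplus>w\<in>V. P w) \<otimes> P v = (\<Oplus>w\<in>V. P w \<otimes> P v)" using V v Pc by (intro finsum_ldistr) auto
        also have "\<dots> = (\<Oplus>w\<in>V. \<zero>)" using V v by (intro finsum_cong') (auto simp: PP subset_iff)
        finally have "(\<Oplus>w\<in>V. P w) \<otimes> P v = \<zero>" by simp
        then show ?thesis
          using m_assoc[of "u s" "\<Oplus>v\<in>V. P v" "P v"] finsum_closed[OF Pc] uc(2)[OF s] V(3) v by simp
      qed
      with V show ?thesis by blast
    qed
    then obtain V where V: "\<And>s. s \<in> S \<Longrightarrow> finite (V s)" "\<And>s v. s \<in> S \<Longrightarrow> v \<in> verts E \<Longrightarrow> v \<notin> V s \<Longrightarrow> u s \<otimes>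
        P v = \<zero>"
      by metis
    have "{p \<in> ?T. \<kappa> u p \<noteq> \<zero>} \<subseteq> (\<Union>s\<in>{s \<in> S. u s \<noteq> \<zero>}. {s} \<times> V s)"
      using V(2) by (force simp: \<kappa>_def)
    moreover have "finite {s \<in> S. u s \<noteq> \<zero>}" using u by (auto simp: W_def regular_module_def)
    ultimately have "finite {p \<in> ?T. \<kappa> u p \<noteq> \<zero>}" using V(1) by (elim finite_subset) auto
    then show ?thesis using uc unfolding Hm_carrier by (auto simp: \<kappa>_def m_assoc PP)
  qed
  have "\<kappa> \<circ> f \<in> lmod_hom R M (Hm ?T snd)"
    unfolding lmod_hom_def
  proof (intro CollectI conjI ballI Pi_I)
    show "(\<kappa> \<circ> f) x \<in> carrier (Hm ?T snd)" if "x \<in> carrier M" for x using \<kappa>c fW that by simp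
    fix x assume x: "x \<in> carrier M"
    have fxs: "s \<in> S \<Longrightarrow> f x s \<in> carrier R" for s using lmod_homD(1)[OF fD x]
        by (auto simp: regular_module_def)
    show "(\<kappa> \<circ> f) (x \<oplus>\<^bsub>M\<^esub> y) = (\<kappa> \<circ> f) x \<oplus>\<^bsub>Hm ?T snd\<^esub> (\<kappa> \<circ> f) y" if y: "y \<in> carrier M" for y
    proof -
      have fys: "s \<in> S \<Longrightarrow> f y s \<in> carrier R" for s using lmod_homD(1)[OF fD y]
          by (auto simp: regular_module_def)
      show ?thesis using lmod_homD(2)[OF fD x y] fxs fys
        by (auto simp: \<kappa>_def fun_eq_iff l_distr regular_module_def)
    qed
    show "(\<kappa> \<circ> f) (a \<odot>\<^bsub>M\<^esub> x) = a \<odot>\<^bsub>Hm ?T snd\<^esub> (\<kappa> \<circ> f) x" if a: "a \<in> carrier R" for a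
      using lmod_homD(3)[OF fD a x] fxs a
          by (auto simp: \<kappa>_def fun_eq_iff m_assoc regular_module_def)
  qed
  moreover from this have "inj_on (\<kappa> \<circ> f) (carrier M)"
  proof (rule inj_onI_kernel[OF M left_module_Hm[OF tT]])
    fix x assume x: "x \<in> carrier M" "(\<kappa> \<circ> f) x = \<zero>\<^bsub>Hm ?T snd\<^esub>"
    have fx: "f x \<in> carrier ?D" "\<And>s. s \<in> S \<Longrightarrow> f x s \<in> I" using fW[OF x(1)] by (auto simp: W_def)
    have "f x s = \<zero>" if s: "s \<in> S" for s
    proof -
      obtain V where V: "V \<subseteq> verts E" "finite V" "f x s \<otimes> (\<Oplus>v\<in>V. P v) = f x s"
        using ex_right_unit[OF fx(2)[OF s]] by blast
      have c: "f x s \<in> carrier R" using fx(2)[OF s] I_carrier by blast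
      have "f x s \<otimes> (\<Oplus>v\<in>V. P v) = (\<Oplus>v\<in>V. f x s \<otimes> P v)" using V c by (intro finsum_rdistr) auto
      also have "\<dots> = (\<Oplus>v\<in>V. \<zero>)"
      proof (rule finsum_cong'[OF HOL.refl])
        fix v assume v: "v \<in> V"
        then have "v \<in> verts E" using V by blast
        then show "f x s \<otimes> P v = \<zero>" using fun_cong[OF x(2), of "(s, v)"] s by (simp add: \<kappa>_def)
      qed simp
      finally show ?thesis using V(3) by simp
    qed
    then have "f x = \<zero>\<^bsub>?D\<^esub>" using fx(1) by (auto simp: regular_module_def fun_eq_iff PiE_def
        extensional_def)
    then have "f x = f \<zero>\<^bsub>M\<^esub>" using lmod_hom_zero[OF M left_module_dp fD] by simp
    then show "x = \<zero>\<^bsub>M\<^esub>" using inj_onD[OF finj] x(1) M.zero_closed by blast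
  qed
  ultimately show ?thesis using has_type_embed[OF M _ tT] fg finitely_generated_iff[OF M] by blast
qed

lemma has_type_FP:
  fixes M :: "('r, nat \<Rightarrow> 'r) module"
  assumes "has_type M \<alpha>"
  shows "M \<in> FP R I"
proof -
  have M: "left_module R M" using assms by (rule has_type_left_module)
  interpret M: left_module R M by (rule M)
  obtain n :: nat and t where t: "t ` {..<n} \<subseteq> verts E" "lmod_iso R (Hm {..<n} t) M"
    using assms by (auto simp: has_type_def)
  interpret H: left_module R "Hm {..<n} t" by (rule left_module_Hm[OF t(1)])
  obtain f where f: "f \<in> lmod_hom R (Hm {..<n} t) M" "bij_betw f (carrier (Hm {..<n} t)) (carrier M)"
    using t(2) by (auto simp: lmod_iso_def)
  have "carrier M = smult_span M I (carrier M)"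
  proof
    have W: "submodule (smult_span M I (carrier M)) R M"
      using I_carrier ideal.I_l_closed[OF ideal] by (intro smult_span_submodule[OF M]) auto
    then show "smult_span M I (carrier M) \<subseteq> carrier M" by (simp add: M.submodule_iff)
    have "{u \<in> carrier (Hm {..<n} t). f u \<in> smult_span M I (carrier M)} = carrier (Hm {..<n} t)"
    proof (rule Hm_gen[OF t(1) submodule_vimage[OF left_module_Hm[OF t(1)] M f(1) W]])
      fix s assume s: "s \<in> {..<n}"
      then have ts: "t s \<in> verts E" using t(1) by auto
      let ?g = "single {..<n} s (P (t s))"
      have g: "?g \<in> carrier (Hm {..<n} t)" using single_P_Hm[OF t(1) s] .
      have "P (t s) \<odot>\<^bsub>Hm {..<n} t\<^esub> ?g = ?g" using ts by (simp add: single_smult PP del: Hm_simps)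
      then have "f ?g = P (t s) \<odot>\<^bsub>M\<^esub> f ?g" using lmod_homD(3)[OF f(1) P_carrier[OF ts] g] by simp
      moreover have "P (t s) \<odot>\<^bsub>M\<^esub> f ?g \<in> smult_span M I (carrier M)"
        unfolding smult_span_def using P_I[OF ts] lmod_homD(1)[OF f(1) g]
            by (intro generate.incl) blast
      ultimately show "?g \<in> {u \<in> carrier (Hm {..<n} t). f u \<in> smult_span M I (carrier M)}" using g
          by simp
    qed
    then have "f ` carrier (Hm {..<n} t) \<subseteq> smult_span M I (carrier M)" by blast
    then show "carrier M \<subseteq> smult_span M I (carrier M)" using f(2) by (simp add: bij_betw_def)
  qed
  moreover have "projective R M"
  proof -
    \<comment> \<open>The definition of \<open>projective\<close> takes the basis from the carrier
      type of \<open>M\<close>, here \<open>nat \<Rightarrow> 'r\<close>. The indices are encoded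
      there, injectively because each \<open>P (t i)\<close> is nonzero.\<close>
    define h where "h i = (\<lambda>k. if k = i then P (t i) else \<zero>)" for i :: nat
    have hinj: "inj_on h {..<n}"
    proof (rule inj_onI)
      fix i j assume ij: "i \<in> {..<n}" "j \<in> {..<n}" "h i = h j"
      have "h i i = h j i" by (simp only: ij(3))
      then have "P (t i) = (if i = j then P (t j) else \<zero>)" by (simp add: h_def)
      moreover have "P (t i) \<noteq> \<zero>" using ij(1) t(1) P_nonzero by auto
      ultimately show "i = j" by (auto split: if_splits)
    qed
    let ?S = "h ` {..<n}" and ?t = "t \<circ> inv_into {..<n} h"
    let ?D = "direct_power ?S (regular_module R)"
    have tS: "?t ` ?S \<subseteq> verts E" using t(1) hinj by auto
    have bij: "bij_betw h {..<n} ?S" using hinj by (simp add: bij_betw_def)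
    have "lmod_iso R (Hm ?S ?t) (Hm {..<n} t)" by (rule Hm_reindex[OF bij]) (use hinj in auto)
    then have "lmod_iso R (Hm ?S ?t) M" using t(2) by (rule lmod_iso_trans)
    then have iso: "lmod_iso R M (Hm ?S ?t)" by (rule lmod_iso_sym[OF left_module_Hm[OF tS]])
    interpret D: left_module R ?D by (rule left_module_dp)
    define H where "H = {u \<in> carrier ?D. \<forall>s\<in>?S. u s \<otimes> P (?t s) = u s}"
    \<comment> \<open>The complement consists of the elements annihilated by the idempotents on the
      right, by the Peirce decomposition of each coordinate.\<close>
    define L where "L = {u \<in> carrier ?D. \<forall>s\<in>?S. u s \<otimes> P (?t s) = \<zero>}"
    have Pc: "P (?t s) \<in> carrier R" "P (?t s) \<otimes> P (?t s) = P (?t s)" if "s \<in> ?S" for s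
      using tS that by (auto simp: image_subset_iff PP)
    have Dc: "u \<in> carrier ?D \<longleftrightarrow> u \<in> extensional ?S \<and> (\<forall>s\<in>?S. u s \<in> carrier R)" for u
      by (auto simp: regular_module_def PiE_def)
    have "internal_direct_sum R ?D H L"
      unfolding internal_direct_sum_def
    proof (intro conjI)
      show H: "submodule H R ?D" unfolding H_def by (rule submodule_Hm[OF tS])
      show L: "submodule L R ?D"
        unfolding D.submodule_iff
      proof (intro conjI ballI)
        show "L \<subseteq> carrier ?D" by (auto simp: L_def)
        show "\<zero>\<^bsub>?D\<^esub> \<in> L"
          unfolding L_def Dc using Pc by (auto simp: regular_module_def)
        fix x assume x: "x \<in> L"
        show "x \<oplus>\<^bsub>?D\<^esub> y \<in> L" if "y \<in> L" for y
          using x that Pc unfolding L_def Dc by (simp add: regular_module_def l_distr)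
        show "a \<odot>\<^bsub>?D\<^esub> x \<in> L" if "a \<in> carrier R" for a
          using x that Pc unfolding L_def Dc by (simp add: regular_module_def m_assoc)
      qed
      show "H <+>\<^bsub>?D\<^esub> L = carrier ?D"
      proof (intro Set.set_eqI iffI)
        fix z assume "z \<in> H <+>\<^bsub>?D\<^esub> L"
        then obtain x y where "x \<in> H" "y \<in> L" "z = x \<oplus>\<^bsub>?D\<^esub> y" by (auto simp: set_add_iff)
        then show "z \<in> carrier ?D" using D.a_closed[of x y] unfolding H_def L_def by blast
      next
        fix z assume z: "z \<in> carrier ?D"
        let ?x = "\<lambda>s\<in>?S. z s \<otimes> P (?t s)" and ?y = "\<lambda>s\<in>?S. z s \<ominus> z s \<otimes> P (?t s)"
        have "?x \<in> H" unfolding H_def Dc using z Pc unfolding Dc by (simp add: m_assoc)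
        moreover have "?y \<in> L"
          unfolding L_def Dc using z Pc unfolding Dc
              by (simp add: minus_eq l_distr l_minus m_assoc r_neg)
        moreover have "z = ?x \<oplus>\<^bsub>?D\<^esub> ?y"
        proof
          fix s
          show "z s = (?x \<oplus>\<^bsub>?D\<^esub> ?y) s"
          proof (cases "s \<in> ?S")
            case True
            then have "z s \<in> carrier R" "z s \<otimes> P (?t s) \<in> carrier R" using z Pc unfolding Dc by auto
            then have "z s \<otimes> P (?t s) \<oplus> (z s \<ominus> z s \<otimes> P (?t s)) = z s"
              using a_lcomm[of "z s \<otimes> P (?t s)" "z s" "\<ominus> (z s \<otimes> P (?t s))"]
              by (simp add: minus_eq r_neg)
            then show ?thesis using True by (simp add: regular_module_def)
          qed (use z in \<open>auto simp: Dc extensional_def\<close>)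
        qed
        ultimately show "z \<in> H <+>\<^bsub>?D\<^esub> L" unfolding set_add_iff by blast
      qed
      show "H \<inter> L = {\<zero>\<^bsub>?D\<^esub>}"
      proof
        show "H \<inter> L \<subseteq> {\<zero>\<^bsub>?D\<^esub>}"
        proof
          fix u assume u: "u \<in> H \<inter> L"
          have "u = \<zero>\<^bsub>?D\<^esub>"
          proof
            fix s
            show "u s = \<zero>\<^bsub>?D\<^esub> s"
            proof (cases "s \<in> ?S")
              case True
              then have "u s \<otimes> P (?t s) = u s" "u s \<otimes> P (?t s) = \<zero>" using u unfolding H_def L_def
                  by blast+
              then show ?thesis using True by (simp add: regular_module_def)
            qed (use u in \<open>auto simp: H_def Dc extensional_def simp del: direct_power_simps(1)\<close>)
          qed
          then show "u \<in> {\<zero>\<^bsub>?D\<^esub>}" by blast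
        qed
        show "{\<zero>\<^bsub>?D\<^esub>} \<subseteq> H \<inter> L" using H L unfolding D.submodule_iff by blast
      qed
    qed
    moreover have "Hm ?S ?t = submod ?D H" by (simp only: Hm_def H_def)
    ultimately show ?thesis
      unfolding projective_def iso_direct_summand_def using iso by metis
  qed
  ultimately show ?thesis
    using M fin_gen_has_type[OF assms] finitely_generated_iff[OF M] by (simp add: FP_def)
qed

end

section \<open>Enveloping groups\<close>

lemma (in comm_monoid) env_rel_iff:
  "((a, b), (c, d)) \<in> env_rel G \<longleftrightarrow> a \<in> carrier G \<and> b \<in> carrier G \<and> c \<in> carrier G \<and> d \<in> carrier G \<and>
     (\<exists>e\<in>carrier G. a \<otimes> d \<otimes> e = c \<otimes> b \<otimes> e)"
  by (auto simp: env_rel_def)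

lemma (in comm_monoid) env_rel_equiv: "equiv (carrier G \<times> carrier G) (env_rel G)"
proof (rule equivI)
  show "env_rel G \<subseteq> (carrier G \<times> carrier G) \<times> (carrier G \<times> carrier G)" by (auto simp: env_rel_iff)
  show "refl_on (carrier G \<times> carrier G) (env_rel G)"
    by (auto simp: refl_on_def env_rel_iff)
  show "sym (env_rel G)"
    by (rule symI) (auto simp: env_rel_iff, metis)
  show "trans (env_rel G)"
  proof (rule transI)
    fix x y z assume xy: "(x, y) \<in> env_rel G" and yz: "(y, z) \<in> env_rel G"
    obtain a b c d p q where abc: "x = (a, b)" "y = (c, d)" "z = (p, q)" by (metis surj_pair)
    from xy obtain e where e: "a \<in> carrier G" "b \<in> carrier G" "c \<in> carrier G" "d \<in> carrier G" "e \<in>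
        carrier G"
      "a \<otimes> d \<otimes> e = c \<otimes> b \<otimes> e" by (auto simp: abc env_rel_iff)
    from yz obtain f where f: "p \<in> carrier G" "q \<in> carrier G" "f \<in> carrier G"
      "c \<otimes> q \<otimes> f = p \<otimes> d \<otimes> f" by (auto simp: abc env_rel_iff)
    \<comment> \<open>In the absence of cancellation the middle pair cannot be removed, so
      \<open>c \<otimes> d\<close> joins the witnesses \<open>e\<close> and
      \<open>f\<close>.\<close>
    have "a \<otimes> q \<otimes> (c \<otimes> d \<otimes> e \<otimes> f) = (a \<otimes> d \<otimes> e) \<otimes> (c \<otimes> q \<otimes> f)" using e(1-5) f(1-3)
        by (simp add: m_ac)
    also have "\<dots> = (c \<otimes> b \<otimes> e) \<otimes> (p \<otimes> d \<otimes> f)" using e f by simp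
    also have "\<dots> = p \<otimes> b \<otimes> (c \<otimes> d \<otimes> e \<otimes> f)" using e(1-5) f(1-3) by (simp add: m_ac)
    finally show "(x, z) \<in> env_rel G" unfolding abc env_rel_iff using e f
      by (intro conjI bexI[of _ "c \<otimes> d \<otimes> e \<otimes> f"]) auto
  qed
qed

text \<open>Equality in the enveloping group is equality in the monoid up to a common summand
  \<open>e\<close>. Adding \<open>e\<close> to both parts of a formal difference leaves its class
  unchanged and turns the hypothesis into an inequality of the monoid.\<close>

theorem (in comm_monoid) unperforated_env_group:
  assumes unp: "unperforated_monoid G"
  shows "unperforated_group (env_group G) (env_cone G)"
proof -
  let ?E = "env_group G"
  define c where "c a b = env_rel G `` {(a, b)}" for a b
  note equiv = env_rel_equiv
  have ceq: "c a b = c a' b' \<longleftrightarrow> (\<exists>e\<in>carrier G. a \<otimes> b' \<otimes> e = a' \<otimes> b \<otimes> e)"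
    if "a \<in> carrier G" "b \<in> carrier G" "a' \<in> carrier G" "b' \<in> carrier G" for a b a' b'
    unfolding c_def using that by (subst eq_equiv_class_iff[OF equiv]) (auto simp: env_rel_iff)
  have carr: "carrier ?E = {c a b | a b. a \<in> carrier G \<and> b \<in> carrier G}"
    by (auto simp: env_group_def quotient_def c_def)
  have memc: "(x, y) \<in> c a b \<longleftrightarrow> a \<in> carrier G \<and> b \<in> carrier G \<and> x \<in> carrier G \<and> y \<in> carrier G \<and>
      c x y = c a b"
    for x y a b
  proof
    assume "(x, y) \<in> c a b"
    then have r: "((a, b), (x, y)) \<in> env_rel G" by (simp add: c_def)
    then have "c a b = c x y" unfolding c_def by (rule equiv_class_eq[OF equiv])
    with r show "a \<in> carrier G \<and> b \<in> carrier G \<and> x \<in> carrier G \<and> y \<in> carrier G \<and> c x y = c a b"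
      by (simp add: env_rel_iff)
  next
    assume "a \<in> carrier G \<and> b \<in> carrier G \<and> x \<in> carrier G \<and> y \<in> carrier G \<and> c x y = c a b"
    then show "(x, y) \<in> c a b" unfolding c_def using equiv_class_self[OF equiv, of "(x, y)"] by auto
  qed
  have mult: "c a b \<otimes>\<^bsub>?E\<^esub> c a' b' = c (a \<otimes> a') (b \<otimes> b')"
    if ab: "a \<in> carrier G" "b \<in> carrier G" "a' \<in> carrier G" "b' \<in> carrier G" for a b a' b'
  proof -
    \<comment> \<open>The product of classes is a union over representatives; all of them yield the
      same class.\<close>
    have const: "c (x \<otimes> x') (y \<otimes> y') = c (a \<otimes> a') (b \<otimes> b')"
      if xy: "(x, y) \<in> c a b" and xy': "(x', y') \<in> c a' b'" for x y x' y'
    proof -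
      from xy obtain e where e: "x \<in> carrier G" "y \<in> carrier G" "e \<in> carrier G" "x \<otimes> b \<otimes> e = a \<otimes> y \<otimes>
          e"
        using ab unfolding memc by (auto simp: ceq)
      from xy' obtain f where f: "x' \<in> carrier G" "y' \<in> carrier G" "f \<in> carrier G" "x' \<otimes> b' \<otimes> f =
          a' \<otimes> y' \<otimes> f"
        using ab unfolding memc by (auto simp: ceq)
      have "x \<otimes> x' \<otimes> (b \<otimes> b') \<otimes> (e \<otimes> f) = (x \<otimes> b \<otimes> e) \<otimes> (x' \<otimes> b' \<otimes> f)" using ab e(1-3) f(1-3)
          by (simp add: m_ac)
      also have "\<dots> = (a \<otimes> y \<otimes> e) \<otimes> (a' \<otimes> y' \<otimes> f)" using e f by simp
      also have "\<dots> = a \<otimes> a' \<otimes> (y \<otimes> y') \<otimes> (e \<otimes> f)" using ab e(1-3) f(1-3) by (simp add: m_ac)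
      finally show ?thesis using ab e f by (auto simp: ceq)
    qed
    have self: "(a, b) \<in> c a b" "(a', b') \<in> c a' b'" using ab by (simp_all add: memc)
    have eq: "c a b \<otimes>\<^bsub>?E\<^esub> c a' b' = (\<Union>p\<in>c a b. \<Union>q\<in>c a' b'. c (fst p \<otimes> fst q) (snd p \<otimes> snd q))"
      by (simp add: env_group_def c_def split_beta)
    have "(\<Union>p\<in>c a b. \<Union>q\<in>c a' b'. c (fst p \<otimes> fst q) (snd p \<otimes> snd q)) =
      (\<Union>p\<in>c a b. \<Union>q\<in>c a' b'. c (a \<otimes> a') (b \<otimes> b'))"
      by (intro SUP_cong HOL.refl const) simp_all
    also have "\<dots> = c (a \<otimes> a') (b \<otimes> b')" using self by blast
    finally show ?thesis using eq by simp
  qed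
  have one: "\<one>\<^bsub>?E\<^esub> = c \<one> \<one>" by (simp add: env_group_def c_def)
  have grp: "comm_group ?E"
  proof (rule comm_groupI)
    fix x y assume "x \<in> carrier ?E" "y \<in> carrier ?E"
    then obtain a b d e where x: "a \<in> carrier G" "b \<in> carrier G" "x = c a b"
      and y: "d \<in> carrier G" "e \<in> carrier G" "y = c d e" unfolding carr by blast
    show "x \<otimes>\<^bsub>?E\<^esub> y \<in> carrier ?E" unfolding carr using x y mult by blast
    show "x \<otimes>\<^bsub>?E\<^esub> y = y \<otimes>\<^bsub>?E\<^esub> x" using x y by (simp add: mult m_comm)
    fix z assume "z \<in> carrier ?E"
    then obtain f g where "f \<in> carrier G" "g \<in> carrier G" "z = c f g" unfolding carr by blast
    with x y show "x \<otimes>\<^bsub>?E\<^esub> y \<otimes>\<^bsub>?E\<^esub> z = x \<otimes>\<^bsub>?E\<^esub> (y \<otimes>\<^bsub>?E\<^esub> z)" by (simp add: mult m_assoc)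
  next
    show "\<one>\<^bsub>?E\<^esub> \<in> carrier ?E" unfolding carr one by blast
  next
    fix x assume "x \<in> carrier ?E"
    then obtain a b where x: "a \<in> carrier G" "b \<in> carrier G" "x = c a b" unfolding carr by blast
    then show "\<one>\<^bsub>?E\<^esub> \<otimes>\<^bsub>?E\<^esub> x = x" by (simp add: mult one)
  next
    fix x assume "x \<in> carrier ?E"
    then obtain a b where x: "a \<in> carrier G" "b \<in> carrier G" "x = c a b" by (auto simp: carr)
    have "c b a \<otimes>\<^bsub>?E\<^esub> x = \<one>\<^bsub>?E\<^esub>" using x by (auto simp: mult one ceq m_ac)
    then show "\<exists>y\<in>carrier ?E. y \<otimes>\<^bsub>?E\<^esub> x = \<one>\<^bsub>?E\<^esub>" using x by (auto simp: carr)
  qed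
  interpret E: comm_group ?E by (rule grp)
  have pow: "c a b [^]\<^bsub>?E\<^esub> n = c (a [^] n) (b [^] n)" if "a \<in> carrier G" "b \<in> carrier G" for a b
      and n :: nat
    using that by (induction n) (auto simp: one mult)
  have cone: "env_cone G = {c a \<one> | a. a \<in> carrier G}" by (simp add: env_cone_def c_def)
  have sub: "Group.submonoid (env_cone G) ?E"
  proof
    show "env_cone G \<subseteq> carrier ?E" by (auto simp: cone carr)
    show "\<one>\<^bsub>?E\<^esub> \<in> env_cone G" by (auto simp: cone one)
    fix x y assume "x \<in> env_cone G" "y \<in> env_cone G"
    then obtain a b where "a \<in> carrier G" "b \<in> carrier G" "x = c a \<one>" "y = c b \<one>"
        by (auto simp: cone)
    then show "x \<otimes>\<^bsub>?E\<^esub> y \<in> env_cone G" by (auto simp: cone mult)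
  qed
  have "g \<in> env_cone G" if g: "g \<in> carrier ?E" and n: "n > 0" and gn: "g [^]\<^bsub>?E\<^esub> n \<in> env_cone G"
      for g and n :: nat
  proof -
    obtain a b where ab: "a \<in> carrier G" "b \<in> carrier G" "g = c a b" using g by (auto simp: carr)
    obtain z where z: "z \<in> carrier G" "c (a [^] n) (b [^] n) = c z \<one>" using gn ab
        by (auto simp: pow cone)
    then obtain e where e: "e \<in> carrier G" "a [^] n \<otimes> \<one> \<otimes> e = z \<otimes> b [^] n \<otimes> e" using ab
        by (auto simp: ceq)
    obtain m where m: "n = Suc m" using n by (cases n) auto
    \<comment> \<open>Additively, \<open>n (a + e) = (n a + e) + m e\<close> with
      \<open>m = n - 1\<close>: one copy of \<open>e\<close> serves the equation, the others are
      carried along.\<close>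
    have "(a \<otimes> e) [^] n = (a [^] n \<otimes> e) \<otimes> e [^] m"
      using ab(1,2) e(1) unfolding m by (simp add: pow_mult_distrib m_ac)
    also have "\<dots> = (z \<otimes> b [^] n \<otimes> e) \<otimes> e [^] m" using ab(1,2) e by simp
    also have "\<dots> = (b \<otimes> e) [^] n \<otimes> z"
      using ab(1,2) e(1) z(1) unfolding m by (simp add: pow_mult_distrib m_ac)
    finally have "alg_le G ((b \<otimes> e) [^] n) ((a \<otimes> e) [^] n)" unfolding alg_le_def using z by blast
    then have "alg_le G (b \<otimes> e) (a \<otimes> e)" using unp n ab e unfolding unperforated_monoid_def by blast
    then obtain y where y: "y \<in> carrier G" "a \<otimes> e = b \<otimes> e \<otimes> y" by (auto simp: alg_le_def)
    have "c a b = c y \<one>" using ab y e by (auto simp: ceq intro!: bexI[of _ e]) (simp add: m_ac)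
    then show ?thesis using y ab by (auto simp: cone)
  qed
  with grp sub show ?thesis by (auto simp: unperforated_group_def)
qed

section \<open>The monoid of isomorphism classes\<close>

context graph_alg
begin

text \<open>The refinement takes place in the graph monoid; \<open>has_type_split\<close> realizes
  the pieces as actual submodules of \<open>A1\<close> and \<open>A2\<close>.\<close>

theorem refinement_FP: "refinement_property R (FP R I :: ('r, 'm) module set)"
  unfolding refinement_property_def
proof (intro ballI impI)
  fix A1 A2 B1 B2 :: "('r, 'm) module"
  assume FP: "A1 \<in> FP R I" "A2 \<in> FP R I" "B1 \<in> FP R I" "B2 \<in> FP R I"
    and iso: "lmod_iso R (direct_sum A1 A2) (direct_sum B1 B2)"
  obtain \<alpha>1 \<alpha>2 \<beta>1 \<beta>2 where t: "has_type A1 \<alpha>1" "has_type A2 \<alpha>2" "has_type B1 \<beta>1" "has_type B2 \<beta>2"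
    using FP FP_has_type by metis
  have "has_type (direct_sum B1 B2) (\<alpha>1 + \<alpha>2)"
    using has_type_iso[OF has_type_sum[OF t(1,2)] _ iso]
        has_type_left_module[OF has_type_sum[OF t(3,4)]] by blast
  then have "gmeq E (\<alpha>1 + \<alpha>2) (\<beta>1 + \<beta>2)" using has_type_sum[OF t(3,4)] by (rule has_type_unique)
  then obtain \<gamma>11 \<gamma>12 \<gamma>21 \<gamma>22 where g: "gmeq E \<alpha>1 (\<gamma>11 + \<gamma>12)" "gmeq E \<alpha>2 (\<gamma>21 + \<gamma>22)"
    "gmeq E \<beta>1 (\<gamma>11 + \<gamma>21)" "gmeq E \<beta>2 (\<gamma>12 + \<gamma>22)" by (rule tame_refinement[OF tame])
  obtain A11 A12 where 1: "internal_direct_sum R A1 A11 A12" "has_type (submod A1 A11) \<gamma>11"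
      "has_type (submod A1 A12) \<gamma>12"
    using has_type_split t(1) has_type_meq[OF g(1)] by metis
  obtain A21 A22 where 2: "internal_direct_sum R A2 A21 A22" "has_type (submod A2 A21) \<gamma>21"
      "has_type (submod A2 A22) \<gamma>22"
    using has_type_split t(2) has_type_meq[OF g(2)] by metis
  have "lmod_iso R (direct_sum (submod A1 A11) (submod A2 A21)) B1"
    using has_type_same[OF has_type_sum[OF 1(2) 2(2)]] t(3) has_type_meq[OF g(3)] by blast
  moreover have "lmod_iso R (direct_sum (submod A1 A12) (submod A2 A22)) B2"
    using has_type_same[OF has_type_sum[OF 1(3) 2(3)]] t(4) has_type_meq[OF g(4)] by blast
  ultimately show "\<exists>A11 A12 A21 A22. internal_direct_sum R A1 A11 A12 \<and>
      internal_direct_sum R A2 A21 A22 \<and>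
      lmod_iso R (direct_sum (submod A1 A11) (submod A2 A21)) B1 \<and>
      lmod_iso R (direct_sum (submod A1 A12) (submod A2 A22)) B2" using 1(1) 2(1) by blast
qed

lemma has_type_iso_summand:
  assumes "has_type C \<gamma>" "has_type M \<alpha>" "iso_direct_summand R C M"
  shows "\<exists>\<delta>. gmeq E (\<gamma> + \<delta>) \<alpha>"
proof -
  obtain H L where ids: "internal_direct_sum R M H L" and iso: "lmod_iso R C (submod M H)"
    using assms(3) by (auto simp: iso_direct_summand_def)
  interpret M: left_module R M by (rule has_type_left_module[OF assms(2)])
  have "left_module R (submod M H)"
    using ids by (intro M.submod_left_module) (simp add: internal_direct_sum_def)
  from has_type_summand[OF assms(2) ids has_type_iso[OF assms(1) this iso]] show ?thesis .
qed

theorem separative_FP: "separative R (FP R I :: ('r, 'm) module set)"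
  unfolding separative_def
proof (intro ballI impI)
  fix A B C :: "('r, 'm) module"
  assume FP: "A \<in> FP R I" "B \<in> FP R I" "C \<in> FP R I"
    and iso: "lmod_iso R (direct_sum A C) (direct_sum B C)"
    and "\<exists>n::nat. iso_direct_summand R C (direct_power {..<n} A) \<and>
        iso_direct_summand R C (direct_power {..<n} B)"
  then obtain n :: nat where n: "iso_direct_summand R C (direct_power {..<n} A)"
    "iso_direct_summand R C (direct_power {..<n} B)" by blast
  obtain \<alpha> \<beta> \<gamma> where t: "has_type A \<alpha>" "has_type B \<beta>" "has_type C \<gamma>" using FP FP_has_type by metis
  have "has_type (direct_sum B C) (\<alpha> + \<gamma>)"
    using has_type_iso[OF has_type_sum[OF t(1,3)] _ iso]
        has_type_left_module[OF has_type_sum[OF t(2,3)]] by blast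
  then have 1: "gmeq E (\<alpha> + \<gamma>) (\<beta> + \<gamma>)" using has_type_sum[OF t(2,3)] by (rule has_type_unique)
  obtain \<delta> \<delta>' where 2: "gmeq E (\<gamma> + \<delta>) (repeat_mset n \<alpha>)" "gmeq E (\<gamma> + \<delta>') (repeat_mset n \<beta>)"
    using has_type_iso_summand[OF t(3) has_type_power[OF t(1)] n(1)] has_type_iso_summand[OF t(3)
        has_type_power[OF t(2)] n(2)] by blast
  have "gmeq E \<alpha> \<beta>" by (rule tame_separative[OF tame 1 2])
  then show "lmod_iso R A B" using has_type_meq t(1,2) has_type_same by blast
qed

text \<open>For a multiset that contains a non-vertex this set is empty, which explains the side
  conditions \<open>set_mset \<alpha> \<subseteq> verts E\<close> below.\<close>

definition cls :: "'v multiset \<Rightarrow> ('r, nat \<Rightarrow> 'r) module set" where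
  "cls \<alpha> = {M. has_type M \<alpha>}"

lemma cls_eq: "gmeq E \<alpha> \<beta> \<Longrightarrow> cls \<alpha> = cls \<beta>"
  by (simp add: cls_def has_type_meq)

lemma cls_eq_iff:
  assumes "set_mset \<alpha> \<subseteq> verts E"
  shows "cls \<alpha> = cls \<beta> \<longleftrightarrow> gmeq E \<alpha> \<beta>"
proof
  assume eq: "cls \<alpha> = cls \<beta>"
  obtain M :: "('r, nat \<Rightarrow> 'r) module" where "has_type M \<alpha>" using ex_has_type[OF assms] by blast
  with eq show "gmeq E \<alpha> \<beta>" using has_type_unique by (metis cls_def mem_Collect_eq)
qed (rule cls_eq)

lemma iso_class_has_type:
  assumes "has_type M \<alpha>"
  shows "iso_class R I M = cls \<alpha>"
proof -
  have "has_type N \<alpha>" if "N \<in> FP R I" "lmod_iso R M N" for N :: "('r, nat \<Rightarrow> 'r) module"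
    using has_type_iso[OF assms _ that(2)] FP_has_type[OF that(1)] has_type_left_module by blast
  then show ?thesis using has_type_FP has_type_same[OF assms] by (auto simp: iso_class_def cls_def)
qed

lemma V_carrier: "carrier (V_monoid R I) = cls ` {\<alpha>. set_mset \<alpha> \<subseteq> verts E}"
proof
  show "carrier (V_monoid R I) \<subseteq> cls ` {\<alpha>. set_mset \<alpha> \<subseteq> verts E}"
  proof
    fix U assume "U \<in> carrier (V_monoid R I)"
    then obtain M :: "('r, nat \<Rightarrow> 'r) module" where M: "M \<in> FP R I" "U = iso_class R I M"
        by (auto simp: V_monoid_def)
    obtain \<alpha> where "has_type M \<alpha>" using FP_has_type[OF M(1)] by blast
    then show "U \<in> cls ` {\<alpha>. set_mset \<alpha> \<subseteq> verts E}" using M(2) iso_class_has_type has_type_verts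
        by blast
  qed
  show "cls ` {\<alpha>. set_mset \<alpha> \<subseteq> verts E} \<subseteq> carrier (V_monoid R I)"
  proof
    fix U assume "U \<in> cls ` {\<alpha>. set_mset \<alpha> \<subseteq> verts E}"
    then obtain \<alpha> where \<alpha>: "set_mset \<alpha> \<subseteq> verts E" "U = cls \<alpha>" by blast
    obtain M :: "('r, nat \<Rightarrow> 'r) module" where M: "has_type M \<alpha>" using ex_has_type[OF \<alpha>(1)] by blast
    have "U \<in> iso_class R I ` (FP R I :: ('r, nat \<Rightarrow> 'r) module set)"
      by (rule image_eqI[OF _ has_type_FP[OF M]]) (simp add: \<alpha>(2) iso_class_has_type[OF M])
    then show "U \<in> carrier (V_monoid R I)" by (simp add: V_monoid_def)
  qed
qed

lemma V_mult:
  assumes "set_mset \<alpha> \<subseteq> verts E" "set_mset \<beta> \<subseteq> verts E"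
  shows "cls \<alpha> \<otimes>\<^bsub>V_monoid R I\<^esub> cls \<beta> = cls (\<alpha> + \<beta>)"
proof -
  obtain A B :: "('r, nat \<Rightarrow> 'r) module" where "A \<in> cls \<alpha>" "B \<in> cls \<beta>"
    using ex_has_type[OF assms(1)] ex_has_type[OF assms(2)] by (auto simp: cls_def)
  moreover have "iso_class R I (direct_sum M N) = cls (\<alpha> + \<beta>)" if "M \<in> cls \<alpha>" "N \<in> cls \<beta>" for M N
    using that by (intro iso_class_has_type has_type_sum) (auto simp: cls_def)
  ultimately show ?thesis unfolding V_monoid_def by auto
qed

lemma has_type_zero_iff:
  assumes "left_module R M"
  shows "has_type M {#} \<longleftrightarrow> carrier M = {\<zero>\<^bsub>M\<^esub>}"
proof
  interpret M: left_module R M by fact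
  let ?H = "Hm ({} :: nat set) undefined"
  have c: "carrier ?H = {\<lambda>_. undefined}" by (auto simp: Hm_carrier)
  have H: "has_type ?H {#}" using has_type_Hm[of "{} :: nat set" undefined]
      by (simp add: type_of_def)
  {
    assume "has_type M {#}"
    then obtain f where "bij_betw f (carrier ?H) (carrier M)" using has_type_same[OF H]
        by (auto simp: lmod_iso_def)
    then obtain x where "carrier M = {x}" unfolding c by (auto simp: bij_betw_def)
    then show "carrier M = {\<zero>\<^bsub>M\<^esub>}" using M.zero_closed by simp
  next
    assume z: "carrier M = {\<zero>\<^bsub>M\<^esub>}"
    have "lmod_iso R ?H M"
    proof (rule lmod_isoI[of "\<lambda>_. \<zero>\<^bsub>M\<^esub>"])
      show "(\<lambda>_. \<zero>\<^bsub>M\<^esub>) \<in> lmod_hom R ?H M" by (simp add: lmod_hom_def M.smult_zero_right)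
      show "bij_betw (\<lambda>_. \<zero>\<^bsub>M\<^esub>) (carrier ?H) (carrier M)" unfolding c z by (simp add: bij_betw_def)
    qed
    then show "has_type M {#}" using has_type_iso[OF H assms] by blast
  }
qed

lemma V_one: "\<one>\<^bsub>V_monoid R I\<^esub> = cls {#}"
proof -
  have "{N \<in> FP R I. carrier N = {\<zero>\<^bsub>N\<^esub>}} = cls {#}"
    using has_type_FP has_type_zero_iff has_type_left_module unfolding cls_def FP_def by blast
  then show ?thesis by (simp add: V_monoid_def)
qed

lemma V_comm_monoid: "comm_monoid (V_monoid R I)"
proof (rule comm_monoidI)
  fix x y z assume "x \<in> carrier (V_monoid R I)" "y \<in> carrier (V_monoid R I)"
  then obtain a b where ab: "x = cls a" "set_mset a \<subseteq> verts E" "y = cls b" "set_mset b \<subseteq> verts E"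
    unfolding V_carrier by blast
  show "x \<otimes>\<^bsub>V_monoid R I\<^esub> y \<in> carrier (V_monoid R I)" using ab by (auto simp: V_mult V_carrier)
  show "x \<otimes>\<^bsub>V_monoid R I\<^esub> y = y \<otimes>\<^bsub>V_monoid R I\<^esub> x" using ab by (simp add: V_mult add.commute)
  assume "z \<in> carrier (V_monoid R I)"
  then obtain d where "z = cls d" "set_mset d \<subseteq> verts E" unfolding V_carrier by blast
  with ab show "x \<otimes>\<^bsub>V_monoid R I\<^esub> y \<otimes>\<^bsub>V_monoid R I\<^esub> z = x \<otimes>\<^bsub>V_monoid R I\<^esub> (y \<otimes>\<^bsub>V_monoid R I\<^esub> z)"
    by (simp add: V_mult add.assoc)
next
  show "\<one>\<^bsub>V_monoid R I\<^esub> \<in> carrier (V_monoid R I)" by (auto simp: V_one V_carrier)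
next
  fix x assume "x \<in> carrier (V_monoid R I)"
  then obtain a where "x = cls a" "set_mset a \<subseteq> verts E" unfolding V_carrier by blast
  then show "\<one>\<^bsub>V_monoid R I\<^esub> \<otimes>\<^bsub>V_monoid R I\<^esub> x = x" by (simp add: V_one V_mult)
qed

theorem V_unperforated: "unperforated_monoid (V_monoid R I)"
  unfolding unperforated_monoid_def
proof (intro conjI ballI allI impI)
  show "comm_monoid (V_monoid R I)" by (rule V_comm_monoid)
  interpret V: comm_monoid "V_monoid R I" by (rule V_comm_monoid)
  fix a b and n :: nat
  assume ab: "a \<in> carrier (V_monoid R I)" "b \<in> carrier (V_monoid R I)" and n: "n > 0"
    and le: "alg_le (V_monoid R I) (a [^]\<^bsub>V_monoid R I\<^esub> n) (b [^]\<^bsub>V_monoid R I\<^esub> n)"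
  obtain \<alpha> \<beta> where a: "a = cls \<alpha>" "set_mset \<alpha> \<subseteq> verts E" and b: "b = cls \<beta>" "set_mset \<beta> \<subseteq> verts E"
    using ab unfolding V_carrier by blast
  have rep: "set_mset (repeat_mset n \<gamma>) \<subseteq> verts E" if "set_mset \<gamma> \<subseteq> verts E" for \<gamma> and n :: nat
    using that by (induction n) auto
  have pow: "cls \<gamma> [^]\<^bsub>V_monoid R I\<^esub> n = cls (repeat_mset n \<gamma>)" if g: "set_mset \<gamma> \<subseteq> verts E" for \<gamma>
      and n :: nat
  proof (induction n)
    case (Suc n)
    then show ?case using V_mult[OF rep[OF g, of n] g] by (simp add: add.commute)
  qed (simp add: V_one)
  obtain z where z: "z \<in> carrier (V_monoid R I)"
    "cls (repeat_mset n \<beta>) = cls (repeat_mset n \<alpha>) \<otimes>\<^bsub>V_monoid R I\<^esub> z"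
    using le unfolding a(1) b(1) pow[OF a(2)] pow[OF b(2)] by (auto simp: alg_le_def)
  obtain \<zeta> where \<zeta>: "z = cls \<zeta>" "set_mset \<zeta> \<subseteq> verts E" using z(1) unfolding V_carrier by blast
  have "cls (repeat_mset n \<beta>) = cls (repeat_mset n \<alpha> + \<zeta>)"
    using z(2) V_mult[OF rep[OF a(2)] \<zeta>(2)] \<zeta>(1) by simp
  then have "gmeq E (repeat_mset n \<alpha> + \<zeta>) (repeat_mset n \<beta>)"
    using cls_eq_iff[OF rep[OF b(2)]] meq.sym by blast
  then obtain \<zeta>' where \<zeta>': "gmeq E (\<alpha> + \<zeta>') \<beta>" by (rule tame_unperforated[OF tame n])
  obtain B :: "('r, nat \<Rightarrow> 'r) module" where "has_type B \<beta>" using ex_has_type[OF b(2)] by blast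
  then have "has_type B (\<alpha> + \<zeta>')" using has_type_meq[OF \<zeta>'] by blast
  \<comment> \<open>The complement found in the graph monoid might contain non-vertices; they are
    excluded because \<open>\<alpha> + \<zeta>'\<close> is the type of a module.\<close>
  then have v: "set_mset \<zeta>' \<subseteq> verts E" using has_type_verts by fastforce
  have "b = a \<otimes>\<^bsub>V_monoid R I\<^esub> cls \<zeta>'" using V_mult[OF a(2) v] cls_eq[OF \<zeta>'] a(1) b(1) by simp
  moreover have "cls \<zeta>' \<in> carrier (V_monoid R I)" using v unfolding V_carrier by blast
  ultimately show "alg_le (V_monoid R I) a b" unfolding alg_le_def by blast
qed

theorem K0_unperforated: "unperforated_group (K0 R I) (K0_cone R I)"
  unfolding K0_def K0_cone_def
  by (rule comm_monoid.unperforated_env_group[OF V_comm_monoid V_unperforated])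

end

section \<open>A representation of the graph algebra\<close>

lemma poly_mapping_single_induct [case_names zero add]:
  assumes "P 0" and add: "\<And>f k c. P f \<Longrightarrow> P (Poly_Mapping.single k c + f)"
  shows "P (f :: 'a \<Rightarrow>\<^sub>0 'b::ab_group_add)"
proof (induction f rule: update_induct)
  case const
  show ?case by (rule assms(1))
next
  case (update f a b)
  have "Poly_Mapping.update a b f = Poly_Mapping.single a b + f"
    using update(1) by (intro poly_mapping_eqI) (auto simp: lookup_update lookup_add lookup_single
        in_keys_iff when_def)
  then show ?case using add[OF update(3)] by simp
qed

text \<open>
  Boundary paths: at every step the current vertex and the edge taken, which is \<open>None\<close> at sinks.
  The graph algebra acts on functions of a boundary path and an integer by shifting the path;
  the integer records the degree and makes paths of different lengths act independently.
\<close>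

definition boundary_path :: "('v, 'e) pre_digraph \<Rightarrow> (nat \<Rightarrow> 'v \<times> 'e option) \<Rightarrow> bool" where
  "boundary_path E \<zeta> \<longleftrightarrow> (\<forall>i. fst (\<zeta> i) \<in> verts E \<and>
     (if out_arcs E (fst (\<zeta> i)) = {} then snd (\<zeta> i) = None
      else \<exists>e\<in>out_arcs E (fst (\<zeta> i)). snd (\<zeta> i) = Some e \<and> fst (\<zeta> (Suc i)) = head E e))"

definition path_cons :: "('v, 'e) pre_digraph \<Rightarrow> 'e \<Rightarrow> (nat \<Rightarrow> 'v \<times> 'e option) \<Rightarrow> nat \<Rightarrow> 'v \<times> 'e option"
    where
  "path_cons E e \<zeta> = case_nat (tail E e, Some e) \<zeta>"

text \<open>Functions are pulled back: \<open>Xgen e\<close> evaluates at the path without its first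
  edge, \<open>Ygen e\<close> at the path with \<open>e\<close> in front. The test for boundary
  paths in every clause makes the relations hold as identities of functions on all
  sequences.\<close>

fun gen_act :: "('v, 'e) pre_digraph \<Rightarrow> ('v, 'e) generator \<Rightarrow> ((nat \<Rightarrow> 'v \<times> 'e option) \<times> int \<Rightarrow>
    'k::field) \<Rightarrow>
    (nat \<Rightarrow> 'v \<times> 'e option) \<times> int \<Rightarrow> 'k" where
  "gen_act E (Pgen v) \<phi> (\<zeta>, n) = (if boundary_path E \<zeta> \<and> fst (\<zeta> 0) = v then \<phi> (\<zeta>, n) else 0)"
| "gen_act E (Xgen e) \<phi> (\<zeta>, n) = (if boundary_path E \<zeta> \<and> snd (\<zeta> 0) = Some e then \<phi> (\<lambda>i. \<zeta> (Suc i),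
    n - 1) else 0)"
| "gen_act E (Ygen e) \<phi> (\<zeta>, n) =
     (if boundary_path E \<zeta> \<and> e \<in> arcs E \<and> fst (\<zeta> 0) = head E e then \<phi> (path_cons E e \<zeta>, n + 1) else
         0)"

definition word_act where "word_act E w \<phi> = foldr (gen_act E) w \<phi>"

definition rep :: "('v, 'e) pre_digraph \<Rightarrow> (('v, 'e) generator list \<Rightarrow>\<^sub>0 'k::field) \<Rightarrow>
    ((nat \<Rightarrow> 'v \<times> 'e option) \<times> int \<Rightarrow> 'k) \<Rightarrow> (nat \<Rightarrow> 'v \<times> 'e option) \<times> int \<Rightarrow> 'k" where
  "rep E f \<phi> z = (\<Sum>w\<in>Poly_Mapping.keys f. Poly_Mapping.lookup f w * word_act E w \<phi> z)"

lemma gen_act_add: "gen_act E g (\<phi> + \<psi>) = gen_act E g \<phi> + gen_act E g \<psi>"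
proof
  fix z show "gen_act E g (\<phi> + \<psi>) z = (gen_act E g \<phi> + gen_act E g \<psi>) z"
    by (cases z; cases g) auto
qed

lemma gen_act_fsc: "gen_act E g (fsc c \<phi>) = fsc c (gen_act E g \<phi>)"
proof
  fix z show "gen_act E g (fsc c \<phi>) z = fsc c (gen_act E g \<phi>) z"
    by (cases z; cases g) auto
qed

lemma word_act_add: "word_act E w (\<phi> + \<psi>) = word_act E w \<phi> + word_act E w \<psi>"
  by (induction w) (simp_all only: word_act_def foldr.simps comp_apply id_apply gen_act_add)

lemma word_act_fsc: "word_act E w (fsc c \<phi>) = fsc c (word_act E w \<phi>)"
  by (induction w) (simp_all only: word_act_def foldr.simps comp_apply id_apply gen_act_fsc)

lemma word_act_0: "word_act E w 0 = 0"
  using word_act_fsc[of E w 0 0] by (simp add: fun_eq_iff)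

lemma word_act_append: "word_act E (u @ w) \<phi> = word_act E u (word_act E w \<phi>)"
  by (simp add: word_act_def)

lemma rep_add: "rep E (f + g) \<phi> = rep E f \<phi> + rep E g \<phi>"
proof
  fix z
  show "rep E (f + g) \<phi> z = (rep E f \<phi> + rep E g \<phi>) z"
    unfolding rep_def plus_fun_apply
    by (rule setsum_keys_plus_distrib[of "\<lambda>w c. c * word_act E w \<phi> z"]) (simp_all
        add: distrib_right)
qed

lemma rep_0: "rep E 0 \<phi> = 0"
  by (simp add: rep_def fun_eq_iff)

lemma rep_single: "rep E (Poly_Mapping.single w c) \<phi> = fsc c (word_act E w \<phi>)"
  by (simp add: rep_def fun_eq_iff)

lemma rep_add_arg: "rep E f (\<phi> + \<psi>) = rep E f \<phi> + rep E f \<psi>"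
  by (simp add: rep_def fun_eq_iff word_act_add distrib_left sum.distrib)

lemma rep_0_arg: "rep E f 0 = 0"
  by (simp add: rep_def fun_eq_iff word_act_0)

lemma rep_mult: "rep E (f * g) \<phi> = rep E f (rep E g \<phi>)"
proof (induction f rule: poly_mapping_single_induct)
  case zero
  show ?case by (simp only: mult_zero_left rep_0)
next
  case (add f k c)
  have "rep E (Poly_Mapping.single k c * g) \<phi> = rep E (Poly_Mapping.single k c) (rep E g \<phi>)"
  proof (induction g rule: poly_mapping_single_induct)
    case zero
    show ?case by (simp only: mult_zero_right rep_0 rep_0_arg)
  next
    case (add g l d)
    have "fsc (c * d) (word_act E (k + l) \<phi>) = fsc c (word_act E k (fsc d (word_act E l \<phi>)))"
      by (simp only: word_act_fsc plus_list_def word_act_append) (auto simp: fun_eq_iff)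
    then show ?case using add
      by (simp only: distrib_left rep_add rep_add_arg mult_single rep_single)
  qed
  then show ?case using add by (simp only: distrib_right rep_add)
qed

lemma rep_minus: "rep E (f - g) \<phi> = rep E f \<phi> - rep E g \<phi>"
proof -
  have "rep E (f - g) \<phi> + rep E g \<phi> = rep E f \<phi>" by (simp only: rep_add[symmetric] diff_add_cancel)
  then show ?thesis by (simp only: eq_diff_eq)
qed

lemma lookup_map_times: "Poly_Mapping.lookup (Poly_Mapping.map ((*) c) f) k =
    c * Poly_Mapping.lookup f k"
  for c :: "'b::mult_zero"
  by (simp add: map.rep_eq when_def)

text \<open>Scaling is multiplication by a constant polynomial. The latter lies outside the
  non-unital free algebra but inside the ambient ring of polynomials, so \<open>rep_mult\<close>
  applies.\<close>

lemma rep_scale: "rep E (Poly_Mapping.map ((*) c) f) \<phi> = fsc c (rep E f \<phi>)"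
proof -
  have "Poly_Mapping.map ((*) c) f = Poly_Mapping.single 0 c * f"
  proof (induction f rule: poly_mapping_single_induct)
    case zero
    show ?case by (rule poly_mapping_eqI) (simp add: lookup_map_times)
  next
    case (add f k d)
    have "Poly_Mapping.map ((*) c) (Poly_Mapping.single k d + f) =
        Poly_Mapping.single k (c * d) + Poly_Mapping.map ((*) c) f"
      by (rule poly_mapping_eqI) (simp add: lookup_map_times lookup_add lookup_single when_def
          distrib_left)
    then show ?case by (simp only: add distrib_left mult_single add_0_left)
  qed
  then show ?thesis
    by (simp only: rep_mult rep_single) (auto simp: word_act_def zero_list_def fun_eq_iff)
qed

section \<open>The relations hold on boundary paths\<close>

lemma boundary_path_Suc: "boundary_path E \<zeta> \<Longrightarrow> boundary_path E (\<lambda>i. \<zeta> (Suc i))"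
  unfolding boundary_path_def by blast

lemma boundary_pathD:
  assumes "boundary_path E \<zeta>"
  shows "fst (\<zeta> i) \<in> verts E"
    and "snd (\<zeta> i) = Some e \<Longrightarrow> e \<in> arcs E \<and> tail E e = fst (\<zeta> i) \<and> fst (\<zeta> (Suc i)) = head E e"
    and "out_arcs E (fst (\<zeta> i)) \<noteq> {} \<Longrightarrow> \<exists>e\<in>out_arcs E (fst (\<zeta> i)). snd (\<zeta> i) = Some e"
proof -
  from assms have *: "fst (\<zeta> i) \<in> verts E \<and>
     (if out_arcs E (fst (\<zeta> i)) = {} then snd (\<zeta> i) = None
      else \<exists>e\<in>out_arcs E (fst (\<zeta> i)). snd (\<zeta> i) = Some e \<and> fst (\<zeta> (Suc i)) = head E e)"
    unfolding boundary_path_def by blast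
  show "fst (\<zeta> i) \<in> verts E" using * by blast
  show "snd (\<zeta> i) = Some e \<Longrightarrow> e \<in> arcs E \<and> tail E e = fst (\<zeta> i) \<and> fst (\<zeta> (Suc i)) = head E e"
    using * by (auto split: if_splits)
  show "out_arcs E (fst (\<zeta> i)) \<noteq> {} \<Longrightarrow> \<exists>e\<in>out_arcs E (fst (\<zeta> i)). snd (\<zeta> i) = Some e"
    using * by (auto split: if_splits)
qed

lemma path_cons_simps [simp]:
  "path_cons E e \<zeta> 0 = (tail E e, Some e)" "path_cons E e \<zeta> (Suc i) = \<zeta> i"
  by (simp_all add: path_cons_def)

lemma boundary_path_cons:
  assumes "wf_digraph E" "boundary_path E \<zeta>" "e \<in> arcs E" "fst (\<zeta> 0) = head E e"
  shows "boundary_path E (path_cons E e \<zeta>)"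
  unfolding boundary_path_def
proof
  fix i
  show "fst (path_cons E e \<zeta> i) \<in> verts E \<and>
     (if out_arcs E (fst (path_cons E e \<zeta> i)) = {} then snd (path_cons E e \<zeta> i) = None
      else \<exists>e'\<in>out_arcs E (fst (path_cons E e \<zeta> i)). snd (path_cons E e \<zeta> i) = Some e' \<and>
        fst (path_cons E e \<zeta> (Suc i)) = head E e')"
  proof (cases i)
    case 0
    then show ?thesis using assms wf_digraph.tail_in_verts[OF assms(1)] by auto
  next
    case (Suc j)
    then show ?thesis using assms(2) unfolding boundary_path_def by simp
  qed
qed

lemma path_cons_Suc: "snd (\<zeta> 0) = Some e \<Longrightarrow> tail E e = fst (\<zeta> 0) \<Longrightarrow> path_cons E e (\<lambda>i. \<zeta> (Suc i)) = \<zeta>"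
proof
  fix i assume "snd (\<zeta> 0) = Some e" "tail E e = fst (\<zeta> 0)"
  then show "path_cons E e (\<lambda>i. \<zeta> (Suc i)) i = \<zeta> i" by (cases i) (auto simp: prod_eq_iff)
qed

text \<open>An edge is chosen at every vertex that emits one. At a sink the sequence stays put,
  since no edge determines the next vertex there.\<close>

lemma ex_boundary_path:
  assumes wf: "wf_digraph E" and v: "v \<in> verts E"
  shows "\<exists>\<zeta>. boundary_path E \<zeta> \<and> fst (\<zeta> 0) = v"
proof -
  define nx where "nx u = (if out_arcs E u = {} then u else head E (SOME e. e \<in> out_arcs E u))"
      for u
  define \<zeta> where "\<zeta> i = ((nx ^^ i) v, if out_arcs E ((nx ^^ i) v) = {} then None
    else Some (SOME e. e \<in> out_arcs E ((nx ^^ i) v)))" for i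
  have some: "(SOME e. e \<in> out_arcs E u) \<in> out_arcs E u" if "out_arcs E u \<noteq> {}" for u
    using that some_in_eq by blast
  have nx: "nx u \<in> verts E" if "u \<in> verts E" for u
    using that some[of u] wf_digraph.head_in_verts[OF wf] by (auto simp: nx_def)
  have verts: "(nx ^^ i) v \<in> verts E" for i by (induction i) (auto simp: v nx)
  have "boundary_path E \<zeta>"
    unfolding boundary_path_def
  proof
    fix i
    show "fst (\<zeta> i) \<in> verts E \<and> (if out_arcs E (fst (\<zeta> i)) = {} then snd (\<zeta> i) = None
      else \<exists>e\<in>out_arcs E (fst (\<zeta> i)). snd (\<zeta> i) = Some e \<and> fst (\<zeta> (Suc i)) = head E e)"
    proof (cases "out_arcs E ((nx ^^ i) v) = {}")
      case True
      then show ?thesis using verts by (simp add: \<zeta>_def)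
    next
      case False
      then show ?thesis using verts some[OF False]
        by (intro conjI) (simp_all add: \<zeta>_def nx_def del: in_out_arcs_conv)
    qed
  qed
  moreover have "fst (\<zeta> 0) = v" by (simp add: \<zeta>_def)
  ultimately show ?thesis by blast
qed

lemma rep_gen_mult: "rep E (gen g * gen h) \<phi> = gen_act E g (gen_act E h \<phi>)"
proof
  fix z
  show "rep E (gen g * gen h) \<phi> z = gen_act E g (gen_act E h \<phi>) z"
    unfolding rep_mult rep_single by (simp add: word_act_def word_act_fsc fsc_def)
qed

lemma rep_gen: "rep E (gen g) \<phi> = gen_act E g \<phi>"
  unfolding rep_single by (simp add: word_act_def fsc_def)

lemma rep_sum: "rep E (\<Sum>i\<in>I. f i) \<phi> z = (\<Sum>i\<in>I. rep E (f i) \<phi> z)"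
  by (induction I rule: infinite_finite_induct) (simp_all add: rep_0 rep_add)

lemma rep_relators:
  assumes wf: "wf_digraph E" and rf: "row_finite E" and x: "x \<in> relators E"
  shows "rep E x \<phi> = 0"
proof -
  have eqI: "rep E (a - b) \<phi> = 0" if "\<And>\<zeta> n. rep E a \<phi> (\<zeta>, n) = rep E b \<phi> (\<zeta>, n)" for a b
    using that by (simp only: rep_minus) (auto simp: fun_eq_iff)
  note pc = boundary_path_cons[OF wf]
  from x show ?thesis
    unfolding relators_def
  proof (elim UnE CollectE exE conjE)
    fix v w assume "x = gen (Pgen v) * gen (Pgen w) - (if v = w then gen (Pgen v) else 0)"
    then show ?thesis by (simp only:, intro eqI, unfold rep_gen_mult) (auto simp: rep_gen rep_0)
  next
    fix e assume "x = gen (Pgen (tail E e)) * gen (Xgen e) - gen (Xgen e)" "e \<in> arcs E"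
    then show ?thesis
      by (simp only:, intro eqI, unfold rep_gen_mult rep_gen) (auto dest: boundary_pathD(2))
  next
    fix e assume "x = gen (Xgen e) * gen (Pgen (head E e)) - gen (Xgen e)" "e \<in> arcs E"
    then show ?thesis
      by (simp only:, intro eqI, unfold rep_gen_mult rep_gen) (auto dest: boundary_pathD(2)
          boundary_path_Suc)
  next
    fix e assume "x = gen (Pgen (head E e)) * gen (Ygen e) - gen (Ygen e)" "e \<in> arcs E"
    then show ?thesis
      by (simp only:, intro eqI, unfold rep_gen_mult rep_gen) auto
  next
    fix e assume "x = gen (Ygen e) * gen (Pgen (tail E e)) - gen (Ygen e)" "e \<in> arcs E"
    then show ?thesis
      by (simp only:, intro eqI, unfold rep_gen_mult rep_gen) (auto dest: pc)
  next
    fix e e' assume "x = gen (Ygen e) * gen (Xgen e') - (if e =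
        e' then gen (Pgen (head E e)) else 0)"
      "e \<in> arcs E" "e' \<in> arcs E"
    then show ?thesis
      by (simp only:, intro eqI, unfold rep_gen_mult) (auto simp: rep_gen rep_0 dest: pc)
  next
    fix v assume x: "x = gen (Pgen v) - (\<Sum>e\<in>out_arcs E v. gen (Xgen e) * gen (Ygen e))"
      and v: "v \<in> verts E" "out_arcs E v \<noteq> {}"
    have fin: "finite (out_arcs E v)" using rf v by (simp add: row_finite_def)
    have "rep E (gen (Pgen v)) \<phi> (\<zeta>, n) = rep E (\<Sum>e\<in>out_arcs E v. gen (Xgen e) * gen (Ygen e)) \<phi> (\<zeta>,
        n)" for \<zeta> n
    proof (cases "boundary_path E \<zeta> \<and> fst (\<zeta> 0) = v")
      case True
      \<comment> \<open>The first edge of the path selects the single summand that does not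
        vanish.\<close>
      then obtain a where a: "a \<in> out_arcs E v" "snd (\<zeta> 0) = Some a"
          using boundary_pathD(3)[of E \<zeta> 0] v by blast
      have "rep E (gen (Xgen e) * gen (Ygen e)) \<phi> (\<zeta>, n) = (if e = a then \<phi> (\<zeta>, n) else 0)" for e
        using True a boundary_path_Suc[of E \<zeta>] boundary_pathD(2)[of E \<zeta> 0 a] path_cons_Suc[of \<zeta> a E]
        unfolding rep_gen_mult by auto
      then show ?thesis using True a fin unfolding rep_sum rep_gen by simp
    next
      case False
      have "rep E (gen (Xgen e) * gen (Ygen e)) \<phi> (\<zeta>, n) = 0" if "e \<in> out_arcs E v" for e
        using False that boundary_pathD(2)[of E \<zeta> 0 e] unfolding rep_gen_mult by auto
      then show ?thesis using False unfolding rep_sum rep_gen by auto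
    qed
    then show ?thesis unfolding x by (rule eqI)
  qed
qed

lemma rep_alg_ideal:
  assumes wf: "wf_digraph E" and rf: "row_finite E"
      and x: "x \<in> alg_ideal (free_algebra G) (relators E)"
  shows "rep E x \<phi> = 0"
  using x
proof (induction arbitrary: \<phi> rule: alg_ideal.induct)
  case (incl s)
  then show ?case by (rule rep_relators[OF wf rf])
next
  case (smult x c)
  have "rep E (Poly_Mapping.map ((*) c) x) \<phi> = fsc c 0" by (simp only: rep_scale smult)
  then show ?case by (simp add: free_algebra_def)
next
  case (left a x)
  have "rep E (a * x) \<phi> = 0" by (simp only: rep_mult left.IH rep_0_arg)
  then show ?case by (simp add: free_algebra_def)
next
  case (right a x)
  have "rep E (x * a) \<phi> = 0" by (simp only: rep_mult right.IH)
  then show ?case by (simp add: free_algebra_def)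
next
  case (add x y)
  have "rep E (x + y) \<phi> = 0 + 0" by (simp only: rep_add add.IH)
  then show ?case by (simp add: free_algebra_def)
qed (simp add: free_algebra_def rep_0)

text \<open>A list is a reversed path: its head is the last edge of the path and is therefore the
  first to be put in front of \<open>\<zeta>\<close>.\<close>

fun prepend :: "('v, 'e) pre_digraph \<Rightarrow> 'e list \<Rightarrow> (nat \<Rightarrow> 'v \<times> 'e option) \<Rightarrow> nat \<Rightarrow> 'v \<times> 'e option"
    where
  "prepend E [] \<zeta> = \<zeta>"
| "prepend E (e # w) \<zeta> = prepend E w (path_cons E e \<zeta>)"

lemma prepend_inj: "length w = length w' \<Longrightarrow> prepend E w \<zeta> = prepend E w' \<zeta>' \<Longrightarrow> w = w' \<and> \<zeta> = \<zeta>'"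
proof (induction w w' arbitrary: \<zeta> \<zeta>' rule: list_induct2)
  case (Cons e w e' w')
  then have *: "w = w'" "path_cons E e \<zeta> = path_cons E e' \<zeta>'" by auto
  have "e = e'" using fun_cong[OF *(2), of 0] by simp
  moreover have "\<zeta> i = \<zeta>' i" for i using fun_cong[OF *(2), of "Suc i"] by simp
  ultimately show ?case using * by auto
qed simp

lemma word_act_path:
  assumes wf: "wf_digraph E" and w: "walk E v w" and \<zeta>: "boundary_path E \<zeta>"
  shows "word_act E (map Ygen w @ [Pgen v]) \<phi> (\<zeta>, n) =
    (if fst (\<zeta> 0) = end_of E v w then \<phi> (prepend E w \<zeta>, n + int (length w)) else 0)"
  using w \<zeta>
proof (induction w arbitrary: \<zeta> n)
  case Nil
  then show ?case by (auto simp: word_act_def)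
next
  case (Cons e w)
  have "word_act E (map Ygen (e # w) @ [Pgen v]) \<phi> =
      gen_act E (Ygen e) (word_act E (map Ygen w @ [Pgen v]) \<phi>)"
    by (simp add: word_act_def)
  then show ?case
    using Cons boundary_path_cons[OF wf Cons.prems(2), of e] by (auto simp: add_ac)
qed

text \<open>The test function is the indicator of one prolonged boundary path in one degree,
  evaluated at the path \<open>\<zeta>\<close> in degree zero. Words of equal length are told apart
  by their edges. Words of different lengths are told apart by the degree, since around a cycle they
  can prolong \<open>\<zeta>\<close> to the same sequence.\<close>

lemma path_words_independent:
  assumes wf: "wf_digraph E" and rf: "row_finite E" and v: "v \<in> verts E"
      and W: "finite W" "\<And>w. w \<in> W \<Longrightarrow> walk E v w"
    and mem: "(\<Sum>w\<in>W. Poly_Mapping.single (map Ygen w @ [Pgen v]) (c w :: 'k::field)) \<in>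
        alg_ideal (free_algebra G) (relators E)"
    and w0: "w0 \<in> W"
  shows "c w0 = 0"
proof -
  have "end_of E v w0 \<in> verts E" using wf_digraph.end_of_verts[OF wf W(2)[OF w0]] .
  then obtain \<zeta> where \<zeta>: "boundary_path E \<zeta>" "fst (\<zeta> 0) = end_of E v w0"
      using ex_boundary_path[OF wf] by blast
  define \<phi> where "\<phi> z = (if z = (prepend E w0 \<zeta>, int (length w0)) then 1 else 0 :: 'k)" for z
  have val: "word_act E (map Ygen w @ [Pgen v]) \<phi> (\<zeta>, 0) = (if w = w0 then 1 else 0)" if "w \<in> W"
      for w
    using word_act_path[OF wf W(2)[OF that] \<zeta>(1), of \<phi> 0] \<zeta>(2) prepend_inj[of w w0 E \<zeta> \<zeta>]
        by (auto simp: \<phi>_def)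
  have "0 = rep E (\<Sum>w\<in>W. Poly_Mapping.single (map Ygen w @ [Pgen v]) (c w)) \<phi> (\<zeta>, 0)"
    using fun_cong[OF rep_alg_ideal[OF wf rf mem, of \<phi>], of "(\<zeta>, 0)"] by simp
  also have "\<dots> = (\<Sum>w\<in>W. c w * (if w = w0 then 1 else 0))"
    unfolding rep_sum by (intro sum.cong HOL.refl) (simp add: rep_single val)
  also have "\<dots> = (\<Sum>w\<in>W. if w = w0 then c w else 0)" by (rule sum.cong) simp_all
  also have "\<dots> = c w0" using W(1) w0 by (simp only: sum.delta if_True)
  finally show ?thesis by simp
qed

section \<open>The quotient of the free algebra\<close>

lemma free_algebra_simps:
  "carrier (free_algebra G) = {f. Poly_Mapping.keys f \<subseteq> lists G - {[]}}"
  "f \<otimes>\<^bsub>free_algebra G\<^esub> g = f * g" "f \<oplus>\<^bsub>free_algebra G\<^esub> g = f + g"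
  "\<zero>\<^bsub>free_algebra G\<^esub> = 0" "c \<odot>\<^bsub>free_algebra G\<^esub> f = Poly_Mapping.map ((*) c) f"
  by (simp_all add: free_algebra_def)

lemma free_algebra_closed:
  fixes G :: "'g set"
  defines "C \<equiv> carrier (free_algebra G :: ('k::field, 'g list \<Rightarrow>\<^sub>0 'k) module)"
  shows "0 \<in> C" "f \<in> C \<Longrightarrow> g \<in> C \<Longrightarrow> f + g \<in> C" "f \<in> C \<Longrightarrow> g \<in> C \<Longrightarrow> f * g \<in> C"
    "f \<in> C \<Longrightarrow> Poly_Mapping.map ((*) c) f \<in> C" "f \<in> C \<Longrightarrow> g \<in> C \<Longrightarrow> f - g \<in> C"
    "set w \<subseteq> G \<Longrightarrow> w \<noteq> [] \<Longrightarrow> Poly_Mapping.single w c \<in> C"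
proof -
  show "0 \<in> C" by (simp add: C_def free_algebra_simps)
  show "f \<in> C \<Longrightarrow> g \<in> C \<Longrightarrow> f + g \<in> C"
    using keys_add[of f g] unfolding C_def free_algebra_simps by blast
  show "f * g \<in> C" if "f \<in> C" "g \<in> C"
  proof -
    have "Poly_Mapping.keys (f * g) \<subseteq> {a + b | a b. a \<in> Poly_Mapping.keys f \<and> b \<in>
        Poly_Mapping.keys g}"
      by (rule keys_mult)
    also have "\<dots> \<subseteq> lists G - {[]}"
    proof
      fix w assume "w \<in> {a + b | a b. a \<in> Poly_Mapping.keys f \<and> b \<in> Poly_Mapping.keys g}"
      then obtain a b where w: "w = a @ b" and "a \<in> Poly_Mapping.keys f" "b \<in> Poly_Mapping.keys g"
        by (auto simp: plus_list_def)
      then have "a \<in> lists G" "b \<in> lists G" "a \<noteq> []"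
        using \<open>f \<in> C\<close> \<open>g \<in> C\<close> unfolding C_def free_algebra_simps by blast+
      then show "w \<in> lists G - {[]}" by (simp add: w)
    qed
    finally show ?thesis unfolding C_def free_algebra_simps by blast
  qed
  show scale: "Poly_Mapping.map ((*) c) f \<in> C" if "f \<in> C" for c f
    using that unfolding C_def free_algebra_simps by (auto simp: in_keys_iff lookup_map_times)
  show "f \<in> C \<Longrightarrow> g \<in> C \<Longrightarrow> f - g \<in> C"
    using keys_diff[of f g] unfolding C_def free_algebra_simps by blast
  show "set w \<subseteq> G \<Longrightarrow> w \<noteq> [] \<Longrightarrow> Poly_Mapping.single w c \<in> C"
    by (auto simp: C_def free_algebra_simps)
qed

lemma gen_closed: "g \<in> G \<Longrightarrow> gen g \<in> carrier (free_algebra G)"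
  by (rule free_algebra_closed(6)) auto

lemma map_times_minus_one: "Poly_Mapping.map ((*) (- 1)) f = - f" for f :: "'a \<Rightarrow>\<^sub>0 'k::field"
  by (rule poly_mapping_eqI) (simp add: lookup_map_times)

section \<open>Cosets of a two-sided ideal of the free algebra\<close>

context
  fixes G :: "'g set" and S :: "('g list \<Rightarrow>\<^sub>0 'k::field) set"
  assumes S: "S \<subseteq> carrier (free_algebra G)"
begin

private abbreviation (input) "fa \<equiv> free_algebra G :: ('k, 'g list \<Rightarrow>\<^sub>0 'k) module"
private abbreviation (input) "C \<equiv> carrier fa"
private abbreviation (input) "J \<equiv> alg_ideal fa S"

lemma alg_ideal_subset: "x \<in> J \<Longrightarrow> x \<in> C"
proof (induction rule: alg_ideal.induct)
  case (incl s)
  then show ?case using S by blast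
qed (unfold free_algebra_simps(2-5), (erule (1) free_algebra_closed | erule free_algebra_closed |
    rule free_algebra_closed)+)

lemma alg_ideal_closed:
  "0 \<in> J" "x \<in> J \<Longrightarrow> y \<in> J \<Longrightarrow> x + y \<in> J" "x \<in> J \<Longrightarrow> Poly_Mapping.map ((*) c) x \<in> J"
  "a \<in> C \<Longrightarrow> x \<in> J \<Longrightarrow> a * x \<in> J" "a \<in> C \<Longrightarrow> x \<in> J \<Longrightarrow> x * a \<in> J"
  by (fact alg_ideal.intros(2-)[where A = fa and S = S, unfolded free_algebra_simps(2-5)])+

lemma alg_ideal_diff: "x \<in> J \<Longrightarrow> y \<in> J \<Longrightarrow> x - y \<in> J"
  using alg_ideal_closed(2)[of x "- y"] alg_ideal_closed(3)[of y "- 1"]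
      by (simp add: map_times_minus_one)

definition alg_coset :: "('g list \<Rightarrow>\<^sub>0 'k) \<Rightarrow> ('g list \<Rightarrow>\<^sub>0 'k) set" where
  "alg_coset f = J +>\<^bsub>fa\<^esub> f"

lemma in_alg_coset: "h \<in> alg_coset f \<longleftrightarrow> h - f \<in> J"
proof -
  have "h \<in> alg_coset f \<longleftrightarrow> (\<exists>j\<in>J. h = j + f)"
    unfolding alg_coset_def a_r_coset_def' free_algebra_simps(3) by blast
  also have "\<dots> \<longleftrightarrow> h - f \<in> J"
  proof
    show "\<exists>j\<in>J. h = j + f \<Longrightarrow> h - f \<in> J" by auto
    show "h - f \<in> J \<Longrightarrow> \<exists>j\<in>J. h = j + f" by (rule bexI[of _ "h - f"]) simp
  qed
  finally show ?thesis .
qed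

lemma alg_coset_self: "f \<in> alg_coset f" by (simp add: in_alg_coset alg_ideal_closed(1))

lemma alg_coset_eq: "alg_coset f = alg_coset g \<longleftrightarrow> f - g \<in> J"
proof
  show "alg_coset f = alg_coset g \<Longrightarrow> f - g \<in> J" using alg_coset_self[of f]
      by (simp add: in_alg_coset)
  assume fg: "f - g \<in> J"
  have "h - f \<in> J \<longleftrightarrow> h - g \<in> J" for h
    using alg_ideal_closed(2)[OF _ fg, of "h - f"] alg_ideal_diff[OF _ fg, of "h - g"] by auto
  then show "alg_coset f = alg_coset g" by (intro Set.set_eqI) (simp only: in_alg_coset)
qed

lemma alg_coset_closed: "f \<in> C \<Longrightarrow> h \<in> alg_coset f \<Longrightarrow> h \<in> C"
  using free_algebra_closed(2)[OF alg_ideal_subset[of "h - f"], of f] by (simp add: in_alg_coset)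

lemma UN_alg_coset:
  assumes "x \<in> A" "\<And>y. y \<in> A \<Longrightarrow> B y = B x" shows "(\<Union>y\<in>A. B y) = B x"
  using assms by blast

lemma quot_carrier: "carrier (alg_quot fa J) = alg_coset ` C"
  unfolding alg_quot_def by (auto simp: A_RCOSETS_def' alg_coset_def)

lemma quot_add: "f \<in> C \<Longrightarrow> g \<in> C \<Longrightarrow> alg_coset f \<oplus>\<^bsub>alg_quot fa J\<^esub> alg_coset g = alg_coset (f + g)"
proof -
  have "h \<in> alg_coset (f + g) \<longleftrightarrow> (\<exists>a\<in>alg_coset f. \<exists>b\<in>alg_coset g. h = a + b)" for h
  proof
    assume "h \<in> alg_coset (f + g)"
    then have "h - g \<in> alg_coset f" by (simp add: in_alg_coset algebra_simps)
    moreover have "h = (h - g) + g" by simp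
    ultimately show "\<exists>a\<in>alg_coset f. \<exists>b\<in>alg_coset g. h = a + b" using alg_coset_self by blast
  next
    assume "\<exists>a\<in>alg_coset f. \<exists>b\<in>alg_coset g. h = a + b"
    then obtain a b where *: "a - f \<in> J" "b - g \<in> J" "h = a + b" by (auto simp: in_alg_coset)
    have "h - (f + g) = (a - f) + (b - g)" using *(3) by simp
    then show "h \<in> alg_coset (f + g)" using alg_ideal_closed(2)[OF *(1,2)]
        by (simp only: in_alg_coset)
  qed
  then show ?thesis
    by (simp add: alg_quot_def set_add_def' free_algebra_simps(3)) blast
qed

text \<open>\<open>rcoset_mult\<close> is a union over representatives. It is constant because
  \<open>a * b - f * g = (a - f) * b + f * (b - g)\<close> and the ideal is two-sided.\<close>

lemma quot_mult: assumes f: "f \<in> C" and g: "g \<in> C"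
  shows "alg_coset f \<otimes>\<^bsub>alg_quot fa J\<^esub> alg_coset g = alg_coset (f * g)"
proof -
  have *: "alg_coset (a * b) = alg_coset (f * g)" if a: "a \<in> alg_coset f" and b: "b \<in> alg_coset g"
      for a b
  proof -
    have "a * b - f * g = (a - f) * b + f * (b - g)" by (simp add: algebra_simps)
    moreover have "(a - f) * b \<in> J" using alg_ideal_closed(5)[OF alg_coset_closed[OF g b]] a
        by (simp add: in_alg_coset)
    moreover have "f * (b - g) \<in> J" using alg_ideal_closed(4)[OF f] b by (simp add: in_alg_coset)
    ultimately show ?thesis using alg_ideal_closed(2) by (simp only: alg_coset_eq)
  qed
  have **: "alg_coset (a * b) = alg_coset (f * b)" if "a \<in> alg_coset f" "b \<in> alg_coset g" for a b
    using *[OF that] *[OF alg_coset_self that(2)] by (simp only:)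
  have "alg_coset f \<otimes>\<^bsub>alg_quot fa J\<^esub> alg_coset g =
      (\<Union>a\<in>alg_coset f. \<Union>b\<in>alg_coset g. alg_coset (a * b))"
    by (simp add: alg_quot_def rcoset_mult_def alg_coset_def free_algebra_simps(2))
  also have "\<dots> = (\<Union>b\<in>alg_coset g. alg_coset (f * b))"
    by (rule UN_alg_coset[OF alg_coset_self]) (rule SUP_cong[OF HOL.refl **])
  also have "\<dots> = alg_coset (f * g)"
    by (rule UN_alg_coset[OF alg_coset_self]) (rule *[OF alg_coset_self])
  finally show ?thesis .
qed

lemma map_times_diff: "Poly_Mapping.map ((*) c) (f - g) =
    Poly_Mapping.map ((*) c) f - Poly_Mapping.map ((*) c) g" for f g :: "'g list \<Rightarrow>\<^sub>0 'k"
  by (rule poly_mapping_eqI) (simp add: lookup_map_times lookup_minus right_diff_distrib)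

lemma quot_smult: "c \<odot>\<^bsub>alg_quot fa J\<^esub> alg_coset f = alg_coset (Poly_Mapping.map ((*) c) f)"
proof -
  have "c \<odot>\<^bsub>alg_quot fa J\<^esub> alg_coset f = (\<Union>a\<in>alg_coset f. alg_coset (Poly_Mapping.map ((*) c) a))"
    by (simp add: alg_quot_def alg_coset_def free_algebra_simps(5))
  also have "\<dots> = alg_coset (Poly_Mapping.map ((*) c) f)"
  proof (rule UN_alg_coset[OF alg_coset_self])
    fix a assume "a \<in> alg_coset f"
    then have "Poly_Mapping.map ((*) c) (a - f) \<in> J" by (simp add: in_alg_coset alg_ideal_closed(3))
    then show "alg_coset (Poly_Mapping.map ((*) c) a) = alg_coset (Poly_Mapping.map ((*) c) f)"
      by (simp only: alg_coset_eq map_times_diff)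
  qed
  finally show ?thesis .
qed

text \<open>Composing \<open>\<iota>\<close> with the coset map gives a homomorphism
  \<open>\<rho>\<close> on polynomials with kernel \<open>alg_ideal fa S\<close>. What follows uses
  only these properties and no longer deals with cosets.\<close>

lemma embedding_rep:
  fixes R :: "('k, 'r) module"
  assumes emb: "ideal_embedding (alg_quot fa J) R \<iota>"
  shows "\<exists>\<rho>. \<iota> ` carrier (alg_quot fa J) = \<rho> ` C \<and> \<rho> 0 = \<zero>\<^bsub>R\<^esub> \<and>
    (\<forall>f\<in>C. \<rho> f \<in> carrier R \<and> (\<forall>c. \<rho> (Poly_Mapping.map ((*) c) f) = c \<odot>\<^bsub>R\<^esub> \<rho> f)) \<and>
    (\<forall>f\<in>C. \<forall>g\<in>C. \<rho> (f + g) = \<rho> f \<oplus>\<^bsub>R\<^esub> \<rho> g \<and> \<rho> (f * g) = \<rho> f \<otimes>\<^bsub>R\<^esub> \<rho> g \<and>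
      (\<rho> f = \<rho> g \<longleftrightarrow> f - g \<in> J))"
proof -
  interpret unital_algebra R using emb by (simp add: ideal_embedding_def)
  have hom: "\<iota> \<in> alg_hom (alg_quot fa J) R" and inj: "inj_on \<iota> (alg_coset ` C)"
    using emb by (simp_all add: ideal_embedding_def quot_carrier)
  have mem: "\<iota> (alg_coset f) \<in> carrier R" if "f \<in> C" for f
    using hom that unfolding alg_hom_def quot_carrier by blast
  have add: "\<iota> (alg_coset (f + g)) = \<iota> (alg_coset f) \<oplus>\<^bsub>R\<^esub> \<iota> (alg_coset g)" if "f \<in> C" "g \<in> C"
      for f g
    unfolding quot_add[OF that, symmetric] using hom that unfolding alg_hom_def quot_carrier
        by blast
  have mult: "\<iota> (alg_coset (f * g)) = \<iota> (alg_coset f) \<otimes>\<^bsub>R\<^esub> \<iota> (alg_coset g)" if "f \<in> C" "g \<in> C"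
      for f g
    unfolding quot_mult[OF that, symmetric] using hom that unfolding alg_hom_def quot_carrier
        by blast
  have scale: "\<iota> (alg_coset (Poly_Mapping.map ((*) c) f)) = c \<odot>\<^bsub>R\<^esub> \<iota> (alg_coset f)" if "f \<in> C"
      for f c
    unfolding quot_smult[symmetric] using hom that unfolding alg_hom_def quot_carrier by blast
  have eq: "\<iota> (alg_coset f) = \<iota> (alg_coset g) \<longleftrightarrow> f - g \<in> J" if "f \<in> C" "g \<in> C" for f g
    using inj_on_eq_iff[OF inj imageI imageI, of f g] that by (simp add: alg_coset_eq)
  have zero: "\<iota> (alg_coset 0) = \<zero>\<^bsub>R\<^esub>"
  proof -
    have "\<iota> (alg_coset 0) \<oplus>\<^bsub>R\<^esub> \<iota> (alg_coset 0) = \<iota> (alg_coset 0)"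
      using add[OF free_algebra_closed(1) free_algebra_closed(1)] by simp
    then show ?thesis using mem[OF free_algebra_closed(1)] by (simp only: add.r_cancel_one)
  qed
  show ?thesis
  proof (intro exI[of _ "\<lambda>f. \<iota> (alg_coset f)"] conjI ballI allI)
    show "\<iota> ` carrier (alg_quot fa J) = (\<lambda>f. \<iota> (alg_coset f)) ` C"
        by (simp only: quot_carrier image_image)
  qed (rule zero, erule mem, erule scale, erule (1) add, erule (1) mult, erule (1) eq)
qed

end

section \<open>From the embedded algebra to generators and relations\<close>

lemma relators_closed:
  fixes E :: "('v, 'e) pre_digraph"
  assumes "wf_digraph E"
  shows "relators E \<subseteq> carrier (free_algebra (generators E) :: ('k::field, _) module)"
proof -
  let ?C = "carrier (free_algebra (generators E) :: ('k, _) module)"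
  have g: "v \<in> verts E \<Longrightarrow> gen (Pgen v) \<in> ?C" "e \<in> arcs E \<Longrightarrow> gen (Xgen e) \<in> ?C"
    "e \<in> arcs E \<Longrightarrow> gen (Ygen e) \<in> ?C" for v :: 'v and e :: 'e
    by (intro gen_closed; simp add: generators_def)+
  have s: "(\<Sum>e\<in>out_arcs E v. gen (Xgen e) * gen (Ygen e)) \<in> ?C" for v
  proof -
    have "(\<Sum>e\<in>A. gen (Xgen e) * gen (Ygen e)) \<in> ?C" if "A \<subseteq> arcs E" for A
      using that by (induction A rule: infinite_finite_induct)
        (simp_all add: free_algebra_closed(1-3) g)
    then show ?thesis by (simp add: out_arcs_def)
  qed
  have ht: "head E e \<in> verts E" "tail E e \<in> verts E" if "e \<in> arcs E" for e
    using assms that by (simp_all add: wf_digraph_def)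
  have "x \<in> ?C" if x: "x \<in> relators E" for x
    using x unfolding relators_def
    by (elim UnE CollectE exE conjE; hypsubst; intro free_algebra_closed(5) free_algebra_closed(3)
        s;
      simp add: g ht free_algebra_closed(1))
  then show ?thesis by blast
qed

lemma poly_mapping_sum_single: "(\<Sum>k\<in>Poly_Mapping.keys f. Poly_Mapping.single k (Poly_Mapping.lookup
    f k)) = f"
  by (rule poly_mapping_eqI) (simp add: lookup_sum lookup_single when_def in_keys_iff)

text \<open>The relations hold since relators lie in the kernel of \<open>\<rho>\<close>. Induction
  over the ideal is induction over words and their linear combinations, and independence is
  reflected by \<open>\<rho>\<close> because its kernel is exactly the ideal of the
  relators.\<close>

lemma ideal_embedding_graph_alg:
  fixes E :: "('v, 'e) pre_digraph" and R :: "('k::field, 'r) module" (structure)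
  assumes wf: "wf_digraph E" and rf: "row_finite E" and emb: "ideal_embedding (graph_algebra E) R \<iota>"
  obtains P X Y where "graph_alg R E P X Y (\<iota> ` carrier (graph_algebra E))"
proof -
  interpret unital_algebra R using emb by (simp add: ideal_embedding_def)
  define G where "G = generators E"
  define C where "C = carrier (free_algebra G :: ('k, _) module)"
  define J where "J = alg_ideal (free_algebra G) (relators E :: (_ \<Rightarrow>\<^sub>0 'k) set)"
  define I where "I = \<iota> ` carrier (graph_algebra E)"
  have id: "ideal I R" using emb by (simp add: ideal_embedding_def I_def)
  obtain \<rho> where *: "I = \<rho> ` C \<and> \<rho> 0 = \<zero> \<and>
    (\<forall>f\<in>C. \<rho> f \<in> carrier R \<and> (\<forall>c. \<rho> (Poly_Mapping.map ((*) c) f) = c \<odot> \<rho> f)) \<and>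
    (\<forall>f\<in>C. \<forall>g\<in>C. \<rho> (f + g) = \<rho> f \<oplus> \<rho> g \<and> \<rho> (f * g) = \<rho> f \<otimes> \<rho> g \<and> (\<rho> f = \<rho> g \<longleftrightarrow> f - g \<in> J))"
    using embedding_rep[OF relators_closed[OF wf] emb[unfolded graph_algebra_def],
      folded graph_algebra_def, folded I_def, folded G_def, folded C_def J_def] ..
  have I: "I = \<rho> ` C" and zero: "\<rho> 0 = \<zero>" using * by blast+
  have mem: "\<rho> f \<in> carrier R" and scale: "\<rho> (Poly_Mapping.map ((*) c) f) = c \<odot> \<rho> f" if "f \<in> C"
      for f c
    using * that by blast+
  have add: "\<rho> (f + g) = \<rho> f \<oplus> \<rho> g" and mult: "\<rho> (f * g) = \<rho> f \<otimes> \<rho> g"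
    and eq: "\<rho> f = \<rho> g \<longleftrightarrow> f - g \<in> J" if "f \<in> C" "g \<in> C" for f g
    using * that by blast+
  note closed = free_algebra_closed[where G = G and ?'k = 'k, folded C_def]
  define P where "P v = \<rho> (gen (Pgen v))" for v
  define X where "X e = \<rho> (gen (Xgen e))" for e
  define Y where "Y e = \<rho> (gen (Ygen e))" for e
  have gens: "v \<in> verts E \<Longrightarrow> gen (Pgen v) \<in> C" "e \<in> arcs E \<Longrightarrow> gen (Xgen e) \<in> C"
    "e \<in> arcs E \<Longrightarrow> gen (Ygen e) \<in> C" for v :: 'v and e :: 'e
    by (simp_all add: C_def gen_closed G_def generators_def)
  have ht: "head E e \<in> verts E" "tail E e \<in> verts E" if "e \<in> arcs E" for e
    using wf that by (simp_all add: wf_digraph_def)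
  have rel: "\<rho> f = \<rho> g" if "f - g \<in> relators E" "f \<in> C" "g \<in> C" for f g
    using eq[OF that(2,3)] alg_ideal.incl[OF that(1)] by (simp add: J_def)
  have sum: "(\<Sum>i\<in>A. f i) \<in> C \<and> \<rho> (\<Sum>i\<in>A. f i) = (\<Oplus>i\<in>A. \<rho> (f i))" if "finite A" "\<And>i. i \<in> A \<Longrightarrow> f i \<in> C"
      for A f
    using that
  proof (induction A rule: finite_induct)
    case (insert x A)
    then have "(\<lambda>i. \<rho> (f i)) \<in> A \<rightarrow> carrier R" "\<rho> (f x) \<in> carrier R" using mem by auto
    then show ?case using insert closed(2) add by simp
  qed (simp add: closed(1) zero)
  have word: "\<rho> (Poly_Mapping.single (g # w) 1) = \<rho> (gen g) \<otimes> \<rho> (Poly_Mapping.single w 1)"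
    if "g \<in> G" "set w \<subseteq> G" "w \<noteq> []" for g w
  proof -
    have "Poly_Mapping.single (g # w) 1 = gen g * Poly_Mapping.single w (1::'k)"
      by (simp add: mult_single plus_list_def)
    then show ?thesis using mult[of "gen g" "Poly_Mapping.single w 1"] closed(6)[of _ 1] that
        by simp
  qed
  have scale_word: "\<rho> (Poly_Mapping.single w c) = c \<odot> \<rho> (Poly_Mapping.single w 1)"
      if "set w \<subseteq> G" "w \<noteq> []" for w c
  proof -
    have "Poly_Mapping.map ((*) c) (Poly_Mapping.single w 1) = Poly_Mapping.single w c"
      by (rule poly_mapping_eqI) (simp add: lookup_map_times lookup_single when_def)
    then show ?thesis using scale[OF closed(6)[OF that], of c 1] by simp
  qed
  have "graph_alg R E P X Y I"
  proof (rule graph_alg.intro[OF _ graph_alg_axioms.intro])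
    show "unital_algebra R" by unfold_locales
    show "wf_digraph E" "row_finite E" "ideal I R" by (fact wf rf id)+
    show "P v \<in> I" if "v \<in> verts E" for v using gens(1)[OF that] by (simp add: P_def I)
    show "X e \<in> I" if "e \<in> arcs E" for e using gens(2)[OF that] by (simp add: X_def I)
    show "Y e \<in> I" if "e \<in> arcs E" for e using gens(3)[OF that] by (simp add: Y_def I)
    show "P v \<otimes> P u = (if v = u then P v else \<zero>)" if "v \<in> verts E" "u \<in> verts E" for v u
    proof -
      have "\<rho> (gen (Pgen v) * gen (Pgen u)) = \<rho> (if v = u then gen (Pgen v) else 0)"
        using that by (intro rel closed(3) gens) (auto simp: relators_def gens closed(1))
      then show ?thesis using that by (simp add: P_def mult gens zero split: if_splits)
    qed
    show "P (tail E e) \<otimes> X e = X e" if "e \<in> arcs E" for e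
      unfolding P_def X_def using that ht[OF that]
      by (subst mult[symmetric]) (auto simp: relators_def gens intro!: rel closed(3))
    show "X e \<otimes> P (head E e) = X e" if "e \<in> arcs E" for e
      unfolding P_def X_def using that ht[OF that]
      by (subst mult[symmetric]) (auto simp: relators_def gens intro!: rel closed(3))
    show "P (head E e) \<otimes> Y e = Y e" if "e \<in> arcs E" for e
      unfolding P_def Y_def using that ht[OF that]
      by (subst mult[symmetric]) (auto simp: relators_def gens intro!: rel closed(3))
    show "Y e \<otimes> P (tail E e) = Y e" if "e \<in> arcs E" for e
      unfolding P_def Y_def using that ht[OF that]
      by (subst mult[symmetric]) (auto simp: relators_def gens intro!: rel closed(3))
    show "Y e \<otimes> X e' = (if e = e' then P (head E e) else \<zero>)" if "e \<in> arcs E" "e' \<in> arcs E" for e e'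
    proof -
      have "\<rho> (gen (Ygen e) * gen (Xgen e')) = \<rho> (if e = e' then gen (Pgen (head E e)) else 0)"
        using that ht[OF that(1)] by (intro rel closed(3) gens) (auto simp: relators_def gens
            closed(1))
      then show ?thesis using that by (simp add: P_def X_def Y_def mult gens zero split: if_splits)
    qed
    show "P v = (\<Oplus>e\<in>out_arcs E v. X e \<otimes> Y e)" if v: "v \<in> verts E" "out_arcs E v \<noteq> {}" for v
    proof -
      have XY: "gen (Xgen e) * gen (Ygen e) \<in> C" if "e \<in> out_arcs E v" for e
        using that by (intro closed(3) gens) auto
      have fin: "finite (out_arcs E v)" using rf v by (simp add: row_finite_def)
      note s = sum[of "out_arcs E v" "\<lambda>e. gen (Xgen e) * gen (Ygen e)", OF fin XY]
      have "gen (Pgen v) - (\<Sum>e\<in>out_arcs E v. gen (Xgen e) * gen (Ygen e)) \<in>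
          (relators E :: (_ \<Rightarrow>\<^sub>0 'k) set)"
        unfolding relators_def using v by blast
      then have "P v = \<rho> (\<Sum>e\<in>out_arcs E v. gen (Xgen e) * gen (Ygen e))"
        unfolding P_def using s gens(1)[OF v(1)] by (intro rel) blast+
      also have "\<dots> = (\<Oplus>e\<in>out_arcs E v. \<rho> (gen (Xgen e) * gen (Ygen e)))" using s by blast
      also have "\<dots> = (\<Oplus>e\<in>out_arcs E v. X e \<otimes> Y e)"
      proof (rule finsum_cong')
        show "(\<lambda>e. X e \<otimes> Y e) \<in> out_arcs E v \<rightarrow> carrier R"
          by (auto simp: X_def Y_def mem gens)
      qed (auto simp: X_def Y_def mult gens)
      finally show ?thesis .
    qed
    show "a \<in> J'" if a: "a \<in> I" and P: "\<And>v. v \<in> verts E \<Longrightarrow> P v \<in> J'" and "\<zero> \<in> J'"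
      and J'_add: "\<And>a b. a \<in> J' \<Longrightarrow> b \<in> J' \<Longrightarrow> a \<oplus> b \<in> J'"
      and J'_smult: "\<And>c a. a \<in> J' \<Longrightarrow> c \<odot> a \<in> J'"
      and PJ': "\<And>v a. v \<in> verts E \<Longrightarrow> a \<in> J' \<Longrightarrow> P v \<otimes> a \<in> J'"
      and XJ': "\<And>e a. e \<in> arcs E \<Longrightarrow> a \<in> J' \<Longrightarrow> X e \<otimes> a \<in> J'"
      and YJ': "\<And>e a. e \<in> arcs E \<Longrightarrow> a \<in> J' \<Longrightarrow> Y e \<otimes> a \<in> J'" for J' a
    proof -
      have gen_mult: "\<rho> (gen g) \<otimes> b \<in> J'" if "g \<in> G" "b \<in> J'" for g b
        using that PJ' XJ' YJ' by (auto simp: G_def generators_def P_def X_def Y_def)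
      have words: "\<rho> (Poly_Mapping.single w 1) \<in> J'" if "set w \<subseteq> G" "w \<noteq> []" for w
        using that
      proof (induction w)
        case (Cons g w)
        show ?case
        proof (cases "w = []")
          case True
          \<comment> \<open>The free algebra has no empty word to start the induction from, so the
            one-letter words in \<open>x\<close> and \<open>y\<close> are written as products that
            end in some \<open>p\<close>.\<close>
          have "X e \<otimes> P (head E e) = X e" "Y e \<otimes> P (tail E e) = Y e" if "e \<in> arcs E" for e
            unfolding P_def X_def Y_def using that ht[OF that]
            by (subst mult[symmetric]; auto simp: relators_def gens intro!: rel closed(3))+
          then have "X e \<in> J'" "Y e \<in> J'" if "e \<in> arcs E" for e
            using that XJ' YJ' P ht[OF that] by metis+
          then show ?thesis using Cons.prems P True
              by (auto simp: G_def generators_def P_def X_def Y_def)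
        next
          case False
          then show ?thesis using Cons gen_mult by (simp add: word)
        qed
      qed simp
      obtain f where f: "f \<in> C" "a = \<rho> f" using a I by blast
      have "(\<Sum>k\<in>A. Poly_Mapping.single k (Poly_Mapping.lookup f k)) \<in> C \<and>
          \<rho> (\<Sum>k\<in>A. Poly_Mapping.single k (Poly_Mapping.lookup f k)) \<in> J'"
        if "finite A" "A \<subseteq> Poly_Mapping.keys f" for A
        using that
      proof (induction A rule: finite_induct)
        case (insert k A)
        then have k: "set k \<subseteq> G" "k \<noteq> []" using f(1) unfolding C_def free_algebra_simps by auto
        let ?s = "\<Sum>k\<in>A. Poly_Mapping.single k (Poly_Mapping.lookup f k)"
        have s: "?s \<in> C" "\<rho> ?s \<in> J'" using insert by blast+
        have k': "Poly_Mapping.single k (Poly_Mapping.lookup f k) \<in> C"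
          "\<rho> (Poly_Mapping.single k (Poly_Mapping.lookup f k)) \<in> J'"
          unfolding scale_word[OF k, of "Poly_Mapping.lookup f k"]
              by (rule closed(6)[OF k] J'_smult words[OF k])+
        show ?case unfolding sum.insert[OF insert.hyps] add[OF k'(1) s(1)]
          by (intro conjI closed(2) J'_add k' s)
      qed (simp add: closed(1) zero \<open>\<zero> \<in> J'\<close>)
      from this[OF finite_keys subset_refl, unfolded poly_mapping_sum_single] show ?thesis
        unfolding f(2) by blast
    qed
    show "c w = 0" if v: "v \<in> verts E" and W: "finite W" "\<And>w. w \<in> W \<Longrightarrow> walk E v w"
      and s: "(\<Oplus>w\<in>W. c w \<odot> foldr (\<lambda>e a. Y e \<otimes> a) w (P v)) = \<zero>" and w: "w \<in> W" for v W c w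
    proof -
      have words: "set (map Ygen w @ [Pgen v]) \<subseteq> G" if "walk E v w" for w
        using that v by (induction w) (auto simp: G_def generators_def)
      have y: "foldr (\<lambda>e a. Y e \<otimes> a) w (P v) = \<rho> (Poly_Mapping.single (map Ygen w @ [Pgen v]) 1)"
          if "walk E v w" for w
        using that
      proof (induction w)
        case (Cons e w)
        then show ?case using words[OF Cons.prems] word[of "Ygen e" "map Ygen w @ [Pgen v]"]
            by (simp add: Y_def)
      qed (simp add: P_def)
      let ?f = "\<lambda>w. Poly_Mapping.single (map Ygen w @ [Pgen v]) (c w)"
      have f: "?f w \<in> C" if "w \<in> W" for w by (rule closed(6)[OF words[OF W(2)[OF that]]]) simp
      have "\<rho> (\<Sum>w\<in>W. ?f w) = (\<Oplus>w\<in>W. \<rho> (?f w))" using sum[of W ?f, OF W(1) f] by blast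
      also have "\<dots> = (\<Oplus>w\<in>W. c w \<odot> foldr (\<lambda>e a. Y e \<otimes> a) w (P v))"
      proof (rule finsum_cong')
        show f': "\<rho> (?f w) = c w \<odot> foldr (\<lambda>e a. Y e \<otimes> a) w (P v)" if "w \<in> W" for w
          unfolding y[OF W(2)[OF that]] by (rule scale_word[OF words[OF W(2)[OF that]]]) simp
        show "(\<lambda>w. c w \<odot> foldr (\<lambda>e a. Y e \<otimes> a) w (P v)) \<in> W \<rightarrow> carrier R"
        proof (rule funcsetI)
          fix w assume w: "w \<in> W"
          show "c w \<odot> foldr (\<lambda>e a. Y e \<otimes> a) w (P v) \<in> carrier R"
            using mem[OF f[OF w]] unfolding f'[OF w] .
        qed
      qed simp
      also have "\<dots> = \<rho> 0" by (simp only: s zero)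
      finally have "(\<Sum>w\<in>W. ?f w) \<in> J" using eq[of "\<Sum>w\<in>W. ?f w" 0] sum[of W ?f, OF W(1) f] closed(1)
          by simp
      then show ?thesis using path_words_independent[OF wf rf v W(1) _ _ w] W(2) unfolding J_def
          by blast
    qed
  qed
  then show thesis unfolding I_def by (rule that)
qed

theorem corollary6p5:
  fixes E :: "('v, 'e) pre_digraph"
    and R :: "('k::field, 'r) module"
    and \<iota> :: "(('v, 'e) generator list \<Rightarrow>\<^sub>0 'k) set \<Rightarrow> 'r"
    and I :: "'r set"
  assumes "wf_digraph E" and "row_finite E"
    and "ideal_embedding (graph_algebra E) R \<iota>" and "I = \<iota> ` carrier (graph_algebra E)"
  shows "refinement_property R (FP R I :: ('r, 'm) module set) \<and>
         separative R (FP R I :: ('r, 'm) module set) \<and>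
         unperforated_monoid (V_monoid R I) \<and>
         unperforated_group (K0 R I) (K0_cone R I)"
proof -
  obtain P X Y where "graph_alg R E P X Y I"
    using ideal_embedding_graph_alg[OF assms(1-3)] unfolding assms(4) by blast
  then interpret graph_alg R E P X Y I .
  show ?thesis
    using refinement_FP separative_FP V_unperforated K0_unperforated by blast
qed

end
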